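(* Let $f:\mathbb N\to\mathbb N_0$ satisfy (P1) for some $L\in\mathbb N$, (P3) for some $R>0$, and (P4). Then there exist $M,N\in\mathbb N$, real numbers $0\le\alpha_M<\alpha_{M-1}<\dots<\alpha_2<\alpha_1=\frac{\alpha}{\alpha+1}$ belonging to $\mathcal L$, real numbers $0<\beta_2<\beta_3<\dots<\beta_N$ belonging to $\mathcal M+\mathcal N$, and constants $A_2,\dots,A_M,B_2,\dots,B_N\in\mathbb C$ such that, as $n\to\infty$, \[ p_f(n)=\frac{C}{n^b}\exp\!\left(A_1n^{\frac{\alpha}{\alpha+1}}+\sum_{j=2}^MA_jn^{\alpha_j}\right)\left(1+\sum_{j=2}^N\frac{B_j}{n^{\beta_j}}+O_{L,R}\!\left(n^{-\min\left\{\frac{2L-\alpha}{2(\alpha+1)},\frac{R}{\alpha+1}\right\}}\right)\right), \] with $A_1,C,b$ as defined below. Moreover, if $\alpha$ is the only positive pole of $L_f$, then one can take $M=1$.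
   Context: Let $f:\mathbb N\to\mathbb N_0$ and $\Lambda:=\{n\in\mathbb N:f(n)\ne0\}$. For $z\in\mathbb C$ with $\mathrm{Re}(z)>0$ and $q=e^{-z}$ define $p_f(n)$ by $G_f(z):=\sum_{n\ge0}p_f(n)q^n=\prod_{n\ge1}(1-q^n)^{-f(n)}$, and let $L_f(s):=\sum_{n\ge1}f(n)n^{-s}$ and $L_f^*(s):=\Gamma(s)\zeta(s+1)L_f(s)$. (P1): Let $\alpha>0$ be the largest pole of $L_f$; there is $L\in\mathbb N$ such that for every prime $p$, $|\Lambda\setminus(p\mathbb N\cap\Lambda)|\ge L>\frac\alpha2$. (P3) (attached to $R>0$): $L_f(s)$ converges for some $s\in\mathbb C$, has a meromorphic continuation to $\{\mathrm{Re}(s)\ge-R\}$ and is holomorphic on the line $\mathrm{Re}(s)=-R$; $L_f^*$ has only real poles $0<\alpha=\gamma_1>\gamma_2>\dots$, all simple except possibly the pole at $s=0$, which may be double. (P4): There is $a<\frac\pi2$ such that in every strip $\sigma_1\le\mathrm{Re}(s)\le\sigma_2$ in the domain of holomorphy of $L_f$ one has, uniformly, $L_f(\sigma+it)=O_{\sigma_1,\sigma_2}(e^{a|t|})$ as $|t|\to\infty$. Let $\mathcal P_R$ be the union of $\{0\}$ with the set of poles of $L_f^*$ greater than $-R$. Define $\mathcal L:=\frac{1}{\alpha+1}\mathcal P_R+\sum_{\mu\in\mathcal P_R}\left(\frac{\mu+1}{\alpha+1}-1\right)\mathbb N_0$, $\mathcal M:=\frac{\alpha}{\alpha+1}\mathbb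 N_0+\left(\left(-\sum_{\mu\in\mathcal P_R}\left(\frac{\mu+1}{\alpha+1}-1\right)\mathbb N_0\right)\cap\left[0,\frac{R+\alpha}{\alpha+1}\right)\right)$, $\mathcal N:=\{\sum_{j=1}^Kb_j\theta_j: K,b_j\in\mathbb N_0,\ \theta_j\in(-\mathcal L)\cap(0,\frac{R}{\alpha+1})\}$ (sums of sets are Minkowski sums). With $\omega_\alpha:=\mathrm{Res}_{s=\alpha}L_f(s)$, set $A_1:=\left(1+\frac1\alpha\right)(\omega_\alpha\Gamma(\alpha+1)\zeta(\alpha+1))^{\frac1{\alpha+1}}$, $C:=\frac{e^{L_f'(0)}(\omega_\alpha\Gamma(\alpha+1)\zeta(\alpha+1))^{\frac{1/2-L_f(0)}{\alpha+1}}}{\sqrt{2\pi(\alpha+1)}}$, $b:=\frac{1-L_f(0)+\frac\alpha2}{\alpha+1}$. *)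

theory Defs
  imports "HOL-Complex_Analysis.Complex_Analysis" "HOL-Library.Landau_Symbols"
    "HOL-Library.Set_Algebras" "HOL-Computational_Algebra.Primes"
begin

(* The natural numbers start at 1 here: the value of f at 0 is never used below. *)

(* The Riemann zeta function on the whole plane, as the holomorphic continuation of its
   Dirichlet series. The value at the pole 1 is an irrelevant convention. *)
definition zeta :: "complex \<Rightarrow> complex" where
  "zeta = (THE Z. Z holomorphic_on (- {1}) \<and> Z 1 = 0 \<and>
     (\<forall>s. Re s > 1 \<longrightarrow> (\<lambda>n. of_nat (Suc n) powr (- s)) sums Z s))"

definition supp :: "(nat \<Rightarrow> nat) \<Rightarrow> nat set" where
  "supp f = {n. n \<ge> 1 \<and> f n \<noteq> 0}"

definition Gf :: "(nat \<Rightarrow> nat) \<Rightarrow> complex \<Rightarrow> complex" where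
  "Gf f z = prodinf (\<lambda>k. inverse ((1 - exp (- z) ^ Suc k) ^ f (Suc k)))"

definition pf :: "(nat \<Rightarrow> nat) \<Rightarrow> nat \<Rightarrow> complex" where
  "pf f = (THE c. \<forall>z. Re z > 0 \<longrightarrow> (\<lambda>n. c n * exp (- z) ^ n) sums Gf f z)"

definition dirichlet_term :: "(nat \<Rightarrow> nat) \<Rightarrow> complex \<Rightarrow> nat \<Rightarrow> complex" where
  "dirichlet_term f s n = of_nat (f (Suc n)) * of_nat (Suc n) powr (- s)"

(* F is the function L_f: the Dirichlet series converges somewhere (hence on a right half-plane),
   and F is a meromorphic continuation of it to the closed half-plane Re s >= -R. Being
   meromorphic on a closed set means being meromorphic around each of its points, and "nicely"
   says that removable singularities have been removed, so that values such as F 0 and deriv F 0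
   are meaningful. All such F agree on the half-plane. *)
definition is_L_function :: "(nat \<Rightarrow> nat) \<Rightarrow> real \<Rightarrow> (complex \<Rightarrow> complex) \<Rightarrow> bool" where
  "is_L_function f R F \<longleftrightarrow>
     (\<exists>s. summable (dirichlet_term f s)) \<and>
     (\<exists>c. \<forall>s. Re s > c \<longrightarrow> F s = (\<Sum>n. dirichlet_term f s n)) \<and>
     F nicely_meromorphic_on {s. Re s \<ge> - R}"

definition Lstar :: "(complex \<Rightarrow> complex) \<Rightarrow> complex \<Rightarrow> complex" where
  "Lstar F s = Gamma s * zeta (s + 1) * F s"

(* alpha is a positive pole of F and the rightmost one among those in the half-plane on which
   F is given. *)
definition largest_pole :: "real \<Rightarrow> (complex \<Rightarrow> complex) \<Rightarrow> real \<Rightarrow> bool" where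
  "largest_pole R F \<alpha> \<longleftrightarrow>
     is_pole F (of_real \<alpha>) \<and> (\<forall>s. Re s \<ge> - R \<and> is_pole F s \<longrightarrow> Re s \<le> \<alpha>)"

(* The disjunct "infinite" is needed because card is 0 on infinite sets. *)
definition P1 :: "(nat \<Rightarrow> nat) \<Rightarrow> real \<Rightarrow> (complex \<Rightarrow> complex) \<Rightarrow> real \<Rightarrow> nat \<Rightarrow> bool" where
  "P1 f R F \<alpha> L \<longleftrightarrow>
     \<alpha> > 0 \<and> largest_pole R F \<alpha> \<and>
     (\<forall>q::nat. prime q \<longrightarrow>
        (let S = supp f - ({n. q dvd n} \<inter> supp f) in infinite S \<or> card S \<ge> L)) \<and>
     real L > \<alpha> / 2"

definition P3 :: "(nat \<Rightarrow> nat) \<Rightarrow> real \<Rightarrow> (complex \<Rightarrow> complex) \<Rightarrow> real \<Rightarrow> bool" where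
  "P3 f R F \<alpha> \<longleftrightarrow>
     is_L_function f R F \<and>
     F analytic_on {s. Re s = - R} \<and>
     largest_pole R (Lstar F) \<alpha> \<and>
     (\<forall>s. Re s \<ge> - R \<and> is_pole (Lstar F) s \<longrightarrow>
        s \<in> \<real> \<and> (zorder (Lstar F) s = - 1 \<or> s = 0 \<and> zorder (Lstar F) s = - 2))"

(* The strips are those inside the half-plane on which F is given; the bound is for large |t|,
   so that real poles of F play no role. The same a serves all strips. *)
definition P4 :: "real \<Rightarrow> (complex \<Rightarrow> complex) \<Rightarrow> bool" where
  "P4 R F \<longleftrightarrow>
     (\<exists>a < pi / 2. \<forall>\<sigma>1 \<sigma>2. - R \<le> \<sigma>1 \<and> \<sigma>1 \<le> \<sigma>2 \<longrightarrow>
        (\<exists>K T. \<forall>\<sigma> t. \<sigma>1 \<le> \<sigma> \<and> \<sigma> \<le> \<sigma>2 \<and> \<bar>t\<bar> \<ge> T \<longrightarrow>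
           cmod (F (Complex \<sigma> t)) \<le> K * exp (a * \<bar>t\<bar>)))"

definition poleset :: "real \<Rightarrow> (complex \<Rightarrow> complex) \<Rightarrow> real set" where
  "poleset R F = {0} \<union> {\<mu>. \<mu> > - R \<and> is_pole (Lstar F) (of_real \<mu>)}"

(* Sums of sets are the Minkowski sums of HOL-Library.Set_Algebras. Unary minus on sets is
   complementation, so the pointwise negative of S is written uminus ` S. The pole set is
   finite whenever P3 holds. *)
definition shift_semigroup :: "real \<Rightarrow> (complex \<Rightarrow> complex) \<Rightarrow> real \<Rightarrow> real set" where
  "shift_semigroup R F \<alpha> =
     (\<Sum>\<mu>\<in>poleset R F. range (\<lambda>k::nat. ((\<mu> + 1) / (\<alpha> + 1) - 1) * real k))"

definition setL :: "real \<Rightarrow> (complex \<Rightarrow> complex) \<Rightarrow> real \<Rightarrow> real set" where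
  "setL R F \<alpha> = (\<lambda>\<mu>. 1 / (\<alpha> + 1) * \<mu>) ` poleset R F + shift_semigroup R F \<alpha>"

definition setM :: "real \<Rightarrow> (complex \<Rightarrow> complex) \<Rightarrow> real \<Rightarrow> real set" where
  "setM R F \<alpha> = range (\<lambda>k::nat. \<alpha> / (\<alpha> + 1) * real k) +
     ((uminus ` shift_semigroup R F \<alpha>) \<inter> {0..<(R + \<alpha>) / (\<alpha> + 1)})"

definition setN :: "real \<Rightarrow> (complex \<Rightarrow> complex) \<Rightarrow> real \<Rightarrow> real set" where
  "setN R F \<alpha> = {(\<Sum>j=1..K. real (b j) * \<theta> j) | (K::nat) (b::nat \<Rightarrow> nat) (\<theta>::nat \<Rightarrow> real).
     \<forall>j\<in>{1..K}. \<theta> j \<in> (uminus ` setL R F \<alpha>) \<inter> {0<..<R / (\<alpha> + 1)}}"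

(* omega_alpha * Gamma (alpha + 1) * zeta (alpha + 1); it is a positive real number, so its
   principal complex powers below are the usual real ones. *)
definition pole_const :: "(complex \<Rightarrow> complex) \<Rightarrow> real \<Rightarrow> complex" where
  "pole_const F \<alpha> =
     residue F (of_real \<alpha>) * Gamma (of_real \<alpha> + 1) * zeta (of_real \<alpha> + 1)"

definition constA1 :: "(complex \<Rightarrow> complex) \<Rightarrow> real \<Rightarrow> complex" where
  "constA1 F \<alpha> = (1 + 1 / of_real \<alpha>) * pole_const F \<alpha> powr (1 / (of_real \<alpha> + 1))"

definition constC :: "(complex \<Rightarrow> complex) \<Rightarrow> real \<Rightarrow> complex" where
  "constC F \<alpha> =
     exp (deriv F 0) * pole_const F \<alpha> powr ((1 / 2 - F 0) / (of_real \<alpha> + 1))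
       / of_real (sqrt (2 * pi * (\<alpha> + 1)))"

definition constb :: "(complex \<Rightarrow> complex) \<Rightarrow> real \<Rightarrow> complex" where
  "constb F \<alpha> = (1 - F 0 + of_real \<alpha> / 2) / (of_real \<alpha> + 1)"

end

theory Submission
  imports Defs "HOL-Probability.Distributions" "HOL-Real_Asymp.Real_Asymp"
begin


text \<open>The proof is the circle method with a saddle point, in the tradition of Meinardus.
  Cauchy's formula (\<open>pf_integral\<close>) writes p_f(n) as the mean over |t| \<le> pi of
  exp(log G_f(z) + n z) on the line z = \<rho> + it, so three things are needed: log G_f near z = 0,
  smallness of G_f away from the real axis, and a choice of \<rho> that makes the rest a Gaussian
  integral.

  Near 0: Mellin inversion of e^{-w}, summed over the series of the logarithm and then over f,
  represents log G_f(z) as an integral of L_f^*(s) z^{-s} over a vertical line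
  (\<open>logG_mellin\<close>). Moving the line to Re s = -R is possible because the decay of Gamma
  beats (P4) and the polynomial growth of zeta. The residues give log G_f(z) = sum of a_\<nu>
  z^{-\<nu>} - L_f(0) Log z + L_f'(0) + O(|z|^R) in a sector around the positive axis
  (\<open>logG_expansion\<close>). The logarithm comes from the double pole at 0, where s^2 Gamma(s)
  zeta(s+1) = 1 + O(s^2).

  Away from the axis (\<open>minor_arcs\<close>): no factor 1/(1-q^k) grows in modulus when z leaves
  the real axis. For small t many factors shrink, since the sum of f(k) over k \<le> y is nearly of
  order y^\<alpha> (\<open>Nc_lower\<close>). Near a fixed \<tau> \<noteq> 0, (P1) supplies L
  elements k of \<Lambda> with e^{ik\<tau>} \<noteq> 1, each saving a factor \<rho>
  (\<open>nonresonant_elements\<close>); two more elements of \<Lambda> give a Cauchy kernel whose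
  integral saves one further \<rho>. The resulting \<rho>^{L+1}, divided by the width of the saddle,
  is the error n^{-(2L-\<alpha>)/(2(\<alpha>+1))}.

  At the saddle: \<rho> = n^{-1/(\<alpha>+1)} w_n, where w_n solves the saddle equation that keeps
  only the positive poles. Linear terms then cancel exactly, the quadratic term is a Gaussian, and
  everything else tends to 0 on the major arc. These are closed under sums, products and composition
  with analytic functions (\<open>cls_compose\<close>); a bootstrap expands w_n
  (\<open>ww_cls\<close>), the integrand follows (\<open>ss_cls\<close>), and integration against
  the Gaussian kills the odd moments and preserves the classes (\<open>IG_cls\<close>). Finally the
  powers of n in the saddle value that do not decay stay in the exponent, while the decaying ones
  are exponentiated into the second factor (\<open>exponent_expansion\<close>).\<close>

section \<open>Decay of the Gamma function on vertical lines\<close>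

lemma power_le_exp:
  fixes c \<delta> :: real
  assumes "c \<ge> 0" "\<delta> > 0"
  shows "\<exists>K>0. \<forall>t\<ge>0. (c + t) ^ m \<le> K * exp (\<delta> * t)"
proof (intro exI conjI allI impI)
  show "fact m / \<delta> ^ m * exp (\<delta> * c) > 0"
    using assms by simp
  fix t :: real assume t: "t \<ge> 0"
  have x: "\<delta> * (c + t) \<ge> 0" using assms t by simp
  have "(\<delta> * (c + t)) ^ m / fact m \<le> (\<Sum>k<Suc m. (\<delta> * (c + t)) ^ k / fact k)"
    using x by (simp add: sum_nonneg)
  also have "\<dots> \<le> exp (\<delta> * (c + t))"
  proof -
    have *: "(\<lambda>k. (\<delta> * (c + t)) ^ k /\<^sub>R fact k) sums exp (\<delta> * (c + t))"
      by (rule exp_converges)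
    have "(\<Sum>k<Suc m. (\<delta> * (c + t)) ^ k /\<^sub>R fact k) \<le> exp (\<delta> * (c + t))"
      unfolding sums_unique[OF *] by (rule sum_le_suminf) (use * x in \<open>auto simp: sums_iff\<close>)
    thus ?thesis by (simp add: divide_inverse mult.commute)
  qed
  finally have "\<delta> ^ m * (c + t) ^ m \<le> fact m * exp (\<delta> * (c + t))"
    by (simp add: power_mult_distrib pos_divide_le_eq mult.commute)
  thus "(c + t) ^ m \<le> fact m / \<delta> ^ m * exp (\<delta> * c) * exp (\<delta> * t)"
    using assms by (simp add: field_simps exp_add)
qed

text \<open>In Euler's limit formula the quotient |Gamma(x+it)| / Gamma(x) is the limit of products
  of the factors (x+k) / |x+k+it|, each of which increases with x > 0. Decay on one vertical line is
  thereby passed on to all lines of smaller positive abscissa; this takes the place of Stirling's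
  formula.\<close>

lemma Gamma_vertical_mono:
  assumes "0 < x" "x \<le> y"
  shows "cmod (Gamma (Complex x t)) * Gamma y \<le> Gamma x * cmod (Gamma (Complex y t))"
proof (rule LIMSEQ_le)
  show "(\<lambda>n. cmod (Gamma_series (Complex x t) n) * Gamma_series y n) \<longlonglongrightarrow> cmod (Gamma (Complex x t)) * Gamma y"
    by (intro tendsto_intros Gamma_series_LIMSEQ)
  show "(\<lambda>n. Gamma_series x n * cmod (Gamma_series (Complex y t) n)) \<longlonglongrightarrow> Gamma x * cmod (Gamma (Complex y t))"
    by (intro tendsto_intros Gamma_series_LIMSEQ)
  have "cmod (Gamma_series (Complex x t) n) * Gamma_series y n
        \<le> Gamma_series x n * cmod (Gamma_series (Complex y t) n)" for n
  proof -
    have poch: "cmod (pochhammer (Complex y t) (n + 1)) * pochhammer x (n + 1)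
        \<le> cmod (pochhammer (Complex x t) (n + 1)) * pochhammer y (n + 1)"
    proof -
      have "(\<Prod>k=0..<n+1. cmod (Complex y t + of_nat k) * (x + of_nat k))
          \<le> (\<Prod>k=0..<n+1. cmod (Complex x t + of_nat k) * (y + of_nat k))"
      proof (rule prod_mono, safe)
        fix k
        show "0 \<le> cmod (Complex y t + of_nat k) * (x + of_nat k)"
          using assms by simp
        have "(x + k)\<^sup>2 \<le> (y + k)\<^sup>2" using assms by (intro power_mono) auto
        hence "t\<^sup>2 * (x + k)\<^sup>2 \<le> t\<^sup>2 * (y + k)\<^sup>2" by (rule mult_left_mono) auto
        hence "((y + k)\<^sup>2 + t\<^sup>2) * (x + k)\<^sup>2 \<le> ((x + k)\<^sup>2 + t\<^sup>2) * (y + k)\<^sup>2"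
          by (simp add: algebra_simps)
        hence "(cmod (Complex y t + of_nat k) * (x + of_nat k))\<^sup>2
            \<le> (cmod (Complex x t + of_nat k) * (y + of_nat k))\<^sup>2"
          by (simp add: power_mult_distrib cmod_power2)
        thus "cmod (Complex y t + of_nat k) * (x + of_nat k)
            \<le> cmod (Complex x t + of_nat k) * (y + of_nat k)"
          by (rule power2_le_imp_le) (use assms in auto)
      qed
      thus ?thesis by (simp add: pochhammer_prod prod.distrib norm_mult prod_norm)
    qed
    have pos: "pochhammer x (n+1) > 0" "pochhammer y (n+1) > 0"
      using assms by (auto intro!: pochhammer_pos)
    have posc: "cmod (pochhammer (Complex z t) (n + 1)) > 0" if "z > 0" for z
    proof -
      have "Complex z t \<noteq> - of_nat k" for k
        using that by (auto simp: complex_eq_iff)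
      thus ?thesis by (simp only: zero_less_norm_iff pochhammer_eq_0_iff) blast
    qed
    have nrm: "cmod (exp (Complex z t * of_real (ln (real n)))) = exp (z * ln (real n))" for z
      by (simp add: norm_exp_eq_Re)
    have "cmod (Gamma_series (Complex x t) n) * Gamma_series y n =
      ((fact n)\<^sup>2 * exp (x * ln n) * exp (y * ln n)) / (cmod (pochhammer (Complex x t) (n + 1)) * pochhammer y (n + 1))"
      using nrm by (simp add: Gamma_series_def norm_divide norm_mult power2_eq_square del: pochhammer_Suc)
    also have "\<dots> \<le> ((fact n)\<^sup>2 * exp (x * ln n) * exp (y * ln n)) / (cmod (pochhammer (Complex y t) (n + 1)) * pochhammer x (n + 1))"
      using poch pos posc[of x] posc[of y] assms by (intro divide_left_mono mult_pos_pos) auto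
    also have "\<dots> = Gamma_series x n * cmod (Gamma_series (Complex y t) n)"
      using nrm by (simp add: Gamma_series_def norm_divide norm_mult power2_eq_square mult_ac del: pochhammer_Suc)
    finally show ?thesis .
  qed
  thus "\<exists>N. \<forall>n\<ge>N. cmod (Gamma_series (Complex x t) n) * Gamma_series y n
        \<le> Gamma_series x n * cmod (Gamma_series (Complex y t) n)" by blast
qed

text \<open>At s = 1/2 + it the number 1 - s is the conjugate of s, so the reflection formula gives
  |Gamma(s)|^2 = pi / cosh(pi t).\<close>

lemma Gamma_half_line_bound: "cmod (Gamma (Complex (1/2) t)) \<le> sqrt (2 * pi) * exp (- (pi / 2) * \<bar>t\<bar>)"
proof (rule power2_le_imp_le)
  have "of_real pi * Complex (1/2) t = of_real (pi / 2) + \<i> * of_real (pi * t)"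
    by (simp add: complex_eq_iff)
  hence "sin (of_real pi * Complex (1/2) t) = cos (\<i> * of_real (pi * t))"
    by (simp only: sin_add cos_of_real sin_of_real) simp
  also have "\<dots> = of_real (cosh (pi * t))"
    by (simp add: cos_exp_eq cosh_def scaleR_conv_of_real exp_minus flip: exp_of_real of_real_mult)
  finally have "Gamma (Complex (1/2) t) * Gamma (1 - Complex (1/2) t) = of_real (pi / cosh (pi * t))"
    by (simp add: Gamma_reflection_complex)
  moreover have "1 - Complex (1/2) t = cnj (Complex (1/2) t)" by (simp add: complex_eq_iff)
  ultimately have "of_real ((cmod (Gamma (Complex (1/2) t)))\<^sup>2) = (of_real (pi / cosh (pi * t)) :: complex)"
    by (simp add: cnj_Gamma[symmetric] complex_norm_square del: of_real_power)
  hence eq: "(cmod (Gamma (Complex (1/2) t)))\<^sup>2 = pi / cosh (pi * t)"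
    using of_real_eq_iff by blast
  have "exp (pi * \<bar>t\<bar>) \<le> exp (pi * t) + exp (- (pi * t))"
    by (cases "t \<ge> 0") auto
  hence "exp (pi * \<bar>t\<bar>) / 2 \<le> cosh (pi * t)"
    unfolding cosh_def by simp
  hence "pi / cosh (pi * t) \<le> pi / (exp (pi * \<bar>t\<bar>) / 2)"
    by (intro divide_left_mono) auto
  also have "\<dots> = (sqrt (2 * pi) * exp (- (pi / 2) * \<bar>t\<bar>))\<^sup>2"
    by (simp add: power_mult_distrib exp_minus field_simps exp_double[symmetric])
  finally show "(cmod (Gamma (Complex (1/2) t)))\<^sup>2 \<le> (sqrt (2 * pi) * exp (- (pi / 2) * \<bar>t\<bar>))\<^sup>2"
    unfolding eq .
qed auto

lemma norm_pochhammer_le: "norm (pochhammer z n :: complex) \<le> (norm z + of_nat n) ^ n"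
proof -
  have "norm (pochhammer z n) = (\<Prod>k=0..<n. norm (z + of_nat k))"
    by (simp add: pochhammer_prod prod_norm)
  also have "\<dots> \<le> (\<Prod>k=0..<n. norm z + of_nat n)"
    by (intro prod_mono conjI order.trans[OF norm_triangle_ineq]) auto
  finally show ?thesis by simp
qed

text \<open>The functional equation multiplies the bound on Re s = 1/2 by a polynomial in |t|, which
  is absorbed by giving up a little of the rate pi/2.\<close>

lemma Gamma_half_integer_line_bound:
  assumes "a < pi / 2"
  shows "\<exists>K>0. \<forall>t. cmod (Gamma (Complex (1/2 + of_nat m) t)) \<le> K * exp (- a * \<bar>t\<bar>)"
proof -
  obtain K where K: "K > 0" "\<And>t::real. t \<ge> 0 \<Longrightarrow> (1/2 + real m + t) ^ m \<le> K * exp ((pi/2 - a) * t)"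
    using power_le_exp[of "1/2 + real m" "pi/2 - a" m] assms by auto
  show ?thesis
  proof (intro exI conjI allI)
    show "K * sqrt (2 * pi) > 0" using K by simp
    fix t
    have "Complex (1/2) t \<notin> \<int>\<^sub>\<le>\<^sub>0"
    proof
      assume "Complex (1/2) t \<in> \<int>\<^sub>\<le>\<^sub>0"
      then obtain n :: int where "Complex (1/2) t = of_int n" "n \<le> 0"
        by (elim nonpos_Ints_cases)
      thus False by (simp add: complex_eq_iff)
    qed
    hence "Gamma (Complex (1/2 + of_nat m) t) = pochhammer (Complex (1/2) t) m * Gamma (Complex (1/2) t)"
      using pochhammer_Gamma[of "Complex (1/2) t" m]
      by (simp add: Gamma_eq_zero_iff Complex_eq field_simps)
    hence "cmod (Gamma (Complex (1/2 + of_nat m) t))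
      \<le> (cmod (Complex (1/2) t) + m) ^ m * (sqrt (2 * pi) * exp (- (pi / 2) * \<bar>t\<bar>))"
      by (simp only: norm_mult) (intro mult_mono norm_pochhammer_le Gamma_half_line_bound, auto)
    also have "\<dots> \<le> (1/2 + real m + \<bar>t\<bar>) ^ m * (sqrt (2 * pi) * exp (- (pi / 2) * \<bar>t\<bar>))"
      using cmod_le[of "Complex (1/2) t"] by (intro mult_right_mono power_mono) auto
    also have "\<dots> \<le> (K * exp ((pi/2 - a) * \<bar>t\<bar>)) * (sqrt (2 * pi) * exp (- (pi / 2) * \<bar>t\<bar>))"
      by (intro mult_right_mono K) auto
    also have "\<dots> = K * sqrt (2 * pi) * exp (- a * \<bar>t\<bar>)"
      by (simp add: algebra_simps flip: exp_add)
    finally show "cmod (Gamma (Complex (1/2 + of_nat m) t)) \<le> K * sqrt (2 * pi) * exp (- a * \<bar>t\<bar>)" .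
  qed
qed

text \<open>For |t| \<ge> 1 the factors s + k have modulus at least 1, so moving s to the right by
  an integer only increases |Gamma|. Once all abscissas are at least 1,
  \<open>Gamma_vertical_mono\<close> compares with a half-integer line to the right of the
  strip.\<close>

lemma Gamma_strip_bound:
  assumes "a < pi / 2"
  shows "\<exists>K>0. \<forall>\<sigma> t. \<sigma>1 \<le> \<sigma> \<and> \<sigma> \<le> \<sigma>2 \<and> \<bar>t\<bar> \<ge> 1 \<longrightarrow> cmod (Gamma (Complex \<sigma> t)) \<le> K * exp (- a * \<bar>t\<bar>)"
proof -
  define M where "M = nat \<lceil>1 - \<sigma>1\<rceil>"
  have M: "\<sigma>1 + M \<ge> 1" unfolding M_def by linarith
  define m where "m = nat \<lceil>\<sigma>2 + M\<rceil>"
  have m: "1/2 + real m \<ge> \<sigma>2 + M" unfolding m_def by linarith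
  obtain K where K: "K > 0" "\<And>t. cmod (Gamma (Complex (1/2 + of_nat m) t)) \<le> K * exp (- a * \<bar>t\<bar>)"
    using Gamma_half_integer_line_bound[OF assms] by blast
  have "compact (Gamma ` {1..max 1 (\<sigma>2 + M)} :: real set)"
    by (intro compact_continuous_image continuous_on_Gamma) (auto elim!: nonpos_Ints_cases)
  then obtain B where B: "B > 0" "\<And>x. x \<in> {1..max 1 (\<sigma>2+M)} \<Longrightarrow> norm (Gamma x :: real) \<le> B"
    by (metis (no_types, opaque_lifting) bounded_pos compact_imp_bounded imageI)
  define G where "G = Gamma (1/2 + real m)"
  have G: "G > 0" unfolding G_def by (intro Gamma_real_pos) auto
  show ?thesis
  proof (intro exI conjI allI impI)
    show "B * K / G > 0" using B K G by simp
    fix \<sigma> t :: real assume *: "\<sigma>1 \<le> \<sigma> \<and> \<sigma> \<le> \<sigma>2 \<and> \<bar>t\<bar> \<ge> 1"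
    have "Complex \<sigma> t \<notin> \<int>\<^sub>\<le>\<^sub>0" using * by (auto elim!: nonpos_Ints_cases simp: complex_eq_iff)
    hence "Gamma (Complex \<sigma> t) * pochhammer (Complex \<sigma> t) M = Gamma (Complex (\<sigma> + M) t)"
      using pochhammer_Gamma[of "Complex \<sigma> t" M]
      by (simp add: Gamma_eq_zero_iff Complex_eq field_simps)
    moreover have "cmod (pochhammer (Complex \<sigma> t) M) \<ge> 1"
    proof -
      have "(\<Prod>k=0..<M. 1) \<le> (\<Prod>k=0..<M. cmod (Complex \<sigma> t + of_nat k))"
        using * abs_Im_le_cmod[of "Complex \<sigma> t + of_nat _"] by (intro prod_mono) (auto intro: order.trans)
      thus ?thesis by (simp add: pochhammer_prod prod_norm)
    qed
    ultimately have "cmod (Gamma (Complex \<sigma> t)) \<le> cmod (Gamma (Complex (\<sigma> + M) t))"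
      by (metis mult_left_mono mult.right_neutral norm_ge_zero norm_mult)
    also have "\<dots> * G \<le> Gamma (\<sigma> + M) * cmod (Gamma (Complex (1/2 + m) t))"
      unfolding G_def using * M m by (intro Gamma_vertical_mono) auto
    also have "\<dots> \<le> B * (K * exp (- a * \<bar>t\<bar>))"
      using B(2)[of "\<sigma> + M"] * M K B(1) by (intro mult_mono) auto
    finally show "cmod (Gamma (Complex \<sigma> t)) \<le> B * K / G * exp (- a * \<bar>t\<bar>)"
      using G by (simp add: field_simps)
  qed
qed


subsection \<open>The Riemann zeta function\<close>

text \<open>The falling factorial a(a-1)...(a-k+1): the k-th derivative of x powr a is
  \<open>ff a k\<close> times x powr (a - k).\<close>

definition ff :: "complex \<Rightarrow> nat \<Rightarrow> complex" where
  "ff a k = (\<Prod>i<k. a - of_nat i)"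

lemma ff_0 [simp]: "ff a 0 = 1" by (simp add: ff_def)
lemma ff_Suc: "ff a (Suc k) = ff a k * (a - of_nat k)" by (simp add: ff_def)
lemma ff_1 [simp]: "ff a (Suc 0) = a" by (simp add: ff_Suc)

lemma norm_ff_le: "norm (ff a k) \<le> (1 + norm a) ^ k * real (Suc k) ^ k"
proof -
  have "norm (ff a k) = (\<Prod>i<k. norm (a - of_nat i))" by (simp add: ff_def prod_norm)
  also have "\<dots> \<le> (\<Prod>i<k. (1 + norm a) * real (Suc k))"
  proof (rule prod_mono, safe)
    fix i assume "i < k"
    have "norm (a - of_nat i) \<le> norm a + real i"
      using norm_triangle_ineq4[of a "of_nat i"] by simp
    also have "\<dots> \<le> norm a * real (Suc k) + real (Suc k)"
      using \<open>i < k\<close> by (intro add_mono) (auto simp: algebra_simps)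
    finally show "norm (a - of_nat i) \<le> (1 + norm a) * real (Suc k)"
      by (simp add: algebra_simps)
  qed auto
  finally show ?thesis by (simp add: power_mult_distrib)
qed

lemma holomorphic_ff [holomorphic_intros]: "f holomorphic_on A \<Longrightarrow> (\<lambda>s. ff (f s) k) holomorphic_on A"
  unfolding ff_def by (intro holomorphic_intros)

text \<open>Taylor remainder of \<open>(n + 1) powr (1 - s)\<close> around \<open>n\<close>, with \<open>n\<close> shifted by one.\<close>

definition zrem :: "nat \<Rightarrow> complex \<Rightarrow> nat \<Rightarrow> complex" where
  "zrem K s n = of_nat (Suc (Suc n)) powr (1 - s)
     - (\<Sum>j\<le>K. ff (1 - s) j / fact j * of_nat (Suc n) powr (1 - s - of_nat j))"

lemma norm_of_nat_powr: "n > 0 \<Longrightarrow> norm (of_nat n powr s :: complex) = real n powr Re s"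
  using norm_powr_real_powr[of "of_nat n" s] by simp

text \<open>Taylor's theorem on the segment from n+1 to n+2. The hypothesis makes the modulus of the
  derivative of order K+1 largest at the left end point.\<close>

lemma norm_zrem_le:
  assumes "Re s + K \<ge> 0"
  shows "norm (zrem K s n) \<le> norm (ff (1 - s) (Suc K)) * real (Suc n) powr (- Re s - K)"
proof -
  define S :: "complex set" where "S = closed_segment (of_nat (Suc n)) (of_nat (Suc (Suc n)))"
  define f where "f = (\<lambda>i x. ff (1 - s) i * x powr (1 - s - of_nat i))"
  have S: "\<exists>r. x = of_real r \<and> real (Suc n) \<le> r" if "x \<in> S" for x
  proof -
    have "x \<in> closed_segment (of_real (real (Suc n))) (of_real (real (Suc (Suc n))))"
      using that by (simp add: S_def)
    then show ?thesis
      unfolding closed_segment_of_real closed_segment_eq_real_ivl by auto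
  qed
  have "norm (f 0 (of_nat (Suc (Suc n))) - (\<Sum>i\<le>K. f i (of_nat (Suc n)) * (of_nat (Suc (Suc n)) - of_nat (Suc n)) ^ i / fact i))
    \<le> (norm (ff (1 - s) (Suc K)) * real (Suc n) powr (- Re s - K)) * norm (of_nat (Suc (Suc n)) - of_nat (Suc n) :: complex) ^ Suc K / fact K"
  proof (rule complex_Taylor[where S = S])
    show "convex S" by (simp add: S_def)
    show "of_nat (Suc n) \<in> S" "of_nat (Suc (Suc n)) \<in> S" by (auto simp: S_def)
    fix i x assume "x \<in> S"
    from S[OF this] obtain r where "x = of_real r" "real (Suc n) \<le> r" by (elim exE conjE)
    hence "x \<notin> \<real>\<^sub>\<le>\<^sub>0" by (auto simp: complex_nonpos_Reals_iff)
    hence "((\<lambda>x. x powr (1 - s - of_nat i)) has_field_derivative (1 - s - of_nat i) * x powr (1 - s - of_nat i - 1)) (at x within S)"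
      by (rule has_field_derivative_at_within[OF has_field_derivative_powr])
    from DERIV_cmult[OF this, of "ff (1 - s) i"]
    show "(f i has_field_derivative f (Suc i) x) (at x within S)"
      by (simp add: f_def ff_Suc algebra_simps)
  next
    fix x assume "x \<in> S"
    from S[OF this] obtain r where r: "x = of_real r" "real (Suc n) \<le> r" by (elim exE conjE)
    have "norm (x powr (1 - s - of_nat (Suc K))) = r powr (Re (1 - s - of_nat (Suc K)))"
      unfolding r(1) using r(2) by (subst norm_powr_real_powr) auto
    also have "\<dots> = r powr (- Re s - K)" by simp
    also have "\<dots> \<le> real (Suc n) powr (- Re s - K)"
      using r(2) assms by (intro powr_mono2') auto
    finally show "norm (f (Suc K) x) \<le> norm (ff (1 - s) (Suc K)) * real (Suc n) powr (- Re s - K)"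
      unfolding f_def norm_mult by (intro mult_left_mono) auto
  qed
  also have "\<dots> \<le> norm (ff (1 - s) (Suc K)) * real (Suc n) powr (- Re s - K)"
    using divide_left_mono[of 1 "fact K :: real" "norm (ff (1 - s) (Suc K)) * real (Suc n) powr (- Re s - K)"]
    by simp
  finally show ?thesis
    by (simp add: f_def zrem_def)
qed

text \<open>The Weierstrass test with local majorants. The termwise derivative is part of the result
  because the derivative of (s-1) zeta(s) at 1 is computed from it.\<close>

lemma holomorphic_suminf:
  fixes f :: "nat \<Rightarrow> complex \<Rightarrow> complex"
  assumes "open S" "\<And>n. f n holomorphic_on S"
    and "\<And>z. z \<in> S \<Longrightarrow> \<exists>d>0. \<exists>M. summable M \<and> (\<forall>n. \<forall>w\<in>ball z d \<inter> S. norm (f n w) \<le> M n)"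
  shows "(\<lambda>z. \<Sum>n. f n z) holomorphic_on S"
    and "z \<in> S \<Longrightarrow> (\<lambda>n. deriv (f n) z) sums deriv (\<lambda>z. \<Sum>n. f n z) z"
    and "z \<in> S \<Longrightarrow> summable (\<lambda>n. f n z)"
proof -
  have "\<exists>g g'. \<forall>x\<in>S. (\<lambda>n. f n x) sums g x \<and> (\<lambda>n. deriv (f n) x) sums g' x \<and>
          (g has_field_derivative g' x) (at x)"
  proof (rule series_and_derivative_comparison_local[OF assms(1)])
    show "(f n has_field_derivative deriv (f n) x) (at x)" if "x \<in> S" for n x
      using assms that by (meson holomorphic_derivI)
    show "\<exists>d h. 0 < d \<and> summable h \<and> (\<forall>\<^sub>F n in sequentially. \<forall>y\<in>ball x d \<inter> S. cmod (f n y) \<le> h n)"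
      if "x \<in> S" for x
      using assms(3)[OF that] by (auto intro!: always_eventually)
  qed
  then obtain g g' where g: "\<And>x. x \<in> S \<Longrightarrow> (\<lambda>n. f n x) sums g x"
     "\<And>x. x \<in> S \<Longrightarrow> (\<lambda>n. deriv (f n) x) sums g' x"
     "\<And>x. x \<in> S \<Longrightarrow> (g has_field_derivative g' x) (at x)" by blast
  have eq: "(\<Sum>n. f n z) = g z" if "z \<in> S" for z using g(1)[OF that] by (simp add: sums_iff)
  have der: "((\<lambda>z. \<Sum>n. f n z) has_field_derivative g' z) (at z)" if "z \<in> S" for z
    by (rule has_field_derivative_transform_within_open[OF g(3)[OF that] assms(1) that]) (simp add: eq)
  thus "(\<lambda>z. \<Sum>n. f n z) holomorphic_on S"
    using assms(1) holomorphic_on_open by blast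
  show "(\<lambda>n. deriv (f n) z) sums deriv (\<lambda>z. \<Sum>n. f n z) z" if "z \<in> S"
    using der[OF that] g(2)[OF that] by (simp add: DERIV_imp_deriv)
  show "summable (\<lambda>n. f n z)" if "z \<in> S" using g(1)[OF that] by (simp add: sums_iff)
qed

lemma summable_Suc_powr: "x < -1 \<Longrightarrow> summable (\<lambda>n. real (Suc n) powr x)"
  using summable_real_powr_iff[of x] by (subst summable_Suc_iff) auto

lemma zrem_local_bound:
  assumes z: "Re z > 1 - real K"
  shows "\<exists>d>0. \<exists>M. summable M \<and> (\<forall>n. \<forall>w\<in>ball z d \<inter> {s. Re s > 1 - real K}. norm (zrem K w n) \<le> M n)"
proof -
  define d where "d = (Re z + K - 1) / 2"
  have d: "d > 0" using z by (simp add: d_def)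
  define B where "B = (1 + (1 + norm z + d)) ^ Suc K * real (Suc (Suc K)) ^ Suc K"
  show ?thesis
  proof (rule exI[of _ d], intro conjI d exI ballI allI)
    show "summable (\<lambda>n. B * real (Suc n) powr (- (Re z - d) - K))"
      using z by (intro summable_mult summable_Suc_powr) (simp add: d_def field_simps)
    fix n w assume w: "w \<in> ball z d \<inter> {s. Re s > 1 - real K}"
    have "norm (w - z) < d" using w by (auto simp: dist_norm norm_minus_commute)
    hence Re: "Re w \<ge> Re z - d" using abs_Re_le_cmod[of "w - z"] by auto
    have nw: "norm (1 - w) \<le> 1 + norm z + d"
      using norm_triangle_ineq4[of 1 w] norm_triangle_ineq[of "w - z" z] \<open>norm (w - z) < d\<close> by simp
    have "norm (zrem K w n) \<le> norm (ff (1 - w) (Suc K)) * real (Suc n) powr (- Re w - K)"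
      using w by (intro norm_zrem_le) auto
    also have "\<dots> \<le> B * real (Suc n) powr (- (Re z - d) - K)"
    proof (intro mult_mono powr_mono)
      have "norm (ff (1 - w) (Suc K)) \<le> (1 + norm (1 - w)) ^ Suc K * real (Suc (Suc K)) ^ Suc K"
        by (rule norm_ff_le)
      also have "\<dots> \<le> B" unfolding B_def using nw by (intro mult_right_mono power_mono) auto
      finally show "norm (ff (1 - w) (Suc K)) \<le> B" .
    qed (use Re d B_def in auto)
    finally show "norm (zrem K w n) \<le> B * real (Suc n) powr (- (Re z - d) - K)" .
  qed
qed

lemma holomorphic_zrem: "(\<lambda>s. zrem K s n) holomorphic_on A"
  unfolding zrem_def by (intro holomorphic_intros) (auto simp: complex_nonpos_Reals_iff)

lemma open_Re_gt [simp]: "open {s. Re s > c}" by (rule open_halfspace_Re_gt)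

lemma zrem_sum:
  shows "(\<lambda>s. \<Sum>n. zrem K s n) holomorphic_on {s. Re s > 1 - real K}"
    and "Re z > 1 - real K \<Longrightarrow> (\<lambda>n. deriv (\<lambda>s. zrem K s n) z) sums deriv (\<lambda>z. \<Sum>n. zrem K z n) z"
    and "Re z > 1 - real K \<Longrightarrow> summable (zrem K z)"
  using holomorphic_suminf[OF open_Re_gt[of "1 - real K"] holomorphic_zrem[of K], OF zrem_local_bound]
  by auto


section \<open>Polynomial growth and the continuation of zeta\<close>

definition pgrow :: "complex set \<Rightarrow> (complex \<Rightarrow> complex) \<Rightarrow> bool" where
  "pgrow S g \<longleftrightarrow> (\<exists>K k. K \<ge> 0 \<and> (\<forall>s\<in>S. norm (g s) \<le> K * (1 + norm s) ^ k))"

lemma pgrowI: "(\<And>s. s \<in> S \<Longrightarrow> norm (g s) \<le> K * (1 + norm s) ^ k) \<Longrightarrow> pgrow S g"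
proof -
  assume *: "\<And>s. s \<in> S \<Longrightarrow> norm (g s) \<le> K * (1 + norm s) ^ k"
  have "norm (g s) \<le> max 0 K * (1 + norm s) ^ k" if "s \<in> S" for s
    using *[OF that] by (rule order.trans) (intro mult_right_mono, auto)
  thus "pgrow S g" unfolding pgrow_def by (intro exI[of _ "max 0 K"]) auto
qed

lemma pgrow_subset: "pgrow S g \<Longrightarrow> T \<subseteq> S \<Longrightarrow> pgrow T g"
  unfolding pgrow_def by blast

lemma pgrow_mult:
  assumes "pgrow S f" "pgrow S g"
  shows "pgrow S (\<lambda>s. f s * g s)"
proof -
  from assms obtain K k K' k' where *: "K \<ge> 0" "K' \<ge> 0"
    "\<And>s. s \<in> S \<Longrightarrow> norm (f s) \<le> K * (1 + norm s) ^ k"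
    "\<And>s. s \<in> S \<Longrightarrow> norm (g s) \<le> K' * (1 + norm s) ^ k'"
    unfolding pgrow_def by metis
  show ?thesis
  proof (rule pgrowI)
    fix s assume s: "s \<in> S"
    have "norm (f s * g s) \<le> (K * (1 + norm s) ^ k) * (K' * (1 + norm s) ^ k')"
      unfolding norm_mult by (intro mult_mono * s) (use * in auto)
    thus "norm (f s * g s) \<le> (K * K') * (1 + norm s) ^ (k + k')"
      by (simp add: power_add mult_ac)
  qed
qed

lemma pgrow_add:
  assumes "pgrow S f" "pgrow S g"
  shows "pgrow S (\<lambda>s. f s + g s)"
proof -
  from assms obtain K k K' k' where *: "K \<ge> 0" "K' \<ge> 0"
    "\<And>s. s \<in> S \<Longrightarrow> norm (f s) \<le> K * (1 + norm s) ^ k"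
    "\<And>s. s \<in> S \<Longrightarrow> norm (g s) \<le> K' * (1 + norm s) ^ k'"
    unfolding pgrow_def by metis
  show ?thesis
  proof (rule pgrowI)
    fix s assume s: "s \<in> S"
    have "norm (f s + g s) \<le> (K * (1 + norm s) ^ k) + (K' * (1 + norm s) ^ k')"
      by (intro norm_triangle_le add_mono * s)
    also have "\<dots> \<le> (K * (1 + norm s) ^ (k + k')) + (K' * (1 + norm s) ^ (k + k'))"
      by (intro add_mono mult_left_mono power_increasing) (use * in auto)
    finally show "norm (f s + g s) \<le> (K + K') * (1 + norm s) ^ (k + k')"
      by (simp add: algebra_simps)
  qed
qed

lemma pgrow_const: "pgrow S (\<lambda>_. c)"
  by (rule pgrowI[of _ _ "norm c" 0]) auto

lemma pgrow_sum: "(\<And>i. i \<in> I \<Longrightarrow> pgrow S (f i)) \<Longrightarrow> pgrow S (\<lambda>s. \<Sum>i\<in>I. f i s)"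
  by (induction I rule: infinite_finite_induct) (auto intro: pgrow_add pgrow_const)

lemma pgrow_ff: "pgrow S (\<lambda>s. ff (1 - s) k)"
proof (rule pgrowI)
  fix s
  have "norm (ff (1 - s) k) \<le> (1 + norm (1 - s)) ^ k * real (Suc k) ^ k"
    by (rule norm_ff_le)
  also have "\<dots> \<le> (2 * (1 + norm s)) ^ k * real (Suc k) ^ k"
  proof (intro mult_right_mono power_mono)
    show "1 + norm (1 - s) \<le> 2 * (1 + norm s)"
      using norm_triangle_ineq4[of 1 s] norm_ge_zero[of s] by (simp del: norm_ge_zero)
  qed auto
  finally show "norm (ff (1 - s) k) \<le> (2 ^ k * real (Suc k) ^ k) * (1 + norm s) ^ k"
    by (simp only: power_mult_distrib mult_ac)
qed

lemma pgrow_shift: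
  assumes "pgrow T g" "\<And>s. s \<in> S \<Longrightarrow> s + c \<in> T"
  shows "pgrow S (\<lambda>s. g (s + c))"
proof -
  obtain K k where *: "K \<ge> 0" "\<And>s. s \<in> T \<Longrightarrow> norm (g s) \<le> K * (1 + norm s) ^ k"
    using assms(1) unfolding pgrow_def by metis
  show ?thesis
  proof (rule pgrowI)
    fix s assume s: "s \<in> S"
    have "norm (g (s + c)) \<le> K * (1 + norm (s + c)) ^ k" using assms(2)[OF s] * by blast
    also have "\<dots> \<le> K * ((1 + norm c) * (1 + norm s)) ^ k"
    proof (intro mult_left_mono power_mono)
      have "1 + norm (s + c) \<le> 1 + norm s + norm c + norm c * norm s"
        using norm_triangle_ineq[of s c] mult_nonneg_nonneg[OF norm_ge_zero[of c] norm_ge_zero[of s]] by linarith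
      thus "1 + norm (s + c) \<le> (1 + norm c) * (1 + norm s)" by (simp add: algebra_simps)
    qed (use * in auto)
    finally show "norm (g (s + c)) \<le> (K * (1 + norm c) ^ k) * (1 + norm s) ^ k"
      by (simp add: power_mult_distrib mult_ac)
  qed
qed

lemma pgrow_zrem:
  assumes "c > 1 - real K"
  shows "pgrow {s. Re s \<ge> c} (\<lambda>s. \<Sum>n. zrem K s n)"
proof -
  define B where "B = (\<Sum>n. real (Suc n) powr (- c - K))"
  have sB: "summable (\<lambda>n. real (Suc n) powr (- c - K))"
    using assms by (intro summable_Suc_powr) auto
  have "norm (\<Sum>n. zrem K s n) \<le> norm (ff (1 - s) (Suc K) * of_real B)" if "s \<in> {s. Re s \<ge> c}" for s
  proof -
    have *: "norm (zrem K s n) \<le> norm (ff (1 - s) (Suc K)) * real (Suc n) powr (- c - K)" for n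
    proof -
      have "norm (zrem K s n) \<le> norm (ff (1 - s) (Suc K)) * real (Suc n) powr (- Re s - K)"
        using that assms by (intro norm_zrem_le) auto
      also have "\<dots> \<le> norm (ff (1 - s) (Suc K)) * real (Suc n) powr (- c - K)"
        using that by (intro mult_left_mono powr_mono) auto
      finally show ?thesis .
    qed
    have "norm (\<Sum>n. zrem K s n) \<le> (\<Sum>n. norm (ff (1 - s) (Suc K)) * real (Suc n) powr (- c - K))"
      by (rule norm_suminf_le[OF *]) (intro summable_mult sB)
    also have "\<dots> = norm (ff (1 - s) (Suc K)) * B"
      unfolding B_def by (rule suminf_mult[OF sB])
    also have "\<dots> \<le> norm (ff (1 - s) (Suc K) * of_real B)"
      by (simp add: norm_mult mult_left_mono)
    finally show ?thesis .
  qed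
  moreover have "pgrow {s. Re s \<ge> c} (\<lambda>s. ff (1 - s) (Suc K) * of_real B)"
    by (intro pgrow_mult pgrow_ff pgrow_const)
  ultimately show ?thesis
    unfolding pgrow_def by (meson order.trans)
qed

definition zseries :: "complex \<Rightarrow> complex" where
  "zseries s = (\<Sum>n. of_nat (Suc n) powr (- s))"

lemma zseries_sums:
  assumes "Re s > 1"
  shows "(\<lambda>n. of_nat (Suc n) powr (- s)) sums zseries s"
proof -
  have "summable (\<lambda>n. norm (of_nat (Suc n) powr (- s) :: complex))"
    using summable_Suc_powr[of "- Re s"] assms by (subst norm_of_nat_powr) auto
  thus ?thesis unfolding zseries_def by (intro summable_sums) (rule summable_norm_cancel)
qed

lemma tendsto_nat_powr_0:
  assumes "Re s < 0"
  shows "(\<lambda>n. of_nat (Suc n) powr s) \<longlonglongrightarrow> (0 :: complex)"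
proof (rule tendsto_norm_zero_cancel)
  have "(\<lambda>n. real (Suc n) powr Re s) \<longlonglongrightarrow> 0"
    using assms by (intro tendsto_neg_powr filterlim_compose[OF filterlim_real_sequentially filterlim_Suc])
  thus "(\<lambda>n. norm (of_nat (Suc n) powr s :: complex)) \<longlonglongrightarrow> 0"
    by (subst norm_of_nat_powr) auto
qed

text \<open>The Taylor terms of order 0 telescope to -1, and those of order j \<ge> 1 sum to
  multiples of zeta(s+j-1). The identity thus ties (s-1) zeta(s) to values of zeta further right and
  to a series that converges further left.\<close>

lemma zrem_suminf:
  assumes "Re s > 1"
  shows "(\<Sum>n. zrem K s n) = - 1 + (\<Sum>i<K. ff (1 - s) i / fact (Suc i) * ((s + of_nat i - 1) * zseries (s + of_nat i)))"
proof -
  define D where "D = (\<lambda>n. of_nat (Suc (Suc n)) powr (1 - s) - of_nat (Suc n) powr (1 - s) :: complex)"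
  have D: "D sums (0 - 1)"
    using telescope_sums[OF tendsto_nat_powr_0[of "1 - s"]] assms by (simp add: D_def)
  have "(\<lambda>n. D n - (\<Sum>i<K. ff (1 - s) (Suc i) / fact (Suc i) * of_nat (Suc n) powr (- (s + of_nat i))))
     sums ((0 - 1) - (\<Sum>i<K. ff (1 - s) (Suc i) / fact (Suc i) * zseries (s + of_nat i)))"
    by (intro sums_diff D sums_sum sums_mult zseries_sums) (use assms in auto)
  also have "(\<lambda>n. D n - (\<Sum>i<K. ff (1 - s) (Suc i) / fact (Suc i) * of_nat (Suc n) powr (- (s + of_nat i)))) = zrem K s"
    unfolding zrem_def D_def lessThan_Suc_atMost[symmetric]
    by (subst sum.lessThan_Suc_shift) (simp add: algebra_simps)
  finally have "zrem K s sums ((0 - 1) - (\<Sum>i<K. ff (1 - s) (Suc i) / fact (Suc i) * zseries (s + of_nat i)))" .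
  hence "(\<Sum>n. zrem K s n) = (0 - 1) - (\<Sum>i<K. ff (1 - s) (Suc i) / fact (Suc i) * zseries (s + of_nat i))"
    by (simp add: sums_iff)
  also have "\<dots> = - 1 + (\<Sum>i<K. ff (1 - s) i / fact (Suc i) * ((s + of_nat i - 1) * zseries (s + of_nat i)))"
  proof -
    have "- (ff (1 - s) (Suc i) / fact (Suc i) * zseries (s + of_nat i)) =
        ff (1 - s) i / fact (Suc i) * ((s + of_nat i - 1) * zseries (s + of_nat i))" for i
      unfolding ff_Suc by (simp add: divide_simps) (simp add: algebra_simps)
    thus ?thesis by (simp add: sum_negf[symmetric] del: fact_Suc)
  qed
  finally show ?thesis .
qed

text \<open>By induction on m: the identity \<open>zrem_suminf\<close> with K = m+1 is solved for
  its term i = 0, which is (s-1) zeta(s). All other terms evaluate the function already continued at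
  s+i with i \<ge> 1, and the remainder series converges for Re s > -m.\<close>

lemma zeta_continuation_half_plane:
  "\<exists>X. X holomorphic_on {s. Re s > 1 - real m} \<and> (\<forall>s. Re s > 1 \<longrightarrow> X s = (s - 1) * zseries s) \<and>
       (\<forall>c>1 - real m. pgrow {s. Re s \<ge> c} X)"
proof (induction m)
  case 0
  have "(\<lambda>s. (s - 1) * zseries s) holomorphic_on {s. Re s > 1}"
  proof -
    have "(\<lambda>z. \<Sum>n. of_nat (Suc n) powr (- z)) holomorphic_on {s. Re s > 1}"
    proof (rule holomorphic_suminf)
      show "(\<lambda>z. of_nat (Suc n) powr (- z)) holomorphic_on {s. Re s > 1}" for n
        by (intro holomorphic_intros) (auto simp: complex_nonpos_Reals_iff)
      fix z assume "z \<in> {s. Re s > 1}"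
      define d where "d = (Re z - 1) / 2"
      have d: "d > 0" using \<open>z \<in> _\<close> by (simp add: d_def)
      show "\<exists>d>0. \<exists>M. summable M \<and> (\<forall>n. \<forall>w\<in>ball z d \<inter> {s. Re s > 1}. norm (of_nat (Suc n) powr (- w) :: complex) \<le> M n)"
      proof (rule exI[of _ d], intro conjI d exI ballI allI)
        show "summable (\<lambda>n. real (Suc n) powr (- (Re z - d)))"
          using d by (intro summable_Suc_powr) (simp add: d_def field_simps)
        fix n w assume w: "w \<in> ball z d \<inter> {s. Re s > 1}"
        have "norm (w - z) < d" using w by (auto simp: dist_norm norm_minus_commute)
        hence "Re w \<ge> Re z - d" using abs_Re_le_cmod[of "w - z"] by auto
        thus "norm (of_nat (Suc n) powr (- w) :: complex) \<le> real (Suc n) powr (- (Re z - d))"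
          by (subst norm_of_nat_powr) (auto intro!: powr_mono)
      qed
    qed auto
    thus ?thesis unfolding zseries_def by (intro holomorphic_intros)
  qed
  moreover have "pgrow {s. Re s \<ge> c} (\<lambda>s. (s - 1) * zseries s)" if c: "c > 1" for c
  proof (rule pgrow_mult)
    show "pgrow {s. Re s \<ge> c} (\<lambda>s. s - 1)"
      by (rule pgrowI[of _ _ 1 1]) (metis add.commute norm_one norm_triangle_ineq4 mult_1 power_one_right)
    show "pgrow {s. Re s \<ge> c} zseries"
    proof (rule pgrowI[of _ _ "\<Sum>n. real (Suc n) powr (- c)" 0])
      fix s assume s: "s \<in> {s. Re s \<ge> c}"
      have "norm (zseries s) \<le> (\<Sum>n. real (Suc n) powr (- c))"
        unfolding zseries_def
      proof (rule norm_suminf_le)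
        show "norm (of_nat (Suc n) powr - s :: complex) \<le> real (Suc n) powr - c" for n
          using s by (subst norm_of_nat_powr) (auto intro!: powr_mono)
      qed (use c in \<open>auto intro!: summable_Suc_powr simp del: of_nat_Suc\<close>)
      thus "norm (zseries s) \<le> (\<Sum>n. real (Suc n) powr (- c)) * (1 + norm s) ^ 0" by simp
    qed
  qed
  ultimately show ?case by (intro exI[of _ "\<lambda>s. (s - 1) * zseries s"]) auto
next
  case (Suc m)
  then obtain X where X: "X holomorphic_on {s. Re s > 1 - real m}"
    "\<And>s. Re s > 1 \<Longrightarrow> X s = (s - 1) * zseries s"
    "\<And>c. c > 1 - real m \<Longrightarrow> pgrow {s. Re s \<ge> c} X" by blast
  define Y where "Y = (\<lambda>s. 1 - (\<Sum>i\<in>{1..<Suc m}. ff (1 - s) i * (1 / fact (Suc i)) * X (s + of_nat i))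
      + (\<Sum>n. zrem (Suc m) s n))"
  show ?case
  proof (intro exI[of _ Y] conjI allI impI)
    have "(\<lambda>s. X (s + of_nat i)) holomorphic_on {s. Re s > 1 - real (Suc m)}" if "i \<ge> 1" for i
    proof -
      have "(X \<circ> (\<lambda>s. s + of_nat i)) holomorphic_on {s. Re s > 1 - real (Suc m)}"
        using that by (intro holomorphic_on_compose_gen[OF _ X(1)] holomorphic_intros) auto
      thus ?thesis by (simp add: o_def)
    qed
    thus "Y holomorphic_on {s. Re s > 1 - real (Suc m)}"
      unfolding Y_def by (intro holomorphic_intros zrem_sum) auto
  next
    fix s :: complex assume s: "Re s > 1"
    have "(\<Sum>i<Suc m. ff (1 - s) i / fact (Suc i) * ((s + of_nat i - 1) * zseries (s + of_nat i)))
       = (s - 1) * zseries s + (\<Sum>i\<in>{1..<Suc m}. ff (1 - s) i / fact (Suc i) * ((s + of_nat i - 1) * zseries (s + of_nat i)))"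
      by (subst lessThan_atLeast0, subst sum.atLeast_Suc_lessThan) auto
    also have "(\<Sum>i\<in>{1..<Suc m}. ff (1 - s) i / fact (Suc i) * ((s + of_nat i - 1) * zseries (s + of_nat i)))
       = (\<Sum>i\<in>{1..<Suc m}. ff (1 - s) i * (1 / fact (Suc i)) * X (s + of_nat i))"
      using s by (intro sum.cong refl) (auto simp: X(2))
    finally show "Y s = (s - 1) * zseries s"
      using zrem_suminf[OF s, of "Suc m"] by (simp only: Y_def) simp
  next
    fix c assume c: "c > 1 - real (Suc m)"
    have "pgrow {s. Re s \<ge> c} (\<lambda>s. X (s + of_nat i))" if "i \<ge> 1" for i
      using that c by (intro pgrow_shift[OF X(3)[of "c + 1"]]) auto
    hence "pgrow {s. Re s \<ge> c} (\<lambda>s. 1 + (- 1) * (\<Sum>i\<in>{1..<Suc m}. ff (1 - s) i * (1 / fact (Suc i)) * X (s + of_nat i))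
      + (\<Sum>n. zrem (Suc m) s n))"
      using c by (intro pgrow_add pgrow_const pgrow_mult pgrow_sum pgrow_ff pgrow_zrem) auto
    thus "pgrow {s. Re s \<ge> c} Y" by (simp add: Y_def)
  qed
qed

lemma eq_on_half_planes:
  assumes "f holomorphic_on {s. Re s > a}" "g holomorphic_on {s. Re s > b}"
    "\<And>s. Re s > c \<Longrightarrow> f s = g s" "Re s > a" "Re s > b"
  shows "f s = g s"
proof (rule analytic_continuation_open[of "{s. Re s > max c (max a b)}" "{s. Re s > max a b}" f g])
  have "complex_of_real (max c (max a b) + 1) \<in> {s. Re s > max c (max a b)}"
    by (auto simp: max_def)
  thus "{s. Re s > max c (max a b)} \<noteq> {}" by blast
  show "open {s. Re s > max c (max a b)}" "open {s. Re s > max a b}" by (rule open_Re_gt)+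
  show "connected {s. Re s > max a b}" by (intro convex_connected convex_halfspace_Re_gt)
  show "f holomorphic_on {s. Re s > max a b}" by (rule holomorphic_on_subset[OF assms(1)]) auto
  show "g holomorphic_on {s. Re s > max a b}" by (rule holomorphic_on_subset[OF assms(2)]) auto
qed (use assms in auto)

text \<open>Value and derivative at 1 are recorded because they determine the principal part of
  \<open>Lstar F\<close> at 0; polynomial growth in right half-planes is what the shift of the
  Mellin integral requires.\<close>

theorem zeta_entire_part:
  obtains X where "X holomorphic_on UNIV" "X 1 = 1" "deriv X 1 = euler_mascheroni"
    "\<And>s. Re s > 1 \<Longrightarrow> X s = (s - 1) * zseries s" "\<And>c. pgrow {s. Re s \<ge> c} X"
proof -
  from zeta_continuation_half_plane obtain X where
    X: "\<And>m. X m holomorphic_on {s. Re s > 1 - real m}"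
    "\<And>m s. Re s > 1 \<Longrightarrow> X m s = (s - 1) * zseries s"
    "\<And>m c. c > 1 - real m \<Longrightarrow> pgrow {s. Re s \<ge> c} (X m)" by metis
  define M where "M = (\<lambda>s. nat \<lceil>2 - Re s\<rceil>)"
  have M: "Re s > 1 - real (M s)" for s unfolding M_def by linarith
  define Y where "Y = (\<lambda>s. X (M s) s)"
  have Y: "Y s = X m s" if "Re s > 1 - real m" for s m
    unfolding Y_def by (rule eq_on_half_planes[OF X(1) X(1), of 1]) (use that M X(2) in auto)
  have hol: "Y holomorphic_on UNIV"
  proof -
    have "Y field_differentiable (at z)" for z
    proof -
      have "X (M z) field_differentiable (at z)"
        using X(1) M by (intro holomorphic_on_imp_differentiable_at[OF X(1)]) auto
      then obtain d where "(X (M z) has_field_derivative d) (at z)" by (auto simp: field_differentiable_def)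
      hence "(Y has_field_derivative d) (at z)"
        by (rule has_field_derivative_transform_within_open[of _ _ _ "{s. Re s > 1 - real (M z)}"])
           (use M Y in auto)
      thus ?thesis by (auto simp: field_differentiable_def)
    qed
    thus ?thesis by (simp add: holomorphic_on_def field_differentiable_at_within)
  qed
  have gr: "Y s = (s - 1) * zseries s" if "Re s > 1" for s
    using Y[of 0] X(2) that by simp
  have pg: "pgrow {s. Re s \<ge> c} Y" for c
  proof -
    define m where "m = nat \<lceil>2 - c\<rceil>"
    have m: "c > 1 - real m" unfolding m_def by linarith
    show ?thesis using X(3)[OF m] m Y[of m] unfolding pgrow_def by (auto simp: order.strict_trans2)
  qed
  \<comment> \<open>The case K = 1 of \<open>zrem_suminf\<close>. It represents the function for Re
    s > 0, so value and derivative at 1 can be read off termwise.\<close>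
  define E where "E = (\<lambda>s. 1 + (\<Sum>n. zrem 1 s n))"
  have E: "Y s = E s" if "Re s > 0" for s
  proof (rule eq_on_half_planes[of Y 0 E 0 1])
    show "E holomorphic_on {s. Re s > 0}"
    proof -
      have "(\<lambda>s. \<Sum>n. zrem 1 s n) holomorphic_on {s. Re s > 0}" using zrem_sum(1)[of 1] by simp
      thus ?thesis unfolding E_def by (intro holomorphic_intros)
    qed
    show "Y s = E s" if "Re s > 1" for s
      using gr[OF that] zrem_suminf[OF that, of 1] by (simp add: E_def)
  qed (use that hol in \<open>auto intro: holomorphic_on_subset\<close>)
  have zr: "(\<lambda>s. zrem 1 s n) = (\<lambda>s. of_nat (Suc (Suc n)) powr (1 - s) - (of_nat (Suc n) powr (1 - s) + (1 - s) * of_nat (Suc n) powr (- s)))" for n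
    by (rule ext) (simp add: zrem_def algebra_simps)
  have nz: "(1 + of_nat n :: complex) \<noteq> 0" "(2 + of_nat n :: complex) \<noteq> 0" for n
    by (auto simp: complex_eq_iff)
  have "zrem 1 1 n = 0" for n using fun_cong[OF zr[of n], of 1] nz by simp
  hence "zrem 1 1 = (\<lambda>_. 0)" by blast
  hence "Y 1 = 1" using E[of 1] by (simp add: E_def)
  have der: "((\<lambda>s. zrem 1 s n) has_field_derivative
      inverse (of_nat (n+1)) + of_real (ln (of_nat (n+1))) - of_real (ln (of_nat (n+2)))) (at 1)" for n
  proof -
    have ln: "Ln (of_nat (Suc m)) = of_real (ln (real (Suc m)))" for m
      using Ln_of_real[of "real (Suc m)"] by simp
    have C: "((\<lambda>s. 1 - s) has_field_derivative - 1) (at (1::complex))"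
      "((\<lambda>s. - s) has_field_derivative - 1) (at (1::complex))"
      by (auto intro!: derivative_eq_intros)
    have P: "((\<lambda>z. of_nat (Suc m) powr z) has_field_derivative of_real (ln (real (Suc m))) * of_nat (Suc m) powr z) (at z)"
      for m and z :: complex
      using has_field_derivative_powr_right[of "of_nat (Suc m)" z] ln[of m] by (simp del: of_nat_Suc add: nz)
    have A: "((\<lambda>s. (of_nat (Suc m) :: complex) powr (1 - s)) has_field_derivative - of_real (ln (real (Suc m)))) (at 1)" for m
      using DERIV_chain2[where f = "\<lambda>z. of_nat (Suc m) powr z" and g = "\<lambda>s. 1 - s", OF P C(1)] by (simp del: of_nat_Suc)
    have B: "((\<lambda>s. (of_nat (Suc m) :: complex) powr (- s)) has_field_derivative - of_real (ln (real (Suc m))) * inverse (of_nat (Suc m))) (at 1)" for m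
      using DERIV_chain2[where f = "\<lambda>z. of_nat (Suc m) powr z" and g = "\<lambda>s. - s", OF P C(2)] by (simp add: powr_minus del: of_nat_Suc)
    have "((\<lambda>s. zrem 1 s n) has_field_derivative
       - of_real (ln (real (Suc (Suc n)))) - (- of_real (ln (real (Suc n))) +
         ((- 1) * of_nat (Suc n) powr (- 1) + (- of_real (ln (real (Suc n))) * inverse (of_nat (Suc n))) * (1 - 1)))) (at 1)"
      unfolding zr by (rule DERIV_diff[OF A DERIV_add[OF A DERIV_mult[OF C(1) B]]])
    thus ?thesis by (simp add: powr_minus algebra_simps del: of_nat_Suc)
  qed
  have "(\<lambda>n. deriv (\<lambda>s. zrem 1 s n) 1) sums deriv (\<lambda>z. \<Sum>n. zrem 1 z n) 1"
    by (rule zrem_sum(2)) auto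
  \<comment> \<open>The termwise derivatives 1/(n+1) + ln(n+1) - ln(n+2) form the series that
    defines Euler's constant.\<close>
  hence "(\<lambda>n. inverse (of_nat (n+1)) + of_real (ln (of_nat (n+1))) - of_real (ln (of_nat (n+2)))) sums deriv (\<lambda>z. \<Sum>n. zrem 1 z n) 1"
    unfolding DERIV_imp_deriv[OF der] .
  hence d: "deriv (\<lambda>z. \<Sum>n. zrem 1 z n) 1 = euler_mascheroni"
    using euler_mascheroni_sum sums_unique2 by blast
  have "deriv Y 1 = deriv E 1"
  proof (rule deriv_cong_ev)
    have "\<forall>\<^sub>F z in nhds 1. z \<in> {s. Re s > 0}" by (intro eventually_nhds_in_open) auto
    thus "\<forall>\<^sub>F x in nhds 1. Y x = E x" by eventually_elim (use E in auto)
  qed auto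
  also have "\<dots> = deriv (\<lambda>z. \<Sum>n. zrem 1 z n) 1"
  proof -
    have "(\<lambda>z. \<Sum>n. zrem 1 z n) field_differentiable (at 1)"
      using zrem_sum(1)[of 1] by (intro holomorphic_on_imp_differentiable_at[OF zrem_sum(1)[of 1]]) auto
    thus ?thesis unfolding E_def by (subst deriv_add) auto
  qed
  finally show ?thesis using that[of Y] hol \<open>Y 1 = 1\<close> d gr pg by simp
qed

text \<open>The entire function (s-1) zeta(s), not Riemann's xi. The choice fixes it together with
  all the facts that are used about it.\<close>

definition xi :: "complex \<Rightarrow> complex" where
  "xi = (SOME X. X holomorphic_on UNIV \<and> X 1 = 1 \<and> deriv X 1 = euler_mascheroni \<and>
     (\<forall>s. Re s > 1 \<longrightarrow> X s = (s - 1) * zseries s) \<and> (\<forall>c. pgrow {s. Re s \<ge> c} X))"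

lemma xi: "xi holomorphic_on UNIV" "xi 1 = 1" "deriv xi 1 = euler_mascheroni"
    "Re s > 1 \<Longrightarrow> xi s = (s - 1) * zseries s" "pgrow {s. Re s \<ge> c} xi"
proof -
  have "\<exists>X. X holomorphic_on UNIV \<and> X 1 = 1 \<and> deriv X 1 = euler_mascheroni \<and>
     (\<forall>s. Re s > 1 \<longrightarrow> X s = (s - 1) * zseries s) \<and> (\<forall>c. pgrow {s. Re s \<ge> c} X)"
    using zeta_entire_part by metis
  from someI_ex[OF this, folded xi_def]
  show "xi holomorphic_on UNIV" "xi 1 = 1" "deriv xi 1 = euler_mascheroni"
    "Re s > 1 \<Longrightarrow> xi s = (s - 1) * zseries s" "pgrow {s. Re s \<ge> c} xi" by blast+
qed

text \<open>The plane without 1 is connected, so the identity theorem shows that the definite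
  description in \<open>zeta\<close> has exactly one solution.\<close>

lemma zeta_eq: "zeta s = (if s = 1 then 0 else xi s / (s - 1))"
proof -
  define Z where "Z = (\<lambda>s. if s = 1 then 0 else xi s / (s - 1))"
  have hol: "Z holomorphic_on (- {1})"
  proof (rule holomorphic_transform)
    show "(\<lambda>s. xi s / (s - 1)) holomorphic_on (- {1})"
      using xi(1) by (intro holomorphic_intros) (auto intro: holomorphic_on_subset)
  qed (auto simp: Z_def)
  have Z: "Z s = zseries s" if "Re s > 1" for s
    using xi(4)[OF that] that by (auto simp: Z_def)
  have "zeta = Z"
    unfolding zeta_def
  proof (rule the_equality, intro conjI allI impI)
    show "(\<lambda>n. of_nat (Suc n) powr (- s)) sums Z s" if "Re s > 1" for s
      using zseries_sums[OF that] Z[OF that] by simp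
    fix Y assume Y: "Y holomorphic_on (- {1}) \<and> Y 1 = 0 \<and>
      (\<forall>s. Re s > 1 \<longrightarrow> (\<lambda>n. of_nat (Suc n) powr (- s)) sums Y s)"
    have "Y s = Z s" if "s \<noteq> 1" for s
    proof (rule analytic_continuation_open[of "{s. Re s > 1}" "- {1}" Y Z])
      have "complex_of_real 2 \<in> {s. Re s > 1}" by simp
      thus "{s. Re s > 1} \<noteq> {}" by blast
      show "connected (- {1 :: complex})"
        by (intro connected_punctured_universe) auto
      show "Y s = Z s" if "s \<in> {s. Re s > 1}" for s
      proof -
        have "(\<lambda>n. of_nat (Suc n) powr (- s)) sums Y s" using Y that by blast
        thus ?thesis using zseries_sums[of s] Z[of s] that sums_unique2 by auto
      qed
    qed (use Y hol that in auto)
    thus "Y = Z" using Y by (auto simp: fun_eq_iff Z_def)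
  qed (use hol in \<open>auto simp: Z_def\<close>)
  hence "zeta s = Z s" by (rule fun_cong)
  thus ?thesis unfolding Z_def .
qed


subsection \<open>Integrals over vertical lines\<close>

lemma integrable_exp_abs:
  assumes "(\<delta>::real) > 0"
  shows "integrable lborel (\<lambda>t. exp (- \<delta> * \<bar>t\<bar>))"
proof -
  have 1: "set_integrable lborel {0..} (\<lambda>t. exp (- \<delta> * t))"
    using nonnegative_absolutely_integrable_1[OF integrable_on_exp_minus_to_infinity[OF assms, of 0]]
    by (simp add: set_integrable_def integrable_completion)
  have "integrable lborel (\<lambda>t. indicator {0..} t * exp (- \<delta> * t))"
    using 1 by (simp add: set_integrable_def)
  moreover have "integrable lborel (\<lambda>t. indicator {0..} (-t) * exp (- \<delta> * (-t)))"
    using lborel_integrable_real_affine[of "\<lambda>t. indicator {0..} t * exp (- \<delta> * t)" "-1" 0] calculation by simp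
  ultimately have "integrable lborel (\<lambda>t. indicator {0..} t * exp (- \<delta> * t) + indicator {0..} (-t) * exp (- \<delta> * (-t)))"
    by (rule Bochner_Integration.integrable_add)
  thus ?thesis
    by (rule Bochner_Integration.integrable_bound) (auto simp: indicator_def intro!: AE_I2)
qed

lemma line_bound_global:
  fixes g :: "real \<Rightarrow> complex"
  assumes "continuous_on UNIV g" "\<And>t. \<bar>t\<bar> \<ge> T0 \<Longrightarrow> norm (g t) \<le> K * exp (- \<delta> * \<bar>t\<bar>)"
  shows "\<exists>K'>0. \<forall>t. norm (g t) \<le> K' * exp (- \<delta> * \<bar>t\<bar>)"
proof -
  have "compact ((\<lambda>t. norm (g t) * exp (\<delta> * \<bar>t\<bar>)) ` {- T0..T0})"
    by (intro compact_continuous_image continuous_intros continuous_on_subset[OF assms(1)]) auto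
  then obtain B where B: "B > 0" "\<And>t. t \<in> {- T0..T0} \<Longrightarrow> norm (norm (g t) * exp (\<delta> * \<bar>t\<bar>)) \<le> B"
    by (metis (no_types, lifting) bounded_pos compact_imp_bounded imageI)
  show ?thesis
  proof (intro exI conjI allI)
    show "max B K > 0" using B by simp
    fix t
    show "norm (g t) \<le> max B K * exp (- \<delta> * \<bar>t\<bar>)"
    proof (cases "\<bar>t\<bar> \<ge> T0")
      case True
      show ?thesis by (rule order.trans[OF assms(2)[OF True]]) (intro mult_right_mono, auto)
    next
      case False
      hence "t \<in> {- T0..T0}" by (simp only: atLeastAtMost_iff) arith
      from B(2)[OF this] have "norm (g t) * exp (\<delta> * \<bar>t\<bar>) \<le> B" by simp
      hence "norm (g t) \<le> B * exp (- \<delta> * \<bar>t\<bar>)" by (simp add: exp_minus field_simps)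
      also have "\<dots> \<le> max B K * exp (- \<delta> * \<bar>t\<bar>)" by (intro mult_right_mono) auto
      finally show ?thesis .
    qed
  qed
qed

lemma integrable_line:
  fixes g :: "real \<Rightarrow> complex"
  assumes "continuous_on UNIV g" "\<And>t. \<bar>t\<bar> \<ge> T0 \<Longrightarrow> norm (g t) \<le> K * exp (- \<delta> * \<bar>t\<bar>)" "\<delta> > 0"
  shows "integrable lborel g"
proof -
  obtain K' where K': "\<And>t. norm (g t) \<le> K' * exp (- \<delta> * \<bar>t\<bar>)"
    using line_bound_global[OF assms(1,2)] by blast
  show ?thesis
  proof (rule Bochner_Integration.integrable_bound)
    show "integrable lborel (\<lambda>t. K' * exp (- \<delta> * \<bar>t\<bar>))"
      using integrable_exp_abs[OF assms(3)] by simp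
    show "AE t in lborel. norm (g t) \<le> norm (K' * exp (- \<delta> * \<bar>t\<bar>))"
      using K' by (intro AE_I2) (metis abs_ge_self order.trans real_norm_def)
    show "g \<in> borel_measurable lborel"
      using assms(1) by (simp add: borel_measurable_continuous_onI)
  qed
qed

lemma norm_line_integral_le:
  fixes g :: "real \<Rightarrow> complex"
  assumes "\<And>t. norm (g t) \<le> K * exp (- \<delta> * \<bar>t\<bar>)" "\<delta> > 0"
  shows "norm (LINT t|lborel. g t) \<le> K * (LINT t|lborel. exp (- \<delta> * \<bar>t\<bar>))"
proof (cases "integrable lborel g")
  case True
  have "norm (LINT t|lborel. g t) \<le> (LINT t|lborel. norm (g t))" by (rule integral_norm_bound)
  also have "\<dots> \<le> (LINT t|lborel. K * exp (- \<delta> * \<bar>t\<bar>))"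
    using assms integrable_exp_abs[OF assms(2)] True by (intro integral_mono) auto
  finally show ?thesis by simp
next
  \<comment> \<open>The integral of a non-integrable function has the default value 0, and the
    right-hand side is nonnegative because \<open>K\<close> is.\<close>
  case False
  have "K * exp (- \<delta> * \<bar>0\<bar>) \<ge> 0" using order.trans[OF norm_ge_zero assms(1)[of 0]] by simp
  hence "K \<ge> 0" by simp
  thus ?thesis using not_integrable_integral_eq[OF False] by (simp add: integral_nonneg_AE)
qed

lemma tendsto_symmetric_integral:
  fixes g :: "real \<Rightarrow> complex"
  assumes "integrable lborel g" "continuous_on UNIV g"
  shows "(\<lambda>n. integral {- real n..real n} g) \<longlonglongrightarrow> (LINT t|lborel. g t)"
proof -
  have "(\<lambda>n. LINT t|lborel. indicator {- real n..real n} t *\<^sub>R g t) \<longlonglongrightarrow> (LINT t|lborel. g t)"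
  proof (rule integral_dominated_convergence)
    show "integrable lborel (\<lambda>t. norm (g t))" using assms by simp
    show "AE t in lborel. (\<lambda>n. indicator {- real n..real n} t *\<^sub>R g t) \<longlonglongrightarrow> g t"
    proof (intro AE_I2 tendsto_eventually)
      fix t :: real
      have "\<forall>\<^sub>F n in sequentially. n \<ge> nat \<lceil>\<bar>t\<bar>\<rceil>" by (rule eventually_ge_at_top)
      thus "\<forall>\<^sub>F n in sequentially. indicator {- real n..real n} t *\<^sub>R g t = g t"
      proof eventually_elim
        case (elim n)
        hence "\<bar>t\<bar> \<le> real n" by linarith
        thus ?case by (simp add: indicator_def abs_le_iff)
      qed
    qed
  qed (use assms in \<open>auto simp: indicator_def\<close>)
  moreover have "(LINT t|lborel. indicator {- real n..real n} t *\<^sub>R g t) = integral {- real n..real n} g" for n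
  proof -
    have "set_integrable lborel {- real n..real n} g"
      using assms(1) by (simp add: set_integrable_def integrable_mult_indicator)
    from set_borel_integral_eq_integral(2)[OF this] show ?thesis
      by (simp add: set_lebesgue_integral_def)
  qed
  ultimately show ?thesis by simp
qed

text \<open>The value of the integral over rectangles is a hypothesis, so that Cauchy's theorem and
  the residue theorem can share the passage to the limit: horizontal edges vanish by the decay,
  vertical edges tend to the line integrals. From dz = i dt the factor 2 pi i becomes 2 pi.\<close>

lemma shift_line_aux:
  fixes f :: "complex \<Rightarrow> complex" and S :: complex
  assumes "\<sigma>1 < \<sigma>2" "\<delta> > 0"
    and bound: "\<And>\<sigma> t. \<sigma>1 \<le> \<sigma> \<Longrightarrow> \<sigma> \<le> \<sigma>2 \<Longrightarrow> \<bar>t\<bar> \<ge> T0 \<Longrightarrow> norm (f (Complex \<sigma> t)) \<le> K * exp (- \<delta> * \<bar>t\<bar>)"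
    and cont: "continuous_on UNIV (\<lambda>t. f (Complex \<sigma>1 t))" "continuous_on UNIV (\<lambda>t. f (Complex \<sigma>2 t))"
    and conth: "\<And>t. \<bar>t\<bar> > T0 \<Longrightarrow> continuous_on {\<sigma>1..\<sigma>2} (\<lambda>\<sigma>. f (Complex \<sigma> t))"
    and rect: "\<And>T. T > T0 \<Longrightarrow> T > 0 \<Longrightarrow> contour_integral (rectpath (Complex \<sigma>1 (- T)) (Complex \<sigma>2 T)) f = 2 * pi * \<i> * S"
  shows "integrable lborel (\<lambda>t. f (Complex \<sigma>1 t))" "integrable lborel (\<lambda>t. f (Complex \<sigma>2 t))"
    "(LINT t|lborel. f (Complex \<sigma>2 t)) - (LINT t|lborel. f (Complex \<sigma>1 t)) = 2 * pi * S"
proof -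
  show int: "integrable lborel (\<lambda>t. f (Complex \<sigma>1 t))" "integrable lborel (\<lambda>t. f (Complex \<sigma>2 t))"
    using assms by (auto intro!: integrable_line[where K = K and \<delta> = \<delta> and ?T0.0 = T0])
  have cintv: "f contour_integrable_on linepath (Complex c (-T)) (Complex c T)"
    "f contour_integrable_on linepath (Complex c T) (Complex c (-T))"
    if "c \<in> {\<sigma>1, \<sigma>2}" for c T
  proof -
    have "continuous_on (closed_segment (Complex c (-T)) (Complex c T)) f"
    proof -
      have "continuous_on (closed_segment (Complex c (-T)) (Complex c T)) (\<lambda>z. f (Complex c (Im z)))"
      proof -
        have "continuous_on UNIV (\<lambda>t. f (Complex c t))" using that cont by auto
        thus ?thesis by (rule continuous_on_compose2) (simp_all add: continuous_on_Im continuous_on_id)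
      qed
      also have "?this \<longleftrightarrow> ?thesis"
        by (intro continuous_on_cong refl) (auto simp: closed_segment_same_Re complex_eq_iff)
      finally show ?thesis .
    qed
    thus "f contour_integrable_on linepath (Complex c (-T)) (Complex c T)"
      "f contour_integrable_on linepath (Complex c T) (Complex c (-T))"
      by (auto intro!: contour_integrable_continuous_linepath simp: closed_segment_commute)
  qed
  have conth': "continuous_on (closed_segment (Complex \<sigma>1 t) (Complex \<sigma>2 t)) f" if "\<bar>t\<bar> > T0" for t
  proof -
    have "continuous_on (closed_segment (Complex \<sigma>1 t) (Complex \<sigma>2 t)) (\<lambda>z. f (Complex (Re z) t))"
      using \<open>\<sigma>1 < \<sigma>2\<close>
      by (intro continuous_on_compose2[OF conth[OF that], of _ Re] continuous_intros)
         (auto simp: closed_segment_same_Im closed_segment_eq_real_ivl)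
    also have "?this \<longleftrightarrow> ?thesis"
      by (intro continuous_on_cong refl) (auto simp: closed_segment_same_Im complex_eq_iff)
    finally show ?thesis .
  qed
  have hbound: "norm (contour_integral (linepath (Complex \<sigma>1 t) (Complex \<sigma>2 t)) f) \<le> K * exp (- \<delta> * \<bar>t\<bar>) * (\<sigma>2 - \<sigma>1)"
    if t: "\<bar>t\<bar> > T0" for t
  proof -
    have "norm (contour_integral (linepath (Complex \<sigma>1 t) (Complex \<sigma>2 t)) f) \<le> K * exp (- \<delta> * \<bar>t\<bar>) * norm (Complex \<sigma>2 t - Complex \<sigma>1 t)"
    proof (rule contour_integral_bound_linepath)
      show "f contour_integrable_on linepath (Complex \<sigma>1 t) (Complex \<sigma>2 t)"
        using conth'[OF t] by (rule contour_integrable_continuous_linepath)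
      show "0 \<le> K * exp (- \<delta> * \<bar>t\<bar>)"
        using order.trans[OF norm_ge_zero bound[of \<sigma>1 t]] assms(1) t by auto
      fix x assume "x \<in> closed_segment (Complex \<sigma>1 t) (Complex \<sigma>2 t)"
      hence x: "x = Complex (Re x) t" "Re x \<in> {\<sigma>1..\<sigma>2}"
        using assms(1) by (auto simp: closed_segment_same_Im complex_eq_iff closed_segment_eq_real_ivl)
      show "norm (f x) \<le> K * exp (- \<delta> * \<bar>t\<bar>)"
        by (subst x(1)) (use bound[of "Re x" t] x(2) t in auto)
    qed
    also have "norm (Complex \<sigma>2 t - Complex \<sigma>1 t) = \<sigma>2 - \<sigma>1"
      using assms(1) by (simp add: cmod_def)
    finally show ?thesis .
  qed
  have lim: "(\<lambda>n. K * exp (- \<delta> * \<bar>real n\<bar>) * (\<sigma>2 - \<sigma>1)) \<longlonglongrightarrow> 0"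
  proof -
    have "filterlim (\<lambda>n. \<delta> * real n) at_top sequentially"
      using assms(2) by (intro filterlim_tendsto_pos_mult_at_top[OF tendsto_const _ filterlim_real_sequentially])
    hence "(\<lambda>n. exp (- (\<delta> * real n))) \<longlonglongrightarrow> 0"
      by (intro filterlim_compose[OF exp_at_bot]) (simp add: filterlim_uminus_at_bot)
    from tendsto_mult_left_zero[OF tendsto_mult_right_zero[OF this, of K], of "\<sigma>2 - \<sigma>1"]
    show ?thesis by simp
  qed
  define B where "B = (\<lambda>t. contour_integral (linepath (Complex \<sigma>1 t) (Complex \<sigma>2 t)) f)"
  have big: "\<forall>\<^sub>F n in sequentially. real n > T0 \<and> real n > 0"
    by (intro eventually_conj eventually_gt_at_top filterlim_at_top_dense[THEN iffD1, rule_format] filterlim_real_sequentially)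
  have B0: "(\<lambda>n. B (real n)) \<longlonglongrightarrow> 0" "(\<lambda>n. B (- real n)) \<longlonglongrightarrow> 0"
  proof -
    have "\<forall>\<^sub>F n in sequentially. norm (B (real n)) \<le> K * exp (- \<delta> * \<bar>real n\<bar>) * (\<sigma>2 - \<sigma>1)"
      using big by eventually_elim (unfold B_def, rule hbound, auto)
    thus "(\<lambda>n. B (real n)) \<longlonglongrightarrow> 0" by (rule Lim_null_comparison[OF _ lim])
    have "\<forall>\<^sub>F n in sequentially. norm (B (- real n)) \<le> K * exp (- \<delta> * \<bar>- real n\<bar>) * (\<sigma>2 - \<sigma>1)"
      using big by eventually_elim (unfold B_def, rule hbound, auto)
    thus "(\<lambda>n. B (- real n)) \<longlonglongrightarrow> 0" using lim by (intro Lim_null_comparison[OF _ lim]) simp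
  qed
  have eq: "\<forall>\<^sub>F n in sequentially. B (- real n) + \<i> * integral {- real n..real n} (\<lambda>t. f (Complex \<sigma>2 t)) - B (real n)
           - \<i> * integral {- real n..real n} (\<lambda>t. f (Complex \<sigma>1 t)) = 2 * pi * \<i> * S"
    using big
  proof eventually_elim
    case (elim n)
    define T where "T = real n"
    have T: "T > T0" "T > 0" using elim by (auto simp: T_def)
    have h: "f contour_integrable_on linepath (Complex \<sigma>1 t) (Complex \<sigma>2 t)"
        "f contour_integrable_on linepath (Complex \<sigma>2 t) (Complex \<sigma>1 t)" if "t = T \<or> t = -T" for t
      using conth'[of t] that T by (auto intro!: contour_integrable_continuous_linepath simp: closed_segment_commute)
    have "2 * pi * \<i> * S = contour_integral (rectpath (Complex \<sigma>1 (- T)) (Complex \<sigma>2 T)) f"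
      using rect T by simp
    also have "\<dots> = B (-T) + (contour_integral (linepath (Complex \<sigma>2 (-T)) (Complex \<sigma>2 T)) f +
        (contour_integral (linepath (Complex \<sigma>2 T) (Complex \<sigma>1 T)) f + contour_integral (linepath (Complex \<sigma>1 T) (Complex \<sigma>1 (-T))) f))"
      unfolding rectpath_def B_def Let_def
      by (simp add: cintv h)
    also have "contour_integral (linepath (Complex \<sigma>2 T) (Complex \<sigma>1 T)) f = - B T"
      unfolding B_def by (subst contour_integral_reversepath[symmetric]) auto
    also have "contour_integral (linepath (Complex \<sigma>1 T) (Complex \<sigma>1 (-T))) f = - contour_integral (linepath (Complex \<sigma>1 (-T)) (Complex \<sigma>1 T)) f"
      by (subst contour_integral_reversepath[symmetric]) auto
    also have "contour_integral (linepath (Complex \<sigma>1 (-T)) (Complex \<sigma>1 T)) f = \<i> * integral {-T..T} (\<lambda>t. f (Complex \<sigma>1 t))"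
      using T by (intro contour_integral_linepath_same_Re) auto
    also have "contour_integral (linepath (Complex \<sigma>2 (-T)) (Complex \<sigma>2 T)) f = \<i> * integral {-T..T} (\<lambda>t. f (Complex \<sigma>2 t))"
      using T by (intro contour_integral_linepath_same_Re) auto
    finally show ?case by (simp add: T_def algebra_simps)
  qed
  have "(\<lambda>n. B (- real n) + \<i> * integral {- real n..real n} (\<lambda>t. f (Complex \<sigma>2 t)) - B (real n)
           - \<i> * integral {- real n..real n} (\<lambda>t. f (Complex \<sigma>1 t))) \<longlonglongrightarrow>
         0 + \<i> * (LINT t|lborel. f (Complex \<sigma>2 t)) - 0 - \<i> * (LINT t|lborel. f (Complex \<sigma>1 t))"
    by (intro tendsto_intros B0 tendsto_symmetric_integral int cont)
  moreover have "(\<lambda>n. B (- real n) + \<i> * integral {- real n..real n} (\<lambda>t. f (Complex \<sigma>2 t)) - B (real n)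
           - \<i> * integral {- real n..real n} (\<lambda>t. f (Complex \<sigma>1 t))) \<longlonglongrightarrow> 2 * pi * \<i> * S"
    using eq by (rule tendsto_eventually)
  ultimately have "0 + \<i> * (LINT t|lborel. f (Complex \<sigma>2 t)) - 0 - \<i> * (LINT t|lborel. f (Complex \<sigma>1 t)) = 2 * pi * \<i> * S"
    by (rule LIMSEQ_unique)
  hence "\<i> * ((LINT t|lborel. f (Complex \<sigma>2 t)) - (LINT t|lborel. f (Complex \<sigma>1 t))) = \<i> * (2 * pi * S)"
    by (simp add: algebra_simps)
  thus "(LINT t|lborel. f (Complex \<sigma>2 t)) - (LINT t|lborel. f (Complex \<sigma>1 t)) = 2 * pi * S"
    by (simp only: mult_left_cancel[OF complex_i_not_zero])
qed

lemma continuous_on_vertical: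
  assumes "continuous_on A f" "\<And>t. t \<in> T \<Longrightarrow> Complex c t \<in> A"
  shows "continuous_on T (\<lambda>t. f (Complex c t))"
  using assms by (intro continuous_on_compose2[OF assms(1)]) (auto simp: Complex_eq intro!: continuous_intros)

lemma continuous_on_horizontal:
  assumes "continuous_on A f" "\<And>t. t \<in> T \<Longrightarrow> Complex t c \<in> A"
  shows "continuous_on T (\<lambda>t. f (Complex t c))"
  using assms by (intro continuous_on_compose2[OF assms(1)]) (auto simp: Complex_eq intro!: continuous_intros)

lemma cbox_Complex_iff: "z \<in> cbox (Complex a b) (Complex c d) \<longleftrightarrow> Re z \<in> {a..c} \<and> Im z \<in> {b..d}"
  by (auto simp: in_cbox_complex_iff)

text \<open>Holomorphy is asked for on the closed strip only, because F is given only for Re s \<ge>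
  -R and the line is moved right onto that border. Cauchy's theorem on the closed rectangle suffices
  for this.\<close>

theorem shift_line_holomorphic:
  fixes f :: "complex \<Rightarrow> complex"
  assumes "\<sigma>1 < \<sigma>2" "\<delta> > 0"
    and bound: "\<And>\<sigma> t. \<sigma>1 \<le> \<sigma> \<Longrightarrow> \<sigma> \<le> \<sigma>2 \<Longrightarrow> \<bar>t\<bar> \<ge> T0 \<Longrightarrow> norm (f (Complex \<sigma> t)) \<le> K * exp (- \<delta> * \<bar>t\<bar>)"
    and hol: "f holomorphic_on {s. \<sigma>1 \<le> Re s \<and> Re s \<le> \<sigma>2}"
  shows "integrable lborel (\<lambda>t. f (Complex \<sigma>1 t))" "integrable lborel (\<lambda>t. f (Complex \<sigma>2 t))"
    "(LINT t|lborel. f (Complex \<sigma>2 t)) = (LINT t|lborel. f (Complex \<sigma>1 t))"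
proof -
  have cont: "continuous_on {s. \<sigma>1 \<le> Re s \<and> Re s \<le> \<sigma>2} f"
    using hol by (rule holomorphic_on_imp_continuous_on)
  have "contour_integral (rectpath (Complex \<sigma>1 (- T)) (Complex \<sigma>2 T)) f = 2 * pi * \<i> * 0"
    if "T > T0" "T > 0" for T
  proof -
    have "f holomorphic_on cbox (Complex \<sigma>1 (- T)) (Complex \<sigma>2 T)"
      by (rule holomorphic_on_subset[OF hol]) (auto simp: cbox_Complex_iff)
    hence "(f has_contour_integral 0) (rectpath (Complex \<sigma>1 (- T)) (Complex \<sigma>2 T))"
      using that assms(1) by (intro Cauchy_theorem_convex_simple[where S = "cbox (Complex \<sigma>1 (- T)) (Complex \<sigma>2 T)"] path_image_rectpath_subset_cbox) auto
    thus ?thesis by (simp add: contour_integral_unique)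
  qed
  note * = this
  have c: "continuous_on UNIV (\<lambda>t. f (Complex \<sigma>1 t))" "continuous_on UNIV (\<lambda>t. f (Complex \<sigma>2 t))"
    "\<And>t. \<bar>t\<bar> > T0 \<Longrightarrow> continuous_on {\<sigma>1..\<sigma>2} (\<lambda>\<sigma>. f (Complex \<sigma> t))"
    using assms(1) by (auto intro!: continuous_on_vertical[OF cont] continuous_on_horizontal[OF cont])
  show "integrable lborel (\<lambda>t. f (Complex \<sigma>1 t))" "integrable lborel (\<lambda>t. f (Complex \<sigma>2 t))"
    by (rule shift_line_aux[OF assms(1,2) bound c *]; simp)+
  have "(LINT t|lborel. f (Complex \<sigma>2 t)) - (LINT t|lborel. f (Complex \<sigma>1 t)) = 2 * pi * (0 :: complex)"
    by (rule shift_line_aux[OF assms(1,2) bound c *]; simp)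
  thus "(LINT t|lborel. f (Complex \<sigma>2 t)) = (LINT t|lborel. f (Complex \<sigma>1 t))" by simp
qed

theorem shift_line_residues:
  fixes f :: "complex \<Rightarrow> complex"
  assumes "\<sigma>1 < \<sigma>2" "\<delta> > 0" "\<sigma>0 < \<sigma>1"
    and bound: "\<And>\<sigma> t. \<sigma>1 \<le> \<sigma> \<Longrightarrow> \<sigma> \<le> \<sigma>2 \<Longrightarrow> \<bar>t\<bar> \<ge> T0 \<Longrightarrow> norm (f (Complex \<sigma> t)) \<le> K * exp (- \<delta> * \<bar>t\<bar>)"
    and fin: "finite pts" and pts: "\<And>p. p \<in> pts \<Longrightarrow> \<sigma>1 < Re p \<and> Re p < \<sigma>2 \<and> \<bar>Im p\<bar> \<le> T0"
    and hol: "f holomorphic_on {s. \<sigma>0 < Re s} - pts"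
  shows "integrable lborel (\<lambda>t. f (Complex \<sigma>1 t))" "integrable lborel (\<lambda>t. f (Complex \<sigma>2 t))"
    "(LINT t|lborel. f (Complex \<sigma>2 t)) - (LINT t|lborel. f (Complex \<sigma>1 t)) = 2 * pi * (\<Sum>p\<in>pts. residue f p)"
proof -
  have cont: "continuous_on ({s. \<sigma>0 < Re s} - pts) f"
    using hol by (rule holomorphic_on_imp_continuous_on)
  have rect: "contour_integral (rectpath (Complex \<sigma>1 (- T)) (Complex \<sigma>2 T)) f = 2 * pi * \<i> * (\<Sum>p\<in>pts. residue f p)"
    if T: "T > T0" "T > 0" for T
  proof -
    let ?\<gamma> = "rectpath (Complex \<sigma>1 (- T)) (Complex \<sigma>2 T)"
    have img: "path_image ?\<gamma> \<subseteq> cbox (Complex \<sigma>1 (- T)) (Complex \<sigma>2 T)"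
      using T assms(1) by (intro path_image_rectpath_subset_cbox) auto
    have "contour_integral ?\<gamma> f = 2 * pi * \<i> * (\<Sum>p\<in>pts. winding_number ?\<gamma> p * residue f p)"
    proof (rule Residue_theorem[OF _ _ fin hol])
      show "open {s. \<sigma>0 < Re s}" by (rule open_Re_gt)
      show "connected {s. \<sigma>0 < Re s}" by (intro convex_connected convex_halfspace_Re_gt)
      show "path_image ?\<gamma> \<subseteq> {s. \<sigma>0 < Re s} - pts"
      proof
        fix z assume z: "z \<in> path_image ?\<gamma>"
        hence "z \<in> cbox (Complex \<sigma>1 (- T)) (Complex \<sigma>2 T)" using img by blast
        hence "\<sigma>0 < Re z" using assms(3) by (auto simp: cbox_Complex_iff)
        moreover have "z \<notin> pts"
          using z pts[of z] T assms(1) by (auto simp: path_image_rectpath)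
        ultimately show "z \<in> {s. \<sigma>0 < Re s} - pts" by simp
      qed
      show "\<forall>z. z \<notin> {s. \<sigma>0 < Re s} \<longrightarrow> winding_number ?\<gamma> z = 0"
        using T assms(1,3) by (auto intro!: winding_number_rectpath_outside simp: cbox_Complex_iff)
    qed auto
    also have "(\<Sum>p\<in>pts. winding_number ?\<gamma> p * residue f p) = (\<Sum>p\<in>pts. residue f p)"
    proof (rule sum.cong)
      fix p assume "p \<in> pts"
      hence "p \<in> box (Complex \<sigma>1 (- T)) (Complex \<sigma>2 T)"
        using pts[of p] T by (auto simp: in_box_complex_iff)
      thus "winding_number ?\<gamma> p * residue f p = residue f p" by (simp add: winding_number_rectpath)
    qed auto
    finally show ?thesis .
  qed
  have c: "continuous_on UNIV (\<lambda>t. f (Complex \<sigma>1 t))" "continuous_on UNIV (\<lambda>t. f (Complex \<sigma>2 t))"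
    "\<And>t. \<bar>t\<bar> > T0 \<Longrightarrow> continuous_on {\<sigma>1..\<sigma>2} (\<lambda>\<sigma>. f (Complex \<sigma> t))"
    using assms(1,3) pts by (fastforce intro!: continuous_on_vertical[OF cont] continuous_on_horizontal[OF cont])+
  show "integrable lborel (\<lambda>t. f (Complex \<sigma>1 t))" "integrable lborel (\<lambda>t. f (Complex \<sigma>2 t))"
    "(LINT t|lborel. f (Complex \<sigma>2 t)) - (LINT t|lborel. f (Complex \<sigma>1 t)) = 2 * pi * (\<Sum>p\<in>pts. residue f p)"
    by (rule shift_line_aux[OF assms(1,2) bound c rect]; simp)+
qed


subsection \<open>Mellin inversion\<close>

lemma norm_powr_line: "w \<noteq> 0 \<Longrightarrow> norm (w powr - Complex \<sigma> t) = norm w powr - \<sigma> * exp (t * Im (Ln w))"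
  by (simp add: norm_powr_complex Arg_eq_Im_Ln)

lemma norm_powr_line_le: "w \<noteq> 0 \<Longrightarrow> norm (w powr - Complex \<sigma> t) \<le> norm w powr - \<sigma> * exp (\<bar>t\<bar> * \<bar>Im (Ln w)\<bar>)"
  unfolding norm_powr_line
  by (intro mult_left_mono) (auto simp flip: abs_mult)

lemma continuous_powr_line: "continuous_on UNIV (\<lambda>t. w powr - Complex \<sigma> t)"
  unfolding powr_def by (cases "w = 0") (auto simp: Complex_eq intro!: continuous_intros)

lemma holomorphic_powr_neg: "w \<noteq> 0 \<Longrightarrow> (\<lambda>s. w powr - s) holomorphic_on A"
  by (simp add: powr_def) (intro holomorphic_intros)

lemma tendsto_powr_neg: "w \<noteq> 0 \<Longrightarrow> ((\<lambda>s. w powr - s) \<longlongrightarrow> (w :: complex) powr - x) (at x)"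
  by (simp add: powr_def) (intro tendsto_intros)

text \<open>Among the N+1 factors s+k that lead back to Re s = 1/2, those with k < N have modulus at
  least N-k and the last has modulus at least 1/2, so their product is at least N!/2.\<close>

lemma Gamma_shift_left_bound:
  "cmod (Gamma (Complex (- real N - 1/2) t)) \<le> 2 / fact N * cmod (Gamma (Complex (1/2) t))"
proof -
  define s where "s = Complex (- real N - 1/2) t"
  have ns: "s \<notin> \<int>\<^sub>\<le>\<^sub>0"
  proof
    assume "s \<in> \<int>\<^sub>\<le>\<^sub>0"
    then obtain n :: int where "s = of_int n" by (elim nonpos_Ints_cases)
    hence "real_of_int (n + int N) = - 1/2" by (simp add: s_def complex_eq_iff)
    hence "real_of_int (2 * (n + int N)) = real_of_int (- 1)" by simp
    hence "2 * (n + int N) = - 1" using of_int_eq_iff by blast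
    thus False by presburger
  qed
  have "s + of_nat (Suc N) = Complex (1/2) t" by (simp add: s_def complex_eq_iff)
  hence "pochhammer s (Suc N) * Gamma s = Gamma (Complex (1/2) t)"
    using pochhammer_Gamma[OF ns, of "Suc N"] ns by (simp add: Gamma_eq_zero_iff del: pochhammer_Suc)
  moreover have "norm (pochhammer s (Suc N)) \<ge> fact N / 2"
  proof -
    have "(\<Prod>k=0..<N. real (N - k)) * (1 / 2) \<le> (\<Prod>k=0..<N. norm (s + of_nat k)) * norm (s + of_nat N)"
    proof (intro mult_mono prod_mono conjI)
      show "real (N - k) \<le> norm (s + of_nat k)" if "k \<in> {0..<N}" for k
        using abs_Re_le_cmod[of "s + of_nat k"] that by (simp add: s_def of_nat_diff)
      show "1 / 2 \<le> norm (s + of_nat N)"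
        using abs_Re_le_cmod[of "s + of_nat N"] by (simp add: s_def)
    qed (auto intro: prod_nonneg)
    moreover have "(\<Prod>k=0..<N. real (N - k)) = fact N"
      by (simp add: fact_prod_rev)
    ultimately show ?thesis by (simp add: pochhammer_prod prod_norm norm_mult)
  qed
  ultimately have "fact N / 2 * norm (Gamma s) \<le> norm (Gamma (Complex (1/2) t))"
    by (metis mult_right_mono norm_ge_zero norm_mult)
  thus ?thesis by (simp add: s_def field_simps)
qed

text \<open>Moving the line to Re s = -N - 1/2 collects the residues (-w)^k / k! of Gamma, that is,
  the partial sums of exp(-w); the remaining integral is O(|w|^N / N!) by
  \<open>Gamma_shift_left_bound\<close>. Since Re w > 0 means |arg w| < pi/2, the decay of Gamma
  beats the growth of w^{-s}.\<close>

theorem mellin_inverse_exp: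
  fixes w :: complex
  assumes w: "Re w > 0" and c: "c > 0"
  shows "(LINT t|lborel. Gamma (Complex c t) * w powr - Complex c t) = 2 * pi * exp (- w)"
proof -
  define \<theta> where "\<theta> = \<bar>Im (Ln w)\<bar>"
  have w0: "w \<noteq> 0" using w by auto
  have \<theta>: "\<theta> < pi / 2" unfolding \<theta>_def using w by (rule Re_Ln_pos_lt_imp)
  \<comment> \<open>A rate strictly between |arg w| and pi/2: Gamma decays at rate \<open>a\<close>,
    the power of \<open>w\<close> grows at rate at most \<theta>, and \<delta> is the net
    decay.\<close>
  define a where "a = (\<theta> + pi/2) / 2"
  define \<delta> where "\<delta> = a - \<theta>"
  have a: "a < pi / 2" and \<delta>: "\<delta> > 0" using \<theta> by (auto simp: a_def \<delta>_def field_simps)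
  define f :: "complex \<Rightarrow> complex" where "f = (\<lambda>s. Gamma s * w powr - s)"
  have expa: "exp (- a * x) * exp (x * \<theta>) = exp (- \<delta> * x)" for x
    by (simp add: \<delta>_def algebra_simps flip: exp_add)
  obtain K where K: "K > 0" "\<And>t. cmod (Gamma (Complex (1/2) t)) \<le> K * exp (- a * \<bar>t\<bar>)"
    using Gamma_half_integer_line_bound[OF a, of 0] by auto
  define I where "I = (LINT t|lborel. exp (- \<delta> * \<bar>t\<bar>))"
  have main: "norm ((LINT t|lborel. f (Complex c t)) - 2 * pi * (\<Sum>k\<le>N. (- w) ^ k / fact k))
     \<le> (2 * K * norm w powr (1/2) * I) * (norm w ^ N / fact N)" for N
  proof -
    define \<sigma> where "\<sigma> = - real N - 1/2"
    obtain B where B: "B > 0" "\<And>x t. \<sigma> \<le> x \<Longrightarrow> x \<le> c \<Longrightarrow> \<bar>t\<bar> \<ge> 1 \<Longrightarrow> cmod (Gamma (Complex x t)) \<le> B * exp (- a * \<bar>t\<bar>)"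
      using Gamma_strip_bound[OF a, of \<sigma> c] by blast
    have "compact ((\<lambda>x. norm w powr - x) ` {\<sigma>..c})"
      using w0 by (intro compact_continuous_image continuous_intros) auto
    then obtain W where W: "W > 0" "\<And>x. x \<in> {\<sigma>..c} \<Longrightarrow> norm (norm w powr - x) \<le> W"
      by (metis (no_types, lifting) bounded_pos compact_imp_bounded imageI)
    define pts :: "complex set" where "pts = (\<lambda>k. - of_nat k) ` {..N}"
    have pts_iff: "s \<in> \<int>\<^sub>\<le>\<^sub>0 \<Longrightarrow> Re s > - real N - 1 \<Longrightarrow> s \<in> pts" for s
    proof -
      assume "s \<in> \<int>\<^sub>\<le>\<^sub>0" "Re s > - real N - 1"
      then obtain k where "s = - of_nat k" by (elim nonpos_Ints_cases')
      moreover from this have "k \<le> N" using \<open>Re s > _\<close> by simp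
      ultimately show ?thesis by (auto simp: pts_def)
    qed
    have "(LINT t|lborel. f (Complex c t)) - (LINT t|lborel. f (Complex \<sigma> t)) = 2 * pi * (\<Sum>p\<in>pts. residue f p)"
    proof (rule shift_line_residues[where \<delta> = \<delta> and K = "B * W" and ?T0.0 = 1 and ?\<sigma>0.0 = "- real N - 1"])
      show "f holomorphic_on {s. - real N - 1 < Re s} - pts"
        unfolding f_def using pts_iff by (intro holomorphic_intros holomorphic_powr_neg w0) auto
      fix x t :: real assume *: "\<sigma> \<le> x" "x \<le> c" "\<bar>t\<bar> \<ge> 1"
      have "norm (f (Complex x t)) \<le> (B * exp (- a * \<bar>t\<bar>)) * (norm w powr - x * exp (\<bar>t\<bar> * \<theta>))"
        unfolding f_def norm_mult \<theta>_def using * B norm_powr_line_le[OF w0] by (intro mult_mono) auto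
      also have "\<dots> \<le> (B * exp (- a * \<bar>t\<bar>)) * (W * exp (\<bar>t\<bar> * \<theta>))"
        using W(2)[of x] * B by (intro mult_left_mono mult_right_mono) auto
      also have "\<dots> = B * W * (exp (- a * \<bar>t\<bar>) * exp (\<bar>t\<bar> * \<theta>))" by (simp only: mult_ac)
      also note expa
      finally show "norm (f (Complex x t)) \<le> B * W * exp (- \<delta> * \<bar>t\<bar>)" .
    qed (use c \<delta> in \<open>auto simp: pts_def \<sigma>_def\<close>)
    moreover have "(\<Sum>p\<in>pts. residue f p) = (\<Sum>k\<le>N. (- w) ^ k / fact k)"
    proof -
      have "residue f (- of_nat k) = (- w) ^ k / fact k" for k
      proof (rule residue_simple')
        show "open (- (\<int>\<^sub>\<le>\<^sub>0 - {-of_nat k}) :: complex set)"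
          by (intro open_Compl closed_subset_Ints) auto
        show "f holomorphic_on (- (\<int>\<^sub>\<le>\<^sub>0 - {-of_nat k}) - {- of_nat k})"
          unfolding f_def by (intro holomorphic_intros holomorphic_powr_neg w0) auto
        have "(\<lambda>s. (Gamma s * (s - (- of_nat k))) * w powr - s) \<midarrow>(- of_nat k)\<rightarrow> (- 1) ^ k / fact k * w powr - (- of_nat k)"
          using Gamma_residues[of k, where ?'a = complex] by (intro tendsto_mult tendsto_powr_neg w0) simp
        thus "(\<lambda>s. f s * (s - (-of_nat k))) \<midarrow>(-of_nat k)\<rightarrow> (- w) ^ k / fact k"
          using w0 by (simp add: f_def mult_ac power_minus[of w])
      qed auto
      thus ?thesis unfolding pts_def by (subst sum.reindex) (auto simp: inj_on_def)
    qed
    ultimately have eq: "(LINT t|lborel. f (Complex c t)) - 2 * pi * (\<Sum>k\<le>N. (- w) ^ k / fact k) = (LINT t|lborel. f (Complex \<sigma> t))"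
      by (simp add: algebra_simps)
    have "norm (LINT t|lborel. f (Complex \<sigma> t)) \<le> (2 / fact N * K * norm w powr - \<sigma>) * I"
      unfolding I_def
    proof (rule norm_line_integral_le[OF _ \<delta>])
      fix t
      have "norm (f (Complex \<sigma> t)) \<le> (2 / fact N * (K * exp (- a * \<bar>t\<bar>))) * (norm w powr - \<sigma> * exp (\<bar>t\<bar> * \<theta>))"
        unfolding f_def norm_mult \<theta>_def
      proof (intro mult_mono norm_powr_line_le[OF w0])
        show "cmod (Gamma (Complex \<sigma> t)) \<le> 2 / fact N * (K * exp (- a * \<bar>t\<bar>))"
          unfolding \<sigma>_def by (rule order.trans[OF Gamma_shift_left_bound]) (intro mult_left_mono K, auto)
      qed (use K in auto)
      also have "\<dots> = 2 / fact N * K * norm w powr - \<sigma> * (exp (- a * \<bar>t\<bar>) * exp (\<bar>t\<bar> * \<theta>))"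
        by (simp only: mult_ac)
      also note expa
      finally show "norm (f (Complex \<sigma> t)) \<le> 2 / fact N * K * norm w powr - \<sigma> * exp (- \<delta> * \<bar>t\<bar>)" .
    qed
    also have "norm w powr - \<sigma> = norm w powr (1/2) * norm w ^ N"
      using w0 by (simp add: \<sigma>_def powr_add powr_realpow)
    finally show ?thesis unfolding eq by (simp add: mult_ac)
  qed
  have "(\<lambda>N. (2 * K * norm w powr (1/2) * I) * (norm w ^ N / fact N)) \<longlonglongrightarrow> 0"
  proof -
    have "summable (\<lambda>N. norm w ^ N /\<^sub>R fact N)" using exp_converges[of "norm w"] by (simp add: sums_iff)
    from summable_LIMSEQ_zero[OF this] have "(\<lambda>N. norm w ^ N / fact N) \<longlonglongrightarrow> 0" by (simp add: field_simps)
    from tendsto_mult_right_zero[OF this] show ?thesis .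
  qed
  hence "(\<lambda>N. (LINT t|lborel. f (Complex c t)) - 2 * pi * (\<Sum>k\<le>N. (- w) ^ k / fact k)) \<longlonglongrightarrow> 0"
    by (rule Lim_null_comparison[OF always_eventually, rotated]) (use main in auto)
  moreover have "(\<lambda>N. (LINT t|lborel. f (Complex c t)) - 2 * pi * (\<Sum>k\<le>N. (- w) ^ k / fact k)) \<longlonglongrightarrow>
      (LINT t|lborel. f (Complex c t)) - 2 * pi * exp (- w)"
  proof -
    have "(\<lambda>N. \<Sum>k\<le>N. (- w) ^ k / fact k) \<longlonglongrightarrow> exp (- w)"
      using exp_converges[of "- w"] unfolding sums_def_le by (simp add: scaleR_conv_of_real field_simps)
    thus ?thesis by (intro tendsto_intros)
  qed
  ultimately have "0 = (LINT t|lborel. f (Complex c t)) - 2 * pi * exp (- w)"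
    by (rule LIMSEQ_unique)
  thus ?thesis by (simp add: f_def)
qed

text \<open>Absolute convergence of the Dirichlet series on the line and exponential decay of the
  integrand permit interchanging sum and integral. It serves twice: with weights 1/k it leads from
  the exponential to the logarithm, with weights f(k) from the logarithm to log G_f.\<close>

lemma mellin_sum:
  fixes a :: "nat \<Rightarrow> real" and h :: "real \<Rightarrow> complex" and e :: "nat \<Rightarrow> complex"
  assumes a: "\<And>n. a n \<ge> 0" and sum: "summable (\<lambda>n. a n * real (Suc n) powr - c)"
    and h: "continuous_on UNIV h" "\<And>t. norm (h t) \<le> K * exp (- b * \<bar>t\<bar>)"
    and w: "w \<noteq> 0" "\<bar>Im (Ln w)\<bar> < b"
    and e: "\<And>n. (LINT t|lborel. h t * (of_nat (Suc n) * w) powr - Complex c t) = 2 * pi * e n"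
  shows "(\<lambda>n. a n * e n) sums (1 / (2 * pi) * (LINT t|lborel.
           h t * (\<Sum>n. of_real (a n) * of_nat (Suc n) powr - Complex c t) * w powr - Complex c t))"
proof -
  define \<delta> where "\<delta> = b - \<bar>Im (Ln w)\<bar>"
  have \<delta>: "\<delta> > 0" using w by (simp add: \<delta>_def)
  define g where "g = (\<lambda>n t. of_real (a n) * of_nat (Suc n) powr - Complex c t * (h t * w powr - Complex c t))"
  have split: "(of_nat (Suc n) * w) powr - s = of_nat (Suc n) powr - s * w powr - s" for n s
    by (rule powr_times_real_left) auto
  have nz: "real (Suc n) powr x * exp y = real (Suc n) powr x * exp y" for n x y ..
  have B0: "norm (h t * w powr - Complex c t) \<le> K * norm w powr - c * exp (- \<delta> * \<bar>t\<bar>)" for t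
  proof -
    have "norm (h t * w powr - Complex c t) \<le> (K * exp (- b * \<bar>t\<bar>)) * (norm w powr - c * exp (\<bar>t\<bar> * \<bar>Im (Ln w)\<bar>))"
      unfolding norm_mult using h(2)[of t] order.trans[OF norm_ge_zero h(2)[of t]]
      by (intro mult_mono norm_powr_line_le w h) auto
    also have "\<dots> = K * norm w powr - c * exp (- \<delta> * \<bar>t\<bar>)"
      by (simp add: \<delta>_def algebra_simps flip: exp_add)
    finally show ?thesis .
  qed
  have B: "norm (g n t) \<le> a n * real (Suc n) powr - c * (K * norm w powr - c * exp (- \<delta> * \<bar>t\<bar>))" for n t
  proof -
    have "norm (g n t) = a n * real (Suc n) powr - c * norm (h t * w powr - Complex c t)"
      using a[of n] unfolding g_def norm_mult norm_of_nat_powr[OF zero_less_Suc] by simp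
    thus ?thesis using a[of n] B0[of t] by (simp only:) (intro mult_left_mono, auto)
  qed
  have cont: "continuous_on UNIV (\<lambda>t. h t * w powr - Complex c t)" "continuous_on UNIV (g n)" for n
    unfolding g_def by (intro continuous_intros h(1) continuous_powr_line)+
  have int: "integrable lborel (g n)" for n
    by (rule integrable_line[OF cont(2) _ \<delta>, of 0 _ "a n * real (Suc n) powr - c * (K * norm w powr - c)"])
       (use B[of n] in \<open>auto simp: mult_ac\<close>)
  have "(\<lambda>n. integral\<^sup>L lborel (g n)) sums (\<integral>t. (\<Sum>n. g n t) \<partial>lborel)"
  proof (rule sums_integral[OF int])
    show "AE t in lborel. summable (\<lambda>n. norm (g n t))"
    proof (rule AE_I2)
      fix t
      show "summable (\<lambda>n. norm (g n t))"
        by (rule summable_comparison_test[OF _ summable_mult2[OF sum, of "K * norm w powr - c * exp (- \<delta> * \<bar>t\<bar>)"]])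
           (use B in auto)
    qed
    show "summable (\<lambda>n. LINT t|lborel. norm (g n t))"
    proof (rule summable_comparison_test[OF _ summable_mult2[OF sum]])
      show "\<exists>N. \<forall>n\<ge>N. norm (LINT t|lborel. norm (g n t)) \<le> a n * real (Suc n) powr - c *
           (K * norm w powr - c * (LINT t|lborel. exp (- \<delta> * \<bar>t\<bar>)))"
      proof (intro exI allI impI)
        fix n
        have "(LINT t|lborel. norm (g n t)) \<le> (LINT t|lborel. a n * real (Suc n) powr - c * (K * norm w powr - c * exp (- \<delta> * \<bar>t\<bar>)))"
          using int B integrable_exp_abs[OF \<delta>] by (intro integral_mono) auto
        thus "norm (LINT t|lborel. norm (g n t)) \<le> a n * real (Suc n) powr - c *
           (K * norm w powr - c * (LINT t|lborel. exp (- \<delta> * \<bar>t\<bar>)))"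
          by (simp add: abs_of_nonneg integral_nonneg_AE)
      qed
    qed
  qed
  hence "(\<lambda>n. 1 / (2 * pi) * integral\<^sup>L lborel (g n)) sums (1 / (2 * pi) * (\<integral>t. (\<Sum>n. g n t) \<partial>lborel))"
    by (rule sums_mult)
  moreover have "integral\<^sup>L lborel (g n) = 2 * pi * (a n * e n)" for n
  proof -
    have "g n = (\<lambda>t. of_real (a n) * (h t * (of_nat (Suc n) * w) powr - Complex c t))"
      unfolding g_def split by (simp add: fun_eq_iff mult_ac)
    thus ?thesis using e[of n] by (simp del: of_nat_Suc)
  qed
  moreover have "(\<Sum>n. g n t) = h t * (\<Sum>n. of_real (a n) * of_nat (Suc n) powr - Complex c t) * w powr - Complex c t" for t
  proof -
    have "summable (\<lambda>n. norm (of_real (a n) * of_nat (Suc n) powr - Complex c t :: complex))"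
      unfolding norm_mult norm_of_nat_powr[OF zero_less_Suc] using sum a by (simp add: abs_of_nonneg)
    hence "summable (\<lambda>n. of_real (a n) * of_nat (Suc n) powr - Complex c t :: complex)"
      by (rule summable_norm_cancel)
    from suminf_mult2[OF this, of "h t * w powr - Complex c t"] show ?thesis
      by (simp add: g_def mult_ac)
  qed
  ultimately show ?thesis by simp
qed

lemma zeta_eq_zseries: "Re s > 1 \<Longrightarrow> zeta s = zseries s"
  using xi(4)[of s] by (auto simp: zeta_eq)

lemma holomorphic_zeta: "zeta holomorphic_on (- {1})"
proof (rule holomorphic_transform)
  show "(\<lambda>s. xi s / (s - 1)) holomorphic_on (- {1})"
    by (intro holomorphic_intros holomorphic_on_subset[OF xi(1)]) auto
qed (auto simp: zeta_eq)

lemma zeta_plus_1_series: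
  assumes "Re s > 0"
  shows "(\<Sum>n. of_real (1 / real (Suc n)) * of_nat (Suc n) powr - s) = zeta (s + 1)"
proof -
  have "of_real (1 / real (Suc n)) * of_nat (Suc n) powr - s = (of_nat (Suc n) :: complex) powr - (s + 1)" for n
    by (simp add: powr_diff add.commute divide_simps del: of_nat_Suc)
       (simp add: powr_minus powr_diff divide_simps del: of_nat_Suc)?
  hence "(\<Sum>n. of_real (1 / real (Suc n)) * of_nat (Suc n) powr - s) = zseries (s + 1)"
    by (simp only: zseries_def)
  also have "\<dots> = zeta (s + 1)"
    using zeta_eq_zseries[of "s + 1"] assms by simp
  finally show ?thesis .
qed

lemma Ln_one_minus_exp_sums:
  assumes "Re w > 0"
  shows "(\<lambda>n. of_real (1 / real (Suc n)) * exp (- (of_nat (Suc n) * w))) sums - Ln (1 - exp (- w))"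
proof -
  have "norm (- exp (- w)) < 1" using assms by (simp add: norm_exp_eq_Re)
  from Ln_series'[OF this] have "(\<lambda>n. - (exp (- w) ^ n / of_nat n)) sums Ln (1 - exp (- w))" by simp
  hence "(\<lambda>n. - (- (exp (- w) ^ n / of_nat n))) sums - Ln (1 - exp (- w))" by (rule sums_minus)
  hence "(\<lambda>n. exp (- w) ^ n / of_nat n) sums - Ln (1 - exp (- w))" by simp
  hence "(\<lambda>n. exp (- w) ^ Suc n / of_nat (Suc n)) sums - Ln (1 - exp (- w))" by (subst sums_Suc_iff) simp
  moreover have "exp (- w) ^ Suc n / of_nat (Suc n) = of_real (1 / real (Suc n)) * exp (- (of_nat (Suc n) * w))" for n
    unfolding exp_of_nat_mult[symmetric] by simp
  ultimately show ?thesis by (simp only:)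
qed

lemma Gamma_line:
  assumes "c > 0"
  shows "continuous_on UNIV (\<lambda>t. Gamma (Complex c t))"
    and "a < pi / 2 \<Longrightarrow> \<exists>K>0. \<forall>t. norm (Gamma (Complex c t)) \<le> K * exp (- a * \<bar>t\<bar>)"
proof -
  have "Complex c t \<notin> \<int>\<^sub>\<le>\<^sub>0" for t
    using assms by (auto elim!: nonpos_Ints_cases simp: complex_eq_iff)
  thus 1: "continuous_on UNIV (\<lambda>t. Gamma (Complex c t))"
    by (intro continuous_on_vertical[OF continuous_on_Gamma[of "- \<int>\<^sub>\<le>\<^sub>0"]]) auto
  show "\<exists>K>0. \<forall>t. norm (Gamma (Complex c t)) \<le> K * exp (- a * \<bar>t\<bar>)" if "a < pi / 2"
    using line_bound_global[OF 1, of 1 _ a] Gamma_strip_bound[OF that, of c c] by (metis order.refl)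
qed

lemma continuous_zeta_line: "c > 1 \<Longrightarrow> continuous_on UNIV (\<lambda>t. zeta (Complex c t))"
proof (rule continuous_on_vertical[of "- {1}"])
  show "continuous_on (- {1}) zeta"
    using holomorphic_zeta by (rule holomorphic_on_imp_continuous_on)
qed (auto simp: complex_eq_iff)

lemma norm_zeta_line_le: "c > 1 \<Longrightarrow> norm (zeta (Complex c t)) \<le> (\<Sum>n. real (Suc n) powr - c)"
proof -
  assume c: "c > 1"
  have "zeta (Complex c t) = zseries (Complex c t)"
    using zeta_eq_zseries[of "Complex c t"] c by simp
  also have "norm \<dots> \<le> (\<Sum>n. real (Suc n) powr - c)"
    unfolding zseries_def
  proof (rule norm_suminf_le)
    show "norm (of_nat (Suc n) powr - Complex c t :: complex) \<le> real (Suc n) powr - c" for n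
      by (subst norm_of_nat_powr) auto
  qed (use c in \<open>auto intro!: summable_Suc_powr simp del: of_nat_Suc\<close>)
  finally show ?thesis .
qed

text \<open>Since -Ln(1 - e^{-w}) is the sum of e^{-kw} / k, the transform Gamma(s) of the
  exponential is multiplied by the sum of k^{-1-s}. This is the origin of the factor zeta(s+1) in
  L_f^*.\<close>

theorem mellin_inverse_log:
  fixes w :: complex
  assumes w: "Re w > 0" and c: "c > 0"
  shows "(LINT t|lborel. Gamma (Complex c t) * zeta (Complex (c + 1) t) * w powr - Complex c t) = 2 * pi * (- Ln (1 - exp (- w)))"
proof -
  have w0: "w \<noteq> 0" using w by auto
  have \<theta>: "\<bar>Im (Ln w)\<bar> < pi / 2" using w by (rule Re_Ln_pos_lt_imp)
  define b where "b = (\<bar>Im (Ln w)\<bar> + pi/2) / 2"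
  have b: "\<bar>Im (Ln w)\<bar> < b" "b < pi / 2" using \<theta> by (auto simp: b_def field_simps)
  obtain K where K: "\<And>t. norm (Gamma (Complex c t)) \<le> K * exp (- b * \<bar>t\<bar>)"
    using Gamma_line(2)[OF c b(2)] by blast
  have "(\<lambda>n. of_real (1 / real (Suc n)) * exp (- (of_nat (Suc n) * w))) sums (1 / (2 * pi) * (LINT t|lborel.
           Gamma (Complex c t) * (\<Sum>n. of_real (1 / real (Suc n)) * of_nat (Suc n) powr - Complex c t) * w powr - Complex c t))"
  proof (rule mellin_sum[OF _ _ Gamma_line(1)[OF c] K w0 b(1)])
    have "1 / real (Suc n) * real (Suc n) powr - c = real (Suc n) powr (- c - 1)" for n
      by (simp add: powr_diff del: of_nat_Suc)
    thus "summable (\<lambda>n. 1 / real (Suc n) * real (Suc n) powr - c)"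
      using c by (simp only:) (intro summable_Suc_powr, simp)
    show "(LINT t|lborel. Gamma (Complex c t) * (of_nat (Suc n) * w) powr - Complex c t) = 2 * pi * exp (- (of_nat (Suc n) * w))" for n
    proof (rule mellin_inverse_exp[OF _ c])
      have "of_nat (Suc n) * w = of_real (real (Suc n)) * w" by simp
      thus "Re (of_nat (Suc n) * w) > 0" using w by (simp del: of_nat_Suc)
    qed
  qed auto
  moreover have "(\<Sum>n. of_real (1 / real (Suc n)) * of_nat (Suc n) powr - Complex c t) = zeta (Complex (c + 1) t)" for t
    using zeta_plus_1_series[of "Complex c t"] c by (simp add: Complex_eq add_ac)
  ultimately have "- Ln (1 - exp (- w)) = 1 / (2 * pi) * (LINT t|lborel. Gamma (Complex c t) * zeta (Complex (c + 1) t) * w powr - Complex c t)"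
    by (intro sums_unique2[OF Ln_one_minus_exp_sums[OF w]]) (simp only:)
  thus ?thesis by (simp add: field_simps)
qed

section \<open>The logarithm of the generating function as a Mellin integral\<close>

text \<open>A sum of principal logarithms: for Re z > 0 each 1 - e^{-kz} has positive real part, so
  this logarithm of G_f is continuous on the half-plane and real on the positive axis.\<close>

definition logG :: "(nat \<Rightarrow> nat) \<Rightarrow> complex \<Rightarrow> complex" where
  "logG f z = (\<Sum>n. of_nat (f (Suc n)) * (- Ln (1 - exp (- (of_nat (Suc n) * z)))))"

theorem logG_mellin:
  assumes z: "Re z > 0" and c: "c > 0" and sum: "summable (\<lambda>n. real (f (Suc n)) * real (Suc n) powr - c)"
  shows "(\<lambda>n. of_nat (f (Suc n)) * (- Ln (1 - exp (- (of_nat (Suc n) * z))))) sums logG f z"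
    and "logG f z = 1 / (2 * pi) * (LINT t|lborel. Gamma (Complex c t) * zeta (Complex (c + 1) t) *
            (\<Sum>n. dirichlet_term f (Complex c t) n) * z powr - Complex c t)"
proof -
  have z0: "z \<noteq> 0" using z by auto
  have \<theta>: "\<bar>Im (Ln z)\<bar> < pi / 2" using z by (rule Re_Ln_pos_lt_imp)
  define b where "b = (\<bar>Im (Ln z)\<bar> + pi/2) / 2"
  have b: "\<bar>Im (Ln z)\<bar> < b" "b < pi / 2" using \<theta> by (auto simp: b_def field_simps)
  obtain K where K: "K > 0" "\<And>t. norm (Gamma (Complex c t)) \<le> K * exp (- b * \<bar>t\<bar>)"
    using Gamma_line(2)[OF c b(2)] by blast
  define Z where "Z = (\<Sum>n. real (Suc n) powr - (c + 1))"
  have "(\<lambda>n. of_real (real (f (Suc n))) * (- Ln (1 - exp (- (of_nat (Suc n) * z))))) sums (1 / (2 * pi) * (LINT t|lborel.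
           (Gamma (Complex c t) * zeta (Complex (c + 1) t)) * (\<Sum>n. of_real (real (f (Suc n))) * of_nat (Suc n) powr - Complex c t) * z powr - Complex c t))"
  proof (rule mellin_sum[OF _ sum _ _ z0 b(1)])
    show "continuous_on UNIV (\<lambda>t. Gamma (Complex c t) * zeta (Complex (c + 1) t))"
      using c by (intro continuous_intros Gamma_line continuous_zeta_line) auto
    fix t
    have "norm (Gamma (Complex c t) * zeta (Complex (c + 1) t)) \<le> (K * exp (- b * \<bar>t\<bar>)) * Z"
      unfolding norm_mult Z_def using K c norm_zeta_line_le[of "c + 1" t]
      by (intro mult_mono) auto
    thus "norm (Gamma (Complex c t) * zeta (Complex (c + 1) t)) \<le> (K * Z) * exp (- b * \<bar>t\<bar>)"
      by (simp add: mult_ac)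
  next
    fix n
    have "of_nat (Suc n) * z = of_real (real (Suc n)) * z" by simp
    hence "Re (of_nat (Suc n) * z) > 0" using z by (simp del: of_nat_Suc)
    thus "(LINT t|lborel. Gamma (Complex c t) * zeta (Complex (c + 1) t) * (of_nat (Suc n) * z) powr - Complex c t)
      = 2 * pi * (- Ln (1 - exp (- (of_nat (Suc n) * z))))"
      by (rule mellin_inverse_log[OF _ c])
  qed auto
  hence *: "(\<lambda>n. of_nat (f (Suc n)) * (- Ln (1 - exp (- (of_nat (Suc n) * z))))) sums (1 / (2 * pi) * (LINT t|lborel.
           Gamma (Complex c t) * zeta (Complex (c + 1) t) * (\<Sum>n. dirichlet_term f (Complex c t) n) * z powr - Complex c t))"
    by (simp add: dirichlet_term_def)
  show "(\<lambda>n. of_nat (f (Suc n)) * (- Ln (1 - exp (- (of_nat (Suc n) * z))))) sums logG f z"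
    unfolding logG_def by (rule summable_sums[OF sums_summable[OF *]])
  show "logG f z = 1 / (2 * pi) * (LINT t|lborel. Gamma (Complex c t) * zeta (Complex (c + 1) t) *
            (\<Sum>n. dirichlet_term f (Complex c t) n) * z powr - Complex c t)"
    unfolding logG_def by (rule sums_unique[OF *, symmetric])
qed


subsection \<open>Gaussian kernels with a prescribed pole\<close>

text \<open>As exp(u^2) = 1 + O(u^2), the principal part at \<nu> is A/(s-\<nu>)^2 + B/(s-\<nu>);
  there is no other pole, and the Gaussian factor gives decay in every vertical strip. Subtracting
  such kernels removes the poles of \<open>Lstar F\<close> without spoiling its decay.\<close>

definition kern :: "real \<Rightarrow> complex \<Rightarrow> complex \<Rightarrow> complex \<Rightarrow> complex" where
  "kern \<nu> A B s = (A + B * (s - of_real \<nu>)) * exp ((s - of_real \<nu>)\<^sup>2) / (s - of_real \<nu>)\<^sup>2"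

lemma diff_eq_swap: "a - b = c \<Longrightarrow> a - c = (b :: complex)"
  by auto

lemma kern_analytic: "s \<noteq> of_real \<nu> \<Longrightarrow> kern \<nu> A B analytic_on {s}"
  unfolding kern_def by (intro analytic_intros) auto

lemma exp_minus_square_le: "exp (- (t\<^sup>2)) \<le> exp (\<delta>\<^sup>2) * exp (- \<delta> * \<bar>t\<bar>)" for t \<delta> :: real
proof -
  have "0 \<le> (\<bar>t\<bar> - \<delta>)\<^sup>2 + t\<^sup>2 + \<delta>\<^sup>2" by (intro add_nonneg_nonneg) auto
  hence "- (t\<^sup>2) \<le> \<delta>\<^sup>2 + - \<delta> * \<bar>t\<bar>" by (simp add: power2_eq_square algebra_simps)
  thus ?thesis by (simp flip: exp_add)
qed

lemma kern_bound:
  assumes "\<sigma>1 \<le> \<sigma>2"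
  shows "\<exists>K>0. \<forall>\<sigma> t. \<sigma>1 \<le> \<sigma> \<and> \<sigma> \<le> \<sigma>2 \<and> \<bar>t\<bar> \<ge> 1 \<longrightarrow> norm (kern \<nu> A B (Complex \<sigma> t)) \<le> K * exp (- \<delta> * \<bar>t\<bar>)"
proof -
  define M where "M = max \<bar>\<sigma>1 - \<nu>\<bar> \<bar>\<sigma>2 - \<nu>\<bar>"
  show ?thesis
  proof (intro exI conjI allI impI)
    show "(norm A + norm B + 1) * exp (M\<^sup>2 + \<delta>\<^sup>2) > 0" by (intro mult_pos_pos add_nonneg_pos) auto
    fix \<sigma> t :: real assume *: "\<sigma>1 \<le> \<sigma> \<and> \<sigma> \<le> \<sigma>2 \<and> \<bar>t\<bar> \<ge> 1"
    define w where "w = Complex \<sigma> t - of_real \<nu>"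
    have w: "w = Complex (\<sigma> - \<nu>) t" by (simp add: w_def complex_eq_iff)
    have w1: "norm w \<ge> 1" using abs_Im_le_cmod[of w] * by (simp add: w)
    have "norm (kern \<nu> A B (Complex \<sigma> t)) = norm ((A + B * w) / w\<^sup>2) * norm (exp (w\<^sup>2))"
      by (simp add: kern_def w_def norm_mult norm_divide)
    also have "norm ((A + B * w) / w\<^sup>2) \<le> norm A + norm B"
    proof -
      have "norm (A + B * w) \<le> norm A * 1 + norm B * norm w"
        by (intro order.trans[OF norm_triangle_ineq]) (simp add: norm_mult)
      also have "\<dots> \<le> norm A * (norm w)\<^sup>2 + norm B * (norm w)\<^sup>2"
        using one_le_power[OF w1, of 2] power_increasing[of 1 2 "norm w"] w1
        by (intro add_mono mult_left_mono) auto
      also have "\<dots> = (norm A + norm B) * (norm w)\<^sup>2" by (simp add: algebra_simps)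
      finally have *: "norm (A + B * w) \<le> (norm A + norm B) * (norm w)\<^sup>2" .
      have "(norm w)\<^sup>2 > 0" using w1 by (intro zero_less_power) auto
      with * show ?thesis by (simp add: norm_divide norm_power pos_divide_le_eq)
    qed
    also have "norm (exp (w\<^sup>2)) = exp ((\<sigma> - \<nu>)\<^sup>2) * exp (- (t\<^sup>2))"
      by (simp add: norm_exp_eq_Re w power2_eq_square flip: exp_add)
    also have "\<dots> \<le> exp (M\<^sup>2) * (exp (\<delta>\<^sup>2) * exp (- \<delta> * \<bar>t\<bar>))"
    proof (intro mult_mono exp_minus_square_le)
      have "\<bar>\<sigma> - \<nu>\<bar> \<le> M" using * unfolding M_def by linarith
      hence "(\<sigma> - \<nu>)\<^sup>2 \<le> M\<^sup>2" by (metis abs_ge_zero power2_abs power_mono)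
      thus "exp ((\<sigma> - \<nu>)\<^sup>2) \<le> exp (M\<^sup>2)" by simp
    qed auto
    finally have "norm (kern \<nu> A B (Complex \<sigma> t)) \<le> (norm A + norm B) * (exp (M\<^sup>2) * (exp (\<delta>\<^sup>2) * exp (- \<delta> * \<bar>t\<bar>)))"
      by (simp add: mult_left_mono mult_right_mono)
    also have "\<dots> \<le> (norm A + norm B + 1) * (exp (M\<^sup>2) * (exp (\<delta>\<^sup>2) * exp (- \<delta> * \<bar>t\<bar>)))"
      by (intro mult_right_mono) auto
    finally show "norm (kern \<nu> A B (Complex \<sigma> t)) \<le> (norm A + norm B + 1) * exp (M\<^sup>2 + \<delta>\<^sup>2) * exp (- \<delta> * \<bar>t\<bar>)"
      by (simp add: exp_add mult_ac)
  qed
qed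

text \<open>A double pole makes the derivative of z^{-s} appear, which brings down -Ln z; this is
  where the logarithm in the expansion of log G_f originates.\<close>

lemma residue_kern:
  assumes "z \<noteq> 0"
  shows "residue (\<lambda>s. kern \<nu> A B s * z powr - s) (of_real \<nu>) = z powr - of_real \<nu> * (B - A * Ln z)"
proof -
  define g where "g = (\<lambda>s. (A + B * (s - of_real \<nu>)) * exp ((s - of_real \<nu>)\<^sup>2) * z powr - s)"
  have "(\<lambda>s. kern \<nu> A B s * z powr - s) = (\<lambda>s. g s / (s - of_real \<nu>) ^ Suc 1)"
    by (simp add: kern_def g_def fun_eq_iff power2_eq_square)
  moreover have "residue (\<lambda>s. g s / (s - of_real \<nu>) ^ Suc 1) (of_real \<nu>) = (deriv ^^ 1) g (of_real \<nu>) / fact 1"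
    by (rule residue_holomorphic_over_power[of UNIV])
       (auto simp: g_def intro!: holomorphic_intros holomorphic_powr_neg assms)
  moreover have "(g has_field_derivative (B - A * Ln z) * z powr - of_real \<nu>) (at (of_real \<nu>))"
    unfolding g_def using assms
    by (auto simp: powr_def intro!: derivative_eq_intros) (simp add: algebra_simps)
  ultimately show ?thesis by (simp add: DERIV_imp_deriv mult_ac)
qed

text \<open>The line is moved to Re s = -R-1, past any pole with \<nu> \<ge> -R including one at -R
  itself. The kernel decays at rate 2\<delta>, of which half is spent on the growth of z^{-s} in the
  sector |arg z| \<le> \<delta>.\<close>

lemma kern_mellin:
  assumes \<nu>: "-R - 1 < \<nu>" "\<nu> < c" and \<delta>: "\<delta> > 0"
  shows "\<exists>K>0. \<forall>z. z \<noteq> 0 \<and> \<bar>Im (Ln z)\<bar> \<le> \<delta> \<longrightarrow>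
           integrable lborel (\<lambda>t. kern \<nu> A B (Complex c t) * z powr - Complex c t) \<and>
           norm ((LINT t|lborel. kern \<nu> A B (Complex c t) * z powr - Complex c t)
               - 2 * pi * (z powr - of_real \<nu> * (B - A * Ln z))) \<le> K * norm z powr (R + 1)"
proof -
  let ?\<sigma> = "- R - 1"
  obtain K where K: "K > 0" "\<And>\<sigma> t. ?\<sigma> \<le> \<sigma> \<Longrightarrow> \<sigma> \<le> c \<Longrightarrow> \<bar>t\<bar> \<ge> 1 \<Longrightarrow> norm (kern \<nu> A B (Complex \<sigma> t)) \<le> K * exp (- (2 * \<delta>) * \<bar>t\<bar>)"
    using kern_bound[of ?\<sigma> c \<nu> A B "2 * \<delta>"] \<nu> by auto
  have "continuous_on UNIV (\<lambda>t. kern \<nu> A B (Complex ?\<sigma> t))"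
    using \<nu> by (intro continuous_on_vertical[of "- {of_real \<nu>}"] holomorphic_on_imp_continuous_on)
      (auto simp: kern_def[abs_def] intro!: holomorphic_intros, auto simp: complex_eq_iff)
  then obtain K' where K': "K' > 0" "\<And>t. norm (kern \<nu> A B (Complex ?\<sigma> t)) \<le> K' * exp (- (2 * \<delta>) * \<bar>t\<bar>)"
    using line_bound_global[of "\<lambda>t. kern \<nu> A B (Complex ?\<sigma> t)" 1 K "2 * \<delta>"] K(2)[of ?\<sigma>] \<nu> by auto
  have expd: "exp (- (2 * \<delta>) * x) * exp (x * \<delta>) = exp (- \<delta> * x)" for x by (simp flip: exp_add)
  define I where "I = (LINT t|lborel. exp (- \<delta> * \<bar>t\<bar>))"
  have I: "I \<ge> 0" unfolding I_def by (intro integral_nonneg_AE) auto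
  show ?thesis
  proof (intro exI conjI allI impI)
    show "K' * I + 1 > 0" using K' I by (intro add_nonneg_pos) auto
    fix z :: complex assume z: "z \<noteq> 0 \<and> \<bar>Im (Ln z)\<bar> \<le> \<delta>"
    have "compact ((\<lambda>x. norm z powr - x) ` {?\<sigma>..c})"
      using z by (intro compact_continuous_image continuous_intros) auto
    then obtain W where W: "W > 0" "\<And>x. x \<in> {?\<sigma>..c} \<Longrightarrow> norm (norm z powr - x) \<le> W"
      by (metis (no_types, lifting) bounded_pos compact_imp_bounded imageI)
    have zb: "norm (z powr - Complex \<sigma> t) \<le> norm z powr - \<sigma> * exp (\<bar>t\<bar> * \<delta>)" for \<sigma> t
    proof (rule order.trans[OF norm_powr_line_le])
      show "norm z powr - \<sigma> * exp (\<bar>t\<bar> * \<bar>Im (Ln z)\<bar>) \<le> norm z powr - \<sigma> * exp (\<bar>t\<bar> * \<delta>)"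
        using z by (intro mult_left_mono) (auto intro: mult_left_mono)
    qed (use z in auto)
    have b: "norm (kern \<nu> A B (Complex \<sigma> t) * z powr - Complex \<sigma> t) \<le> K * W * exp (- \<delta> * \<bar>t\<bar>)"
      if "?\<sigma> \<le> \<sigma>" "\<sigma> \<le> c" "\<bar>t\<bar> \<ge> 1" for \<sigma> t
    proof -
      have "norm (kern \<nu> A B (Complex \<sigma> t) * z powr - Complex \<sigma> t)
         \<le> (K * exp (- (2 * \<delta>) * \<bar>t\<bar>)) * (norm z powr - \<sigma> * exp (\<bar>t\<bar> * \<delta>))"
        unfolding norm_mult using K(2)[OF that] zb K(1) by (intro mult_mono) auto
      also have "\<dots> \<le> (K * exp (- (2 * \<delta>) * \<bar>t\<bar>)) * (W * exp (\<bar>t\<bar> * \<delta>))"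
        using W(2)[of \<sigma>] K(1) that by (intro mult_left_mono mult_right_mono) auto
      also have "\<dots> = K * W * (exp (- (2 * \<delta>) * \<bar>t\<bar>) * exp (\<bar>t\<bar> * \<delta>))" by (simp only: mult_ac)
      also note expd
      finally show ?thesis .
    qed
    have hol: "(\<lambda>s. kern \<nu> A B s * z powr - s) holomorphic_on {s. ?\<sigma> - 1 < Re s} - {of_real \<nu>}"
      unfolding kern_def using z by (auto intro!: holomorphic_intros holomorphic_powr_neg)
    note sh = shift_line_residues[of ?\<sigma> c \<delta> "?\<sigma> - 1" 1 "\<lambda>s. kern \<nu> A B s * z powr - s" "K * W" "{of_real \<nu>}",
        OF _ \<delta> _ b _ _ hol]
    show "integrable lborel (\<lambda>t. kern \<nu> A B (Complex c t) * z powr - Complex c t)"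
      by (rule sh(2)) (use \<nu> in auto)
    have "(LINT t|lborel. kern \<nu> A B (Complex c t) * z powr - Complex c t)
         - (LINT t|lborel. kern \<nu> A B (Complex ?\<sigma> t) * z powr - Complex ?\<sigma> t)
         = 2 * pi * (\<Sum>p\<in>{of_real \<nu>}. residue (\<lambda>s. kern \<nu> A B s * z powr - s) p)"
      by (rule sh(3)) (use \<nu> in auto)
    also have "(\<Sum>p\<in>{of_real \<nu>}. residue (\<lambda>s. kern \<nu> A B s * z powr - s) p) = z powr - of_real \<nu> * (B - A * Ln z)"
      using z by (simp add: residue_kern)
    finally have "(LINT t|lborel. kern \<nu> A B (Complex c t) * z powr - Complex c t)
         - 2 * pi * (z powr - of_real \<nu> * (B - A * Ln z)) = (LINT t|lborel. kern \<nu> A B (Complex ?\<sigma> t) * z powr - Complex ?\<sigma> t)"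
      by (rule diff_eq_swap)
    also have "norm \<dots> \<le> (K' * norm z powr - ?\<sigma>) * I"
      unfolding I_def
    proof (rule norm_line_integral_le[OF _ \<delta>])
      fix t
      have "norm (kern \<nu> A B (Complex ?\<sigma> t) * z powr - Complex ?\<sigma> t)
         \<le> (K' * exp (- (2 * \<delta>) * \<bar>t\<bar>)) * (norm z powr - ?\<sigma> * exp (\<bar>t\<bar> * \<delta>))"
        unfolding norm_mult by (intro mult_mono zb K'(2)) (use K'(1) in auto)
      also have "\<dots> = K' * norm z powr - ?\<sigma> * (exp (- (2 * \<delta>) * \<bar>t\<bar>) * exp (\<bar>t\<bar> * \<delta>))" by (simp only: mult_ac)
      also note expd
      finally show "norm (kern \<nu> A B (Complex ?\<sigma> t) * z powr - Complex ?\<sigma> t) \<le> K' * norm z powr - ?\<sigma> * exp (- \<delta> * \<bar>t\<bar>)" .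
    qed
    also have "\<dots> = (K' * I) * norm z powr (R + 1)" by (simp add: add.commute)
    also have "\<dots> \<le> (K' * I + 1) * norm z powr (R + 1)" by (intro mult_right_mono) auto
    finally show "norm ((LINT t|lborel. kern \<nu> A B (Complex c t) * z powr - Complex c t)
               - 2 * pi * (z powr - of_real \<nu> * (B - A * Ln z))) \<le> (K' * I + 1) * norm z powr (R + 1)" .
  qed
qed

subsection \<open>Removable singularities\<close>

text \<open>At an isolated singularity this says that the singularity is removable. In this form it
  passes through sums and differences, so principal parts can be cancelled pole by pole.\<close>

definition has_lim :: "(complex \<Rightarrow> complex) \<Rightarrow> complex \<Rightarrow> bool" where
  "has_lim f p \<longleftrightarrow> (\<exists>l. f \<midarrow>p\<rightarrow> l)"

lemma has_lim_analytic: "f analytic_on {p} \<Longrightarrow> has_lim f p"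
  unfolding has_lim_def by (intro exI[of _ "f p"] isContD analytic_at_imp_isCont)

lemma has_lim_add: "has_lim f p \<Longrightarrow> has_lim g p \<Longrightarrow> has_lim (\<lambda>s. f s + g s) p"
  unfolding has_lim_def by (elim exE, rule exI, rule tendsto_add)

lemma has_lim_diff: "has_lim f p \<Longrightarrow> has_lim g p \<Longrightarrow> has_lim (\<lambda>s. f s - g s) p"
  unfolding has_lim_def by (elim exE, rule exI, rule tendsto_diff)

lemma has_lim_sum: "(\<And>i. i \<in> I \<Longrightarrow> has_lim (f i) p) \<Longrightarrow> has_lim (\<lambda>s. \<Sum>i\<in>I. f i s) p"
proof (induction I rule: infinite_finite_induct)
  case (insert x I)
  have "has_lim (\<lambda>s. f x s + (\<Sum>i\<in>I. f i s)) p"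
    using insert by (intro has_lim_add) simp_all
  thus ?case using insert by simp
qed (use tendsto_const in \<open>force simp: has_lim_def\<close>)+

lemma has_lim_cong: "eventually (\<lambda>s. f s = g s) (at p) \<Longrightarrow> has_lim g p \<Longrightarrow> has_lim f p"
  unfolding has_lim_def by (simp add: tendsto_cong)

lemma analytic_factor_root:
  assumes "f analytic_on {p}" "f p = (0::complex)"
  shows "\<exists>g. g analytic_on {p} \<and> eventually (\<lambda>s. f s = (s - p) * g s) (nhds p) \<and> g p = deriv f p"
proof -
  obtain S where S: "open S" "p \<in> S" "f holomorphic_on S"
    using assms(1) by (auto simp: analytic_at)
  define g where "g = (\<lambda>z. if z = p then deriv f p else (f z - f p) / (z - p))"
  have "g holomorphic_on S" unfolding g_def by (rule pole_lemma_open[OF S(3,1)])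
  hence "g analytic_on {p}" using S analytic_at by blast
  moreover have "\<forall>\<^sub>F s in nhds p. f s = (s - p) * g s"
    using assms(2) by (intro always_eventually) (auto simp: g_def)
  ultimately show ?thesis by (intro exI[of _ g]) (auto simp: g_def)
qed

lemma has_lim_simple_root:
  assumes "f analytic_on {p}" "f p = 0"
  shows "has_lim (\<lambda>s. f s / (s - p)) p"
proof -
  obtain g where g: "g analytic_on {p}" "eventually (\<lambda>s. f s = (s - p) * g s) (nhds p)"
    using analytic_factor_root[OF assms] by blast
  show ?thesis
  proof (rule has_lim_cong[OF _ has_lim_analytic[OF g(1)]])
    have "\<forall>\<^sub>F s in at p. s \<noteq> p" by (simp add: eventually_at_filter)
    moreover have "\<forall>\<^sub>F s in at p. f s = (s - p) * g s" using g(2) by (auto simp: eventually_at_filter elim: eventually_mono)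
    ultimately show "\<forall>\<^sub>F s in at p. f s / (s - p) = g s" by eventually_elim auto
  qed
qed

lemma has_lim_double_root:
  assumes "f analytic_on {p}" "f p = 0" "deriv f p = 0"
  shows "has_lim (\<lambda>s. f s / (s - p)\<^sup>2) p"
proof -
  obtain g where g: "g analytic_on {p}" "eventually (\<lambda>s. f s = (s - p) * g s) (nhds p)" "g p = 0"
    using analytic_factor_root[OF assms(1,2)] assms(3) by auto
  show ?thesis
  proof (rule has_lim_cong[OF _ has_lim_simple_root[OF g(1,3)]])
    have "\<forall>\<^sub>F s in at p. s \<noteq> p" by (simp add: eventually_at_filter)
    moreover have "\<forall>\<^sub>F s in at p. f s = (s - p) * g s" using g(2) by (auto simp: eventually_at_filter elim: eventually_mono)
    ultimately show "\<forall>\<^sub>F s in at p. f s / (s - p)\<^sup>2 = g s / (s - p)"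
      by eventually_elim (auto simp: power2_eq_square)
  qed
qed

lemma is_pole_not_has_lim: "is_pole f p \<Longrightarrow> \<not> has_lim f p"
  unfolding has_lim_def is_pole_def by (metis not_tendsto_and_filterlim_at_infinity trivial_limit_at)

text \<open>The numerator \<open>e\<close> is left free, subject to e(p) = 1, so that the principal
  part can be subtracted in the Gaussian-damped form of \<open>kern\<close>.\<close>

lemma simple_pole_decomp:
  assumes "f meromorphic_on {p}" "is_pole f p" "zorder f p = -1"
  shows "\<exists>a. a \<noteq> 0 \<and> ((\<lambda>s. (s - p) * f s) \<longlongrightarrow> a) (at p) \<and>
           (\<forall>e. e analytic_on {p} \<and> e p = 1 \<longrightarrow> has_lim (\<lambda>s. f s - a * e s / (s - p)) p)"
proof -
  have iso: "isolated_singularity_at f p" "not_essential f p"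
    using assms(1) by (auto simp: meromorphic_at_iff)
  have "\<exists>\<^sub>F w in at p. f w \<noteq> 0"
    using non_zero_neighbour_pole[OF assms(2)] by (intro eventually_frequently) auto
  from zorder_exist[OF iso this] obtain r where r: "zor_poly f p p \<noteq> 0" "r > 0"
    "zor_poly f p holomorphic_on cball p r"
    "\<And>w. w \<in> cball p r - {p} \<Longrightarrow> f w = zor_poly f p w * (w - p) powi (-1)"
    unfolding assms(3) by blast
  define g where "g = zor_poly f p"
  have g: "g analytic_on {p}"
    using r(2,3) unfolding g_def analytic_at
    by (intro exI[of _ "ball p r"]) (auto intro: holomorphic_on_subset)
  have ev: "\<forall>\<^sub>F w in at p. f w = g w / (w - p) \<and> w \<noteq> p"
  proof -
    have "\<forall>\<^sub>F w in at p. w \<in> ball p r - {p}" using r(2) by (intro eventually_at_in_open) auto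
    thus ?thesis by eventually_elim (use r(4) in \<open>auto simp: g_def power_int_minus field_simps\<close>)
  qed
  show ?thesis
  proof (intro exI[of _ "g p"] conjI allI impI)
    show "g p \<noteq> 0" using r(1) by (simp add: g_def)
    have "g \<midarrow>p\<rightarrow> g p" by (intro isContD analytic_at_imp_isCont g)
    moreover have "\<forall>\<^sub>F w in at p. (w - p) * f w = g w" using ev by eventually_elim auto
    ultimately show "((\<lambda>s. (s - p) * f s) \<longlongrightarrow> g p) (at p)" by (simp add: tendsto_cong)
    fix e assume e: "e analytic_on {p} \<and> e p = 1"
    show "has_lim (\<lambda>s. f s - g p * e s / (s - p)) p"
    proof (rule has_lim_cong[OF _ has_lim_simple_root])
      show "(\<lambda>s. g s - g p * e s) analytic_on {p}" using e g by (intro analytic_intros) auto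
      show "\<forall>\<^sub>F s in at p. f s - g p * e s / (s - p) = (g s - g p * e s) / (s - p)"
        using ev by eventually_elim (auto simp: diff_divide_distrib)
    qed (use e in auto)
  qed
qed

subsection \<open>The expansion of the logarithm of the generating function\<close>

lemma meromorphic_Gamma: "Gamma meromorphic_on A"
proof -
  have "(\<lambda>s. inverse (rGamma s)) meromorphic_on A"
    by (intro meromorphic_intros analytic_on_imp_meromorphic_on analytic_rGamma)
  thus ?thesis by (simp add: rGamma_inverse_Gamma)
qed

lemma meromorphic_zeta_shift: "(\<lambda>s. zeta (s + 1)) meromorphic_on A"
proof -
  have "(\<lambda>s. xi (s + 1)) holomorphic_on UNIV"
    using holomorphic_on_compose_gen[OF _ xi(1), of "\<lambda>s. s + 1" UNIV] by (simp add: o_def holomorphic_on_add holomorphic_on_ident holomorphic_on_const)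
  hence "(\<lambda>s. xi (s + 1)) analytic_on A" using analytic_on_open analytic_on_subset by blast
  hence "(\<lambda>s. xi (s + 1) / s) meromorphic_on A"
    by (intro meromorphic_intros analytic_on_imp_meromorphic_on)
  moreover have "\<forall>\<^sub>F s in at z. xi (s + 1) / s = zeta (s + 1)" for z
  proof -
    have "\<forall>\<^sub>F s in at z. s \<noteq> 0"
    proof (cases "z = 0")
      case False
      have "\<forall>\<^sub>F s in nhds z. s \<in> - {0}" using False by (intro eventually_nhds_in_open) auto
      thus ?thesis unfolding eventually_at_filter by eventually_elim auto
    qed (simp add: eventually_at_filter)
    thus ?thesis by eventually_elim (simp add: zeta_eq)
  qed
  thus ?thesis using calculation by (subst (asm) meromorphic_on_cong[OF _ refl]) auto
qed


section \<open>The setting of the theorem and the singularities of L_f^*\<close>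

locale partition_setting =
  fixes f :: "nat \<Rightarrow> nat" and F :: "complex \<Rightarrow> complex" and \<alpha> R :: real and L :: nat
  assumes R_pos: "R > 0" and P1: "P1 f R F \<alpha> L" and P3: "P3 f R F \<alpha>" and P4: "P4 R F"
begin

abbreviation "H \<equiv> Lstar F"

lemma alpha_pos: "\<alpha> > 0" using P1 by (simp add: P1_def)

lemma F_nice: "F nicely_meromorphic_on {s. Re s \<ge> - R}"
  using P3 by (simp add: P3_def is_L_function_def)

lemma F_pole_le: "Re s \<ge> - R \<Longrightarrow> is_pole F s \<Longrightarrow> Re s \<le> \<alpha>"
  using P1 by (auto simp: P1_def largest_pole_def)

lemma H_pole_le: "Re s \<ge> - R \<Longrightarrow> is_pole H s \<Longrightarrow> Re s \<le> \<alpha>"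
  using P3 by (auto simp: P3_def largest_pole_def)

lemma H_pole_alpha: "is_pole H (of_real \<alpha>)"
  using P3 by (auto simp: P3_def largest_pole_def)

lemma H_pole_real: "Re s \<ge> - R \<Longrightarrow> is_pole H s \<Longrightarrow> s = of_real (Re s)"
  using P3 unfolding P3_def by (metis complex_is_Real_iff complex_eq_iff Im_complex_of_real Re_complex_of_real)

lemma H_zorder: "Re s \<ge> - R \<Longrightarrow> is_pole H s \<Longrightarrow> zorder H s = -1 \<or> s = 0 \<and> zorder H s = -2"
  using P3 by (auto simp: P3_def)

lemma F_analytic: "Re s \<ge> - R \<Longrightarrow> \<not> is_pole F s \<Longrightarrow> F analytic_on {s}"
  using nicely_meromorphic_on_imp_analytic_at[OF F_nice] by simp

lemma H_meromorphic: "H meromorphic_on {s. Re s \<ge> - R}"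
proof -
  have "F meromorphic_on {s. Re s \<ge> - R}" using F_nice by (simp add: nicely_meromorphic_on_def)
  thus ?thesis unfolding Lstar_def[abs_def]
    by (intro meromorphic_on_mult meromorphic_Gamma meromorphic_zeta_shift)
qed

lemma H_analytic:
  assumes "F analytic_on {s}" "s \<notin> \<int>\<^sub>\<le>\<^sub>0"
  shows "H analytic_on {s}"
proof -
  have "s \<noteq> 0" using assms(2) by auto
  have "zeta analytic_on - {1}" using holomorphic_zeta by (simp add: analytic_on_open open_Compl)
  hence "zeta analytic_on (\<lambda>s. s + 1) ` {s}" by (rule analytic_on_subset) (use \<open>s \<noteq> 0\<close> in auto)
  hence "(\<lambda>s. zeta (s + 1)) analytic_on {s}"
    using analytic_on_compose[of "\<lambda>s. s + 1" "{s}" zeta] by (simp add: o_def analytic_intros)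
  moreover have "Gamma analytic_on {s}" using assms(2) by (intro analytic_Gamma) auto
  ultimately show ?thesis unfolding Lstar_def[abs_def] using assms(1) by (intro analytic_on_mult)
qed

text \<open>Beyond the abscissa \<open>c\<close>, \<open>F\<close> is given by its absolutely convergent series.\<close>

definition c :: real where
  "c = (SOME c. c > \<alpha> \<and> summable (\<lambda>n. real (f (Suc n)) * real (Suc n) powr - c) \<and>
         (\<forall>s. Re s \<ge> c \<longrightarrow> F s = (\<Sum>n. dirichlet_term f s n)))"

text \<open>The terms of a series convergent at s0 are bounded, so f(n) = O(n^{Re s0}), and at
  abscissas from Re s0 + 2 on the series converges absolutely.\<close>

lemma c: "c > \<alpha>" "summable (\<lambda>n. real (f (Suc n)) * real (Suc n) powr - c)"
  "Re s \<ge> c \<Longrightarrow> F s = (\<Sum>n. dirichlet_term f s n)"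
proof -
  obtain s0 c0 where s0: "summable (dirichlet_term f s0)" and c0: "\<And>s. Re s > c0 \<Longrightarrow> F s = (\<Sum>n. dirichlet_term f s n)"
    using P3 unfolding P3_def is_L_function_def by blast
  from summable_LIMSEQ_zero[OF s0] have "Bseq (dirichlet_term f s0)"
    by (intro convergent_imp_Bseq convergentI)
  then obtain B where B: "\<And>n. norm (dirichlet_term f s0 n) \<le> B" by (auto simp: Bseq_def)
  define c1 where "c1 = max (\<alpha> + 1) (max (c0 + 1) (Re s0 + 2))"
  have "summable (\<lambda>n. real (f (Suc n)) * real (Suc n) powr - c1)"
  proof (rule summable_comparison_test)
    show "summable (\<lambda>n. B * real (Suc n) powr (Re s0 - c1))"
      by (intro summable_mult summable_Suc_powr) (auto simp: c1_def)
    show "\<exists>N. \<forall>n\<ge>N. norm (real (f (Suc n)) * real (Suc n) powr - c1) \<le> B * real (Suc n) powr (Re s0 - c1)"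
    proof (intro exI allI impI)
      fix n
      have "real (f (Suc n)) * real (Suc n) powr - Re s0 \<le> B"
        using B[of n] unfolding dirichlet_term_def norm_mult norm_of_nat_powr[OF zero_less_Suc] by simp
      hence "real (f (Suc n)) * real (Suc n) powr - Re s0 * real (Suc n) powr (Re s0 - c1) \<le> B * real (Suc n) powr (Re s0 - c1)"
        by (intro mult_right_mono) auto
      thus "norm (real (f (Suc n)) * real (Suc n) powr - c1) \<le> B * real (Suc n) powr (Re s0 - c1)"
        by (simp add: mult.assoc flip: powr_add)
    qed
  qed
  hence "\<exists>c. c > \<alpha> \<and> summable (\<lambda>n. real (f (Suc n)) * real (Suc n) powr - c) \<and>
         (\<forall>s. Re s \<ge> c \<longrightarrow> F s = (\<Sum>n. dirichlet_term f s n))"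
    using c0 by (intro exI[of _ c1]) (auto simp: c1_def)
  from someI_ex[OF this, folded c_def]
  show "c > \<alpha>" "summable (\<lambda>n. real (f (Suc n)) * real (Suc n) powr - c)"
  "Re s \<ge> c \<Longrightarrow> F s = (\<Sum>n. dirichlet_term f s n)" by blast+
qed

lemma c_pos: "c > 0" using c(1) alpha_pos by linarith

text \<open>In contrast to \<open>poleset\<close>, a pole at -R is included and 0 is excluded. On
  the line Re s = -R the function F is analytic, but Gamma may still have a pole there; the point 0
  is treated separately because the pole may be double.\<close>

definition Pol :: "real set" where "Pol = {\<mu>. - R \<le> \<mu> \<and> \<mu> \<noteq> 0 \<and> is_pole H (of_real \<mu>)}"

lemma finite_Pol: "finite Pol"
proof -
  define S :: "complex set" where "S = of_real ` {- R..\<alpha>}"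
  have "compact S" unfolding S_def by (intro compact_continuous_image continuous_intros) auto
  have "{s \<in> S. \<not> H analytic_on {s}} sparse_in S"
    by (intro meromorphic_on_imp_sparse_singularities' meromorphic_on_subset[OF H_meromorphic])
       (auto simp: S_def)
  hence "finite {s \<in> S. \<not> H analytic_on {s}}"
    by (rule finite_subset[OF _ sparse_in_compact_finite[OF _ \<open>compact S\<close>], rotated]) auto
  moreover have "complex_of_real ` Pol \<subseteq> {s \<in> S. \<not> H analytic_on {s}}"
    using H_pole_le[of "of_real _"] by (auto simp: Pol_def S_def analytic_at_imp_no_pole)
  ultimately have "finite (complex_of_real ` Pol)" by (rule finite_subset[rotated])
  thus ?thesis by (rule finite_imageD) (auto simp: inj_on_def)
qed

text \<open>The residue of \<open>Lstar F\<close> at a simple pole, fixed by choice together with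
  its limit description and the cancellation property of \<open>simple_pole_decomp\<close>.\<close>

definition acoef :: "real \<Rightarrow> complex" where
  "acoef \<nu> = (SOME a. a \<noteq> 0 \<and> ((\<lambda>s. (s - of_real \<nu>) * H s) \<longlongrightarrow> a) (at (of_real \<nu>)) \<and>
      (\<forall>e. e analytic_on {of_real \<nu>} \<and> e (of_real \<nu>) = 1 \<longrightarrow> has_lim (\<lambda>s. H s - a * e s / (s - of_real \<nu>)) (of_real \<nu>)))"

lemma acoef:
  assumes "\<nu> \<in> Pol"
  shows "acoef \<nu> \<noteq> 0" "((\<lambda>s. (s - of_real \<nu>) * H s) \<longlongrightarrow> acoef \<nu>) (at (of_real \<nu>))"
    "has_lim (\<lambda>s. H s - kern \<nu> 0 (acoef \<nu>) s) (of_real \<nu>)"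
proof -
  have "\<exists>a. a \<noteq> 0 \<and> ((\<lambda>s. (s - of_real \<nu>) * H s) \<longlongrightarrow> a) (at (of_real \<nu>)) \<and>
      (\<forall>e. e analytic_on {of_real \<nu>} \<and> e (of_real \<nu>) = 1 \<longrightarrow> has_lim (\<lambda>s. H s - a * e s / (s - of_real \<nu>)) (of_real \<nu>))"
  proof (rule simple_pole_decomp)
    show "H meromorphic_on {of_real \<nu>}"
      by (rule meromorphic_on_subset[OF H_meromorphic]) (use assms in \<open>auto simp: Pol_def\<close>)
    show "is_pole H (of_real \<nu>)" using assms by (simp add: Pol_def)
    show "zorder H (of_real \<nu>) = -1" using H_zorder[of "of_real \<nu>"] assms by (auto simp: Pol_def)
  qed
  note * = someI_ex[OF this, folded acoef_def]
  show "acoef \<nu> \<noteq> 0" "((\<lambda>s. (s - of_real \<nu>) * H s) \<longlongrightarrow> acoef \<nu>) (at (of_real \<nu>))" using * by blast+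
  define e where "e = (\<lambda>s. exp ((s - complex_of_real \<nu>)\<^sup>2))"
  have "has_lim (\<lambda>s. H s - acoef \<nu> * e s / (s - of_real \<nu>)) (of_real \<nu>)"
    by (rule *[THEN conjunct2, THEN conjunct2, rule_format]) (auto simp: e_def intro!: analytic_intros)
  moreover have "kern \<nu> 0 (acoef \<nu>) s = acoef \<nu> * e s / (s - of_real \<nu>)" for s
    by (cases "s = of_real \<nu>") (auto simp: kern_def e_def power2_eq_square)
  ultimately show "has_lim (\<lambda>s. H s - kern \<nu> 0 (acoef \<nu>) s) (of_real \<nu>)" by simp
qed

text \<open>Equal to s^2 Gamma(s) zeta(s+1) for s \<noteq> 0, but analytic at 0; thus
  \<open>Lstar F\<close> is \<open>qfun\<close> times F(s)/s^2 (\<open>H_qfun\<close>).\<close>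

definition qfun :: "complex \<Rightarrow> complex" where "qfun s = Gamma (s + 1) * xi (s + 1)"

text \<open>The derivative vanishes because Gamma'(1) is minus Euler's constant while
  \<open>xi\<close> has derivative plus Euler's constant at 1. Hence the principal part of
  \<open>Lstar F\<close> at 0 is simply F(0)/s^2 + F'(0)/s.\<close>

lemma qfun: "qfun analytic_on {0}" "qfun 0 = 1" "deriv qfun 0 = 0"
proof -
  have x: "xi field_differentiable (at 1)" using xi(1) holomorphic_on_imp_differentiable_at by blast
  have 1: "(Gamma has_field_derivative - euler_mascheroni) (at (1 :: complex))"
    using has_field_derivative_Gamma[of "1::complex" UNIV] by simp
  have 2: "(xi has_field_derivative euler_mascheroni) (at 1)"
    using field_differentiable_derivI[OF x] xi(3) by simp
  have 3: "((\<lambda>s. s + 1) has_field_derivative 1) (at (0 :: complex))" by (auto intro!: derivative_eq_intros)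
  have "(qfun has_field_derivative (- euler_mascheroni * 1) * xi (0 + 1) + (euler_mascheroni * 1) * Gamma (0 + 1)) (at 0)"
    unfolding qfun_def
    by (rule DERIV_mult[OF DERIV_chain2[of Gamma _ "\<lambda>s. s + 1"] DERIV_chain2[of xi _ "\<lambda>s. s + 1"]])
       (use 1 2 3 in auto)
  thus "deriv qfun 0 = 0" by (simp add: DERIV_imp_deriv xi(2))
  show "qfun 0 = 1" by (simp add: qfun_def xi(2))
  have 4: "(\<lambda>s. s + 1) analytic_on {0 :: complex}" by (intro analytic_intros)
  have 5: "Gamma analytic_on {1 :: complex}" by (rule analytic_Gamma) auto
  have 6: "xi analytic_on {1}" using xi(1) analytic_on_open analytic_on_subset by (metis open_UNIV subset_UNIV)
  have "(\<lambda>s. Gamma (s + 1)) analytic_on {0}" "(\<lambda>s. xi (s + 1)) analytic_on {0}"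
    using analytic_on_compose[OF 4, of Gamma] analytic_on_compose[OF 4, of xi] 5 6 by (simp_all add: o_def)
  thus "qfun analytic_on {0}" unfolding qfun_def[abs_def] by (intro analytic_on_mult)
qed

lemma H_qfun: "s \<noteq> 0 \<Longrightarrow> H s = qfun s * F s / s\<^sup>2"
proof -
  assume s: "s \<noteq> 0"
  have "Gamma (s + 1) = s * Gamma s" 
  proof (cases "s \<in> \<int>\<^sub>\<le>\<^sub>0")
    case True
    then obtain k where k: "s = - of_nat k" by (elim nonpos_Ints_cases')
    with s have "s + 1 = - of_nat (k - 1)" by (cases k) auto
    thus ?thesis using k by (simp add: Gamma_eq_zero_iff)
  qed (simp add: Gamma_plus1)
  thus ?thesis using s by (simp add: Lstar_def zeta_eq qfun_def power2_eq_square)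
qed

text \<open>If F had a pole at 0 then so would \<open>Lstar F\<close>, of order at most 2 by (P3).
  But then F = s^2 \<open>Lstar F\<close> / \<open>qfun\<close> would have a finite limit at
  0.\<close>

lemma F_analytic_0: "F analytic_on {0}"
proof -
  have "\<not> is_pole F 0"
  proof
    assume p: "is_pole F 0"
    have q1: "qfun \<midarrow>0\<rightarrow> 1" using qfun(1,2) analytic_at_imp_isCont[OF qfun(1)] isContD by metis
    have ne: "\<forall>\<^sub>F s in at 0. s \<noteq> (0::complex)" by (simp add: eventually_at_filter)
    have qn: "\<forall>\<^sub>F s in at 0. qfun s \<noteq> 0"
      by (rule tendsto_imp_eventually_ne[OF q1]) simp
    have "is_pole H 0"
    proof -
      have p2: "is_pole (\<lambda>s. qfun s / s\<^sup>2) 0"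
        unfolding is_pole_def
        by (rule filterlim_divide_at_infinity[OF q1]) (auto intro!: filterlim_atI tendsto_eq_intros simp: eventually_at_filter)
      have "is_pole (\<lambda>s. F s * (qfun s / s\<^sup>2)) 0"
        using tendsto_mult_filterlim_at_infinity p p2 unfolding is_pole_def
        by (metis filterlim_at_infinity_times)
      moreover have "\<forall>\<^sub>F s in at 0. F s * (qfun s / s\<^sup>2) = H s"
        using ne by eventually_elim (simp add: H_qfun)
      ultimately show ?thesis unfolding is_pole_def using filterlim_cong by force
    qed
    hence z: "zorder H 0 = -1 \<or> zorder H 0 = -2" using H_zorder[of 0] R_pos by auto
    have "H meromorphic_on {0}" by (rule meromorphic_on_subset[OF H_meromorphic]) (use R_pos in auto)
    hence iso: "isolated_singularity_at H 0" "not_essential H 0" by (auto simp: meromorphic_at_iff)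
    have "\<exists>\<^sub>F w in at 0. H w \<noteq> 0"
      using non_zero_neighbour_pole[OF \<open>is_pole H 0\<close>] by (intro eventually_frequently) auto
    from zorder_exist[OF iso this] obtain r where r: "r > 0" "zor_poly H 0 holomorphic_on cball 0 r"
      "\<And>w. w \<in> cball 0 r - {0} \<Longrightarrow> H w = zor_poly H 0 w * (w - 0) powi zorder H 0" by blast
    define g where "g = zor_poly H 0"
    have "g analytic_on {0}"
      using r(1,2) unfolding g_def analytic_at
      by (intro exI[of _ "ball 0 r"]) (auto intro: holomorphic_on_subset)
    hence g: "g \<midarrow>0\<rightarrow> g 0" by (intro isContD analytic_at_imp_isCont)
    \<comment> \<open>The order of \<open>H\<close> at 0 is -1 or -2 here, so \<open>m\<close> is 1
      or 0 and \<open>nat\<close> truncates nothing.\<close>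
    define m where "m = nat (zorder H 0 + 2)"
    have "((\<lambda>w. g w * w ^ m / qfun w) \<longlongrightarrow> g 0 * 0 ^ m / 1) (at 0)"
      by (intro tendsto_intros g q1) auto
    moreover have "\<forall>\<^sub>F w in at 0. F w = g w * w ^ m / qfun w"
    proof -
      have "\<forall>\<^sub>F w in at 0. w \<in> ball 0 r - {0}" using r(1) by (intro eventually_at_in_open) auto
      thus ?thesis using qn
      proof eventually_elim
        case (elim w)
        have "F w = H w * w\<^sup>2 / qfun w" using elim by (simp add: H_qfun)
        also have "H w = g w * w powi zorder H 0" using r(3)[of w] elim by (simp add: g_def)
        also have "g w * w powi zorder H 0 * w\<^sup>2 = g w * w ^ m"
          using z elim by (elim disjE) (simp_all add: m_def power_int_minus power2_eq_square field_simps)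
        finally show ?case .
      qed
    qed
    ultimately have "has_lim F 0" unfolding has_lim_def by (auto simp: tendsto_cong)
    thus False using is_pole_not_has_lim[OF p] by blast
  qed
  thus ?thesis using F_analytic[of 0] R_pos by simp
qed

lemma H_decomp_0: "has_lim (\<lambda>s. H s - kern 0 (F 0) (deriv F 0) s) 0"
proof -
  define N where "N = (\<lambda>s. qfun s * F s - (F 0 + deriv F 0 * s) * exp (s\<^sup>2))"
  have an: "N analytic_on {0}" unfolding N_def by (intro analytic_intros qfun F_analytic_0)
  have dq: "(qfun has_field_derivative 0) (at 0)"
    using qfun(3) analytic_on_imp_differentiable_at[OF qfun(1)] field_differentiable_derivI by force
  have dF: "(F has_field_derivative deriv F 0) (at 0)"
    using analytic_on_imp_differentiable_at[OF F_analytic_0] by (intro field_differentiable_derivI) auto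
  have "(N has_field_derivative 0) (at 0)"
    unfolding N_def by (rule derivative_eq_intros dq dF refl | simp add: qfun)+
  hence "has_lim (\<lambda>s. N s / (s - 0)\<^sup>2) 0"
    by (intro has_lim_double_root an) (auto simp: N_def qfun DERIV_imp_deriv)
  thus ?thesis
  proof (rule has_lim_cong[rotated])
    have "\<forall>\<^sub>F s in at 0. s \<noteq> (0::complex)" by (simp add: eventually_at_filter)
    thus "\<forall>\<^sub>F s in at 0. H s - kern 0 (F 0) (deriv F 0) s = N s / (s - 0)\<^sup>2"
      by eventually_elim (simp add: H_qfun kern_def N_def diff_divide_distrib)
  qed
qed

lemma P4_bound:
  obtains a K T where "a < pi / 2" "a \<ge> 0" "K > 0" "T \<ge> 1"
    "\<And>\<sigma> t. - R \<le> \<sigma> \<Longrightarrow> \<sigma> \<le> c + 1 \<Longrightarrow> \<bar>t\<bar> \<ge> T \<Longrightarrow> norm (F (Complex \<sigma> t)) \<le> K * exp (a * \<bar>t\<bar>)"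
proof -
  obtain a where a: "a < pi / 2" "\<And>\<sigma>1 \<sigma>2. - R \<le> \<sigma>1 \<Longrightarrow> \<sigma>1 \<le> \<sigma>2 \<Longrightarrow> \<exists>K T. \<forall>\<sigma> t. \<sigma>1 \<le> \<sigma> \<and> \<sigma> \<le> \<sigma>2 \<and> \<bar>t\<bar> \<ge> T \<longrightarrow>
           cmod (F (Complex \<sigma> t)) \<le> K * exp (a * \<bar>t\<bar>)"
    using P4 unfolding P4_def by blast
  have "- R \<le> c + 1" using c_pos R_pos by linarith
  from a(2)[OF order.refl this] obtain K T where KT: "\<And>\<sigma> t. - R \<le> \<sigma> \<Longrightarrow> \<sigma> \<le> c + 1 \<Longrightarrow> \<bar>t\<bar> \<ge> T \<Longrightarrow>
     cmod (F (Complex \<sigma> t)) \<le> K * exp (a * \<bar>t\<bar>)" by blast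
  show ?thesis
  proof (rule that[of "max 0 a" "max 1 K" "max 1 T"])
    fix \<sigma> t assume *: "- R \<le> \<sigma>" "\<sigma> \<le> c + 1" "\<bar>t\<bar> \<ge> max 1 T"
    have "norm (F (Complex \<sigma> t)) \<le> K * exp (a * \<bar>t\<bar>)" using * by (intro KT) auto
    also have "\<dots> \<le> max 1 K * exp (max 0 a * \<bar>t\<bar>)"
    proof (intro mult_mono)
      have "a * \<bar>t\<bar> \<le> max 0 a * \<bar>t\<bar>" by (intro mult_right_mono) auto
      thus "exp (a * \<bar>t\<bar>) \<le> exp (max 0 a * \<bar>t\<bar>)" by simp
    qed auto
    finally show "norm (F (Complex \<sigma> t)) \<le> max 1 K * exp (max 0 a * \<bar>t\<bar>)" .
  qed (use a in \<open>auto simp: max_def\<close>)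
qed

text \<open>Right of the line Re s = -R the growth bound keeps F bounded around the point, which
  excludes a pole. On the line itself the bound covers only one side, and analyticity is taken from
  (P3).\<close>

lemma F_analytic_high:
  assumes bnd: "\<And>\<sigma> t. - R \<le> \<sigma> \<Longrightarrow> \<sigma> \<le> c + 1 \<Longrightarrow> \<bar>t\<bar> \<ge> T \<Longrightarrow> norm (F (Complex \<sigma> t)) \<le> K * exp (a * \<bar>t\<bar>)"
    and s: "- R \<le> Re s" "Re s \<le> c" "\<bar>Im s\<bar> > T" and aK: "a \<ge> 0" "K > 0"
  shows "F analytic_on {s}"
proof (cases "Re s = - R")
  case True
  have "F analytic_on {s. Re s = - R}" using P3 by (simp add: P3_def)
  thus ?thesis by (rule analytic_on_subset) (use True in auto)
next
  case False
  have "\<not> is_pole F s"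
  proof
    assume p: "is_pole F s"
    define M where "M = K * exp (a * (\<bar>Im s\<bar> + 1)) + 1"
    have "\<forall>\<^sub>F w in at s. norm (F w) \<ge> M"
      using p unfolding is_pole_def filterlim_at_infinity[OF order.refl]
      using aK(2) by (simp add: M_def add_pos_pos)
    moreover have "\<forall>\<^sub>F w in at s. - R < Re w \<and> Re w < c + 1 \<and> \<bar>Im w\<bar> > T \<and> \<bar>Im w\<bar> < \<bar>Im s\<bar> + 1"
    proof -
      have "open {w. - R < Re w \<and> Re w < c + 1 \<and> \<bar>Im w\<bar> > T \<and> \<bar>Im w\<bar> < \<bar>Im s\<bar> + 1}"
        by (intro open_Collect_conj open_Collect_less continuous_intros)
      hence "\<forall>\<^sub>F w in nhds s. w \<in> {w. - R < Re w \<and> Re w < c + 1 \<and> \<bar>Im w\<bar> > T \<and> \<bar>Im w\<bar> < \<bar>Im s\<bar> + 1}"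
        using False s by (intro eventually_nhds_in_open) auto
      thus ?thesis unfolding eventually_at_filter by eventually_elim auto
    qed
    ultimately have "\<forall>\<^sub>F w in at s. False"
    proof eventually_elim
      case (elim w)
      have "norm (F (Complex (Re w) (Im w))) \<le> K * exp (a * \<bar>Im w\<bar>)" using elim by (intro bnd) auto
      also have "\<dots> \<le> K * exp (a * (\<bar>Im s\<bar> + 1))" using elim aK by (simp add: mult_left_mono)
      finally show False using elim by (simp add: M_def)
    qed
    thus False by simp
  qed
  thus ?thesis using F_analytic s by simp
qed

lemma H_bound:
  obtains \<eta> K T where "\<eta> > 0" "K > 0" "T \<ge> 1"
    "\<And>\<sigma> t. - R \<le> \<sigma> \<Longrightarrow> \<sigma> \<le> c \<Longrightarrow> \<bar>t\<bar> \<ge> T \<Longrightarrow> norm (H (Complex \<sigma> t)) \<le> K * exp (- (2 * \<eta>) * \<bar>t\<bar>)"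
    "\<And>s. - R \<le> Re s \<Longrightarrow> Re s \<le> c \<Longrightarrow> \<bar>Im s\<bar> \<ge> T \<Longrightarrow> F analytic_on {s}"
proof -
  obtain a K T where F: "a < pi / 2" "a \<ge> 0" "K > 0" "T \<ge> 1"
    "\<And>\<sigma> t. - R \<le> \<sigma> \<Longrightarrow> \<sigma> \<le> c + 1 \<Longrightarrow> \<bar>t\<bar> \<ge> T \<Longrightarrow> norm (F (Complex \<sigma> t)) \<le> K * exp (a * \<bar>t\<bar>)"
    by (rule P4_bound, rule that, assumption+)
  \<comment> \<open>A quarter of the gap pi/2 - a. Gamma gives up one \<eta> of its rate, the
    polynomial growth of zeta costs another, and decay at rate 2\<eta> is left; half of that will
    pay for z^{-s} in the sector |arg z| \<le> \<eta>.\<close>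
  define \<eta> where "\<eta> = (pi / 2 - a) / 4"
  have \<eta>: "\<eta> > 0" using F by (simp add: \<eta>_def)
  obtain KG where KG: "KG > 0" "\<And>\<sigma> t. - R \<le> \<sigma> \<Longrightarrow> \<sigma> \<le> c \<Longrightarrow> \<bar>t\<bar> \<ge> 1 \<Longrightarrow> norm (Gamma (Complex \<sigma> t)) \<le> KG * exp (- (pi / 2 - \<eta>) * \<bar>t\<bar>)"
    using Gamma_strip_bound[of "pi / 2 - \<eta>" "- R" c] \<eta> by auto
  obtain Kz k where Kz: "Kz \<ge> 0" "\<And>s. Re s \<ge> - R + 1 \<Longrightarrow> norm (xi s) \<le> Kz * (1 + norm s) ^ k"
    using xi(5)[of "- R + 1"] unfolding pgrow_def by auto
  define D where "D = R + c + 2"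
  have D: "D \<ge> 0" using R_pos c_pos by (simp add: D_def)
  obtain Kp where Kp: "Kp > 0" "\<And>t. t \<ge> 0 \<Longrightarrow> (D + t) ^ k \<le> Kp * exp (\<eta> * t)"
    using power_le_exp[OF D \<eta>] by blast
  show ?thesis
  proof (rule that[of \<eta> "KG * ((Kz + 1) * Kp) * K" "T + 1"])
    fix \<sigma> t :: real assume *: "- R \<le> \<sigma>" "\<sigma> \<le> c" "\<bar>t\<bar> \<ge> T + 1"
    define s where "s = Complex \<sigma> t"
    have s1: "norm s \<ge> 1" "s \<noteq> 0" using * F abs_Im_le_cmod[of s] by (auto simp: s_def complex_eq_iff)
    have "norm (zeta (s + 1)) = norm (xi (s + 1)) / norm s" using s1 by (simp add: zeta_eq norm_divide)
    also have "\<dots> \<le> norm (xi (s + 1)) / 1" using s1 by (intro divide_left_mono) auto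
    also have "\<dots> \<le> Kz * (1 + norm (s + 1)) ^ k" using Kz(2)[of "s + 1"] * by (simp add: s_def)
    also have "\<dots> \<le> Kz * (D + \<bar>t\<bar>) ^ k"
    proof (intro mult_left_mono power_mono)
      have "norm (s + 1) \<le> \<bar>\<sigma> + 1\<bar> + \<bar>t\<bar>" using cmod_le[of "s + 1"] by (simp add: s_def)
      thus "1 + norm (s + 1) \<le> D + \<bar>t\<bar>" using * R_pos c_pos unfolding D_def by linarith
    qed (use Kz in auto)
    also have "\<dots> \<le> (Kz + 1) * (Kp * exp (\<eta> * \<bar>t\<bar>))" using Kp Kz D by (intro mult_mono) auto
    finally have z: "norm (zeta (s + 1)) \<le> (Kz + 1) * (Kp * exp (\<eta> * \<bar>t\<bar>))" .
    have "norm (H s) \<le> (KG * exp (- (pi / 2 - \<eta>) * \<bar>t\<bar>)) * ((Kz + 1) * (Kp * exp (\<eta> * \<bar>t\<bar>))) * (K * exp (a * \<bar>t\<bar>))"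
      unfolding Lstar_def norm_mult
    proof (intro mult_mono z)
      show "norm (Gamma s) \<le> KG * exp (- (pi / 2 - \<eta>) * \<bar>t\<bar>)"
        unfolding s_def using * F by (intro KG) auto
      show "norm (F s) \<le> K * exp (a * \<bar>t\<bar>)" unfolding s_def using * by (intro F) auto
    qed (use KG Kz Kp in auto)
    also have "\<dots> = KG * ((Kz + 1) * Kp) * K * (exp (- (pi / 2 - \<eta>) * \<bar>t\<bar>) * exp (\<eta> * \<bar>t\<bar>) * exp (a * \<bar>t\<bar>))"
      by (simp only: mult_ac)
    also have "exp (- (pi / 2 - \<eta>) * \<bar>t\<bar>) * exp (\<eta> * \<bar>t\<bar>) * exp (a * \<bar>t\<bar>) = exp (- (2 * \<eta>) * \<bar>t\<bar>)"
    proof -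
      have "- (pi / 2 - \<eta>) * x + \<eta> * x + a * x = - (2 * \<eta>) * x" for x
        unfolding \<eta>_def by (simp add: field_simps)
      thus ?thesis by (simp only: exp_add[symmetric])
    qed
    finally show "norm (H (Complex \<sigma> t)) \<le> KG * ((Kz + 1) * Kp) * K * exp (- (2 * \<eta>) * \<bar>t\<bar>)"
      by (simp add: s_def)
  next
    fix s assume "- R \<le> Re s" "Re s \<le> c" "\<bar>Im s\<bar> \<ge> T + 1"
    thus "F analytic_on {s}" using F(2,3) by (intro F_analytic_high[OF F(5)]) auto
  qed (use \<eta> F KG Kz Kp in auto)
qed

lemma kern_meromorphic: "kern \<nu> A B meromorphic_on S"
proof -
  have "(\<lambda>s. (A + B * (s - of_real \<nu>)) * exp ((s - of_real \<nu>)\<^sup>2) / (s - of_real \<nu>)\<^sup>2) meromorphic_on S"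
    by (rule meromorphic_on_divide; rule analytic_on_imp_meromorphic_on; intro analytic_intros)
  thus ?thesis by (simp add: kern_def[abs_def])
qed

definition Acf :: "real \<Rightarrow> complex" where "Acf \<nu> = (if \<nu> = 0 then F 0 else 0)"
definition Bcf :: "real \<Rightarrow> complex" where "Bcf \<nu> = (if \<nu> = 0 then deriv F 0 else acoef \<nu>)"

definition g0 :: "complex \<Rightarrow> complex" where
  "g0 s = H s - (\<Sum>\<nu>\<in>insert 0 Pol. kern \<nu> (Acf \<nu>) (Bcf \<nu>) s)"

text \<open>All singularities of \<open>g0\<close> with Re s \<ge> -R are removable
  (\<open>g0_has_lim\<close>), but the values of \<open>g0\<close> there are conventions such as
  those of division by 0; \<open>remove_sings\<close> replaces them by the limits.\<close>

definition gg :: "complex \<Rightarrow> complex" where "gg = remove_sings g0"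

lemma g0_has_lim:
  assumes p: "- R \<le> Re p"
  shows "has_lim g0 p"
proof (cases "\<exists>\<nu>\<in>insert 0 Pol. p = of_real \<nu>")
  case True
  then obtain \<nu> where \<nu>: "\<nu> \<in> insert 0 Pol" "p = of_real \<nu>" by blast
  have "has_lim (\<lambda>s. (H s - kern \<nu> (Acf \<nu>) (Bcf \<nu>) s) - (\<Sum>\<mu>\<in>insert 0 Pol - {\<nu>}. kern \<mu> (Acf \<mu>) (Bcf \<mu>) s)) p"
  proof (rule has_lim_diff[OF _ has_lim_sum])
    show "has_lim (\<lambda>s. H s - kern \<nu> (Acf \<nu>) (Bcf \<nu>) s) p"
      using \<nu> H_decomp_0 acoef(3)[of \<nu>] by (auto simp: Acf_def Bcf_def Pol_def)
    show "has_lim (kern \<mu> (Acf \<mu>) (Bcf \<mu>)) p" if "\<mu> \<in> insert 0 Pol - {\<nu>}" for \<mu>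
      using that \<nu>(2) by (intro has_lim_analytic kern_analytic) auto
  qed
  moreover have "g0 = (\<lambda>s. (H s - kern \<nu> (Acf \<nu>) (Bcf \<nu>) s) - (\<Sum>\<mu>\<in>insert 0 Pol - {\<nu>}. kern \<mu> (Acf \<mu>) (Bcf \<mu>) s))"
    unfolding g0_def using finite_Pol \<nu>(1) by (subst sum.remove[OF _ \<nu>(1)]) (auto simp: fun_eq_iff)
  ultimately show ?thesis by simp
next
  case False
  have "\<not> is_pole H p"
  proof
    assume *: "is_pole H p"
    have "p = of_real (Re p)" using H_pole_real[OF p *] .
    moreover from this * p have "Re p \<in> insert 0 Pol" unfolding Pol_def by auto
    ultimately show False using False by blast
  qed
  moreover have "not_essential H p"
    using meromorphic_on_not_essential[OF meromorphic_on_subset[OF H_meromorphic]] p by auto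
  ultimately have H: "has_lim H p" by (auto simp: not_essential_def has_lim_def)
  show ?thesis unfolding g0_def[abs_def] using False
    by (intro has_lim_diff[OF H] has_lim_sum has_lim_analytic kern_analytic) auto
qed

lemma gg_holomorphic: "gg holomorphic_on {s. - R \<le> Re s \<and> Re s \<le> c}"
proof -
  let ?S = "{s. - R \<le> Re s \<and> Re s \<le> c}"
  have "H meromorphic_on ?S" by (rule meromorphic_on_subset[OF H_meromorphic]) auto
  hence m: "g0 meromorphic_on ?S" unfolding g0_def[abs_def]
    by (intro meromorphic_on_diff meromorphic_on_sum kern_meromorphic)
  have "gg analytic_on ?S"
  proof (rule nicely_meromorphic_without_singularities)
    show "gg nicely_meromorphic_on ?S" unfolding gg_def by (rule remove_sings_nicely_meromorphic[OF m])
    show "\<forall>z\<in>?S. \<not> is_pole gg z"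
    proof
      fix z assume z: "z \<in> ?S"
      have "isolated_singularity_at g0 z" using meromorphic_on_isolated_singularity[OF meromorphic_on_subset[OF m]] z by auto
      thus "\<not> is_pole gg z" unfolding gg_def using is_pole_not_has_lim[of g0 z] g0_has_lim[of z] z by auto
    qed
  qed
  thus ?thesis by (rule analytic_imp_holomorphic)
qed

lemma gg_eq:
  assumes "F analytic_on {s}" "s \<notin> \<int>\<^sub>\<le>\<^sub>0" "s \<notin> of_real ` insert 0 Pol"
  shows "gg s = g0 s"
proof -
  have "g0 analytic_on {s}" unfolding g0_def[abs_def] using assms
    by (intro analytic_on_diff analytic_on_sum H_analytic kern_analytic) auto
  thus ?thesis unfolding gg_def by simp
qed

lemma Pol_range: "\<nu> \<in> insert 0 Pol \<Longrightarrow> - R \<le> \<nu> \<and> \<nu> \<le> \<alpha>"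
  using H_pole_le[of "of_real \<nu>"] R_pos alpha_pos by (auto simp: Pol_def)

text \<open>On the line Re s = c the Mellin integrand is \<open>gg\<close> plus the kernels, times
  z^{-s}. The holomorphic part \<open>gg\<close> is moved to Re s = -R and contributes O(|z|^R);
  every kernel contributes its residue up to O(|z|^{R+1}) by \<open>kern_mellin\<close>. The
  restriction to a sector reflects that only an exponential rate 2\<eta> is available against the
  growth of z^{-s}.\<close>

theorem logG_expansion:
  "\<exists>\<eta>>0. \<exists>K>0. \<forall>z. Re z > 0 \<and> \<bar>Im (Ln z)\<bar> \<le> \<eta> \<and> norm z \<le> 1 \<longrightarrow>
     norm (logG f z - ((\<Sum>\<nu>\<in>Pol. acoef \<nu> * z powr - of_real \<nu>) + (deriv F 0 - F 0 * Ln z))) \<le> K * norm z powr R"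
proof -
  obtain \<eta> KH T where Hb: "\<eta> > 0" "KH > 0" "T \<ge> 1"
    "\<And>\<sigma> t. - R \<le> \<sigma> \<Longrightarrow> \<sigma> \<le> c \<Longrightarrow> \<bar>t\<bar> \<ge> T \<Longrightarrow> norm (H (Complex \<sigma> t)) \<le> KH * exp (- (2 * \<eta>) * \<bar>t\<bar>)"
    "\<And>s. - R \<le> Re s \<Longrightarrow> Re s \<le> c \<Longrightarrow> \<bar>Im s\<bar> \<ge> T \<Longrightarrow> F analytic_on {s}"
    by (rule H_bound, rule that, assumption+)
  let ?P = "insert 0 Pol"
  have fP: "finite ?P" using finite_Pol by simp
  have Rc: "- R \<le> c" using R_pos c_pos by simp
  have "\<forall>\<nu>. \<exists>K>0. \<forall>\<sigma> t. - R \<le> \<sigma> \<and> \<sigma> \<le> c \<and> \<bar>t\<bar> \<ge> 1 \<longrightarrow> norm (kern \<nu> (Acf \<nu>) (Bcf \<nu>) (Complex \<sigma> t)) \<le> K * exp (- (2 * \<eta>) * \<bar>t\<bar>)"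
    using kern_bound[OF Rc] by blast
  from choice[OF this] obtain Kk where Kk0: "\<forall>\<nu>. Kk \<nu> > 0 \<and> (\<forall>\<sigma> t. - R \<le> \<sigma> \<and> \<sigma> \<le> c \<and> \<bar>t\<bar> \<ge> 1 \<longrightarrow>
      norm (kern \<nu> (Acf \<nu>) (Bcf \<nu>) (Complex \<sigma> t)) \<le> Kk \<nu> * exp (- (2 * \<eta>) * \<bar>t\<bar>))"
    by (elim exE)
  have Kk: "Kk \<nu> > 0" "- R \<le> \<sigma> \<Longrightarrow> \<sigma> \<le> c \<Longrightarrow> \<bar>t\<bar> \<ge> 1 \<Longrightarrow>
      norm (kern \<nu> (Acf \<nu>) (Bcf \<nu>) (Complex \<sigma> t)) \<le> Kk \<nu> * exp (- (2 * \<eta>) * \<bar>t\<bar>)" for \<nu> \<sigma> t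
    using Kk0 by blast+
  define Kg where "Kg = KH + (\<Sum>\<nu>\<in>?P. Kk \<nu>)"
  have Kg: "Kg > 0" unfolding Kg_def using Hb(2) Kk(1) by (intro add_pos_nonneg sum_nonneg) (auto intro: less_imp_le)
  have ggb: "norm (gg (Complex \<sigma> t)) \<le> Kg * exp (- (2 * \<eta>) * \<bar>t\<bar>)"
    if "- R \<le> \<sigma>" "\<sigma> \<le> c" "\<bar>t\<bar> \<ge> T" for \<sigma> t
  proof -
    have "t \<noteq> 0" using that Hb(3) by auto
    hence "gg (Complex \<sigma> t) = g0 (Complex \<sigma> t)"
      using Hb(5)[of "Complex \<sigma> t"] that by (intro gg_eq) (auto elim!: nonpos_Ints_cases simp: complex_eq_iff)
    also have "norm \<dots> \<le> KH * exp (- (2 * \<eta>) * \<bar>t\<bar>) + (\<Sum>\<nu>\<in>?P. Kk \<nu> * exp (- (2 * \<eta>) * \<bar>t\<bar>))"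
      unfolding g0_def using that Hb(3)
      by (intro order.trans[OF norm_triangle_ineq4] add_mono Hb(4) order.trans[OF norm_sum] sum_mono Kk(2)) auto
    also have "\<dots> = Kg * exp (- (2 * \<eta>) * \<bar>t\<bar>)" unfolding Kg_def by (simp add: sum_distrib_right distrib_right)
    finally show ?thesis .
  qed
  have contg: "continuous_on UNIV (\<lambda>t. gg (Complex (- R) t))"
    using R_pos c_pos by (intro continuous_on_vertical[OF holomorphic_on_imp_continuous_on[OF gg_holomorphic]]) auto
  obtain K' where K': "K' > 0" "\<And>t. norm (gg (Complex (- R) t)) \<le> K' * exp (- (2 * \<eta>) * \<bar>t\<bar>)"
    using line_bound_global[OF contg ggb] Rc by auto
  have "\<forall>\<nu>\<in>?P. \<exists>K>0. \<forall>z. z \<noteq> 0 \<and> \<bar>Im (Ln z)\<bar> \<le> \<eta> \<longrightarrow>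
           integrable lborel (\<lambda>t. kern \<nu> (Acf \<nu>) (Bcf \<nu>) (Complex c t) * z powr - Complex c t) \<and>
           norm ((LINT t|lborel. kern \<nu> (Acf \<nu>) (Bcf \<nu>) (Complex c t) * z powr - Complex c t)
               - 2 * pi * (z powr - of_real \<nu> * (Bcf \<nu> - Acf \<nu> * Ln z))) \<le> K * norm z powr (R + 1)"
  proof
    fix \<nu> assume "\<nu> \<in> ?P"
    hence "- R - 1 < \<nu>" "\<nu> < c" using Pol_range[of \<nu>] c(1) by auto
    thus "\<exists>K>0. \<forall>z. z \<noteq> 0 \<and> \<bar>Im (Ln z)\<bar> \<le> \<eta> \<longrightarrow>
           integrable lborel (\<lambda>t. kern \<nu> (Acf \<nu>) (Bcf \<nu>) (Complex c t) * z powr - Complex c t) \<and>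
           norm ((LINT t|lborel. kern \<nu> (Acf \<nu>) (Bcf \<nu>) (Complex c t) * z powr - Complex c t)
               - 2 * pi * (z powr - of_real \<nu> * (Bcf \<nu> - Acf \<nu> * Ln z))) \<le> K * norm z powr (R + 1)"
      by (rule kern_mellin[OF _ _ Hb(1)])
  qed
  from bchoice[OF this] obtain Km where Km0: "\<forall>\<nu>\<in>?P. Km \<nu> > 0 \<and> (\<forall>z. z \<noteq> 0 \<and> \<bar>Im (Ln z)\<bar> \<le> \<eta> \<longrightarrow>
           integrable lborel (\<lambda>t. kern \<nu> (Acf \<nu>) (Bcf \<nu>) (Complex c t) * z powr - Complex c t) \<and>
           norm ((LINT t|lborel. kern \<nu> (Acf \<nu>) (Bcf \<nu>) (Complex c t) * z powr - Complex c t)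
               - 2 * pi * (z powr - of_real \<nu> * (Bcf \<nu> - Acf \<nu> * Ln z))) \<le> Km \<nu> * norm z powr (R + 1))"
    by (elim exE)
  have Km: "\<nu> \<in> ?P \<Longrightarrow> Km \<nu> > 0"
    "\<nu> \<in> ?P \<Longrightarrow> z \<noteq> 0 \<Longrightarrow> \<bar>Im (Ln z)\<bar> \<le> \<eta> \<Longrightarrow> integrable lborel (\<lambda>t. kern \<nu> (Acf \<nu>) (Bcf \<nu>) (Complex c t) * z powr - Complex c t)"
    "\<nu> \<in> ?P \<Longrightarrow> z \<noteq> 0 \<Longrightarrow> \<bar>Im (Ln z)\<bar> \<le> \<eta> \<Longrightarrow> norm ((LINT t|lborel. kern \<nu> (Acf \<nu>) (Bcf \<nu>) (Complex c t) * z powr - Complex c t)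
               - 2 * pi * (z powr - of_real \<nu> * (Bcf \<nu> - Acf \<nu> * Ln z))) \<le> Km \<nu> * norm z powr (R + 1)" for \<nu> z
    by (drule bspec[OF Km0], simp)+
  have expd: "exp (- (2 * \<eta>) * x) * exp (x * \<eta>) = exp (- \<eta> * x)" for x by (simp flip: exp_add)
  define I where "I = (LINT t|lborel. exp (- \<eta> * \<bar>t\<bar>))"
  have I: "I \<ge> 0" unfolding I_def by (intro integral_nonneg_AE) auto
  define Kf where "Kf = K' * I + (\<Sum>\<nu>\<in>?P. Km \<nu>)"
  have Kf: "Kf > 0" unfolding Kf_def using K' I Km(1) fP by (intro add_nonneg_pos sum_pos) auto
  have main: "norm (logG f z - ((\<Sum>\<nu>\<in>Pol. acoef \<nu> * z powr - of_real \<nu>) + (deriv F 0 - F 0 * Ln z))) \<le> Kf * norm z powr R"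
    if z: "Re z > 0" "\<bar>Im (Ln z)\<bar> \<le> \<eta>" "norm z \<le> 1" for z
  proof -
    have z0: "z \<noteq> 0" using z by auto
    have zb: "norm (z powr - Complex \<sigma> t) \<le> norm z powr - \<sigma> * exp (\<bar>t\<bar> * \<eta>)" for \<sigma> t
    proof (rule order.trans[OF norm_powr_line_le[OF z0]])
      show "norm z powr - \<sigma> * exp (\<bar>t\<bar> * \<bar>Im (Ln z)\<bar>) \<le> norm z powr - \<sigma> * exp (\<bar>t\<bar> * \<eta>)"
        using z by (intro mult_left_mono) (auto intro: mult_left_mono)
    qed
    have "compact ((\<lambda>x. norm z powr - x) ` {- R..c})"
      using z0 by (intro compact_continuous_image continuous_intros) auto
    then obtain W where W: "W > 0" "\<And>x. x \<in> {- R..c} \<Longrightarrow> norm (norm z powr - x) \<le> W"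
      by (metis (no_types, lifting) bounded_pos compact_imp_bounded imageI)
    have b: "norm (gg (Complex \<sigma> t) * z powr - Complex \<sigma> t) \<le> Kg * W * exp (- \<eta> * \<bar>t\<bar>)"
      if "- R \<le> \<sigma>" "\<sigma> \<le> c" "\<bar>t\<bar> \<ge> T" for \<sigma> t
    proof -
      have "norm (gg (Complex \<sigma> t) * z powr - Complex \<sigma> t)
         \<le> (Kg * exp (- (2 * \<eta>) * \<bar>t\<bar>)) * (norm z powr - \<sigma> * exp (\<bar>t\<bar> * \<eta>))"
        unfolding norm_mult by (intro mult_mono ggb that zb) (use Kg in auto)
      also have "\<dots> \<le> (Kg * exp (- (2 * \<eta>) * \<bar>t\<bar>)) * (W * exp (\<bar>t\<bar> * \<eta>))"
        using W(2)[of \<sigma>] Kg that by (intro mult_left_mono mult_right_mono) auto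
      also have "\<dots> = Kg * W * (exp (- (2 * \<eta>) * \<bar>t\<bar>) * exp (\<bar>t\<bar> * \<eta>))" by (simp only: mult_ac)
      also note expd
      finally show ?thesis .
    qed
    have hol: "(\<lambda>s. gg s * z powr - s) holomorphic_on {s. - R \<le> Re s \<and> Re s \<le> c}"
      by (intro holomorphic_intros gg_holomorphic holomorphic_powr_neg z0)
    have Rc': "- R < c" using R_pos c_pos by linarith
    have sh: "integrable lborel (\<lambda>t. gg (Complex c t) * z powr - Complex c t)"
      "(LINT t|lborel. gg (Complex c t) * z powr - Complex c t) = (LINT t|lborel. gg (Complex (- R) t) * z powr - Complex (- R) t)"
      by (rule shift_line_holomorphic[of "- R" c \<eta> T "\<lambda>s. gg s * z powr - s" "Kg * W", OF Rc' Hb(1) _ hol], rule b, assumption+)+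
    have "norm (LINT t|lborel. gg (Complex (- R) t) * z powr - Complex (- R) t) \<le> (K' * norm z powr - (- R)) * I"
      unfolding I_def
    proof (rule norm_line_integral_le[OF _ Hb(1)])
      fix t
      have "norm (gg (Complex (- R) t) * z powr - Complex (- R) t)
         \<le> (K' * exp (- (2 * \<eta>) * \<bar>t\<bar>)) * (norm z powr - (- R) * exp (\<bar>t\<bar> * \<eta>))"
        unfolding norm_mult by (intro mult_mono K' zb) (use K' in auto)
      also have "\<dots> = K' * norm z powr - (- R) * (exp (- (2 * \<eta>) * \<bar>t\<bar>) * exp (\<bar>t\<bar> * \<eta>))" by (simp only: mult_ac)
      also note expd
      finally show "norm (gg (Complex (- R) t) * z powr - Complex (- R) t) \<le> K' * norm z powr - (- R) * exp (- \<eta> * \<bar>t\<bar>)" .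
    qed
    hence gI: "norm (LINT t|lborel. gg (Complex c t) * z powr - Complex c t) \<le> K' * I * norm z powr R"
      unfolding sh(2) by (simp add: mult_ac)
    have Heq: "Gamma (Complex c t) * zeta (Complex (c + 1) t) * (\<Sum>n. dirichlet_term f (Complex c t) n) * z powr - Complex c t
        = gg (Complex c t) * z powr - Complex c t + (\<Sum>\<nu>\<in>?P. kern \<nu> (Acf \<nu>) (Bcf \<nu>) (Complex c t) * z powr - Complex c t)" for t
    proof -
      have "gg (Complex c t) = g0 (Complex c t)"
      proof (rule gg_eq)
        have "\<not> is_pole F (Complex c t)" using F_pole_le[of "Complex c t"] Rc c(1) by auto
        thus "F analytic_on {Complex c t}" using F_analytic[of "Complex c t"] Rc by simp
        show "Complex c t \<notin> \<int>\<^sub>\<le>\<^sub>0" using c_pos by (auto elim!: nonpos_Ints_cases simp: complex_eq_iff)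
        show "Complex c t \<notin> complex_of_real ` insert 0 Pol"
          using Pol_range c(1) c_pos by (force simp: complex_eq_iff)
      qed
      moreover have "Complex (c + 1) t = Complex c t + 1" by (simp add: complex_eq_iff)
      ultimately have "Gamma (Complex c t) * zeta (Complex (c + 1) t) * (\<Sum>n. dirichlet_term f (Complex c t) n)
         = gg (Complex c t) + (\<Sum>\<nu>\<in>?P. kern \<nu> (Acf \<nu>) (Bcf \<nu>) (Complex c t))"
        unfolding g0_def Lstar_def c(3)[of "Complex c t", simplified, symmetric] by simp
      thus ?thesis by (simp only: distrib_right sum_distrib_right)
    qed
    have "2 * pi * logG f z = (LINT t|lborel. gg (Complex c t) * z powr - Complex c t + (\<Sum>\<nu>\<in>?P. kern \<nu> (Acf \<nu>) (Bcf \<nu>) (Complex c t) * z powr - Complex c t))"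
      using logG_mellin(2)[OF z(1) c_pos c(2)] by (simp add: Heq)
    also have "\<dots> = (LINT t|lborel. gg (Complex c t) * z powr - Complex c t) + (\<Sum>\<nu>\<in>?P. LINT t|lborel. kern \<nu> (Acf \<nu>) (Bcf \<nu>) (Complex c t) * z powr - Complex c t)"
      using sh(1) Km(2) z0 z by (subst Bochner_Integration.integral_add) (auto intro!: Bochner_Integration.integrable_sum Bochner_Integration.integral_sum)
    finally have eq: "2 * pi * logG f z = \<dots>" .
    have sumeq: "(\<Sum>\<nu>\<in>?P. z powr - of_real \<nu> * (Bcf \<nu> - Acf \<nu> * Ln z)) = (\<Sum>\<nu>\<in>Pol. acoef \<nu> * z powr - of_real \<nu>) + (deriv F 0 - F 0 * Ln z)"
    proof -
      have "0 \<notin> Pol" by (simp add: Pol_def)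
      hence "(\<Sum>\<nu>\<in>?P. z powr - of_real \<nu> * (Bcf \<nu> - Acf \<nu> * Ln z)) = (deriv F 0 - F 0 * Ln z) + (\<Sum>\<nu>\<in>Pol. z powr - of_real \<nu> * (Bcf \<nu> - Acf \<nu> * Ln z))"
        using finite_Pol z0 by (subst sum.insert) (auto simp: Acf_def Bcf_def)
      also have "(\<Sum>\<nu>\<in>Pol. z powr - of_real \<nu> * (Bcf \<nu> - Acf \<nu> * Ln z)) = (\<Sum>\<nu>\<in>Pol. acoef \<nu> * z powr - of_real \<nu>)"
        by (intro sum.cong) (auto simp: Acf_def Bcf_def Pol_def)
      finally show ?thesis by simp
    qed
    have "norm (2 * pi * (logG f z - ((\<Sum>\<nu>\<in>Pol. acoef \<nu> * z powr - of_real \<nu>) + (deriv F 0 - F 0 * Ln z))))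
      = norm ((LINT t|lborel. gg (Complex c t) * z powr - Complex c t) +
         (\<Sum>\<nu>\<in>?P. (LINT t|lborel. kern \<nu> (Acf \<nu>) (Bcf \<nu>) (Complex c t) * z powr - Complex c t)
            - 2 * pi * (z powr - of_real \<nu> * (Bcf \<nu> - Acf \<nu> * Ln z))))"
      unfolding sumeq[symmetric] sum_subtractf sum_distrib_left[symmetric] right_diff_distrib eq
      by (simp add: algebra_simps)
    also have "\<dots> \<le> K' * I * norm z powr R + (\<Sum>\<nu>\<in>?P. Km \<nu> * norm z powr (R + 1))"
      using Km(3) z0 z by (intro order.trans[OF norm_triangle_ineq] add_mono gI order.trans[OF norm_sum] sum_mono) auto
    also have "\<dots> \<le> K' * I * norm z powr R + (\<Sum>\<nu>\<in>?P. Km \<nu> * norm z powr R)"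
    proof -
      have "norm z powr (R + 1) \<le> norm z powr R" using z z0 by (intro powr_mono') auto
      thus ?thesis using Km(1) by (intro add_left_mono sum_mono mult_left_mono) (auto intro: less_imp_le)
    qed
    also have "\<dots> = Kf * norm z powr R" unfolding Kf_def by (simp add: distrib_right sum_distrib_right)
    finally have "2 * pi * norm (logG f z - ((\<Sum>\<nu>\<in>Pol. acoef \<nu> * z powr - of_real \<nu>) + (deriv F 0 - F 0 * Ln z))) \<le> Kf * norm z powr R"
      by (simp add: norm_mult)
    moreover have "1 * norm (logG f z - ((\<Sum>\<nu>\<in>Pol. acoef \<nu> * z powr - of_real \<nu>) + (deriv F 0 - F 0 * Ln z))) \<le>
      2 * pi * norm (logG f z - ((\<Sum>\<nu>\<in>Pol. acoef \<nu> * z powr - of_real \<nu>) + (deriv F 0 - F 0 * Ln z)))"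
      using pi_gt3 by (intro mult_right_mono) auto
    ultimately show ?thesis by linarith
  qed
  show ?thesis by (rule exI[of _ \<eta>], rule conjI[OF Hb(1)], rule exI[of _ Kf], rule conjI[OF Kf]) (use main in blast)
qed

end


subsection \<open>The generating function and its coefficients\<close>

definition ell :: "real \<Rightarrow> real" where "ell y = - ln (1 - exp (- y))"

lemma ell_ge: "y > 0 \<Longrightarrow> exp (- y) \<le> ell y"
  unfolding ell_def using ln_le_minus_one[of "1 - exp (- y)"] by simp

lemma ell_nonneg: "y > 0 \<Longrightarrow> ell y \<ge> 0"
  using ell_ge[of y] by (meson exp_ge_zero order.trans)

lemma ell_antimono: "0 < x \<Longrightarrow> x \<le> y \<Longrightarrow> ell y \<le> ell x"
  unfolding ell_def by simp

lemma ell_le: assumes "y \<ge> 1" shows "ell y \<le> 2 * exp (- y)"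
proof -
  have e: "exp (- y) \<le> 1 / 2"
  proof -
    have "2 \<le> exp (1::real)" using exp_ge_add_one_self[of 1] by simp
    also have "\<dots> \<le> exp y" using assms by simp
    finally show ?thesis by (simp add: exp_minus field_simps)
  qed
  have "ln (1 / (1 - exp (- y))) \<le> 1 / (1 - exp (- y)) - 1"
    using e assms by (intro ln_le_minus_one) auto
  also have "\<dots> = exp (- y) / (1 - exp (- y))"
  proof -
    have "1 / (1 - E) - 1 = E / (1 - E)" if "1 - E \<noteq> 0" for E :: real using that by (simp add: field_simps)
    moreover have "1 - exp (- y) \<noteq> 0" using e by linarith
    ultimately show ?thesis by blast
  qed
  also have "\<dots> \<le> exp (- y) / (1 / 2)" using e assms by (intro divide_left_mono) auto
  finally show ?thesis using e assms by (simp add: ell_def ln_div)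
qed

lemma ell_le_ln: assumes "0 < x" "x \<le> 1" shows "ell x \<le> ln (2 / x)"
proof -
  have "exp (- x) \<le> 1 - x / 2"
  proof -
    have "exp (- x) * (1 + x) \<le> exp (- x) * exp x" by (intro mult_left_mono exp_ge_add_one_self) auto
    hence "exp (- x) \<le> 1 / (1 + x)" using assms by (simp add: field_simps flip: exp_add)
    also have "\<dots> \<le> 1 - x / 2" using assms by (simp add: field_simps power2_eq_square mult_left_le)
    finally show ?thesis .
  qed
  hence "ln (x / 2) \<le> ln (1 - exp (- x))" using assms by simp
  thus ?thesis using assms by (simp add: ell_def ln_div)
qed

lemma Ln_one_minus_exp_of_real: "y > 0 \<Longrightarrow> - Ln (1 - exp (- of_real y)) = of_real (ell y)"
proof -
  assume "y > 0"
  hence "Ln (of_real (1 - exp (- y))) = of_real (ln (1 - exp (- y)))" by (intro Ln_of_real) simp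
  thus ?thesis by (simp add: ell_def exp_of_real flip: of_real_minus)
qed

lemma Re_Ln_one_minus_exp: "Re z > 0 \<Longrightarrow> Re (Ln (1 - exp (- z))) = ln (norm (1 - exp (- z)))"
proof -
  assume "Re z > 0"
  hence "norm (exp (- z)) < 1" by (simp add: norm_exp_eq_Re)
  hence "1 - exp (- z) \<noteq> 0" by (metis eq_iff_diff_eq_0 less_irrefl norm_one)
  thus ?thesis by simp
qed

lemma norm_Ln_one_minus_le:
  assumes "norm w < 1"
  shows "norm (Ln (1 - w)) \<le> norm w / (1 - norm w)"
proof -
  have "(\<lambda>n. - (w ^ n / of_nat n)) sums Ln (1 - w)" using Ln_series'[of "- w"] assms by simp
  hence 1: "(\<lambda>n. - (w ^ Suc n / of_nat (Suc n))) sums Ln (1 - w)" by (subst sums_Suc_iff) simp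
  have 2: "(\<lambda>n. norm w * norm w ^ n) sums (norm w * (1 / (1 - norm w)))"
    using assms by (intro sums_mult geometric_sums) auto
  have "norm (Ln (1 - w)) = norm (\<Sum>n. - (w ^ Suc n / of_nat (Suc n)))" using 1 by (simp add: sums_iff)
  also have "\<dots> \<le> (\<Sum>n. norm w * norm w ^ n)"
  proof (rule norm_suminf_le)
    show "norm (- (w ^ Suc n / of_nat (Suc n))) \<le> norm w * norm w ^ n" for n
    proof -
      have "norm (- (w ^ Suc n / of_nat (Suc n))) = norm w ^ Suc n / real (Suc n)"
        by (simp add: norm_divide norm_power del: of_nat_Suc power_Suc)
      also have "\<dots> \<le> norm w ^ Suc n / 1" by (intro divide_left_mono) auto
      finally show ?thesis by simp
    qed
  qed (use 2 in \<open>simp add: sums_iff\<close>)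
  also have "\<dots> = norm w / (1 - norm w)" using 2 by (simp add: sums_iff)
  finally show ?thesis .
qed

lemma powr_at_right_0: "a > 0 \<Longrightarrow> ((\<lambda>x::real. x powr a) \<longlongrightarrow> 0) (at_right 0)"
  by real_asymp

lemma powr_ln_at_right_0: "a > 0 \<Longrightarrow> ((\<lambda>x::real. x powr a * ln x) \<longlongrightarrow> 0) (at_right 0)"
  by real_asymp

lemma Re_mult_real: "Re (z * of_real x) = Re z * x" and Im_mult_real: "Im (z * of_real x) = Im z * x"
  by simp_all

context partition_setting begin

lemmas logG_sums = logG_mellin(1)[OF _ c_pos c(2)]

definition lg :: "real \<Rightarrow> real" where "lg x = (\<Sum>n. real (f (Suc n)) * ell (real (Suc n) * x))"

lemma lg_sums:
  assumes "x > 0"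
  shows "(\<lambda>n. real (f (Suc n)) * ell (real (Suc n) * x)) sums lg x" "logG f (of_real x) = of_real (lg x)"
proof -
  have eq: "of_nat (f (Suc n)) * (- Ln (1 - exp (- (of_nat (Suc n) * of_real x)))) = (of_real (real (f (Suc n)) * ell (real (Suc n) * x)) :: complex)" for n
    using Ln_one_minus_exp_of_real[of "real (Suc n) * x"] assms by (simp del: of_nat_Suc)
  have *: "(\<lambda>n. of_real (real (f (Suc n)) * ell (real (Suc n) * x)) :: complex) sums logG f (of_real x)"
    unfolding eq[symmetric] by (rule logG_sums) (use assms in auto)
  hence "(\<lambda>n. real (f (Suc n)) * ell (real (Suc n) * x)) sums Re (logG f (of_real x))"
    using sums_Re[OF *] by simp
  thus 1: "(\<lambda>n. real (f (Suc n)) * ell (real (Suc n) * x)) sums lg x"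
    unfolding lg_def by (simp add: sums_iff)
  show "logG f (of_real x) = of_real (lg x)"
    by (rule sums_unique2[OF * sums_of_real[OF 1]])
qed

lemma lg_nonneg: "x > 0 \<Longrightarrow> lg x \<ge> 0"
  using lg_sums(1)[of x] by (intro sums_le[OF _ sums_zero lg_sums(1)]) (auto intro!: mult_nonneg_nonneg ell_nonneg)

lemma Gf_eq: "Re z > 0 \<Longrightarrow> Gf f z = exp (logG f z)"
proof -
  assume z: "Re z > 0"
  have "inverse ((1 - exp (- z) ^ Suc k) ^ f (Suc k)) = exp (of_nat (f (Suc k)) * (- Ln (1 - exp (- (of_nat (Suc k) * z)))))" for k
  proof -
    have e: "exp (- z) ^ Suc k = exp (- (of_nat (Suc k) * z))" by (simp only: exp_of_nat_mult[symmetric]) simp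
    have "Re (of_nat (Suc k) * z) > 0" using z by (simp del: of_nat_Suc)
    hence "norm (exp (- (of_nat (Suc k) * z))) < 1" by (simp add: norm_exp_eq_Re del: of_nat_Suc)
    hence nz: "1 - exp (- (of_nat (Suc k) * z)) \<noteq> 0" by (metis eq_iff_diff_eq_0 less_irrefl norm_one)
    have "exp (- Ln w) = inverse w" if "w \<noteq> 0" for w using that by (simp add: exp_minus)
    thus ?thesis unfolding e exp_of_nat_mult[of "f (Suc k)"] using nz by (simp add: power_inverse del: of_nat_Suc)
  qed
  hence "Gf f z = prodinf (\<lambda>k. exp (of_nat (f (Suc k)) * (- Ln (1 - exp (- (of_nat (Suc k) * z))))))"
    unfolding Gf_def by (simp only:)
  also have "\<dots> = exp (logG f z)"
    using logG_sums[OF z] by (subst prodinf_exp) (auto simp: sums_iff)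
  finally show ?thesis .
qed

lemma summable_f_exp: "x > 0 \<Longrightarrow> summable (\<lambda>n. real (f (Suc n)) * exp (- x) ^ Suc n)"
proof (rule summable_comparison_test)
  assume x: "x > 0"
  show "summable (\<lambda>n. real (f (Suc n)) * ell (real (Suc n) * x))" using lg_sums(1)[OF x] by (simp add: sums_iff)
  show "\<exists>N. \<forall>n\<ge>N. norm (real (f (Suc n)) * exp (- x) ^ Suc n) \<le> real (f (Suc n)) * ell (real (Suc n) * x)"
  proof (intro exI allI impI)
    fix n
    have "exp (- x) ^ Suc n = exp (- (real (Suc n) * x))" by (simp only: exp_of_nat_mult[symmetric]) simp
    also have "\<dots> \<le> ell (real (Suc n) * x)" using x by (intro ell_ge) simp
    finally show "norm (real (f (Suc n)) * exp (- x) ^ Suc n) \<le> real (f (Suc n)) * ell (real (Suc n) * x)"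
      by (simp add: mult_left_mono del: power_Suc)
  qed
qed

text \<open>Working in the variable q = e^{-z} gives both the Taylor coefficients of G_f and the
  continuity of \<open>logG\<close> on the half-plane.\<close>

lemma holomorphic_logG_series:
  "(\<lambda>q. \<Sum>k. of_nat (f (Suc k)) * (- Ln (1 - q ^ Suc k))) holomorphic_on ball 0 1"
proof (rule holomorphic_suminf)
  show "(\<lambda>q. of_nat (f (Suc n)) * (- Ln (1 - q ^ Suc n))) holomorphic_on ball 0 1" for n
  proof (intro holomorphic_intros)
    fix q :: complex assume "q \<in> ball 0 1"
    hence "norm (q ^ Suc n) < 1" by (simp add: norm_power power_less_one_iff del: power_Suc)
    hence "Re (q ^ Suc n) < 1" using complex_Re_le_cmod[of "q ^ Suc n"] by linarith
    thus "1 - q ^ Suc n \<notin> \<real>\<^sub>\<le>\<^sub>0" by (auto simp: complex_nonpos_Reals_iff)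
  qed
  fix z :: complex assume z: "z \<in> ball 0 1"
  define r where "r = (1 + norm z) / 2"
  have r: "0 < r" "r < 1" "norm z < r" using z by (auto simp: r_def add_pos_nonneg)
  define x where "x = - ln r"
  have x: "x > 0" "exp (- x) = r" using r by (auto simp: x_def)
  show "\<exists>d>0. \<exists>M. summable M \<and> (\<forall>n. \<forall>w\<in>ball z d \<inter> ball 0 1. norm (of_nat (f (Suc n)) * (- Ln (1 - w ^ Suc n))) \<le> M n)"
  proof (rule exI[of _ "r - norm z"], intro conjI exI ballI allI)
    show "summable (\<lambda>n. (real (f (Suc n)) * r ^ Suc n) * (1 / (1 - r)))"
      using summable_f_exp[OF x(1)] unfolding x(2) by (rule summable_mult2)
    fix n w assume w: "w \<in> ball z (r - norm z) \<inter> ball 0 1"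
    have "norm w \<le> norm z + norm (w - z)" by (metis add.commute diff_add_cancel norm_triangle_ineq)
    hence wr: "norm w \<le> r" using w by (auto simp: dist_norm norm_minus_commute)
    have w1: "norm (w ^ Suc n) \<le> r ^ Suc n" unfolding norm_power using wr by (intro power_mono) auto
    have r1: "r ^ Suc n \<le> r" using r by (simp add: mult_left_le power_le_one)
    have "norm (Ln (1 - w ^ Suc n)) \<le> norm (w ^ Suc n) / (1 - norm (w ^ Suc n))"
      by (rule norm_Ln_one_minus_le[OF le_less_trans[OF order.trans[OF w1 r1] r(2)]])
    also have "\<dots> \<le> r ^ Suc n / (1 - r)"
      using r by (intro frac_le diff_left_mono w1 order.trans[OF w1 r1]) auto
    finally have "real (f (Suc n)) * norm (Ln (1 - w ^ Suc n)) \<le> real (f (Suc n)) * (r ^ Suc n / (1 - r))"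
      by (rule mult_left_mono) auto
    thus "norm (of_nat (f (Suc n)) * (- Ln (1 - w ^ Suc n))) \<le> (real (f (Suc n)) * r ^ Suc n) * (1 / (1 - r))"
      by (simp add: norm_mult)
  qed (use r in auto)
qed auto

lemma continuous_logG: "continuous_on {z. Re z > 0} (logG f)"
proof -
  have "continuous_on {z. Re z > 0} (\<lambda>z. \<Sum>k. of_nat (f (Suc k)) * (- Ln (1 - exp (- z) ^ Suc k)))"
    by (rule continuous_on_compose2[OF holomorphic_on_imp_continuous_on[OF holomorphic_logG_series]])
       (auto intro!: continuous_intros simp: norm_exp_eq_Re)
  moreover have "exp (- z) ^ Suc k = exp (- (of_nat (Suc k) * z))" for z :: complex and k
    by (simp only: exp_of_nat_mult[symmetric]) simp
  ultimately show ?thesis unfolding logG_def by (simp only:)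
qed

lemma integral_exp_int:
  "integral {- pi..pi} (\<lambda>t. exp (\<i> * of_real (of_int k * t))) = (if k = 0 then of_real (2 * pi) else 0)"
proof (cases "k = 0")
  case True
  thus ?thesis by (simp add: scaleR_conv_of_real)
next
  case False
  define a where "a = \<i> * of_int k"
  have a: "a \<noteq> 0" using False by (simp add: a_def)
  have "((\<lambda>t. exp (a * of_real t)) has_integral (exp (a * of_real pi) / a - exp (a * of_real (- pi)) / a)) {- pi..pi}"
  proof (rule fundamental_theorem_of_calculus)
    fix x assume "x \<in> {- pi..pi}"
    have "((\<lambda>z. a * z) has_field_derivative a) (at (of_real x))" using DERIV_cmult_Id .
    from DERIV_cdivide[OF DERIV_fun_exp[OF this], of a]
    have "((\<lambda>z. exp (a * z) / a) has_field_derivative exp (a * of_real x)) (at (of_real x))"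
      using a by simp
    thus "((\<lambda>t. exp (a * of_real t) / a) has_vector_derivative exp (a * of_real x)) (at x within {- pi..pi})"
      by (rule has_vector_derivative_real_field)
  qed auto
  moreover have "exp (a * of_real pi) = exp (a * of_real (- pi))"
    unfolding exp_eq by (rule exI[of _ k]) (simp add: a_def algebra_simps)
  ultimately have "((\<lambda>t. exp (a * of_real t)) has_integral 0) {- pi..pi}" by simp
  hence "integral {- pi..pi} (\<lambda>t. exp (a * of_real t)) = 0" by (rule integral_unique)
  moreover have "\<i> * of_real (of_int k * t) = a * of_real t" for t by (simp add: a_def)
  ultimately show ?thesis using False by (simp only:) simp
qed

text \<open>Uniform convergence on the segment and orthogonality of the exponentials. The
  coefficients are arbitrary ones that represent G_f, so the formula also proves their uniqueness,
  as the definite description in \<open>pf\<close> demands.\<close>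

lemma coeff_integral:
  assumes a: "\<And>z. Re z > 0 \<Longrightarrow> (\<lambda>n. a n * exp (- z) ^ n) sums Gf f z" and \<rho>: "\<rho> > 0"
  shows "a n = 1 / (2 * pi) * integral {- pi..pi} (\<lambda>t. exp (logG f (Complex \<rho> t) + of_nat n * Complex \<rho> t))"
proof -
  define h where "h = (\<lambda>m t. a m * exp (- Complex \<rho> t) ^ m * exp (of_nat n * Complex \<rho> t))"
  define h' where "h' = (\<lambda>t. exp (logG f (Complex \<rho> t) + of_nat n * Complex \<rho> t))"
  have sums: "(\<lambda>m. h m t) sums h' t" for t
    unfolding h_def h'_def exp_add using sums_mult2[OF a[of "Complex \<rho> t"]] Gf_eq[of "Complex \<rho> t"] \<rho> by simp
  have sm: "summable (\<lambda>m. norm (a m * (exp (- of_real \<rho>)) ^ m))"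
  proof (rule powser_insidea)
    show "summable (\<lambda>m. a m * exp (- of_real (\<rho> / 2)) ^ m)"
      using a[of "of_real (\<rho> / 2)"] \<rho> by (simp add: sums_iff)
    show "norm (exp (- of_real \<rho>) :: complex) < norm (exp (- of_real (\<rho> / 2)) :: complex)"
      using \<rho> by (simp add: norm_exp_eq_Re)
  qed
  have bnd: "norm (h m t) \<le> norm (a m * (exp (- of_real \<rho>)) ^ m) * exp (n * \<rho>)" for m t
    by (simp add: h_def norm_mult norm_power norm_exp_eq_Re)
  have "uniform_limit {- pi..pi} (\<lambda>M t. \<Sum>m<M. h m t) (\<lambda>t. \<Sum>m. h m t) sequentially"
    by (rule Weierstrass_m_test[OF _ summable_mult2[OF sm, of "exp (n * \<rho>)"]]) (use bnd in auto)
  hence ul: "uniform_limit {- pi..pi} (\<lambda>M t. \<Sum>m<M. h m t) h' sequentially"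
    using sums by (simp add: sums_iff)
  have hint: "((\<lambda>t. h m t) has_integral (if m = n then 2 * pi * a n else 0)) {- pi..pi}" for m
  proof -
    have eq: "h m t = a m * exp (of_real ((real n - real m) * \<rho>)) * exp (\<i> * of_real (of_int (int n - int m) * t))" for t
      unfolding h_def exp_of_nat_mult[symmetric] mult.assoc exp_add[symmetric]
      by (simp add: Complex_eq algebra_simps)
    have "integral {- pi..pi} (h m) = (if m = n then 2 * pi * a n else 0)"
      unfolding eq integral_mult_right integral_exp_int by auto
    moreover have "h m integrable_on {- pi..pi}"
      unfolding eq by (intro integrable_continuous_interval continuous_intros)
    ultimately show ?thesis using integrable_integral by metis
  qed
  have "\<forall>M. continuous_on {- pi..pi} (\<lambda>t. \<Sum>m<M. h m t)"
    unfolding h_def Complex_eq by (intro allI continuous_intros)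
  hence cn: "\<And>M. continuous_on {- pi..pi} (\<lambda>t. \<Sum>m<M. h m t)" by blast
  obtain I J where
    IJ: "\<And>M. ((\<lambda>t. \<Sum>m<M. h m t) has_integral I M) {- pi..pi}" "(h' has_integral J) {- pi..pi}" "I \<longlonglongrightarrow> J"
    by (rule uniform_limit_integral[OF ul cn trivial_limit_sequentially], rule that, assumption+)
  have "I M = 2 * pi * a n" if "M > n" for M
  proof -
    have "((\<lambda>t. \<Sum>m<M. h m t) has_integral (\<Sum>m<M. if m = n then 2 * pi * a n else 0)) {- pi..pi}"
      by (intro has_integral_sum hint) auto
    from has_integral_unique[OF IJ(1) this] show ?thesis using that by simp
  qed
  hence "I \<longlonglongrightarrow> 2 * pi * a n"
    by (intro tendsto_eventually) (auto simp: eventually_sequentially intro!: exI[of _ "Suc n"])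
  with IJ(3) have "J = 2 * pi * a n" by (rule LIMSEQ_unique)
  moreover have "integral {- pi..pi} h' = J" using IJ(2) by (simp add: integral_unique)
  ultimately show ?thesis by (simp add: h'_def)
qed

theorem pf_integral:
  assumes "\<rho> > 0"
  shows "pf f n = 1 / (2 * pi) * integral {- pi..pi} (\<lambda>t. exp (logG f (Complex \<rho> t) + of_nat n * Complex \<rho> t))"
proof -
  define g where "g = (\<lambda>q. exp (\<Sum>k. of_nat (f (Suc k)) * (- Ln (1 - q ^ Suc k))))"
  have g: "g holomorphic_on ball 0 1" unfolding g_def by (intro holomorphic_intros holomorphic_logG_series)
  define a where "a = (\<lambda>n. (deriv ^^ n) g 0 / fact n)"
  have a: "(\<lambda>n. a n * exp (- z) ^ n) sums Gf f z" if z: "Re z > 0" for z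
  proof -
    have "exp (- z) \<in> ball 0 1" using z by (simp add: norm_exp_eq_Re)
    from holomorphic_power_series[OF g this] have "(\<lambda>n. a n * exp (- z) ^ n) sums g (exp (- z))"
      by (simp add: a_def)
    also have "g (exp (- z)) = Gf f z"
    proof -
      have "exp (- z) ^ Suc k = exp (- (of_nat (Suc k) * z))" for k by (simp only: exp_of_nat_mult[symmetric]) simp
      thus ?thesis unfolding g_def Gf_eq[OF z] logG_def by (simp only:)
    qed
    finally show ?thesis .
  qed
  have "pf f = a"
    unfolding pf_def
  proof (rule the_equality)
    show "\<forall>z. 0 < Re z \<longrightarrow> (\<lambda>n. a n * exp (- z) ^ n) sums Gf f z" using a by blast
    fix b assume "\<forall>z. 0 < Re z \<longrightarrow> (\<lambda>n. b n * exp (- z) ^ n) sums Gf f z"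
    hence "b n = a n" for n
      by (intro trans[OF coeff_integral[of b 1 n] coeff_integral[OF a, of 1 n, symmetric]]) auto
    thus "b = a" by (rule ext)
  qed
  thus ?thesis using coeff_integral[OF a assms] by simp
qed

subsection \<open>Real saddle data\<close>

lemma alpha_Pol: "\<alpha> \<in> Pol" using H_pole_alpha alpha_pos R_pos by (auto simp: Pol_def)

lemma logG_expansion_real:
  obtains K where "K > 0" "\<And>x. 0 < x \<Longrightarrow> x \<le> 1 \<Longrightarrow>
    norm (of_real (lg x) - ((\<Sum>\<nu>\<in>Pol. acoef \<nu> * of_real (x powr - \<nu>)) + (deriv F 0 - F 0 * of_real (ln x)))) \<le> K * x powr R"
proof -
  from logG_expansion obtain \<eta> K where K: "\<eta> > 0" "K > 0" and K3: "\<forall>z. Re z > 0 \<and> \<bar>Im (Ln z)\<bar> \<le> \<eta> \<and> norm z \<le> 1 \<longrightarrow>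
     norm (logG f z - ((\<Sum>\<nu>\<in>Pol. acoef \<nu> * z powr - of_real \<nu>) + (deriv F 0 - F 0 * Ln z))) \<le> K * norm z powr R"
    by (elim exE conjE)
  show ?thesis
  proof (rule that[OF K(2)])
    fix x :: real assume x: "0 < x" "x \<le> 1"
    have p: "of_real x powr - of_real \<nu> = (of_real (x powr - \<nu>) :: complex)" for \<nu>
      by (simp only: of_real_minus[symmetric] powr_of_real[OF less_imp_le[OF x(1)]])
    have l: "Ln (of_real x) = of_real (ln x)" by (rule Ln_of_real[OF x(1)])
    have nx: "norm (complex_of_real x) = x" using x by simp
    have "Re (of_real x) > 0 \<and> \<bar>Im (Ln (of_real x))\<bar> \<le> \<eta> \<and> norm (complex_of_real x) \<le> 1"
      using x K(1) by (simp only: l nx Re_complex_of_real Im_complex_of_real) simp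
    from K3[rule_format, OF this]
    show "norm (of_real (lg x) - ((\<Sum>\<nu>\<in>Pol. acoef \<nu> * of_real (x powr - \<nu>)) + (deriv F 0 - F 0 * of_real (ln x)))) \<le> K * x powr R"
      unfolding l p lg_sums(2)[OF x(1)] nx .
  qed
qed

text \<open>On the positive axis log G_f is real, so the imaginary part of its expansion is O(x^R).
  If m were the largest positive pole with a non-real coefficient, multiplying by x^m and letting x
  tend to 0 would isolate that imaginary part, yet give 0.\<close>

lemma Im_acoef:
  assumes "\<nu> \<in> Pol" "\<nu> > 0"
  shows "Im (acoef \<nu>) = 0"
proof (rule ccontr)
  assume nz: "Im (acoef \<nu>) \<noteq> 0"
  define S where "S = {\<mu>\<in>Pol. \<mu> > 0 \<and> Im (acoef \<mu>) \<noteq> 0}"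
  define m where "m = Max S"
  have S: "finite S" "S \<noteq> {}" using finite_Pol assms nz by (auto simp: S_def)
  have mS: "m \<in> S" unfolding m_def using S by (rule Max_in)
  have m: "m > 0" "m \<in> Pol" "Im (acoef m) \<noteq> 0" using mS by (auto simp: S_def)
  have mmax: "Im (acoef \<mu>) = 0" if "\<mu> \<in> Pol" "\<mu> > m" for \<mu>
  proof (rule ccontr)
    assume "Im (acoef \<mu>) \<noteq> 0"
    hence "\<mu> \<in> S" using that m by (simp add: S_def)
    hence "\<mu> \<le> m" unfolding m_def using S(1) by (intro Max_ge)
    thus False using that by simp
  qed
  obtain K where K: "K > 0" "\<And>x. 0 < x \<Longrightarrow> x \<le> 1 \<Longrightarrow>
    norm (of_real (lg x) - ((\<Sum>\<nu>\<in>Pol. acoef \<nu> * of_real (x powr - \<nu>)) + (deriv F 0 - F 0 * of_real (ln x)))) \<le> K * x powr R"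
    by (rule logG_expansion_real, rule that, assumption+)
  define h where "h = (\<lambda>x. (\<Sum>\<nu>\<in>Pol. Im (acoef \<nu>) * x powr - \<nu>) + (Im (deriv F 0) - Im (F 0) * ln x))"
  have h: "\<bar>h x\<bar> \<le> K * x powr R" if "0 < x" "x \<le> 1" for x
  proof -
    define E where "E = of_real (lg x) - ((\<Sum>\<nu>\<in>Pol. acoef \<nu> * of_real (x powr - \<nu>)) + (deriv F 0 - F 0 * of_real (ln x)))"
    have "Im E = - h x"
      unfolding E_def h_def by (simp only: minus_complex.sel plus_complex.sel Im_sum Im_mult_real Im_complex_of_real)
    moreover have "\<bar>Im E\<bar> \<le> norm E" by (rule abs_Im_le_cmod)
    moreover have "norm E \<le> K * x powr R" unfolding E_def by (rule K(2)[OF that])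
    ultimately show ?thesis by linarith
  qed
  have ev: "\<forall>\<^sub>F x in at_right 0. 0 < x \<and> x \<le> (1::real)"
    unfolding eventually_at_right_field by (intro exI[of _ 1]) auto
  have l0: "((\<lambda>x. x powr m * h x) \<longlongrightarrow> 0) (at_right 0)"
  proof (rule Lim_null_comparison)
    show "\<forall>\<^sub>F x in at_right 0. norm (x powr m * h x) \<le> K * x powr (m + R)"
      using ev by eventually_elim (use h in \<open>auto simp: abs_mult powr_add mult_left_mono\<close>)
    show "((\<lambda>x. K * x powr (m + R)) \<longlongrightarrow> 0) (at_right 0)"
      using m R_pos by (intro tendsto_mult_right_zero powr_at_right_0) simp
  qed
  have l1: "((\<lambda>x. (\<Sum>\<nu>\<in>Pol. Im (acoef \<nu>) * (x powr m * x powr - \<nu>)) + (Im (deriv F 0) * x powr m - Im (F 0) * (x powr m * ln x)))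
      \<longlongrightarrow> (\<Sum>\<nu>\<in>Pol. if \<nu> = m then Im (acoef m) else 0) + (Im (deriv F 0) * 0 - Im (F 0) * 0)) (at_right 0)"
  proof (intro tendsto_add tendsto_diff tendsto_mult tendsto_const tendsto_sum)
    show "((\<lambda>x. x powr m) \<longlongrightarrow> 0) (at_right 0)" using m(1) by (intro powr_at_right_0 powr_ln_at_right_0)
    show "((\<lambda>x. x powr m * ln x) \<longlongrightarrow> 0) (at_right 0)" using m(1) by (intro powr_at_right_0 powr_ln_at_right_0)
    fix \<mu> assume \<mu>: "\<mu> \<in> Pol"
    consider "\<mu> = m" | "\<mu> > m" | "\<mu> < m" by linarith
    thus "((\<lambda>x. Im (acoef \<mu>) * (x powr m * x powr - \<mu>)) \<longlongrightarrow> (if \<mu> = m then Im (acoef m) else 0)) (at_right 0)"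
    proof cases
      case 1
      have "\<forall>\<^sub>F x in at_right 0. Im (acoef \<mu>) * (x powr m * x powr - \<mu>) = Im (acoef m)"
        using ev by eventually_elim (simp add: 1 flip: powr_add)
      thus ?thesis using 1 by (simp add: tendsto_eventually)
    next
      case 3
      have "((\<lambda>x. x powr m * x powr - \<mu>) \<longlongrightarrow> 0) (at_right 0)"
        unfolding powr_add[symmetric] using 3 by (intro powr_at_right_0) simp
      from tendsto_mult_right_zero[OF this] show ?thesis using 3 by simp
    qed (use mmax[OF \<mu>] in auto)
  qed
  have "(\<lambda>x. (\<Sum>\<nu>\<in>Pol. Im (acoef \<nu>) * (x powr m * x powr - \<nu>)) + (Im (deriv F 0) * x powr m - Im (F 0) * (x powr m * ln x))) = (\<lambda>x. x powr m * h x)"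
    by (simp add: h_def fun_eq_iff algebra_simps sum_distrib_left)
  with l1 l0 have "(\<Sum>\<nu>\<in>Pol. if \<nu> = m then Im (acoef m) else 0) + (Im (deriv F 0) * 0 - Im (F 0) * 0) = 0"
    using tendsto_unique[OF _ l1] by simp
  thus False using m finite_Pol by simp
qed

lemma lg_asymp: "((\<lambda>x. x powr \<alpha> * lg x) \<longlongrightarrow> Re (acoef \<alpha>)) (at_right 0)"
proof -
  obtain K where K: "K > 0" "\<And>x. 0 < x \<Longrightarrow> x \<le> 1 \<Longrightarrow>
    norm (of_real (lg x) - ((\<Sum>\<nu>\<in>Pol. acoef \<nu> * of_real (x powr - \<nu>)) + (deriv F 0 - F 0 * of_real (ln x)))) \<le> K * x powr R"
    by (rule logG_expansion_real, rule that, assumption+)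
  define h where "h = (\<lambda>x. (\<Sum>\<nu>\<in>Pol. Re (acoef \<nu>) * x powr - \<nu>) + (Re (deriv F 0) - Re (F 0) * ln x))"
  have h: "\<bar>lg x - h x\<bar> \<le> K * x powr R" if "0 < x" "x \<le> 1" for x
  proof -
    define E where "E = of_real (lg x) - ((\<Sum>\<nu>\<in>Pol. acoef \<nu> * of_real (x powr - \<nu>)) + (deriv F 0 - F 0 * of_real (ln x)))"
    have "Re E = lg x - h x"
      unfolding E_def h_def by (simp only: minus_complex.sel plus_complex.sel Re_sum Re_mult_real Re_complex_of_real)
    moreover have "\<bar>Re E\<bar> \<le> norm E" by (rule abs_Re_le_cmod)
    moreover have "norm E \<le> K * x powr R" unfolding E_def by (rule K(2)[OF that])
    ultimately show ?thesis by linarith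
  qed
  have ev: "\<forall>\<^sub>F x in at_right 0. 0 < x \<and> x \<le> (1::real)"
    unfolding eventually_at_right_field by (intro exI[of _ 1]) auto
  have l0: "((\<lambda>x. x powr \<alpha> * (lg x - h x)) \<longlongrightarrow> 0) (at_right 0)"
  proof (rule Lim_null_comparison)
    show "\<forall>\<^sub>F x in at_right 0. norm (x powr \<alpha> * (lg x - h x)) \<le> K * x powr (\<alpha> + R)"
      using ev by eventually_elim (use h in \<open>auto simp: abs_mult powr_add mult_left_mono\<close>)
    show "((\<lambda>x. K * x powr (\<alpha> + R)) \<longlongrightarrow> 0) (at_right 0)"
      using alpha_pos R_pos by (intro tendsto_mult_right_zero powr_at_right_0) simp
  qed
  have l1: "((\<lambda>x. (\<Sum>\<nu>\<in>Pol. Re (acoef \<nu>) * (x powr \<alpha> * x powr - \<nu>)) + (Re (deriv F 0) * x powr \<alpha> - Re (F 0) * (x powr \<alpha> * ln x)))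
      \<longlongrightarrow> (\<Sum>\<nu>\<in>Pol. if \<nu> = \<alpha> then Re (acoef \<alpha>) else 0) + (Re (deriv F 0) * 0 - Re (F 0) * 0)) (at_right 0)"
  proof (intro tendsto_add tendsto_diff tendsto_mult tendsto_const tendsto_sum)
    show "((\<lambda>x. x powr \<alpha>) \<longlongrightarrow> 0) (at_right 0)" using alpha_pos by (intro powr_at_right_0 powr_ln_at_right_0)
    show "((\<lambda>x. x powr \<alpha> * ln x) \<longlongrightarrow> 0) (at_right 0)" using alpha_pos by (intro powr_at_right_0 powr_ln_at_right_0)
    fix \<mu> assume \<mu>: "\<mu> \<in> Pol"
    hence "\<mu> = \<alpha> \<or> \<mu> < \<alpha>" using Pol_range[of \<mu>] by auto
    thus "((\<lambda>x. Re (acoef \<mu>) * (x powr \<alpha> * x powr - \<mu>)) \<longlongrightarrow> (if \<mu> = \<alpha> then Re (acoef \<alpha>) else 0)) (at_right 0)"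
    proof
      assume 1: "\<mu> = \<alpha>"
      have "\<forall>\<^sub>F x in at_right 0. Re (acoef \<mu>) * (x powr \<alpha> * x powr - \<mu>) = Re (acoef \<alpha>)"
        using ev by eventually_elim (simp add: 1 flip: powr_add)
      thus ?thesis using 1 by (simp add: tendsto_eventually)
    next
      assume 3: "\<mu> < \<alpha>"
      have "((\<lambda>x. x powr \<alpha> * x powr - \<mu>) \<longlongrightarrow> 0) (at_right 0)"
        unfolding powr_add[symmetric] using 3 by (intro powr_at_right_0) simp
      from tendsto_mult_right_zero[OF this] show ?thesis using 3 by simp
    qed
  qed
  have "(\<lambda>x. (\<Sum>\<nu>\<in>Pol. Re (acoef \<nu>) * (x powr \<alpha> * x powr - \<nu>)) + (Re (deriv F 0) * x powr \<alpha> - Re (F 0) * (x powr \<alpha> * ln x))) = (\<lambda>x. x powr \<alpha> * h x)"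
    by (simp add: h_def fun_eq_iff algebra_simps sum_distrib_left)
  with l1 have "((\<lambda>x. x powr \<alpha> * h x) \<longlongrightarrow> Re (acoef \<alpha>)) (at_right 0)"
    using finite_Pol alpha_Pol by simp
  from tendsto_add[OF l0 this] show ?thesis by (simp add: algebra_simps)
qed

text \<open>It is the limit of the nonnegative quantities x^\<alpha> log G_f(x), and it is not 0
  because \<alpha> is a genuine pole. Positivity is what makes the saddle point exist.\<close>

lemma acoef_alpha: "acoef \<alpha> = of_real (Re (acoef \<alpha>))" "Re (acoef \<alpha>) > 0"
proof -
  have im: "Im (acoef \<alpha>) = 0" using Im_acoef[OF alpha_Pol alpha_pos] .
  thus "acoef \<alpha> = of_real (Re (acoef \<alpha>))" by (simp add: complex_eq_iff)
  hence "Re (acoef \<alpha>) \<noteq> 0" using acoef(1)[OF alpha_Pol] by auto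
  moreover have "Re (acoef \<alpha>) \<ge> 0"
  proof (rule tendsto_lowerbound[OF lg_asymp])
    show "\<forall>\<^sub>F x in at_right 0. 0 \<le> x powr \<alpha> * lg x"
      using lg_nonneg by (auto simp: eventually_at_filter intro!: always_eventually mult_nonneg_nonneg)
  qed simp
  ultimately show "Re (acoef \<alpha>) > 0" by simp
qed

end


subsection \<open>Bounds away from the real axis\<close>

lemma sin_ge_half: "0 \<le> y \<Longrightarrow> y \<le> 1 \<Longrightarrow> sin y \<ge> y / (2::real)"
proof -
  assume y: "0 \<le> y" "y \<le> 1"
  have "sin 0 - 0 / 2 \<le> sin y - y / 2"
  proof (rule DERIV_nonneg_imp_nondecreasing[OF y(1)])
    fix x assume x: "0 \<le> x" "x \<le> y"
    have "cos x \<ge> cos (pi / 3)" using x y pi_gt3 by (subst cos_mono_le_eq) auto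
    hence "cos x - 1 / 2 \<ge> 0" by (simp add: cos_60)
    moreover have "((\<lambda>y. sin y - y / 2) has_real_derivative cos x - 1 / 2) (at x)"
      by (auto intro!: derivative_eq_intros)
    ultimately show "\<exists>D. ((\<lambda>y. sin y - y / 2) has_real_derivative D) (at x) \<and> 0 \<le> D" by blast
  qed
  thus ?thesis by simp
qed

lemma norm_one_minus_exp_sq:
  "(norm (1 - exp (- Complex x y)))\<^sup>2 = (1 - exp (- x))\<^sup>2 + 4 * exp (- x) * (sin (y / 2))\<^sup>2"
proof -
  have re: "Re (exp (- Complex x y)) = exp (- x) * cos y" and im: "Im (exp (- Complex x y)) = - exp (- x) * sin y"
    by (simp_all add: Re_exp Im_exp)
  have "(norm (1 - exp (- Complex x y)))\<^sup>2 = (1 - exp (- x) * cos y)\<^sup>2 + (exp (- x) * sin y)\<^sup>2"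
    unfolding cmod_power2 by (simp add: re im)
  also have "\<dots> = 1 - 2 * exp (- x) * cos y + (exp (- x))\<^sup>2 * ((sin y)\<^sup>2 + (cos y)\<^sup>2)"
  proof -
    have "(1 - E * c)\<^sup>2 + (E * s)\<^sup>2 = 1 - 2 * E * c + E\<^sup>2 * (s\<^sup>2 + c\<^sup>2)" for E c s :: real
      by (simp add: power2_eq_square algebra_simps)
    thus ?thesis .
  qed
  also have "\<dots> = 1 - 2 * exp (- x) * cos y + (exp (- x))\<^sup>2" by simp
  also have "cos y = 1 - 2 * (sin (y / 2))\<^sup>2" using cos_double_sin[of "y / 2"] by simp
  finally show ?thesis by (simp add: power2_eq_square algebra_simps)
qed

text \<open>The logarithm of |1 - e^{-kz}| / (1 - e^{-k\<rho>}) for z = \<rho> + it: by how much the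
  k-th factor of the product shrinks when z leaves the real axis.\<close>

definition dlog :: "nat \<Rightarrow> real \<Rightarrow> real \<Rightarrow> real" where
  "dlog k \<rho> t = ell (real k * \<rho>) + ln (norm (1 - exp (- (of_nat k * Complex \<rho> t))))"

lemma of_nat_mult_Complex: "of_nat k * Complex x y = Complex (real k * x) (real k * y)"
  by (simp add: complex_eq_iff)

lemma exp_minus_dlog:
  assumes "k > 0" "\<rho> > 0"
  shows "exp (- dlog k \<rho> t) = (1 - exp (- (real k * \<rho>))) / norm (1 - exp (- (of_nat k * Complex \<rho> t)))"
    and "dlog k \<rho> t \<ge> 0"
    and "norm (1 - exp (- (of_nat k * Complex \<rho> t))) > 0"
proof -
  have p: "1 - exp (- (real k * \<rho>)) > 0" using assms by simp
  have "(1 - exp (- (real k * \<rho>)))\<^sup>2 \<le> (norm (1 - exp (- (of_nat k * Complex \<rho> t))))\<^sup>2"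
    unfolding of_nat_mult_Complex norm_one_minus_exp_sq by simp
  hence le: "1 - exp (- (real k * \<rho>)) \<le> norm (1 - exp (- (of_nat k * Complex \<rho> t)))"
    by (rule power2_le_imp_le) simp
  thus pos: "norm (1 - exp (- (of_nat k * Complex \<rho> t))) > 0" using p by linarith
  have "ln (1 - exp (- (real k * \<rho>))) \<le> ln (norm (1 - exp (- (of_nat k * Complex \<rho> t))))"
    using le p pos by simp
  thus "dlog k \<rho> t \<ge> 0" by (simp add: dlog_def ell_def)
  show "exp (- dlog k \<rho> t) = (1 - exp (- (real k * \<rho>))) / norm (1 - exp (- (of_nat k * Complex \<rho> t)))"
    using p pos by (simp add: dlog_def ell_def exp_diff)
qed

lemma dlog_ge:
  assumes "k > 0" "\<rho> > 0" "real k * \<rho> \<le> 1" "real k * \<bar>t\<bar> \<le> 1"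
  shows "dlog k \<rho> t \<ge> ln (1 + t\<^sup>2 / (12 * \<rho>\<^sup>2)) / 2"
proof -
  define x where "x = real k * \<rho>"
  define y where "y = real k * t"
  have x: "0 < x" "x \<le> 1" using assms by (auto simp: x_def)
  have y: "\<bar>y\<bar> \<le> 1" using assms by (simp add: y_def abs_mult)
  have e3: "exp (- x) \<ge> 1 / 3"
  proof -
    have "exp x \<le> exp 1" using x by simp
    also have "\<dots> \<le> 3" using exp_le by simp
    finally show ?thesis by (simp add: exp_minus field_simps)
  qed
  have s: "(sin (y / 2))\<^sup>2 \<ge> y\<^sup>2 / 16"
  proof -
    have "sin \<bar>y / 2\<bar> \<ge> \<bar>y / 2\<bar> / 2" using y by (intro sin_ge_half) auto
    hence "(\<bar>y / 2\<bar> / 2)\<^sup>2 \<le> (sin \<bar>y / 2\<bar>)\<^sup>2" by (intro power_mono) auto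
    also have "(sin \<bar>y / 2\<bar>)\<^sup>2 = (sin (y / 2))\<^sup>2" by (cases "y \<ge> 0") auto
    finally show ?thesis by (simp add: power2_eq_square)
  qed
  have q: "0 < 1 - exp (- x)" "1 - exp (- x) \<le> x" using x exp_ge_add_one_self[of "- x"] by auto
  define N where "N = norm (1 - exp (- (of_nat k * Complex \<rho> t)))"
  have N: "N > 0" unfolding N_def by (rule exp_minus_dlog(3)[OF assms(1,2)])
  have N2: "N\<^sup>2 = (1 - exp (- x))\<^sup>2 + 4 * exp (- x) * (sin (y / 2))\<^sup>2"
    unfolding N_def of_nat_mult_Complex norm_one_minus_exp_sq x_def y_def ..
  have "t\<^sup>2 / (12 * \<rho>\<^sup>2) = (4 * (1 / 3) * (y\<^sup>2 / 16)) / x\<^sup>2"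
    using assms by (simp add: x_def y_def power_mult_distrib)
  also have "\<dots> \<le> (4 * exp (- x) * (sin (y / 2))\<^sup>2) / (1 - exp (- x))\<^sup>2"
    using e3 s q by (intro frac_le mult_mono power_mono) auto
  finally have "1 + t\<^sup>2 / (12 * \<rho>\<^sup>2) \<le> N\<^sup>2 / (1 - exp (- x))\<^sup>2"
    using q unfolding N2 by (simp add: add_divide_distrib)
  hence "ln (1 + t\<^sup>2 / (12 * \<rho>\<^sup>2)) \<le> ln ((N / (1 - exp (- x)))\<^sup>2)"
    unfolding power_divide by (intro ln_mono add_pos_nonneg) auto
  also have "\<dots> = 2 * (ln N - ln (1 - exp (- x)))" using N q by (simp add: ln_realpow ln_div)
  also have "\<dots> = 2 * dlog k \<rho> t" by (simp add: dlog_def ell_def N_def x_def)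
  finally show ?thesis by simp
qed

text \<open>If e^{ik\<tau>} = 1, the k-th factor repeats at \<tau> its behaviour at 0, which makes
  \<open>dlog_ge\<close> available around \<tau>.\<close>

lemma dlog_shift:
  assumes "exp (\<i> * of_real (real k * \<tau>)) = 1"
  shows "dlog k \<rho> t = dlog k \<rho> (t - \<tau>)"
proof -
  have "of_nat k * Complex \<rho> t = of_nat k * Complex \<rho> (t - \<tau>) + \<i> * of_real (real k * \<tau>)"
    by (simp add: complex_eq_iff algebra_simps)
  hence "exp (- (of_nat k * Complex \<rho> t)) = exp (- (of_nat k * Complex \<rho> (t - \<tau>)))"
    using assms by (simp only: minus_add_distrib exp_add exp_minus[of "\<i> * _"]) simp
  thus ?thesis by (simp add: dlog_def)
qed

text \<open>Near i\<tau> the value 1 - e^{-kz} stays away from 0 while 1 - e^{-k\<rho>} \<le>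
  k\<rho>, so such a factor saves a full power of \<rho>.\<close>

lemma exp_minus_dlog_nonresonant:
  assumes "k > 0" "exp (\<i> * of_real (real k * \<tau>)) \<noteq> 1"
  shows "\<exists>\<delta>>0. \<exists>C>0. \<forall>\<rho> t. 0 < \<rho> \<and> \<rho> < \<delta> \<and> \<bar>t - \<tau>\<bar> < \<delta> \<longrightarrow> exp (- dlog k \<rho> t) \<le> C * \<rho>"
proof -
  define g :: "complex \<Rightarrow> real" where "g = (\<lambda>z. norm (1 - exp (- (of_nat k * z))))"
  have nz: "g (Complex 0 \<tau>) \<noteq> 0"
  proof
    assume "g (Complex 0 \<tau>) = 0"
    hence "exp (- (of_nat k * Complex 0 \<tau>)) = 1" by (simp add: g_def)
    moreover have "of_nat k * Complex 0 \<tau> = \<i> * of_real (real k * \<tau>)" by (simp add: complex_eq_iff)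
    ultimately have "inverse (exp (\<i> * of_real (real k * \<tau>))) = 1" by (simp only: exp_minus)
    hence "exp (\<i> * of_real (real k * \<tau>)) = 1" by (metis inverse_1 inverse_inverse_eq)
    thus False using assms by blast
  qed
  define m where "m = g (Complex 0 \<tau>) / 2"
  have m: "m > 0" using nz by (simp add: m_def g_def)
  have "isCont g (Complex 0 \<tau>)" unfolding g_def by (intro continuous_intros)
  then obtain d where d: "d > 0" "\<And>z. dist z (Complex 0 \<tau>) < d \<Longrightarrow> dist (g z) (g (Complex 0 \<tau>)) < m"
    using m unfolding continuous_at_eps_delta by metis
  show ?thesis
  proof (rule exI[of _ "d / 2"], intro conjI exI[of _ "real k / m"] allI impI)
    fix \<rho> t assume *: "0 < \<rho> \<and> \<rho> < d / 2 \<and> \<bar>t - \<tau>\<bar> < d / 2"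
    have "dist (Complex \<rho> t) (Complex 0 \<tau>) \<le> \<bar>\<rho>\<bar> + \<bar>t - \<tau>\<bar>"
      using cmod_le[of "Complex \<rho> t - Complex 0 \<tau>"] by (simp add: dist_norm)
    hence "dist (Complex \<rho> t) (Complex 0 \<tau>) < d" using * by simp
    from d(2)[OF this] have "g (Complex \<rho> t) \<ge> m" unfolding m_def dist_real_def by linarith
    moreover have "1 - exp (- (real k * \<rho>)) \<le> real k * \<rho>" using exp_ge_add_one_self[of "- (real k * \<rho>)"] by simp
    ultimately have "(1 - exp (- (real k * \<rho>))) / g (Complex \<rho> t) \<le> real k * \<rho> / m"
      using m * by (intro frac_le) auto
    thus "exp (- dlog k \<rho> t) \<le> real k / m * \<rho>"
      using exp_minus_dlog(1)[OF assms(1), of \<rho> t] * by (simp add: g_def)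
  qed (use d m assms in auto)
qed

section \<open>The generating function off the real axis and the partial sums of f\<close>

context partition_setting begin

text \<open>No factor grows off the real axis, so the sum of the savings over all k can be cut down
  to any finite set of k.\<close>

lemma norm_exp_logG_le:
  assumes \<rho>: "\<rho> > 0" and A: "finite A" "0 \<notin> A"
  shows "norm (exp (logG f (Complex \<rho> t))) \<le> exp (lg \<rho>) * exp (- (\<Sum>k\<in>A. real (f k) * dlog k \<rho> t))"
proof -
  have z: "Re (Complex \<rho> t) > 0" using \<rho> by simp
  have "(\<lambda>n. Re (of_nat (f (Suc n)) * (- Ln (1 - exp (- (of_nat (Suc n) * Complex \<rho> t)))))) sums Re (logG f (Complex \<rho> t))"
    by (rule sums_Re[OF logG_sums[OF z]])
  moreover have "Re (of_nat (f (Suc n)) * (- Ln (1 - exp (- (of_nat (Suc n) * Complex \<rho> t)))))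
      = real (f (Suc n)) * ell (real (Suc n) * \<rho>) - real (f (Suc n)) * dlog (Suc n) \<rho> t" for n
    using Re_Ln_one_minus_exp[of "of_nat (Suc n) * Complex \<rho> t"] \<rho>
    by (simp add: dlog_def algebra_simps of_nat_mult_Complex del: of_nat_Suc)
  ultimately have "(\<lambda>n. real (f (Suc n)) * ell (real (Suc n) * \<rho>) - real (f (Suc n)) * dlog (Suc n) \<rho> t) sums Re (logG f (Complex \<rho> t))"
    by (simp only:)
  from sums_diff[OF lg_sums(1)[OF \<rho>] this]
  have s: "(\<lambda>n. real (f (Suc n)) * dlog (Suc n) \<rho> t) sums (lg \<rho> - Re (logG f (Complex \<rho> t)))" by simp
  define B where "B = (\<lambda>k. k - 1) ` A"
  have AB: "A = Suc ` B"
  proof -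
    have "Suc (k - 1) = k" if "k \<in> A" for k using that A(2) by (cases k) auto
    thus ?thesis unfolding B_def by (force simp: image_image)
  qed
  have fB: "finite B" unfolding B_def using A by simp
  have "(\<Sum>n\<in>B. real (f (Suc n)) * dlog (Suc n) \<rho> t) \<le> (\<Sum>n. real (f (Suc n)) * dlog (Suc n) \<rho> t)"
    using s fB exp_minus_dlog(2)[OF zero_less_Suc \<rho>] by (intro sum_le_suminf) (auto simp: sums_iff)
  also have "\<dots> = lg \<rho> - Re (logG f (Complex \<rho> t))" using s by (simp add: sums_iff)
  also have "(\<Sum>n\<in>B. real (f (Suc n)) * dlog (Suc n) \<rho> t) = (\<Sum>k\<in>A. real (f k) * dlog k \<rho> t)"
    unfolding AB by (subst sum.reindex) auto
  finally have "Re (logG f (Complex \<rho> t)) \<le> lg \<rho> + - (\<Sum>k\<in>A. real (f k) * dlog k \<rho> t)" by simp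
  thus ?thesis by (simp add: norm_exp_eq_Re flip: exp_add)
qed

definition Nc :: "real \<Rightarrow> real" where "Nc y = (\<Sum>k | k \<ge> 1 \<and> real k \<le> y. real (f k))"

lemma finite_Nc: "finite {k. k \<ge> 1 \<and> real k \<le> y}"
proof (rule finite_subset)
  show "{k. k \<ge> 1 \<and> real k \<le> y} \<subseteq> {..nat \<lceil>y\<rceil>}" by (auto simp: le_nat_iff) linarith
qed simp

lemma Nc_mono: "x \<le> y \<Longrightarrow> Nc x \<le> Nc y"
  unfolding Nc_def by (intro sum_mono2 finite_Nc) auto

lemma Nc_nonneg: "Nc x \<ge> 0" unfolding Nc_def by (intro sum_nonneg) auto

lemma lg_bounds:
  obtains c1 c2 x0 where "c1 > 0" "c2 > 0" "x0 > 0" "\<And>x. 0 < x \<Longrightarrow> x \<le> x0 \<Longrightarrow> c1 * x powr - \<alpha> \<le> lg x"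
    "\<And>x. 0 < x \<Longrightarrow> x \<le> x0 \<Longrightarrow> lg x \<le> c2 * x powr - \<alpha>"
proof -
  define a where "a = Re (acoef \<alpha>)"
  have a: "a > 0" using acoef_alpha by (simp add: a_def)
  have "\<forall>\<^sub>F x in at_right 0. a / 2 < x powr \<alpha> * lg x \<and> x powr \<alpha> * lg x < 2 * a"
    using a by (intro eventually_conj order_tendstoD[OF lg_asymp]) (auto simp: a_def)
  then obtain b where b: "b > 0" "\<And>x. 0 < x \<Longrightarrow> x < b \<Longrightarrow> a / 2 < x powr \<alpha> * lg x \<and> x powr \<alpha> * lg x < 2 * a"
    unfolding eventually_at_right_field by blast
  show ?thesis
  proof (rule that[of "a / 2" "2 * a" "b / 2"])
    fix x assume x: "0 < x" "x \<le> b / 2"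
    hence *: "a / 2 < x powr \<alpha> * lg x" "x powr \<alpha> * lg x < 2 * a" using b(2)[of x] b(1) by auto
    have e: "x powr - \<alpha> * (x powr \<alpha> * lg x) = lg x" using x by (simp add: powr_minus)
    have "x powr - \<alpha> * (a / 2) \<le> x powr - \<alpha> * (x powr \<alpha> * lg x)" using * by (intro mult_left_mono) auto
    thus "a / 2 * x powr - \<alpha> \<le> lg x" unfolding e by (simp add: mult.commute)
    have "x powr - \<alpha> * (x powr \<alpha> * lg x) \<le> x powr - \<alpha> * (2 * a)" using * by (intro mult_left_mono) auto
    thus "lg x \<le> 2 * a * x powr - \<alpha>" unfolding e by (simp add: mult.commute)
  qed (use a b in auto)
qed

text \<open>An elementary Tauberian bound. In log G_f(x), of order x^{-\<alpha>}, the terms with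
  index above K/x are at most 2 e^{-K/2} log G_f(x/2), hence negligible for large K; the remaining
  ones are at most \<open>Nc (K / x)\<close> times \<open>ell x\<close>, and \<open>ell x\<close> is
  O(x^{-\<eta>}). Replacing x by K x gives the claim.\<close>

lemma Nc_lower:
  assumes \<eta>: "\<eta> > 0"
  obtains c0 x0 where "c0 > 0" "x0 > 0" "\<And>x. 0 < x \<Longrightarrow> x \<le> x0 \<Longrightarrow> Nc (1 / x) \<ge> c0 * x powr - (\<alpha> - \<eta>)"
proof -
  obtain c1 c2 x1 where b: "c1 > 0" "c2 > 0" "x1 > 0" "\<And>x. 0 < x \<Longrightarrow> x \<le> x1 \<Longrightarrow> c1 * x powr - \<alpha> \<le> lg x"
    "\<And>x. 0 < x \<Longrightarrow> x \<le> x1 \<Longrightarrow> lg x \<le> c2 * x powr - \<alpha>"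
    by (rule lg_bounds, rule that, assumption+)
  define D where "D = 2 * c2 * 2 powr \<alpha>"
  have D: "D > 0" using b by (simp add: D_def)
  \<comment> \<open>Large enough that the tail, at most D e^{-K/2} x^{-\<alpha>}, takes away no more
    than half of the lower bound c1 x^{-\<alpha>}.\<close>
  define K where "K = max 1 (2 * ln (2 * D / c1))"
  have K1: "K \<ge> 1" by (simp add: K_def)
  have KD: "D * exp (- K / 2) \<le> c1 / 2"
  proof -
    have "ln (2 * D / c1) \<le> K / 2" by (simp add: K_def)
    hence "2 * D / c1 \<le> exp (K / 2)" using D b by (simp add: ln_ge_iff[symmetric] ln_le_cancel_iff[symmetric] del: ln_le_cancel_iff)
    thus ?thesis using b D by (simp add: exp_minus field_simps)
  qed
  have main: "Nc (K / x) \<ge> (c1 * \<eta> / (2 * 2 powr \<eta>)) * x powr - (\<alpha> - \<eta>)" if x: "0 < x" "x \<le> min 1 x1" for x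
  proof -
    define S where "S = {n. real (Suc n) \<le> K / x}"
    have fS: "finite S"
    proof (rule finite_subset)
      show "S \<subseteq> (\<lambda>k. k - 1) ` {k. k \<ge> 1 \<and> real k \<le> K / x}"
      proof
        fix n assume "n \<in> S"
        thus "n \<in> (\<lambda>k. k - 1) ` {k. k \<ge> 1 \<and> real k \<le> K / x}"
          by (intro image_eqI[of _ _ "Suc n"]) (auto simp: S_def)
      qed
    qed (use finite_Nc in auto)
    have s2: "(\<lambda>n. real (f (Suc n)) * ell (real (Suc n) * (x / 2))) sums lg (x / 2)"
      using x by (intro lg_sums) auto
    have le: "real (f (Suc n)) * ell (real (Suc n) * x) \<le>
       (if n \<in> S then real (f (Suc n)) * ell x else 0) + 2 * exp (- K / 2) * (real (f (Suc n)) * ell (real (Suc n) * (x / 2)))" for n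
    proof (cases "n \<in> S")
      case True
      have "ell (real (Suc n) * x) \<le> ell x" using x by (intro ell_antimono) auto
      moreover have "0 \<le> 2 * exp (- K / 2) * (real (f (Suc n)) * ell (real (Suc n) * (x / 2)))"
        using x by (intro mult_nonneg_nonneg ell_nonneg) auto
      ultimately show ?thesis using True
        by (simp add: add_increasing2 mult_left_mono del: of_nat_Suc)
    next
      case False
      define y where "y = real (Suc n) * x"
      have y: "y \<ge> K" using False x by (simp add: S_def y_def field_simps)
      have "ell y \<le> 2 * exp (- y)" using y K1 by (intro ell_le) auto
      also have "\<dots> = 2 * (exp (- (y / 2)) * exp (- (y / 2)))" by (simp flip: exp_add)
      also have "\<dots> \<le> 2 * (exp (- K / 2) * ell (y / 2))"
        using y K1 by (intro mult_left_mono mult_mono ell_ge) auto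
      finally have "real (f (Suc n)) * ell y \<le> real (f (Suc n)) * (2 * (exp (- K / 2) * ell (y / 2)))"
        by (intro mult_left_mono) auto
      thus ?thesis using False by (simp add: y_def mult_ac del: of_nat_Suc)
    qed
    have "(\<lambda>n. (if n \<in> S then real (f (Suc n)) * ell x else 0) + 2 * exp (- K / 2) * (real (f (Suc n)) * ell (real (Suc n) * (x / 2))))
       sums ((\<Sum>n\<in>S. real (f (Suc n)) * ell x) + 2 * exp (- K / 2) * lg (x / 2))"
      by (intro sums_add sums_If_finite_set fS sums_mult s2)
    from sums_le[OF le lg_sums(1)[OF x(1)] this]
    have "lg x \<le> (\<Sum>n\<in>S. real (f (Suc n))) * ell x + 2 * exp (- K / 2) * lg (x / 2)"
      by (simp add: sum_distrib_right)
    also have "(\<Sum>n\<in>S. real (f (Suc n))) = Nc (K / x)"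
    proof -
      have "{k. k \<ge> 1 \<and> real k \<le> K / x} = Suc ` S"
        unfolding S_def by (auto simp: image_iff) (metis Suc_pred of_nat_Suc add.commute less_eq_Suc_le)
      thus ?thesis unfolding Nc_def by (simp add: sum.reindex)
    qed
    also have "2 * exp (- K / 2) * lg (x / 2) \<le> 2 * exp (- K / 2) * (c2 * (x / 2) powr - \<alpha>)"
      using b(5)[of "x / 2"] x by (intro mult_left_mono) auto
    also have "\<dots> = (D * exp (- K / 2)) * x powr - \<alpha>"
      using x by (simp add: D_def powr_divide powr_minus field_simps)
    also have "\<dots> \<le> c1 / 2 * x powr - \<alpha>" by (intro mult_right_mono KD) auto
    finally have "c1 * x powr - \<alpha> \<le> Nc (K / x) * ell x + c1 / 2 * x powr - \<alpha>"
      using b(4)[of x] x by auto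
    hence 1: "c1 / 2 * x powr - \<alpha> \<le> Nc (K / x) * ell x" by simp
    have "ell x \<le> ln (2 / x)" using x by (intro ell_le_ln) auto
    also have "\<dots> \<le> (2 / x) powr \<eta> / \<eta>" using x \<eta> by (intro ln_powr_bound) auto
    also have "\<dots> = 2 powr \<eta> / \<eta> * x powr - \<eta>" using x by (simp add: powr_divide powr_minus field_simps)
    finally have "Nc (K / x) * ell x \<le> Nc (K / x) * (2 powr \<eta> / \<eta> * x powr - \<eta>)"
      by (rule mult_left_mono) (rule Nc_nonneg)
    with 1 have "c1 / 2 * x powr - \<alpha> \<le> Nc (K / x) * (2 powr \<eta> / \<eta> * x powr - \<eta>)" by linarith
    hence "(c1 / 2 * x powr - \<alpha>) * (\<eta> / 2 powr \<eta> * x powr \<eta>) \<le> Nc (K / x) * (2 powr \<eta> / \<eta> * x powr - \<eta>) * (\<eta> / 2 powr \<eta> * x powr \<eta>)"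
      using \<eta> by (intro mult_right_mono) auto
    also have "\<dots> = Nc (K / x)" using x \<eta> by (simp add: powr_minus field_simps)
    also have "(c1 / 2 * x powr - \<alpha>) * (\<eta> / 2 powr \<eta> * x powr \<eta>) = (c1 * \<eta> / (2 * 2 powr \<eta>)) * x powr - (\<alpha> - \<eta>)"
      by (simp add: powr_add[symmetric] add.commute)
         (simp add: powr_diff powr_minus field_simps)?
    finally show ?thesis .
  qed
  show ?thesis
  proof (rule that[of "(c1 * \<eta> / (2 * 2 powr \<eta>)) * K powr - (\<alpha> - \<eta>)" "min 1 x1 / K"])
    show "0 < c1 * \<eta> / (2 * 2 powr \<eta>) * K powr - (\<alpha> - \<eta>)" using b \<eta> K1 by (intro mult_pos_pos) auto
    show "min 1 x1 / K > 0" using b K1 by simp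
    fix x assume x: "0 < x" "x \<le> min 1 x1 / K"
    hence "K * x \<le> min 1 x1" using K1 by (simp add: field_simps)
    from main[of "K * x"] this x K1
    have "Nc (K / (K * x)) \<ge> (c1 * \<eta> / (2 * 2 powr \<eta>)) * (K * x) powr - (\<alpha> - \<eta>)" by simp
    thus "c1 * \<eta> / (2 * 2 powr \<eta>) * K powr - (\<alpha> - \<eta>) * x powr - (\<alpha> - \<eta>) \<le> Nc (1 / x)"
      using x K1 by (simp add: powr_mult mult.assoc)
  qed
qed

lemma Nc_ge: obtains y where "y > 0" "Nc y \<ge> B"
proof -
  obtain c0 x0 where c0: "c0 > 0" "x0 > 0" "\<And>x. 0 < x \<Longrightarrow> x \<le> x0 \<Longrightarrow> Nc (1 / x) \<ge> c0 * x powr - (\<alpha> - \<alpha> / 2)"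
    by (rule Nc_lower[of "\<alpha> / 2"], use alpha_pos in simp, rule that, assumption+)
  define b where "b = max 1 (B / c0)"
  define x where "x = min x0 (b powr - (2 / \<alpha>))"
  have b: "b \<ge> 1" "b * c0 \<ge> B" using c0 by (auto simp: b_def max_def field_simps)
  have x: "x > 0" "x \<le> x0" using c0 b by (auto simp: x_def)
  have "x powr - (\<alpha> / 2) \<ge> (b powr - (2 / \<alpha>)) powr - (\<alpha> / 2)"
    using x alpha_pos by (intro powr_mono2') (auto simp: x_def)
  also have "(b powr - (2 / \<alpha>)) powr - (\<alpha> / 2) = b" using b alpha_pos by (simp add: powr_powr)
  finally have "c0 * x powr - (\<alpha> / 2) \<ge> c0 * b" using c0 by (intro mult_left_mono) auto
  moreover have "Nc (1 / x) \<ge> c0 * x powr - (\<alpha> / 2)" using c0(3)[OF x] by simp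
  ultimately have "Nc (1 / x) \<ge> B" using b by (simp add: mult.commute)
  thus ?thesis using that[of "1 / x"] x by simp
qed

lemma infinite_supp: "infinite (supp f)"
proof
  assume fin: "finite (supp f)"
  define B where "B = (\<Sum>k\<in>supp f. real (f k))"
  obtain y where y: "Nc y \<ge> B + 1" by (rule Nc_ge)
  have "Nc y = (\<Sum>k\<in>{k. k \<ge> 1 \<and> real k \<le> y} \<inter> supp f. real (f k))"
    unfolding Nc_def by (rule sum.mono_neutral_right) (use finite_Nc in \<open>auto simp: supp_def\<close>)
  also have "\<dots> \<le> B" unfolding B_def using fin by (intro sum_mono2) auto
  finally show False using y by simp
qed

text \<open>Every k \<le> 1/m satisfies the hypotheses of \<open>dlog_ge\<close>, always with the
  same conclusion; weighting by f(k) turns the sum of savings into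
  \<open>Nc (1 / m)\<close>.\<close>

lemma norm_exp_logG_Nc:
  assumes \<rho>: "\<rho> > 0" and m: "m \<ge> \<rho>" "m \<ge> \<bar>t\<bar>"
  shows "norm (exp (logG f (Complex \<rho> t))) \<le> exp (lg \<rho>) * exp (- (Nc (1 / m) * (ln (1 + t\<^sup>2 / (12 * \<rho>\<^sup>2)) / 2)))"
proof -
  have m0: "m > 0" using m \<rho> by linarith
  have "norm (exp (logG f (Complex \<rho> t))) \<le> exp (lg \<rho>) * exp (- (\<Sum>k\<in>{k. k \<ge> 1 \<and> real k \<le> 1 / m}. real (f k) * dlog k \<rho> t))"
    by (rule norm_exp_logG_le[OF \<rho> finite_Nc]) simp
  also have "\<dots> \<le> exp (lg \<rho>) * exp (- (Nc (1 / m) * (ln (1 + t\<^sup>2 / (12 * \<rho>\<^sup>2)) / 2)))"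
  proof -
    have "Nc (1 / m) * (ln (1 + t\<^sup>2 / (12 * \<rho>\<^sup>2)) / 2) \<le> (\<Sum>k\<in>{k. k \<ge> 1 \<and> real k \<le> 1 / m}. real (f k) * dlog k \<rho> t)"
      unfolding Nc_def sum_distrib_right
    proof (intro sum_mono mult_left_mono dlog_ge \<rho>)
      fix k assume k: "k \<in> {k. k \<ge> 1 \<and> real k \<le> 1 / m}"
      hence "real k * m \<le> 1" using m0 by (simp add: field_simps)
      moreover have "real k * \<rho> \<le> real k * m" "real k * \<bar>t\<bar> \<le> real k * m" using m by (auto intro: mult_left_mono)
      ultimately show "real k * \<rho> \<le> 1" "real k * \<bar>t\<bar> \<le> 1" by linarith+
    qed auto
    thus ?thesis by simp
  qed
  finally show ?thesis .
qed

end


section \<open>Minor arcs\<close>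

context partition_setting begin

text \<open>Here y = t^2 / (12 \<rho>^2) is at most 1/12, where ln(1+y) \<ge> y/2, so the savings of
  about \<rho>^{-(\<alpha>-\<eta>)} factors add up to Gaussian decay in t/\<rho>.\<close>

lemma minor_arc_near:
  assumes "\<eta> > 0"
  obtains c0 r0 where "c0 > 0" "r0 > 0" "\<And>\<rho> t. 0 < \<rho> \<Longrightarrow> \<rho> \<le> r0 \<Longrightarrow> \<bar>t\<bar> \<le> \<rho> \<Longrightarrow>
    norm (exp (logG f (Complex \<rho> t))) \<le> exp (lg \<rho>) * exp (- (c0 * (t / \<rho>)\<^sup>2 * \<rho> powr - (\<alpha> - \<eta>)))"
proof -
  obtain c0 r0 where c0: "c0 > 0" "r0 > 0" "\<And>x. 0 < x \<Longrightarrow> x \<le> r0 \<Longrightarrow> Nc (1 / x) \<ge> c0 * x powr - (\<alpha> - \<eta>)"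
    by (rule Nc_lower[OF assms], rule that, assumption+)
  show ?thesis
  proof (rule that[of "c0 / 48" r0])
    fix \<rho> t assume *: "0 < \<rho>" "\<rho> \<le> r0" "\<bar>t\<bar> \<le> \<rho>"
    define y where "y = t\<^sup>2 / (12 * \<rho>\<^sup>2)"
    have "t\<^sup>2 \<le> \<rho>\<^sup>2" using * by (metis abs_ge_zero power2_abs power_mono)
    hence y: "0 \<le> y" "y \<le> 1 / 12" using * by (auto simp: y_def field_simps)
    have "y / 2 \<le> y - y\<^sup>2"
      using mult_left_mono[OF y(2) y(1)] y by (simp add: power2_eq_square)
    also have "\<dots> \<le> ln (1 + y)" using y by (intro ln_one_plus_pos_lower_bound) auto
    finally have l: "ln (1 + y) / 2 \<ge> y / 4" by simp
    have "(c0 * \<rho> powr - (\<alpha> - \<eta>)) * (y / 4) \<le> Nc (1 / \<rho>) * (ln (1 + y) / 2)"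
      using c0(3)[OF *(1,2)] l y c0(1) Nc_nonneg by (intro mult_mono) auto
    hence "exp (- (Nc (1 / \<rho>) * (ln (1 + y) / 2))) \<le> exp (- ((c0 * \<rho> powr - (\<alpha> - \<eta>)) * (y / 4)))" by simp
    moreover have "(c0 * \<rho> powr - (\<alpha> - \<eta>)) * (y / 4) = c0 / 48 * (t / \<rho>)\<^sup>2 * \<rho> powr - (\<alpha> - \<eta>)"
      by (simp add: y_def power_divide)
    moreover have "norm (exp (logG f (Complex \<rho> t))) \<le> exp (lg \<rho>) * exp (- (Nc (1 / \<rho>) * (ln (1 + y) / 2)))"
      unfolding y_def using * by (intro norm_exp_logG_Nc) auto
    ultimately show "norm (exp (logG f (Complex \<rho> t))) \<le> exp (lg \<rho>) * exp (- (c0 / 48 * (t / \<rho>)\<^sup>2 * \<rho> powr - (\<alpha> - \<eta>)))"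
      by (metis (no_types, lifting) exp_ge_zero mult_left_mono order.trans)
  qed (use c0 in auto)
qed

text \<open>Two regimes. If t^2 \<ge> \<rho>, each factor saves a power of \<rho>, and \<epsilon> is
  small enough that \<open>Nc (1 / \<bar>t\<bar>)\<close> is at least 4m. If t^2 < \<rho>, each
  factor saves only a constant, but there are at least c \<rho>^{-\<alpha>/4} of them, which saves
  more than any power of \<rho>.\<close>

lemma minor_arc_middle:
  obtains \<epsilon> K r0 where "\<epsilon> > 0" "K > 0" "r0 > 0" "\<And>\<rho> t. 0 < \<rho> \<Longrightarrow> \<rho> \<le> r0 \<Longrightarrow> \<rho> \<le> \<bar>t\<bar> \<Longrightarrow> \<bar>t\<bar> \<le> \<epsilon> \<Longrightarrow>
    norm (exp (logG f (Complex \<rho> t))) \<le> exp (lg \<rho>) * (K * \<rho> ^ m)"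
proof -
  obtain y0 where y0: "y0 > 0" "Nc y0 \<ge> 4 * real m" by (rule Nc_ge)
  obtain c0 x0 where c0: "c0 > 0" "x0 > 0" "\<And>x. 0 < x \<Longrightarrow> x \<le> x0 \<Longrightarrow> Nc (1 / x) \<ge> c0 * x powr - (\<alpha> - \<alpha> / 2)"
    by (rule Nc_lower[of "\<alpha> / 2"], use alpha_pos in simp, rule that, assumption+)
  define l0 where "l0 = ln (13 / 12 :: real) / 2"
  have l0: "l0 > 0" by (simp add: l0_def)
  \<comment> \<open>With T = \<rho>^{-\<alpha>/4}, the bound of e^{-cT} by a multiple of T^{-j}
    yields \<rho>^{\<alpha>j/4}, and this \<open>j\<close> makes the exponent at least
    \<open>m\<close>.\<close>
  define j where "j = nat \<lceil>4 * real m / \<alpha>\<rceil>"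
  have j: "\<alpha> * real j / 4 \<ge> real m"
  proof -
    have "real j \<ge> 4 * real m / \<alpha>" unfolding j_def by linarith
    thus ?thesis using alpha_pos by (simp add: field_simps)
  qed
  obtain K where K: "K > 0" "\<And>t. t \<ge> 0 \<Longrightarrow> (0 + t) ^ j \<le> K * exp (c0 * l0 * t)"
    using power_le_exp[of 0 "c0 * l0" j] c0 l0 by auto
  show ?thesis
  proof (rule that[of "1 / y0" "12 ^ (2 * m) + K" "min (1 / 12) (x0\<^sup>2)"])
    fix \<rho> t assume *: "0 < \<rho>" "\<rho> \<le> min (1 / 12) (x0\<^sup>2)" "\<rho> \<le> \<bar>t\<bar>" "\<bar>t\<bar> \<le> 1 / y0"
    have t0: "\<bar>t\<bar> > 0" using * by linarith
    define y where "y = t\<^sup>2 / (12 * \<rho>\<^sup>2)"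
    have base: "norm (exp (logG f (Complex \<rho> t))) \<le> exp (lg \<rho>) * exp (- (Nc (1 / \<bar>t\<bar>) * (ln (1 + y) / 2)))"
      unfolding y_def using * by (intro norm_exp_logG_Nc) auto
    have "exp (- (Nc (1 / \<bar>t\<bar>) * (ln (1 + y) / 2))) \<le> (12 ^ (2 * m) + K) * \<rho> ^ m"
    proof (cases "t\<^sup>2 \<ge> \<rho>")
      case True
      have "1 / (12 * \<rho>) = \<rho> / (12 * \<rho>\<^sup>2)" using * by (simp add: power2_eq_square)
      also have "\<dots> \<le> y" unfolding y_def using True * by (intro divide_right_mono) auto
      finally have "ln (1 / (12 * \<rho>)) \<le> ln (1 + y)" using * by (intro ln_mono) auto
      moreover have "ln (1 / (12 * \<rho>)) \<ge> 0" using * by (intro ln_ge_zero) (simp add: field_simps)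
      moreover have "Nc (1 / \<bar>t\<bar>) \<ge> 4 * real m"
      proof -
        have "y0 \<le> 1 / \<bar>t\<bar>" using * y0 t0 by (simp add: field_simps)
        from Nc_mono[OF this] y0 show ?thesis by linarith
      qed
      ultimately have "4 * real m * (ln (1 / (12 * \<rho>)) / 2) \<le> Nc (1 / \<bar>t\<bar>) * (ln (1 + y) / 2)"
        by (intro mult_mono Nc_nonneg) auto
      hence "exp (- (Nc (1 / \<bar>t\<bar>) * (ln (1 + y) / 2))) \<le> exp (- (4 * real m * (ln (1 / (12 * \<rho>)) / 2)))" by simp
      also have "- (4 * real m * (ln (1 / (12 * \<rho>)) / 2)) = real (2 * m) * ln (12 * \<rho>)"
        using * by (simp add: ln_div)
      also have "exp (real (2 * m) * ln (12 * \<rho>)) = (12 * \<rho>) ^ (2 * m)"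
        using * unfolding exp_of_nat_mult by simp
      also have "\<dots> = 12 ^ (2 * m) * \<rho> ^ (2 * m)" by (rule power_mult_distrib)
      also have "\<dots> \<le> 12 ^ (2 * m) * \<rho> ^ m" using * by (intro mult_left_mono power_decreasing) auto
      also have "\<dots> \<le> (12 ^ (2 * m) + K) * \<rho> ^ m" using K * by (intro mult_right_mono) auto
      finally show ?thesis .
    next
      case False
      have st: "\<bar>t\<bar> \<le> sqrt \<rho>" using False by (intro real_le_rsqrt) (simp add: power2_abs)
      have sx: "sqrt \<rho> \<le> x0" using * c0 by (intro real_le_lsqrt) auto
      have y: "y \<ge> 1 / 12"
      proof -
        have "\<rho>\<^sup>2 \<le> t\<^sup>2" using * by (metis abs_of_pos power2_abs power_mono less_imp_le)
        thus ?thesis using * by (simp add: y_def field_simps)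
      qed
      have "ln (13 / 12) \<le> ln (1 + y)" using y by (intro ln_mono) auto
      hence l: "l0 \<le> ln (1 + y) / 2" by (simp add: l0_def)
      define T where "T = \<rho> powr - (\<alpha> / 4)"
      have "c0 * T = c0 * (sqrt \<rho>) powr - (\<alpha> - \<alpha> / 2)"
        using * by (simp add: T_def powr_half_sqrt[symmetric] powr_powr)
      also have "\<dots> \<le> Nc (1 / sqrt \<rho>)" using c0(3)[of "sqrt \<rho>"] sx * by simp
      also have "\<dots> \<le> Nc (1 / \<bar>t\<bar>)" using st t0 * by (intro Nc_mono divide_left_mono) auto
      finally have "(c0 * T) * l0 \<le> Nc (1 / \<bar>t\<bar>) * (ln (1 + y) / 2)"
        using l l0 c0 by (intro mult_mono Nc_nonneg) (auto simp: T_def)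
      hence "exp (- (Nc (1 / \<bar>t\<bar>) * (ln (1 + y) / 2))) \<le> exp (- (c0 * l0 * T))" by (simp add: mult_ac)
      also have "\<dots> \<le> K * T powr - real j"
      proof -
        have T: "T > 0" using * by (simp add: T_def)
        have "T ^ j \<le> K * exp (c0 * l0 * T)" using K(2)[of T] T by simp
        hence "T powr - real j * T ^ j * exp (- (c0 * l0 * T)) \<le> T powr - real j * (K * exp (c0 * l0 * T)) * exp (- (c0 * l0 * T))"
          by (intro mult_right_mono mult_left_mono) auto
        thus ?thesis using T by (simp add: powr_minus powr_realpow exp_minus mult_ac)
      qed
      also have "T powr - real j = \<rho> powr (\<alpha> * real j / 4)" by (simp add: T_def powr_powr)
      also have "\<rho> powr (\<alpha> * real j / 4) \<le> \<rho> powr real m" using * j by (intro powr_mono') auto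
      also have "\<rho> powr real m = \<rho> ^ m" using * by (simp add: powr_realpow)
      finally have "exp (- (Nc (1 / \<bar>t\<bar>) * (ln (1 + y) / 2))) \<le> K * \<rho> ^ m" using K by (simp add: mult_left_mono)
      also have "\<dots> \<le> (12 ^ (2 * m) + K) * \<rho> ^ m" using * by (intro mult_right_mono) auto
      finally show ?thesis .
    qed
    thus "norm (exp (logG f (Complex \<rho> t))) \<le> exp (lg \<rho>) * ((12 ^ (2 * m) + K) * \<rho> ^ m)"
      using base by (meson exp_ge_zero mult_left_mono order.trans)
  qed (use y0 K c0 in \<open>auto intro: add_pos_pos\<close>)
qed

text \<open>The use of (P1). If some k \<ge> 1 has e^{ik\<tau>} = 1, all such k are multiples of the
  least one, q, and q \<noteq> 1 since 0 < |\<tau>| \<le> pi. For a prime p dividing q, the elements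
  of \<Lambda> outside the multiples of p are non-resonant, and (P1) guarantees L of them. If there
  is no such k, all of the infinite set \<Lambda> is available.\<close>

lemma nonresonant_elements:
  assumes \<tau>: "\<tau> \<noteq> 0" "\<bar>\<tau>\<bar> \<le> pi"
  shows "\<exists>A\<subseteq>supp f. finite A \<and> card A = L \<and> (\<forall>k\<in>A. exp (\<i> * of_real (real k * \<tau>)) \<noteq> 1)"
proof -
  define E where "E = (\<lambda>k::nat. exp (\<i> * complex_of_real (real k * \<tau>)))"
  have E_add: "E (a + b) = E a * E b" for a b by (simp add: E_def algebra_simps exp_add)
  define NV where "NV = {k\<in>supp f. E k \<noteq> 1}"
  have "infinite NV \<or> card NV \<ge> L"
  proof (cases "\<exists>k\<ge>1. E k = 1")
    case False
    hence "NV = supp f" by (auto simp: NV_def supp_def)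
    thus ?thesis using infinite_supp by simp
  next
    case True
    define q where "q = (LEAST k. k \<ge> 1 \<and> E k = 1)"
    have q: "q \<ge> 1" "E q = 1" using LeastI_ex[OF True] unfolding q_def by auto
    have qmin: "k = 0" if "E k = 1" "k < q" for k
      using not_less_Least[of k "\<lambda>k. k \<ge> 1 \<and> E k = 1"] that unfolding q_def by fastforce
    have "q \<noteq> 1"
    proof
      assume "q = 1"
      hence "exp (\<i> * complex_of_real \<tau>) = 1" using q by (simp add: E_def)
      then obtain n :: int where n: "\<tau> = of_int (2 * n) * pi" by (auto simp: exp_eq_1)
      hence "\<bar>of_int (2 * n) :: real\<bar> * pi \<le> 1 * pi" using \<tau>(2) by (simp add: abs_mult)
      hence "\<bar>of_int (2 * n) :: real\<bar> \<le> 1" by (subst (asm) mult_le_cancel_right) auto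
      hence "n = 0" by linarith
      thus False using n \<tau>(1) by simp
    qed
    then obtain p where p: "prime p" "p dvd q" using prime_factor_nat by blast
    have Emult: "E (q * j) = 1" for j
      by (induction j) (simp_all add: E_add q, simp add: E_def)
    have "supp f - ({n. p dvd n} \<inter> supp f) \<subseteq> NV"
    proof
      fix k assume k: "k \<in> supp f - ({n. p dvd n} \<inter> supp f)"
      have "E k \<noteq> 1"
      proof
        assume "E k = 1"
        have "E k = E (q * (k div q)) * E (k mod q)" unfolding E_add[symmetric] by simp
        hence "E (k mod q) = 1" using Emult \<open>E k = 1\<close> by simp
        hence "k mod q = 0" using q(1) by (intro qmin) auto
        hence "p dvd k" using p(2) by (meson dvd_trans mod_0_imp_dvd)
        thus False using k by auto
      qed
      thus "k \<in> NV" using k by (simp add: NV_def)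
    qed
    moreover have "infinite (supp f - ({n. p dvd n} \<inter> supp f)) \<or> card (supp f - ({n. p dvd n} \<inter> supp f)) \<ge> L"
      using P1 p(1) by (auto simp: P1_def Let_def)
    ultimately show ?thesis by (meson card_mono finite_subset order.trans)
  qed
  hence "\<exists>A\<subseteq>NV. finite A \<and> card A = L"
    using infinite_arbitrarily_large[of NV L] obtain_subset_with_card_n[of L NV] by metis
  thus ?thesis unfolding NV_def E_def by blast
qed

text \<open>L non-resonant factors save \<rho>^L. Two further elements of the infinite set \<Lambda>
  are added: if one of them is non-resonant it saves another \<rho>, and if both are resonant their
  joint saving is the Cauchy kernel around \<tau>.\<close>

lemma minor_arc_far_local:
  assumes \<tau>: "\<tau> \<noteq> 0" "\<bar>\<tau>\<bar> \<le> pi"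
  shows "\<exists>\<delta>>0. \<exists>K>0. \<forall>\<rho> t. 0 < \<rho> \<and> \<rho> < \<delta> \<and> \<bar>t - \<tau>\<bar> < \<delta> \<longrightarrow>
    norm (exp (logG f (Complex \<rho> t))) \<le> exp (lg \<rho>) * (K * \<rho> ^ L * (\<rho> + 1 / (1 + (t - \<tau>)\<^sup>2 / (12 * \<rho>\<^sup>2))))"
proof -
  obtain A where A: "A \<subseteq> supp f" "finite A" "card A = L" "\<And>k. k \<in> A \<Longrightarrow> exp (\<i> * of_real (real k * \<tau>)) \<noteq> 1"
    using nonresonant_elements[OF \<tau>] by blast
  have "infinite (supp f - A)" using infinite_supp A(2) by simp
  then obtain B where B: "B \<subseteq> supp f - A" "finite B" "card B = 2"
    using infinite_arbitrarily_large by blast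
  then obtain k1 k2 where k12: "B = {k1, k2}" "k1 \<noteq> k2" by (auto simp: card_2_iff)
  have kpos: "k > 0" if "k \<in> A \<union> B" for k using that A(1) B(1) by (auto simp: supp_def)
  have fpos: "f k \<ge> 1" if "k \<in> A \<union> B" for k using that A(1) B(1) by (auto simp: supp_def Suc_le_eq)
  have "\<forall>k\<in>A. \<exists>\<delta>. \<exists>C. \<delta> > 0 \<and> C > 0 \<and> (\<forall>\<rho> t. 0 < \<rho> \<and> \<rho> < \<delta> \<and> \<bar>t - \<tau>\<bar> < \<delta> \<longrightarrow> exp (- dlog k \<rho> t) \<le> C * \<rho>)"
  proof
    fix k assume "k \<in> A"
    hence "k > 0" using kpos by simp
    from exp_minus_dlog_nonresonant[OF this A(4)[OF \<open>k \<in> A\<close>]]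
    show "\<exists>\<delta>. \<exists>C. \<delta> > 0 \<and> C > 0 \<and> (\<forall>\<rho> t. 0 < \<rho> \<and> \<rho> < \<delta> \<and> \<bar>t - \<tau>\<bar> < \<delta> \<longrightarrow> exp (- dlog k \<rho> t) \<le> C * \<rho>)"
      by (elim exE conjE) (intro exI conjI)
  qed
  from bchoice[OF this] obtain \<delta>A where "\<forall>k\<in>A. \<exists>C. \<delta>A k > 0 \<and> C > 0 \<and> (\<forall>\<rho> t. 0 < \<rho> \<and> \<rho> < \<delta>A k \<and> \<bar>t - \<tau>\<bar> < \<delta>A k \<longrightarrow> exp (- dlog k \<rho> t) \<le> C * \<rho>)"
    by (elim exE)
  from bchoice[OF this] obtain CA where dA0: "\<forall>k\<in>A. \<delta>A k > 0 \<and> CA k > 0 \<and> (\<forall>\<rho> t. 0 < \<rho> \<and> \<rho> < \<delta>A k \<and> \<bar>t - \<tau>\<bar> < \<delta>A k \<longrightarrow> exp (- dlog k \<rho> t) \<le> CA k * \<rho>)"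
    by (elim exE)
  have dA: "k \<in> A \<Longrightarrow> \<delta>A k > 0" "k \<in> A \<Longrightarrow> CA k > 0"
    "k \<in> A \<Longrightarrow> 0 < \<rho> \<Longrightarrow> \<rho> < \<delta>A k \<Longrightarrow> \<bar>t - \<tau>\<bar> < \<delta>A k \<Longrightarrow> exp (- dlog k \<rho> t) \<le> CA k * \<rho>" for k \<rho> t
    by (drule bspec[OF dA0], simp)+
  \<comment> \<open>The saving of a single resonant factor. The product of two is integrable in t
    with integral O(\<rho>); one alone would cost a logarithm of \<rho>.\<close>
  define s where "s = (\<lambda>\<rho> t. 1 / sqrt (1 + (t - \<tau>)\<^sup>2 / (12 * \<rho>\<^sup>2)))"
  have two: "\<exists>\<delta>>0. \<exists>C>0. \<forall>\<rho> t. 0 < \<rho> \<and> \<rho> < \<delta> \<and> \<bar>t - \<tau>\<bar> < \<delta> \<longrightarrow> exp (- dlog k \<rho> t) \<le> C * \<rho> \<or> exp (- dlog k \<rho> t) \<le> s \<rho> t"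
    if k: "k > 0" for k
  proof (cases "exp (\<i> * of_real (real k * \<tau>)) = 1")
    case False
    from exp_minus_dlog_nonresonant[OF k False] obtain \<delta> C where d: "\<delta> > 0" "C > 0"
      "\<forall>\<rho> t. 0 < \<rho> \<and> \<rho> < \<delta> \<and> \<bar>t - \<tau>\<bar> < \<delta> \<longrightarrow> exp (- dlog k \<rho> t) \<le> C * \<rho>" by (elim exE conjE)
    show ?thesis
      by (rule exI[of _ \<delta>], rule conjI, rule d, rule exI[of _ C], rule conjI, rule d, intro allI impI disjI1, rule d(3)[rule_format])
  next
    case True
    have "exp (- dlog k \<rho> t) \<le> s \<rho> t" if "0 < \<rho> \<and> \<rho> < 1 / real k \<and> \<bar>t - \<tau>\<bar> < 1 / real k" for \<rho> t
    proof -
      note * = that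
      define y where "y = (t - \<tau>)\<^sup>2 / (12 * \<rho>\<^sup>2)"
      have y: "y \<ge> 0" by (simp add: y_def)
      have "dlog k \<rho> (t - \<tau>) \<ge> ln (1 + y) / 2"
        unfolding y_def
      proof (rule dlog_ge[OF k])
        have "real k * \<rho> < real k * (1 / real k)" "real k * \<bar>t - \<tau>\<bar> < real k * (1 / real k)"
          using * k by (simp_all only: mult_less_cancel_left_pos of_nat_0_less_iff)
        thus "real k * \<rho> \<le> 1" "real k * \<bar>t - \<tau>\<bar> \<le> 1" using k by simp_all
      qed (use * in simp)
      hence "exp (- dlog k \<rho> t) \<le> exp (- (ln (1 + y) / 2))"
        by (subst dlog_shift[OF True]) (simp only: exp_le_cancel_iff neg_le_iff_le)
      also have "\<dots> = 1 / sqrt (1 + y)"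
      proof -
        have "1 + y \<noteq> 0" "1 + y \<ge> 0" using y by auto
        hence "sqrt (1 + y) = exp (1 / 2 * ln (1 + y))"
          by (simp only: powr_half_sqrt[symmetric] powr_def if_False)
        moreover have "ln (1 + y) / 2 = 1 / 2 * ln (1 + y)" by simp
        ultimately have "exp (ln (1 + y) / 2) = sqrt (1 + y)" by (simp only:)
        thus ?thesis by (simp only: exp_minus inverse_eq_divide)
      qed
      finally show "exp (- dlog k \<rho> t) \<le> s \<rho> t" unfolding s_def y_def .
    qed
    hence "\<forall>\<rho> t. 0 < \<rho> \<and> \<rho> < 1 / real k \<and> \<bar>t - \<tau>\<bar> < 1 / real k \<longrightarrow> exp (- dlog k \<rho> t) \<le> 1 * \<rho> \<or> exp (- dlog k \<rho> t) \<le> s \<rho> t"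
      by (intro allI impI disjI2)
    moreover have "1 / real k > 0" using k by simp
    ultimately show ?thesis by (intro exI conjI) (assumption, rule zero_less_one, assumption)
  qed
  have kp1: "k1 > 0" using kpos[of k1] k12 by simp
  from two[OF kp1] obtain \<delta>1 C1 where k1a: "\<delta>1 > 0" "C1 > 0" and k1b: "\<forall>\<rho> t. 0 < \<rho> \<and> \<rho> < \<delta>1 \<and> \<bar>t - \<tau>\<bar> < \<delta>1 \<longrightarrow> exp (- dlog k1 \<rho> t) \<le> C1 * \<rho> \<or> exp (- dlog k1 \<rho> t) \<le> s \<rho> t"
    by (elim exE conjE)
  note k1 = k1a k1b[rule_format, OF conjI[OF _ conjI]]
  have kp2: "k2 > 0" using kpos[of k2] k12 by simp
  from two[OF kp2] obtain \<delta>2 C2 where k2a: "\<delta>2 > 0" "C2 > 0" and k2b: "\<forall>\<rho> t. 0 < \<rho> \<and> \<rho> < \<delta>2 \<and> \<bar>t - \<tau>\<bar> < \<delta>2 \<longrightarrow> exp (- dlog k2 \<rho> t) \<le> C2 * \<rho> \<or> exp (- dlog k2 \<rho> t) \<le> s \<rho> t"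
    by (elim exE conjE)
  note k2 = k2a k2b[rule_format, OF conjI[OF _ conjI]]
  define \<delta> where "\<delta> = Min ({\<delta>1, \<delta>2} \<union> \<delta>A ` A)"
  have \<delta>: "\<delta> > 0" "\<delta> \<le> \<delta>1" "\<delta> \<le> \<delta>2" "\<And>k. k \<in> A \<Longrightarrow> \<delta> \<le> \<delta>A k"
  proof -
    have fin: "finite ({\<delta>1, \<delta>2} \<union> \<delta>A ` A)" using A(2) by simp
    show "\<delta> > 0" unfolding \<delta>_def using k1(1) k2(1) dA(1) fin by (subst Min_gr_iff) auto
    show "\<delta> \<le> \<delta>1" "\<delta> \<le> \<delta>2" "\<And>k. k \<in> A \<Longrightarrow> \<delta> \<le> \<delta>A k"
      unfolding \<delta>_def by (rule Min_le[OF fin]; simp)+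
  qed
  define CP where "CP = (\<Prod>k\<in>A. CA k)"
  have CP: "CP > 0" unfolding CP_def by (intro prod_pos dA)
  show ?thesis
  proof (rule exI[of _ \<delta>], intro conjI \<delta>(1) exI[of _ "CP * (C1 + C2 + 1)"] allI impI)
    show "CP * (C1 + C2 + 1) > 0" using CP k1 k2 by (intro mult_pos_pos) auto
    fix \<rho> t assume "0 < \<rho> \<and> \<rho> < \<delta> \<and> \<bar>t - \<tau>\<bar> < \<delta>"
    hence *: "0 < \<rho>" "\<rho> < \<delta>" "\<bar>t - \<tau>\<bar> < \<delta>" by auto
    define y where "y = (t - \<tau>)\<^sup>2 / (12 * \<rho>\<^sup>2)"
    have y: "y \<ge> 0" by (simp add: y_def)
    have s2: "s \<rho> t * s \<rho> t = 1 / (1 + y)" "s \<rho> t \<ge> 0"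
      using y by (auto simp: s_def y_def)
    have e: "exp (- dlog k \<rho> t) \<le> 1" if "k > 0" for k using exp_minus_dlog(2)[OF that *(1), of t] by simp
    have "norm (exp (logG f (Complex \<rho> t))) \<le> exp (lg \<rho>) * exp (- (\<Sum>k\<in>A \<union> B. real (f k) * dlog k \<rho> t))"
      by (rule norm_exp_logG_le[OF *(1)]) (use A B kpos in auto)
    also have "\<dots> \<le> exp (lg \<rho>) * exp (- (\<Sum>k\<in>A \<union> B. dlog k \<rho> t))"
    proof -
      have "(\<Sum>k\<in>A \<union> B. dlog k \<rho> t) \<le> (\<Sum>k\<in>A \<union> B. real (f k) * dlog k \<rho> t)"
      proof (rule sum_mono)
        fix k assume k: "k \<in> A \<union> B"
        have "1 * dlog k \<rho> t \<le> real (f k) * dlog k \<rho> t"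
          using fpos[OF k] exp_minus_dlog(2)[OF kpos[OF k] *(1)] by (intro mult_right_mono) auto
        thus "dlog k \<rho> t \<le> real (f k) * dlog k \<rho> t" by simp
      qed
      thus ?thesis by simp
    qed
    also have "exp (- (\<Sum>k\<in>A \<union> B. dlog k \<rho> t)) = (\<Prod>k\<in>A. exp (- dlog k \<rho> t)) * (exp (- dlog k1 \<rho> t) * exp (- dlog k2 \<rho> t))"
    proof -
      have "(\<Sum>k\<in>A \<union> B. dlog k \<rho> t) = (\<Sum>k\<in>A. dlog k \<rho> t) + (\<Sum>k\<in>B. dlog k \<rho> t)"
        using A B by (intro sum.union_disjoint) auto
      moreover have "(\<Sum>k\<in>B. dlog k \<rho> t) = dlog k1 \<rho> t + dlog k2 \<rho> t" using k12 by simp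
      ultimately have "- (\<Sum>k\<in>A \<union> B. dlog k \<rho> t) = (\<Sum>k\<in>A. - dlog k \<rho> t) + (- dlog k1 \<rho> t + - dlog k2 \<rho> t)"
        by (simp add: sum_negf)
      thus ?thesis by (simp only: exp_add exp_sum[OF A(2)])
    qed
    also have "exp (lg \<rho>) * \<dots> \<le> exp (lg \<rho>) * ((CP * \<rho> ^ L) * ((C1 + C2 + 1) * (\<rho> + 1 / (1 + y))))"
    proof (rule mult_left_mono[OF mult_mono])
      have "(\<Prod>k\<in>A. exp (- dlog k \<rho> t)) \<le> (\<Prod>k\<in>A. CA k * \<rho>)"
        using * \<delta>(4) by (intro prod_mono conjI dA(3)) force+
      also have "\<dots> = CP * \<rho> ^ L" using A(2,3) by (simp add: CP_def prod.distrib)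
      finally show "(\<Prod>k\<in>A. exp (- dlog k \<rho> t)) \<le> CP * \<rho> ^ L" .
      have a1: "exp (- dlog k1 \<rho> t) \<le> C1 * \<rho> \<or> exp (- dlog k1 \<rho> t) \<le> s \<rho> t"
        using * \<delta>(2) by (intro k1(3)) auto
      have a2: "exp (- dlog k2 \<rho> t) \<le> C2 * \<rho> \<or> exp (- dlog k2 \<rho> t) \<le> s \<rho> t"
        using * \<delta>(3) by (intro k2(3)) auto
      have e1: "exp (- dlog k1 \<rho> t) \<le> 1" and e2: "exp (- dlog k2 \<rho> t) \<le> 1" using e kpos k12 by auto
      have n: "0 \<le> C1 * \<rho>" "0 \<le> C2 * \<rho>" "0 \<le> 1 / (1 + y)" using k1 k2 * y by auto
      have "exp (- dlog k1 \<rho> t) * exp (- dlog k2 \<rho> t) \<le> C1 * \<rho> + C2 * \<rho> + 1 / (1 + y)"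
      proof -
        consider "exp (- dlog k1 \<rho> t) \<le> C1 * \<rho>" | "exp (- dlog k2 \<rho> t) \<le> C2 * \<rho>"
          | "exp (- dlog k1 \<rho> t) \<le> s \<rho> t" "exp (- dlog k2 \<rho> t) \<le> s \<rho> t" using a1 a2 by blast
        thus ?thesis
        proof cases
          case 1
          have "exp (- dlog k1 \<rho> t) * exp (- dlog k2 \<rho> t) \<le> C1 * \<rho> * 1" using 1 e2 n by (intro mult_mono) auto
          thus ?thesis using n by linarith
        next
          case 2
          have "exp (- dlog k1 \<rho> t) * exp (- dlog k2 \<rho> t) \<le> 1 * (C2 * \<rho>)" using 2 e1 n by (intro mult_mono) auto
          thus ?thesis using n by linarith
        next
          case 3
          have "exp (- dlog k1 \<rho> t) * exp (- dlog k2 \<rho> t) \<le> s \<rho> t * s \<rho> t" using 3 s2 by (intro mult_mono) auto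
          thus ?thesis using n s2 by linarith
        qed
      qed
      also have "\<dots> \<le> (C1 + C2 + 1) * (\<rho> + 1 / (1 + y))"
      proof -
        define W where "W = 1 / (1 + y)"
        have "0 \<le> \<rho> + C1 * W + C2 * W"
          using k1(1,2) k2(1,2) * n(3) unfolding W_def[symmetric] by (intro add_nonneg_nonneg mult_nonneg_nonneg) auto
        thus ?thesis unfolding W_def[symmetric] by (simp add: algebra_simps)
      qed
      finally show "exp (- dlog k1 \<rho> t) * exp (- dlog k2 \<rho> t) \<le> (C1 + C2 + 1) * (\<rho> + 1 / (1 + y))" .
    qed (use CP * in auto)
    finally show "norm (exp (logG f (Complex \<rho> t))) \<le> exp (lg \<rho>) * (CP * (C1 + C2 + 1) * \<rho> ^ L * (\<rho> + 1 / (1 + (t - \<tau>)\<^sup>2 / (12 * \<rho>\<^sup>2))))"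
      by (simp add: y_def mult_ac)
  qed
qed

text \<open>The closed set \<epsilon> \<le> |t| \<le> pi is compact, so finitely many of the local
  bounds cover it; the sum over the finite set of centres dominates each of them.\<close>

lemma minor_arc_far:
  assumes \<epsilon>: "\<epsilon> > 0"
  obtains T K r0 where "finite T" "K > 0" "r0 > 0" "\<And>\<rho> t. 0 < \<rho> \<Longrightarrow> \<rho> < r0 \<Longrightarrow> \<epsilon> \<le> \<bar>t\<bar> \<Longrightarrow> \<bar>t\<bar> \<le> pi \<Longrightarrow>
    norm (exp (logG f (Complex \<rho> t))) \<le> exp (lg \<rho>) * (K * \<rho> ^ L * (\<rho> + (\<Sum>\<tau>\<in>T. 1 / (1 + (t - \<tau>)\<^sup>2 / (12 * \<rho>\<^sup>2)))))"
proof -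
  define X where "X = {- pi..- \<epsilon>} \<union> {\<epsilon>..pi}"
  have X: "t \<in> X \<longleftrightarrow> \<epsilon> \<le> \<bar>t\<bar> \<and> \<bar>t\<bar> \<le> pi" for t using \<epsilon> by (auto simp: X_def)
  have "compact X" unfolding X_def by (intro compact_Un) auto
  have "\<forall>\<tau>\<in>X. \<exists>\<delta>. \<exists>K. \<delta> > 0 \<and> K > 0 \<and> (\<forall>\<rho> t. 0 < \<rho> \<and> \<rho> < \<delta> \<and> \<bar>t - \<tau>\<bar> < \<delta> \<longrightarrow>
    norm (exp (logG f (Complex \<rho> t))) \<le> exp (lg \<rho>) * (K * \<rho> ^ L * (\<rho> + 1 / (1 + (t - \<tau>)\<^sup>2 / (12 * \<rho>\<^sup>2)))))"
  proof
    fix \<tau> assume "\<tau> \<in> X"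
    hence "\<tau> \<noteq> 0" "\<bar>\<tau>\<bar> \<le> pi" using X \<epsilon> by auto
    from minor_arc_far_local[OF this] show "\<exists>\<delta>. \<exists>K. \<delta> > 0 \<and> K > 0 \<and> (\<forall>\<rho> t. 0 < \<rho> \<and> \<rho> < \<delta> \<and> \<bar>t - \<tau>\<bar> < \<delta> \<longrightarrow>
      norm (exp (logG f (Complex \<rho> t))) \<le> exp (lg \<rho>) * (K * \<rho> ^ L * (\<rho> + 1 / (1 + (t - \<tau>)\<^sup>2 / (12 * \<rho>\<^sup>2)))))"
      by blast
  qed
  from bchoice[OF this] obtain \<delta> where "\<forall>\<tau>\<in>X. \<exists>K. \<delta> \<tau> > 0 \<and> K > 0 \<and> (\<forall>\<rho> t. 0 < \<rho> \<and> \<rho> < \<delta> \<tau> \<and> \<bar>t - \<tau>\<bar> < \<delta> \<tau> \<longrightarrow>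
    norm (exp (logG f (Complex \<rho> t))) \<le> exp (lg \<rho>) * (K * \<rho> ^ L * (\<rho> + 1 / (1 + (t - \<tau>)\<^sup>2 / (12 * \<rho>\<^sup>2)))))" by (elim exE)
  from bchoice[OF this] obtain K where dK: "\<forall>\<tau>\<in>X. \<delta> \<tau> > 0 \<and> K \<tau> > 0 \<and> (\<forall>\<rho> t. 0 < \<rho> \<and> \<rho> < \<delta> \<tau> \<and> \<bar>t - \<tau>\<bar> < \<delta> \<tau> \<longrightarrow>
    norm (exp (logG f (Complex \<rho> t))) \<le> exp (lg \<rho>) * (K \<tau> * \<rho> ^ L * (\<rho> + 1 / (1 + (t - \<tau>)\<^sup>2 / (12 * \<rho>\<^sup>2)))))" by (elim exE)
  have cover: "X \<subseteq> (\<Union>\<tau>\<in>X. ball \<tau> (\<delta> \<tau>))" using dK by auto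
  from compactE_image[OF \<open>compact X\<close> _ cover] obtain T where T: "T \<subseteq> X" "finite T" "X \<subseteq> (\<Union>\<tau>\<in>T. ball \<tau> (\<delta> \<tau>))"
    by auto
  define Kt where "Kt = 1 + (\<Sum>\<tau>\<in>T. K \<tau>)"
  have KtT: "K \<tau> \<le> Kt" if "\<tau> \<in> T" for \<tau>
  proof -
    have "K \<tau> \<le> (\<Sum>\<tau>\<in>T. K \<tau>)" using that T dK by (intro member_le_sum) (auto intro: less_imp_le)
    thus ?thesis by (simp add: Kt_def)
  qed
  define r0 where "r0 = Min (insert 1 (\<delta> ` T))"
  have r0: "r0 > 0" "\<And>\<tau>. \<tau> \<in> T \<Longrightarrow> r0 \<le> \<delta> \<tau>" using T dK by (auto simp: r0_def)
  show ?thesis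
  proof (rule that[OF T(2), of Kt r0])
    show "Kt > 0" unfolding Kt_def using T dK by (intro add_pos_nonneg sum_nonneg) (auto intro: less_imp_le)
    fix \<rho> t assume *: "0 < \<rho>" "\<rho> < r0" "\<epsilon> \<le> \<bar>t\<bar>" "\<bar>t\<bar> \<le> pi"
    hence "t \<in> X" using X by simp
    then obtain \<tau> where \<tau>: "\<tau> \<in> T" "\<bar>t - \<tau>\<bar> < \<delta> \<tau>" using T(3) by (auto simp: dist_real_def abs_minus_commute)
    have nn: "0 \<le> 1 / (1 + (t - \<tau>)\<^sup>2 / (12 * \<rho>\<^sup>2))" for \<tau> by (intro divide_nonneg_nonneg add_nonneg_nonneg) auto
    have "norm (exp (logG f (Complex \<rho> t))) \<le> exp (lg \<rho>) * (K \<tau> * \<rho> ^ L * (\<rho> + 1 / (1 + (t - \<tau>)\<^sup>2 / (12 * \<rho>\<^sup>2))))"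
      using dK \<tau> T(1) * r0(2)[OF \<tau>(1)] by auto
    also have "\<dots> \<le> exp (lg \<rho>) * (Kt * \<rho> ^ L * (\<rho> + (\<Sum>\<tau>\<in>T. 1 / (1 + (t - \<tau>)\<^sup>2 / (12 * \<rho>\<^sup>2)))))"
    proof (intro mult_left_mono mult_mono add_left_mono)
      show "1 / (1 + (t - \<tau>)\<^sup>2 / (12 * \<rho>\<^sup>2)) \<le> (\<Sum>\<tau>\<in>T. 1 / (1 + (t - \<tau>)\<^sup>2 / (12 * \<rho>\<^sup>2)))"
        using \<tau>(1) T(2) nn by (intro member_le_sum[of \<tau> T "\<lambda>\<tau>. 1 / (1 + (t - \<tau>)\<^sup>2 / (12 * \<rho>\<^sup>2))"]) auto
      show "K \<tau> \<le> Kt" by (rule KtT[OF \<tau>(1)])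
      show "0 \<le> Kt" using \<open>Kt > 0\<close> by simp
      show "0 \<le> \<rho> + 1 / (1 + (t - \<tau>)\<^sup>2 / (12 * \<rho>\<^sup>2))" using * nn[of \<tau>] by linarith
    qed (use * \<open>Kt > 0\<close> in auto)
    finally show "norm (exp (logG f (Complex \<rho> t))) \<le> exp (lg \<rho>) * (Kt * \<rho> ^ L * (\<rho> + (\<Sum>\<tau>\<in>T. 1 / (1 + (t - \<tau>)\<^sup>2 / (12 * \<rho>\<^sup>2)))))" .
  qed (use r0 in auto)
qed

lemma cauchy_integral_le:
  assumes "\<rho> > 0" "a \<le> b"
  shows "integral {a..b} (\<lambda>t. 1 / (1 + (t - \<tau>)\<^sup>2 / (12 * \<rho>\<^sup>2))) \<le> 4 * pi * \<rho>"
proof -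
  define k where "k = sqrt 12 * \<rho>"
  have k: "k > 0" "k\<^sup>2 = 12 * \<rho>\<^sup>2" using assms by (auto simp: k_def power_mult_distrib)
  have "((\<lambda>t. 1 / (1 + (t - \<tau>)\<^sup>2 / (12 * \<rho>\<^sup>2))) has_integral (k * arctan ((b - \<tau>) / k) - k * arctan ((a - \<tau>) / k))) {a..b}"
  proof (rule fundamental_theorem_of_calculus[OF assms(2)])
    fix x assume "x \<in> {a..b}"
    have "((\<lambda>t. k * arctan ((t - \<tau>) / k)) has_real_derivative 1 / (1 + (x - \<tau>)\<^sup>2 / k\<^sup>2)) (at x)"
      using k(1) by (auto intro!: derivative_eq_intros simp: power_divide inverse_eq_divide)
    thus "((\<lambda>t. k * arctan ((t - \<tau>) / k)) has_vector_derivative 1 / (1 + (x - \<tau>)\<^sup>2 / (12 * \<rho>\<^sup>2))) (at x within {a..b})"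
      unfolding k(2) has_real_derivative_iff_has_vector_derivative[symmetric] by (rule has_field_derivative_at_within)
  qed
  hence "integral {a..b} (\<lambda>t. 1 / (1 + (t - \<tau>)\<^sup>2 / (12 * \<rho>\<^sup>2))) = k * (arctan ((b - \<tau>) / k) - arctan ((a - \<tau>) / k))"
    by (simp add: integral_unique algebra_simps)
  also have "\<dots> \<le> k * pi"
    using arctan_ubound[of "(b - \<tau>) / k"] arctan_lbound[of "(a - \<tau>) / k"] k by (intro mult_left_mono) linarith+
  also have "\<dots> \<le> 4 * pi * \<rho>"
  proof -
    have "sqrt 12 \<le> 4" by (rule real_le_lsqrt) auto
    hence "sqrt 12 * \<rho> * pi \<le> 4 * \<rho> * pi" using assms by (intro mult_right_mono) auto
    thus ?thesis by (simp only: k_def mult.assoc mult.commute[of \<rho> pi])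
  qed
  finally show ?thesis .
qed

text \<open>The three ranges |t| \<le> \<rho>, \<rho> \<le> |t| \<le> \<epsilon> and |t| \<ge>
  \<epsilon> are combined. In the last one the pointwise bound has only \<rho>^L times a Cauchy
  kernel, and it is the integration over t that produces \<rho>^{L+1}; \<theta> is the border of the
  major arc.\<close>

theorem minor_arcs:
  assumes \<eta>: "\<eta> > 0"
  obtains c0 K r0 where "c0 > 0" "K > 0" "r0 > 0" "\<And>\<rho> \<theta> a b. 0 < \<rho> \<Longrightarrow> \<rho> \<le> r0 \<Longrightarrow> 0 \<le> \<theta> \<Longrightarrow> \<theta> \<le> \<rho> \<Longrightarrow> - pi \<le> a \<Longrightarrow> a \<le> b \<Longrightarrow> b \<le> pi \<Longrightarrow>
      (\<And>t. t \<in> {a..b} \<Longrightarrow> \<theta> \<le> \<bar>t\<bar>) \<Longrightarrow>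
      integral {a..b} (\<lambda>t. norm (exp (logG f (Complex \<rho> t)))) \<le>
        exp (lg \<rho>) * (K * \<rho> ^ Suc L + 2 * pi * exp (- (c0 * (\<theta> / \<rho>)\<^sup>2 * \<rho> powr - (\<alpha> - \<eta>))))"
proof -
  obtain c0 r1 where near: "c0 > 0" "r1 > 0" "\<And>\<rho> t. 0 < \<rho> \<Longrightarrow> \<rho> \<le> r1 \<Longrightarrow> \<bar>t\<bar> \<le> \<rho> \<Longrightarrow>
    norm (exp (logG f (Complex \<rho> t))) \<le> exp (lg \<rho>) * exp (- (c0 * (t / \<rho>)\<^sup>2 * \<rho> powr - (\<alpha> - \<eta>)))"
    by (rule minor_arc_near[OF \<eta>], rule that, assumption+)
  obtain \<epsilon> K2 r2 where mid: "\<epsilon> > 0" "K2 > 0" "r2 > 0" "\<And>\<rho> t. 0 < \<rho> \<Longrightarrow> \<rho> \<le> r2 \<Longrightarrow> \<rho> \<le> \<bar>t\<bar> \<Longrightarrow> \<bar>t\<bar> \<le> \<epsilon> \<Longrightarrow>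
    norm (exp (logG f (Complex \<rho> t))) \<le> exp (lg \<rho>) * (K2 * \<rho> ^ Suc L)"
    by (rule minor_arc_middle[of "Suc L"], rule that, assumption+)
  obtain T K3 r3 where far: "finite T" "K3 > 0" "r3 > 0" "\<And>\<rho> t. 0 < \<rho> \<Longrightarrow> \<rho> < r3 \<Longrightarrow> \<epsilon> \<le> \<bar>t\<bar> \<Longrightarrow> \<bar>t\<bar> \<le> pi \<Longrightarrow>
    norm (exp (logG f (Complex \<rho> t))) \<le> exp (lg \<rho>) * (K3 * \<rho> ^ L * (\<rho> + (\<Sum>\<tau>\<in>T. 1 / (1 + (t - \<tau>)\<^sup>2 / (12 * \<rho>\<^sup>2)))))"
    by (rule minor_arc_far[OF mid(1)], rule that, assumption+)
  define K where "K = 2 * pi * (K2 + K3) + K3 * (real (card T) * (4 * pi))"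
  show ?thesis
  proof (rule that[of c0 K "min r1 (min r2 (r3 / 2))"])
    show "K > 0" unfolding K_def using mid far by (intro add_pos_nonneg mult_pos_pos) auto
    fix \<rho> \<theta> a b assume *: "0 < \<rho>" "\<rho> \<le> min r1 (min r2 (r3 / 2))" "0 \<le> \<theta>" "\<theta> \<le> \<rho>" "- pi \<le> a" "a \<le> b" "b \<le> pi"
      and \<theta>: "\<And>t. t \<in> {a..b} \<Longrightarrow> \<theta> \<le> \<bar>t\<bar>"
    define X where "X = exp (- (c0 * (\<theta> / \<rho>)\<^sup>2 * \<rho> powr - (\<alpha> - \<eta>)))"
    define S where "S = (\<lambda>t. \<Sum>\<tau>\<in>T. 1 / (1 + (t - \<tau>)\<^sup>2 / (12 * \<rho>\<^sup>2)))"
    have nn: "0 < 1 + (t - \<tau>)\<^sup>2 / (12 * \<rho>\<^sup>2)" for t \<tau> :: real by (intro add_pos_nonneg) auto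
    have S0: "S t \<ge> 0" for t unfolding S_def by (intro sum_nonneg) (use nn in \<open>auto intro: less_imp_le\<close>)
    have X0: "X \<ge> 0" by (simp add: X_def)
    have pt: "norm (exp (logG f (Complex \<rho> t))) \<le> exp (lg \<rho>) * ((X + (K2 + K3) * \<rho> ^ Suc L) + K3 * \<rho> ^ L * S t)"
      if t: "t \<in> {a..b}" for t
    proof -
      have tp: "\<bar>t\<bar> \<le> pi" using t * by auto
      have nnn: "0 \<le> K2 * \<rho> ^ Suc L" "0 \<le> K3 * \<rho> ^ Suc L" "0 \<le> K3 * \<rho> ^ L * S t" using mid far * S0 by auto
      have "\<bar>t\<bar> \<le> \<rho> \<or> \<rho> \<le> \<bar>t\<bar> \<and> \<bar>t\<bar> \<le> \<epsilon> \<or> \<epsilon> \<le> \<bar>t\<bar>" by linarith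
      hence "norm (exp (logG f (Complex \<rho> t))) \<le> exp (lg \<rho>) * X \<or> norm (exp (logG f (Complex \<rho> t))) \<le> exp (lg \<rho>) * (K2 * \<rho> ^ Suc L)
        \<or> norm (exp (logG f (Complex \<rho> t))) \<le> exp (lg \<rho>) * (K3 * \<rho> ^ Suc L + K3 * \<rho> ^ L * S t)"
      proof (elim disjE conjE)
        assume t1: "\<bar>t\<bar> \<le> \<rho>"
        have "(\<theta> / \<rho>)\<^sup>2 \<le> (t / \<rho>)\<^sup>2"
        proof -
          have "(\<theta> / \<rho>)\<^sup>2 \<le> (\<bar>t\<bar> / \<rho>)\<^sup>2" using \<theta>[OF t] * by (intro power_mono divide_right_mono) auto
          thus ?thesis by (simp add: power_divide)
        qed
        hence "exp (- (c0 * (t / \<rho>)\<^sup>2 * \<rho> powr - (\<alpha> - \<eta>))) \<le> X"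
          unfolding X_def using near(1) by (simp add: mult_left_mono mult_right_mono)
        moreover have "norm (exp (logG f (Complex \<rho> t))) \<le> exp (lg \<rho>) * exp (- (c0 * (t / \<rho>)\<^sup>2 * \<rho> powr - (\<alpha> - \<eta>)))"
          using * t1 by (intro near(3)) auto
        ultimately show ?thesis by (meson exp_ge_zero mult_left_mono order.trans)
      next
        assume "\<rho> \<le> \<bar>t\<bar>" "\<bar>t\<bar> \<le> \<epsilon>"
        thus ?thesis using mid(4)[of \<rho> t] * by auto
      next
        assume "\<epsilon> \<le> \<bar>t\<bar>"
        thus ?thesis using far(4)[of \<rho> t] * far(3) tp by (auto simp: S_def algebra_simps)
      qed
      moreover have "norm (exp (logG f (Complex \<rho> t))) \<le> exp (lg \<rho>) * ((X + (K2 + K3) * \<rho> ^ Suc L) + K3 * \<rho> ^ L * S t)"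
        if "norm (exp (logG f (Complex \<rho> t))) \<le> exp (lg \<rho>) * Y" "Y \<le> (X + (K2 + K3) * \<rho> ^ Suc L) + K3 * \<rho> ^ L * S t" for Y
        using that by (meson exp_ge_zero mult_left_mono order.trans)
      moreover have "X \<le> (X + (K2 + K3) * \<rho> ^ Suc L) + K3 * \<rho> ^ L * S t"
        "K2 * \<rho> ^ Suc L \<le> (X + (K2 + K3) * \<rho> ^ Suc L) + K3 * \<rho> ^ L * S t"
        "K3 * \<rho> ^ Suc L + K3 * \<rho> ^ L * S t \<le> (X + (K2 + K3) * \<rho> ^ Suc L) + K3 * \<rho> ^ L * S t"
        using nnn X0 unfolding distrib_right by linarith+
      ultimately show ?thesis by blast
    qed
    have int1: "(\<lambda>t. norm (exp (logG f (Complex \<rho> t)))) integrable_on {a..b}"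
      by (intro integrable_continuous_interval continuous_intros continuous_on_compose2[OF continuous_logG])
         (use * in \<open>auto simp: Complex_eq intro!: continuous_intros\<close>)
    have intS: "(\<lambda>t. 1 / (1 + (t - \<tau>)\<^sup>2 / (12 * \<rho>\<^sup>2))) integrable_on {a..b}" for \<tau>
      by (intro integrable_continuous_interval continuous_intros) (use nn *(1) in \<open>auto simp: less_imp_neq[OF nn, symmetric]\<close>)
    have "integral {a..b} S \<le> real (card T) * (4 * pi * \<rho>)"
      unfolding S_def using intS far(1)
      by (subst integral_sum) (auto intro!: sum_bounded_above cauchy_integral_le *)
    hence SI: "K3 * \<rho> ^ L * integral {a..b} S \<le> K3 * \<rho> ^ L * (real (card T) * (4 * pi * \<rho>))"
      using far * by (intro mult_left_mono) auto
    have S_int: "S integrable_on {a..b}" unfolding S_def using intS far(1) by (intro integrable_sum)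
    have "integral {a..b} (\<lambda>t. norm (exp (logG f (Complex \<rho> t)))) \<le>
      integral {a..b} (\<lambda>t. exp (lg \<rho>) * ((X + (K2 + K3) * \<rho> ^ Suc L) + K3 * \<rho> ^ L * S t))"
      by (intro integral_le int1 pt integrable_on_mult_right integrable_add integrable_const_ivl S_int)
    also have "\<dots> = exp (lg \<rho>) * ((b - a) * (X + (K2 + K3) * \<rho> ^ Suc L) + K3 * \<rho> ^ L * integral {a..b} S)"
    proof -
      have "((\<lambda>t. (X + (K2 + K3) * \<rho> ^ Suc L) + K3 * \<rho> ^ L * S t) has_integral
          ((b - a) * (X + (K2 + K3) * \<rho> ^ Suc L) + K3 * \<rho> ^ L * integral {a..b} S)) {a..b}"
        using has_integral_const_real[of "X + (K2 + K3) * \<rho> ^ Suc L" a b] *(6)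
        by (intro has_integral_add has_integral_mult_right integrable_integral S_int) simp
      from has_integral_mult_right[OF this, of "exp (lg \<rho>)"] show ?thesis by (rule integral_unique)
    qed
    also have "\<dots> \<le> exp (lg \<rho>) * (2 * pi * (X + (K2 + K3) * \<rho> ^ Suc L) + K3 * \<rho> ^ L * (real (card T) * (4 * pi * \<rho>)))"
    proof (rule mult_left_mono[OF add_mono[OF mult_right_mono SI]])
      show "b - a \<le> 2 * pi" using * by linarith
      show "0 \<le> X + (K2 + K3) * \<rho> ^ Suc L" using X0 mid far * by (intro add_nonneg_nonneg mult_nonneg_nonneg) auto
    qed auto
    also have "\<dots> = exp (lg \<rho>) * (K * \<rho> ^ Suc L + 2 * pi * X)" by (simp add: K_def algebra_simps)
    finally show "integral {a..b} (\<lambda>t. norm (exp (logG f (Complex \<rho> t)))) \<le>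
        exp (lg \<rho>) * (K * \<rho> ^ Suc L + 2 * pi * exp (- (c0 * (\<theta> / \<rho>)\<^sup>2 * \<rho> powr - (\<alpha> - \<eta>))))" by (simp add: X_def)
  qed (use near mid far in auto)
qed

end


subsection \<open>Generalised asymptotic expansions\<close>

text \<open>Finite linear combinations of monomials, built up one term at a time so that closure
  properties follow by rule induction.\<close>

inductive_set espan :: "('a \<Rightarrow> complex) set \<Rightarrow> ('a \<Rightarrow> complex) set" for G where
  espan_zero: "(\<lambda>_. 0) \<in> espan G"
| espan_step: "p \<in> espan G \<Longrightarrow> m \<in> G \<Longrightarrow> (\<lambda>x. c * m x + p x) \<in> espan G"

lemma espan_add: "p \<in> espan G \<Longrightarrow> q \<in> espan G \<Longrightarrow> (\<lambda>x. p x + q x) \<in> espan G"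
proof (induction rule: espan.induct)
  case (espan_step p m c)
  have "(\<lambda>x. c * m x + (p x + q x)) \<in> espan G"
    by (rule espan.espan_step) (use espan_step in auto)
  thus ?case by (simp add: add.assoc)
qed simp

lemma espan_cmult: "p \<in> espan G \<Longrightarrow> (\<lambda>x. d * p x) \<in> espan G"
proof (induction rule: espan.induct)
  case (espan_step p m c)
  have "(\<lambda>x. (d * c) * m x + d * p x) \<in> espan G"
    by (rule espan.espan_step) (use espan_step in auto)
  thus ?case by (simp add: algebra_simps)
qed (simp add: espan_zero)

lemma espan_base: "m \<in> G \<Longrightarrow> m \<in> espan G"
  using espan_step[OF espan_zero, of m G 1] by simp

lemma espan_mult_base:
  assumes "\<And>m n. m \<in> G \<Longrightarrow> n \<in> G \<Longrightarrow> (\<lambda>x. m x * n x) \<in> G" "m \<in> G"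
  shows "p \<in> espan G \<Longrightarrow> (\<lambda>x. m x * p x) \<in> espan G"
proof (induction rule: espan.induct)
  case (espan_step p n c)
  have "(\<lambda>x. c * (m x * n x) + m x * p x) \<in> espan G"
    using assms espan_step by (intro espan.espan_step) auto
  thus ?case by (simp add: algebra_simps)
qed (simp add: espan_zero)

lemma espan_mult:
  assumes "\<And>m n. m \<in> G \<Longrightarrow> n \<in> G \<Longrightarrow> (\<lambda>x. m x * n x) \<in> G" "q \<in> espan G"
  shows "p \<in> espan G \<Longrightarrow> (\<lambda>x. p x * q x) \<in> espan G"
proof (induction rule: espan.induct)
  case (espan_step p m c)
  have "(\<lambda>x. m x * q x) \<in> espan G"
    by (rule espan_mult_base[OF _ espan_step.hyps(2) assms(2)]) (rule assms(1), assumption+)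
  from espan_add[OF espan_cmult[OF this, of c] espan_step.IH]
  have "(\<lambda>x. c * (m x * q x) + p x * q x) \<in> espan G" .
  thus ?case by (simp add: algebra_simps)
qed (simp add: espan_zero)

lemma espan_map:
  assumes "\<And>m. m \<in> G \<Longrightarrow> (\<lambda>x. m (h x)) \<in> G'"
  shows "p \<in> espan G \<Longrightarrow> (\<lambda>x. p (h x)) \<in> espan G'"
  by (induction rule: espan.induct) (auto intro: espan_zero espan_step assms)

text \<open>\<open>e\<close> is the small parameter in powers of which error terms are measured along the filter \<open>Fl\<close>;
  \<open>G\<close> is the multiplicative monoid of the monomials that are admitted in expansions.\<close>

locale scale =
  fixes Fl :: "'a filter" and e :: "'a \<Rightarrow> real" and G :: "('a \<Rightarrow> complex) set"
  assumes ntriv: "Fl \<noteq> bot"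
    and e_pos: "\<forall>\<^sub>F a in Fl. 0 < e a \<and> e a \<le> 1"
    and e_lim: "(e \<longlongrightarrow> 0) Fl"
    and one: "(\<lambda>_. 1) \<in> G"
    and mult: "m \<in> G \<Longrightarrow> n \<in> G \<Longrightarrow> (\<lambda>a. m a * n a) \<in> G"
    and small: "m \<in> G \<Longrightarrow> m = (\<lambda>_. 1) \<or> (\<exists>\<delta>>0. \<exists>K. \<forall>\<^sub>F a in Fl. norm (m a) \<le> K * e a powr \<delta>)"
begin

definition ord :: "real \<Rightarrow> ('a \<Rightarrow> complex) \<Rightarrow> bool" where
  "ord T g \<longleftrightarrow> (\<exists>K. \<forall>\<^sub>F a in Fl. norm (g a) \<le> K * e a powr T)"

lemma ordE:
  assumes "ord T g"
  obtains K where "K \<ge> 0" "\<forall>\<^sub>F a in Fl. norm (g a) \<le> K * e a powr T"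
proof -
  obtain K where K: "\<forall>\<^sub>F a in Fl. norm (g a) \<le> K * e a powr T" using assms by (auto simp: ord_def)
  have "\<forall>\<^sub>F a in Fl. norm (g a) \<le> max 0 K * e a powr T"
    using K by eventually_elim (erule order.trans, intro mult_right_mono, auto)
  thus ?thesis using that[of "max 0 K"] by simp
qed

lemma ordI: "\<forall>\<^sub>F a in Fl. norm (g a) \<le> K * e a powr T \<Longrightarrow> ord T g"
  by (auto simp: ord_def)

lemma ord_mono: "ord T g \<Longrightarrow> T' \<le> T \<Longrightarrow> ord T' g"
proof -
  assume g: "ord T g" and T: "T' \<le> T"
  obtain K where K: "K \<ge> 0" "\<forall>\<^sub>F a in Fl. norm (g a) \<le> K * e a powr T" using g by (rule ordE)
  have "\<forall>\<^sub>F a in Fl. norm (g a) \<le> K * e a powr T'"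
    using K(2) e_pos
  proof eventually_elim
    case (elim a)
    have "e a powr T \<le> e a powr T'" using elim T by (intro powr_mono') auto
    thus ?case using elim(1) K(1) by (meson mult_left_mono order.trans)
  qed
  thus ?thesis by (rule ordI)
qed

lemma ord_add: "ord T g \<Longrightarrow> ord T h \<Longrightarrow> ord T (\<lambda>a. g a + h a)"
proof -
  assume g: "ord T g" and h: "ord T h"
  obtain K where K: "K \<ge> 0" "\<forall>\<^sub>F a in Fl. norm (g a) \<le> K * e a powr T" using g by (rule ordE)
  obtain K' where K': "K' \<ge> 0" "\<forall>\<^sub>F a in Fl. norm (h a) \<le> K' * e a powr T" using h by (rule ordE)
  have "\<forall>\<^sub>F a in Fl. norm (g a + h a) \<le> (K + K') * e a powr T"
    using K(2) K'(2) by eventually_elim (rule norm_triangle_le, simp add: distrib_right)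
  thus ?thesis by (rule ordI)
qed

lemma ord_mult: "ord S g \<Longrightarrow> ord T h \<Longrightarrow> ord (S + T) (\<lambda>a. g a * h a)"
proof -
  assume g: "ord S g" and h: "ord T h"
  obtain K where K: "K \<ge> 0" "\<forall>\<^sub>F a in Fl. norm (g a) \<le> K * e a powr S" using g by (rule ordE)
  obtain K' where K': "K' \<ge> 0" "\<forall>\<^sub>F a in Fl. norm (h a) \<le> K' * e a powr T" using h by (rule ordE)
  have "\<forall>\<^sub>F a in Fl. norm (g a * h a) \<le> (K * K') * e a powr (S + T)"
    using K(2) K'(2)
  proof eventually_elim
    case (elim a)
    have "norm (g a * h a) \<le> (K * e a powr S) * (K' * e a powr T)"
      unfolding norm_mult using elim K K' by (intro mult_mono) auto
    thus ?case by (simp add: powr_add mult_ac)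
  qed
  thus ?thesis by (rule ordI)
qed

lemma ord_const: "ord 0 (\<lambda>_. c)"
proof (rule ordI[of _ "norm c"])
  show "\<forall>\<^sub>F a in Fl. norm c \<le> norm c * e a powr 0" using e_pos by eventually_elim simp
qed

lemma ord_cmult: "ord T g \<Longrightarrow> ord T (\<lambda>a. c * g a)"
  using ord_mult[OF ord_const, of T g c] by simp

lemma ord_zero: "ord T (\<lambda>_. 0)"
  by (rule ordI[of _ 0]) simp

lemma ord_diff: "ord T g \<Longrightarrow> ord T h \<Longrightarrow> ord T (\<lambda>a. g a - h a)"
  using ord_add[OF _ ord_cmult[of T h "-1"], of g] by simp

lemma ord_sum: "(\<And>i. i \<in> I \<Longrightarrow> ord T (g i)) \<Longrightarrow> ord T (\<lambda>a. \<Sum>i\<in>I. g i a)"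
proof (induction I rule: infinite_finite_induct)
  case (insert x I)
  have "ord T (\<lambda>a. g x a + (\<Sum>i\<in>I. g i a))" using insert by (intro ord_add) auto
  thus ?case using insert by simp
qed (auto simp: ord_zero)

lemma ord_cong: "\<forall>\<^sub>F a in Fl. g a = h a \<Longrightarrow> ord T h \<Longrightarrow> ord T g"
proof -
  assume eq: "\<forall>\<^sub>F a in Fl. g a = h a" and h: "ord T h"
  obtain K where K: "\<forall>\<^sub>F a in Fl. norm (h a) \<le> K * e a powr T" using h by (rule ordE)
  have "\<forall>\<^sub>F a in Fl. norm (g a) \<le> K * e a powr T" using eq K by eventually_elim simp
  thus ?thesis by (rule ordI)
qed

lemma e_powr_lim: "\<delta> > 0 \<Longrightarrow> ((\<lambda>a. e a powr \<delta>) \<longlongrightarrow> 0) Fl"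
proof -
  assume d: "\<delta> > 0"
  have "((\<lambda>a. e a powr \<delta>) \<longlongrightarrow> 0 powr \<delta>) Fl"
    by (rule tendsto_powr2[OF e_lim tendsto_const]) (use e_pos d in \<open>auto elim!: eventually_mono\<close>)
  thus ?thesis using d by simp
qed

lemma ord_tendsto_0: "ord \<delta> g \<Longrightarrow> \<delta> > 0 \<Longrightarrow> (g \<longlongrightarrow> 0) Fl"
proof -
  assume g: "ord \<delta> g" and d: "\<delta> > 0"
  obtain K where K: "\<forall>\<^sub>F a in Fl. norm (g a) \<le> K * e a powr \<delta>" using g by (rule ordE)
  show ?thesis by (rule Lim_null_comparison[OF K tendsto_mult_right_zero[OF e_powr_lim[OF d]]])
qed

lemma tendsto_ord_0: "(g \<longlongrightarrow> c) Fl \<Longrightarrow> ord 0 g"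
proof -
  assume g: "(g \<longlongrightarrow> c) Fl"
  have "\<forall>\<^sub>F a in Fl. dist (g a) c < 1" using tendstoD[OF g, of 1] by simp
  hence "\<forall>\<^sub>F a in Fl. norm (g a) \<le> (norm c + 1) * e a powr 0"
    using e_pos
  proof eventually_elim
    case (elim a)
    have "norm (g a) \<le> norm c + norm (g a - c)" by (metis add.commute diff_add_cancel norm_triangle_ineq)
    thus ?case using elim by (simp add: dist_norm)
  qed
  thus ?thesis by (rule ordI)
qed

text \<open>\<open>T\<close> is the accuracy of the expansion, not the size of the function: in
  \<open>cls 0\<close> lies every bounded function, and larger \<open>T\<close> is a stronger
  statement.\<close>

definition cls :: "real \<Rightarrow> ('a \<Rightarrow> complex) set" where
  "cls T = {g. \<exists>p\<in>espan G. ord T (\<lambda>a. g a - p a)}"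

lemma clsI: "p \<in> espan G \<Longrightarrow> ord T (\<lambda>a. g a - p a) \<Longrightarrow> g \<in> cls T"
  by (auto simp: cls_def)

lemma clsE: assumes "g \<in> cls T" obtains p where "p \<in> espan G" "ord T (\<lambda>a. g a - p a)"
  using assms by (auto simp: cls_def)

lemma cls_ord: "ord T g \<Longrightarrow> g \<in> cls T"
  by (rule clsI[OF espan_zero]) simp

lemma cls_espan: "p \<in> espan G \<Longrightarrow> p \<in> cls T"
  by (rule clsI) (auto simp: ord_zero)

lemma cls_base: "m \<in> G \<Longrightarrow> m \<in> cls T" by (intro cls_espan espan_base)

lemma cls_const: "(\<lambda>_. c) \<in> cls T"
  using cls_espan[OF espan_cmult[OF espan_base[OF one], of c]] by simp

lemma cls_mono: "g \<in> cls T \<Longrightarrow> T' \<le> T \<Longrightarrow> g \<in> cls T'"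
  by (auto simp: cls_def intro: ord_mono)

lemma cls_cong: "\<forall>\<^sub>F a in Fl. g a = h a \<Longrightarrow> h \<in> cls T \<Longrightarrow> g \<in> cls T"
proof -
  assume eq: "\<forall>\<^sub>F a in Fl. g a = h a" and h: "h \<in> cls T"
  from h obtain p where p: "p \<in> espan G" "ord T (\<lambda>a. h a - p a)" by (rule clsE)
  have "ord T (\<lambda>a. g a - p a)"
    by (rule ord_cong[OF _ p(2)]) (use eq in eventually_elim, simp)
  thus ?thesis by (rule clsI[OF p(1)])
qed

lemma cls_add: "g \<in> cls T \<Longrightarrow> h \<in> cls T \<Longrightarrow> (\<lambda>a. g a + h a) \<in> cls T"
proof -
  assume g: "g \<in> cls T" and h: "h \<in> cls T"
  from g obtain p where p: "p \<in> espan G" "ord T (\<lambda>a. g a - p a)" by (rule clsE)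
  from h obtain q where q: "q \<in> espan G" "ord T (\<lambda>a. h a - q a)" by (rule clsE)
  show ?thesis
    by (rule clsI[OF espan_add[OF p(1) q(1)]]) (use ord_add[OF p(2) q(2)] in \<open>simp add: algebra_simps\<close>)
qed

text \<open>A monomial is either the constant 1 or decays like a power of \<open>e\<close>, so a
  finite combination converges, and at a power rate.\<close>

lemma espan_lim:
  assumes "p \<in> espan G"
  shows "\<exists>c. \<exists>\<delta>>0. ord \<delta> (\<lambda>a. p a - c)"
  using assms
proof (induction rule: espan.induct)
  case espan_zero
  show ?case by (rule exI[of _ 0], rule exI[of _ 1]) (simp add: ord_zero)
next
  case (espan_step p m c)
  then obtain c0 \<delta> where p: "\<delta> > 0" "ord \<delta> (\<lambda>a. p a - c0)" by blast
  from small[OF espan_step.hyps(2)] show ?case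
  proof
    assume "m = (\<lambda>_. 1)"
    thus ?thesis using p by (intro exI[of _ "c + c0"] exI[of _ \<delta>]) simp
  next
    assume "\<exists>\<delta>>0. \<exists>K. \<forall>\<^sub>F a in Fl. norm (m a) \<le> K * e a powr \<delta>"
    then obtain \<delta>' where m: "\<delta>' > 0" "ord \<delta>' m" by (auto simp: ord_def)
    have "ord (min \<delta> \<delta>') (\<lambda>a. c * m a + (p a - c0))"
      by (intro ord_add ord_cmult ord_mono[OF m(2)] ord_mono[OF p(2)]) auto
    thus ?thesis using p m by (intro exI[of _ c0] exI[of _ "min \<delta> \<delta>'"]) (simp add: algebra_simps)
  qed
qed

text \<open>Mere convergence of an expandable function improves to convergence at some power rate;
  this is the gain per step in \<open>cls_compose\<close>.\<close>

lemma cls_lim: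
  assumes "g \<in> cls T" "T > 0" "(g \<longlongrightarrow> c) Fl"
  shows "\<exists>\<delta>>0. ord \<delta> (\<lambda>a. g a - c)"
proof -
  from assms(1) obtain p where p: "p \<in> espan G" "ord T (\<lambda>a. g a - p a)" by (rule clsE)
  from espan_lim[OF p(1)] obtain c' \<delta> where c': "\<delta> > 0" "ord \<delta> (\<lambda>a. p a - c')" by blast
  have "ord (min T \<delta>) (\<lambda>a. (g a - p a) + (p a - c'))"
    by (intro ord_add ord_mono[OF p(2)] ord_mono[OF c'(2)]) auto
  hence o: "ord (min T \<delta>) (\<lambda>a. g a - c')" by simp
  have "((\<lambda>a. g a - c') \<longlongrightarrow> 0) Fl" by (rule ord_tendsto_0[OF o]) (use assms c' in auto)
  hence "(g \<longlongrightarrow> c') Fl" by (simp add: LIM_zero_iff)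
  hence "c' = c" by (rule tendsto_unique[OF ntriv _ assms(3)])
  thus ?thesis using o assms(2) c'(1) by (intro exI[of _ "min T \<delta>"]) auto
qed

lemma espan_ord_0: "p \<in> espan G \<Longrightarrow> ord 0 p"
proof -
  assume "p \<in> espan G"
  from espan_lim[OF this] obtain c \<delta> where "\<delta> > 0" "ord \<delta> (\<lambda>a. p a - c)" by blast
  hence "((\<lambda>a. p a - c) \<longlongrightarrow> 0) Fl" by (intro ord_tendsto_0)
  hence "(p \<longlongrightarrow> c) Fl" by (simp add: LIM_zero_iff)
  thus ?thesis by (rule tendsto_ord_0)
qed

lemma cls_ord_0: "g \<in> cls T \<Longrightarrow> T \<ge> 0 \<Longrightarrow> ord 0 g"
proof -
  assume g: "g \<in> cls T" and T: "T \<ge> 0"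
  from g obtain p where p: "p \<in> espan G" "ord T (\<lambda>a. g a - p a)" by (rule clsE)
  have "ord 0 (\<lambda>a. (g a - p a) + p a)" by (intro ord_add ord_mono[OF p(2) T] espan_ord_0 p)
  thus ?thesis by simp
qed

lemma cls_mult: "g \<in> cls T \<Longrightarrow> h \<in> cls T \<Longrightarrow> T \<ge> 0 \<Longrightarrow> (\<lambda>a. g a * h a) \<in> cls T"
proof -
  assume g: "g \<in> cls T" and h: "h \<in> cls T" and T: "T \<ge> 0"
  from g obtain p where p: "p \<in> espan G" "ord T (\<lambda>a. g a - p a)" by (rule clsE)
  from h obtain q where q: "q \<in> espan G" "ord T (\<lambda>a. h a - q a)" by (rule clsE)
  have "ord T (\<lambda>a. (g a - p a) * h a + p a * (h a - q a))"
    using ord_mult[OF p(2) cls_ord_0[OF h T]] ord_mult[OF espan_ord_0[OF p(1)] q(2)] by (intro ord_add) auto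
  hence "ord T (\<lambda>a. g a * h a - p a * q a)" by (simp add: algebra_simps)
  moreover have "(\<lambda>a. p a * q a) \<in> espan G"
    by (rule espan_mult[OF _ q(1) p(1)]) (rule mult, assumption+)
  ultimately show ?thesis by (intro clsI)
qed

lemma cls_cmult: "g \<in> cls T \<Longrightarrow> T \<ge> 0 \<Longrightarrow> (\<lambda>a. c * g a) \<in> cls T"
  by (rule cls_mult[OF cls_const])

lemma cls_diff: "g \<in> cls T \<Longrightarrow> h \<in> cls T \<Longrightarrow> T \<ge> 0 \<Longrightarrow> (\<lambda>a. g a - h a) \<in> cls T"
  using cls_add[OF _ cls_cmult[of h T "-1"], of g] by simp

lemma cls_sum: "(\<And>i. i \<in> I \<Longrightarrow> g i \<in> cls T) \<Longrightarrow> (\<lambda>a. \<Sum>i\<in>I. g i a) \<in> cls T"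
proof (induction I rule: infinite_finite_induct)
  case (insert x I)
  have "(\<lambda>a. g x a + (\<Sum>i\<in>I. g i a)) \<in> cls T" using insert by (intro cls_add) auto
  thus ?case using insert by simp
qed (auto simp: cls_const)

text \<open>Write h(g) = h(c) + (g-c) h1(g) with h1 again analytic at c. Since g - c has order
  \<delta>, an expansion of h1(g) of accuracy k\<delta> yields one of h(g) of accuracy
  (k+1)\<delta>, as long as this does not exceed T. The induction starts at accuracy 0, where
  boundedness is enough.\<close>

theorem cls_compose:
  assumes g: "g \<in> cls T" "T > 0" "(g \<longlongrightarrow> c) Fl" and f: "f analytic_on {c}"
  shows "(\<lambda>a. f (g a)) \<in> cls T"
proof -
  obtain \<delta> where \<delta>: "\<delta> > 0" "ord \<delta> (\<lambda>a. g a - c)" using cls_lim[OF g] by blast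
  have lim: "((\<lambda>a. h (g a)) \<longlongrightarrow> h c) Fl" if "h analytic_on {c}" for h
    using isCont_tendsto_compose[OF analytic_at_imp_isCont[OF that] g(3)] .
  have r: "(\<lambda>a. g a - c) \<in> cls T" using g by (intro cls_diff cls_const) auto
  have main: "(\<lambda>a. h (g a)) \<in> cls (min T (real k * \<delta>))" if "h analytic_on {c}" for h k
    using that
  proof (induction k arbitrary: h)
    case 0
    have "min T (real 0 * \<delta>) = 0" using g(2) by simp
    moreover have "(\<lambda>a. h (g a)) \<in> cls 0" by (rule cls_ord[OF tendsto_ord_0[OF lim[OF 0]]])
    ultimately show ?case by simp
  next
    case (Suc k)
    have "(\<lambda>s. h s - h c) analytic_on {c}" using Suc.prems by (intro analytic_intros)
    from analytic_factor_root[OF this] obtain h1 where h1: "h1 analytic_on {c}"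
      "\<forall>\<^sub>F s in nhds c. h s - h c = (s - c) * h1 s" by auto
    define S where "S = min T (real k * \<delta>)"
    have S: "S \<ge> 0" using g(2) \<delta>(1) by (simp add: S_def)
    have q: "(\<lambda>a. h1 (g a)) \<in> cls S" unfolding S_def by (rule Suc.IH[OF h1(1)])
    then obtain p where p: "p \<in> espan G" "ord S (\<lambda>a. h1 (g a) - p a)" by (rule clsE)
    have a1: "(\<lambda>a. (g a - c) * p a) \<in> cls (min T (real (Suc k) * \<delta>))"
      by (rule cls_mono[OF cls_mult[OF r cls_espan[OF p(1)]]]) (use g in auto)
    have "ord (\<delta> + S) (\<lambda>a. (g a - c) * (h1 (g a) - p a))" by (rule ord_mult[OF \<delta>(2) p(2)])
    moreover have "min T (real (Suc k) * \<delta>) \<le> \<delta> + S"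
      using \<delta>(1) unfolding S_def of_nat_Suc distrib_right by (auto simp: min_def)
    ultimately have a2: "(\<lambda>a. (g a - c) * (h1 (g a) - p a)) \<in> cls (min T (real (Suc k) * \<delta>))"
      by (rule cls_ord[OF ord_mono])
    have "(\<lambda>a. h c + ((g a - c) * p a + (g a - c) * (h1 (g a) - p a))) \<in> cls (min T (real (Suc k) * \<delta>))"
      by (intro cls_add cls_const a1 a2)
    thus ?case
    proof (rule cls_cong[rotated])
      have "\<forall>\<^sub>F a in Fl. h (g a) - h c = (g a - c) * h1 (g a)"
        using eventually_compose_filterlim[OF h1(2) g(3)] .
      thus "\<forall>\<^sub>F a in Fl. h (g a) = h c + ((g a - c) * p a + (g a - c) * (h1 (g a) - p a))"
        by eventually_elim (simp add: algebra_simps)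
    qed
  qed
  define k where "k = nat \<lceil>T / \<delta>\<rceil>"
  have "real k \<ge> T / \<delta>" unfolding k_def by linarith
  hence "real k * \<delta> \<ge> T" using \<delta>(1) by (simp add: field_simps)
  hence "min T (real k * \<delta>) = T" by simp
  thus ?thesis using main[OF f, of k] by simp
qed

end

subsection \<open>Expansions of sequences in powers of \<open>n\<close>\<close>

text \<open>The power n^{-s}. The case s = 0 is separate because 0 powr 0 is 0: with it, the
  constant 1 is a monomial and products of monomials are monomials for every n, n = 0
  included.\<close>

definition mon :: "real \<Rightarrow> nat \<Rightarrow> complex" where
  "mon s n = (if s = 0 then 1 else of_real (real n powr - s))"

definition GX :: "real set \<Rightarrow> (nat \<Rightarrow> complex) set" where "GX S = mon ` S"

lemma mon_eq: "n > 0 \<Longrightarrow> mon s n = of_real (real n powr - s)"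
  by (simp add: mon_def)

lemma mon_mult: "s \<ge> 0 \<Longrightarrow> t \<ge> 0 \<Longrightarrow> mon s n * mon t n = mon (s + t) n"
  by (auto simp: mon_def add_nonneg_eq_0_iff powr_add[symmetric] add.commute simp flip: of_real_mult)

lemma norm_mon: "n > 0 \<Longrightarrow> norm (mon s n) = (1 / real n) powr s"
  by (simp add: mon_eq powr_divide powr_minus norm_inverse inverse_eq_divide norm_divide)

lemma scale_X:
  assumes "0 \<in> S" "\<And>s t. s \<in> S \<Longrightarrow> t \<in> S \<Longrightarrow> s + t \<in> S" "\<And>s. s \<in> S \<Longrightarrow> s \<ge> 0"
  shows "scale sequentially (\<lambda>n. 1 / real n) (GX S)"
proof
  show "\<forall>\<^sub>F n in sequentially. 0 < 1 / real n \<and> 1 / real n \<le> 1"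
    using eventually_gt_at_top[of 0] by eventually_elim simp
  show "(\<lambda>n. 1 / real n) \<longlonglongrightarrow> 0" by (rule lim_1_over_n)
  show "(\<lambda>_. 1) \<in> GX S" using assms(1) by (auto simp: GX_def mon_def image_iff intro!: bexI[of _ 0])
  show "(\<lambda>n. m n * m' n) \<in> GX S" if mm: "m \<in> GX S" "m' \<in> GX S" for m m'
  proof -
    obtain s t where st: "s \<in> S" "t \<in> S" "m = mon s" "m' = mon t" using mm unfolding GX_def by blast
    have "(\<lambda>n. m n * m' n) = mon (s + t)" using st assms(3) by (simp add: mon_mult)
    thus ?thesis using assms(2) st by (simp add: GX_def)
  qed
  show "m = (\<lambda>_. 1) \<or> (\<exists>\<delta>>0. \<exists>K. \<forall>\<^sub>F n in sequentially. norm (m n) \<le> K * (1 / real n) powr \<delta>)" if mm: "m \<in> GX S" for m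
  proof -
    obtain s where s: "s \<in> S" "m = mon s" using mm by (auto simp: GX_def)
    show ?thesis
    proof (cases "s = 0")
      case False
      hence "s > 0" using assms(3)[OF s(1)] by simp
      moreover have "\<forall>\<^sub>F n in sequentially. norm (m n) \<le> 1 * (1 / real n) powr s"
        using eventually_gt_at_top[of 0] by eventually_elim (simp only: s(2) norm_mon)
      ultimately show ?thesis by blast
    qed (simp add: s mon_def fun_eq_iff)
  qed
qed simp

lemma espan_GX_explicit:
  "p \<in> espan (GX S) \<Longrightarrow> \<exists>D c. finite D \<and> D \<subseteq> S \<and> p = (\<lambda>n. \<Sum>s\<in>D. c s * mon s n)"
proof (induction rule: espan.induct)
  case espan_zero
  show ?case by (rule exI[of _ "{}"]) auto
next
  case (espan_step p m a)
  then obtain D c where D: "finite D" "D \<subseteq> S" "p = (\<lambda>n. \<Sum>s\<in>D. c s * mon s n)" by blast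
  obtain t where t: "t \<in> S" "m = mon t" using espan_step.hyps(2) by (auto simp: GX_def)
  define c' where "c' = (\<lambda>s. (if s \<in> D then c s else 0) + (if s = t then a else 0))"
  have "(\<Sum>s\<in>insert t D. c' s * mon s n) = a * m n + p n" for n
  proof -
    have "(\<Sum>s\<in>insert t D. c' s * mon s n) = (\<Sum>s\<in>insert t D. (if s \<in> D then c s else 0) * mon s n) + (\<Sum>s\<in>insert t D. if s = t then a * mon s n else 0)"
      unfolding c'_def distrib_right sum.distrib by (intro arg_cong2[of _ _ _ _ "(+)"] sum.cong) auto
    also have "(\<Sum>s\<in>insert t D. if s = t then a * mon s n else 0) = a * mon t n" using D(1) by simp
    also have "(\<Sum>s\<in>insert t D. (if s \<in> D then c s else 0) * mon s n) = (\<Sum>s\<in>D. (if s \<in> D then c s else 0) * mon s n)"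
      using D(1) by (intro sum.mono_neutral_right) auto
    also have "\<dots> = p n" unfolding D(3) by (intro sum.cong) auto
    finally show ?thesis by (simp add: t(2))
  qed
  hence "(\<lambda>n. a * m n + p n) = (\<lambda>n. \<Sum>s\<in>insert t D. c' s * mon s n)" by simp
  thus ?case using D t by (intro exI[of _ "insert t D"] exI[of _ c']) auto
qed


context scale
begin

text \<open>Multiplication by a monomial of order d raises the accuracy by d. This drives the
  bootstrap for the saddle point.\<close>

lemma cls_shift:
  assumes "m \<in> G" "ord d m" "g \<in> cls t"
  shows "(\<lambda>a. m a * g a) \<in> cls (t + d)"
proof -
  from assms(3) obtain p where p: "p \<in> espan G" "ord t (\<lambda>a. g a - p a)" by (rule clsE)
  have 1: "(\<lambda>a. m a * p a) \<in> espan G"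
    by (rule espan_mult_base[OF _ assms(1) p(1)]) (rule mult, assumption+)
  have "ord (t + d) (\<lambda>a. m a * g a - m a * p a)"
    using ord_mult[OF assms(2) p(2)] by (simp add: add.commute right_diff_distrib)
  thus ?thesis by (rule clsI[OF 1])
qed

lemma cls_powr:
  fixes g :: "'a \<Rightarrow> real"
  assumes "(\<lambda>a. of_real (g a)) \<in> cls T" "T > 0" "(g \<longlongrightarrow> c) Fl" "c > 0"
  shows "(\<lambda>a. of_real (g a) powr q) \<in> cls T"
proof (rule cls_compose[OF assms(1,2) tendsto_of_real[OF assms(3)]])
  have "(\<lambda>s. s powr q) holomorphic_on {s. Re s > 0}"
    by (intro holomorphic_intros) (auto simp: complex_nonpos_Reals_iff)
  hence "(\<lambda>s. s powr q) analytic_on {s. Re s > 0}"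
    by (simp add: analytic_on_open open_halfspace_Re_gt)
  thus "(\<lambda>s. s powr q) analytic_on {complex_of_real c}"
    by (rule analytic_on_subset) (use assms in auto)
qed

lemma cls_powr_real:
  fixes g :: "'a \<Rightarrow> real"
  assumes "(\<lambda>a. of_real (g a)) \<in> cls T" "T > 0" "(g \<longlongrightarrow> c) Fl" "c > 0"
  shows "(\<lambda>a. of_real (g a powr q)) \<in> cls T"
proof (rule cls_cong[OF _ cls_powr[OF assms, of "of_real q"]])
  have "\<forall>\<^sub>F a in Fl. g a > 0" using order_tendstoD(1)[OF assms(3,4)] .
  thus "\<forall>\<^sub>F a in Fl. complex_of_real (g a powr q) = of_real (g a) powr of_real q"
    by eventually_elim (simp add: powr_of_real)
qed

end

subsection \<open>The exponents\<close>

context partition_setting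
begin

definition kap :: real where "kap = 1 / (\<alpha> + 1)"

lemma kap: "kap > 0" "(\<alpha> + 1) * kap = 1" "\<alpha> * kap = 1 - kap" "\<alpha> * kap > 0"
  using alpha_pos by (auto simp: kap_def field_simps)

text \<open>The additive semigroup generated by the gaps (\<alpha>-\<mu>)/(\<alpha>+1); the sign is
  reversed so that its elements are nonnegative and can serve as exponents of 1/n.\<close>

definition nshift :: "real set" where "nshift = uminus ` shift_semigroup R F \<alpha>"

lemma poleset_Pol: "poleset R F \<subseteq> insert 0 Pol"
  by (auto simp: poleset_def Pol_def)

lemma finite_poleset: "finite (poleset R F)"
  using finite_subset[OF poleset_Pol] finite_Pol by simp

lemma nshift_eq: "nshift = {\<Sum>\<mu>\<in>poleset R F. (\<alpha> - \<mu>) * kap * real (k \<mu>) |k. True}"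
proof -
  have r: "((\<mu> + 1) / (\<alpha> + 1) - 1) * x = - ((\<alpha> - \<mu>) * kap * x)" for \<mu> x :: real
    using alpha_pos by (simp add: kap_def field_simps)
  show ?thesis
  proof (intro equalityI subsetI)
    fix x assume "x \<in> nshift"
    then obtain s where s: "x = - sum s (poleset R F)"
      "\<forall>\<mu>\<in>poleset R F. s \<mu> \<in> range (\<lambda>k::nat. ((\<mu> + 1) / (\<alpha> + 1) - 1) * real k)"
      unfolding nshift_def shift_semigroup_def set_sum_alt[OF finite_poleset] by blast
    from s(2) have "\<forall>\<mu>\<in>poleset R F. \<exists>k::nat. s \<mu> = ((\<mu> + 1) / (\<alpha> + 1) - 1) * real k" by blast
    from bchoice[OF this] obtain k :: "real \<Rightarrow> nat"
      where k: "\<forall>\<mu>\<in>poleset R F. s \<mu> = ((\<mu> + 1) / (\<alpha> + 1) - 1) * real (k \<mu>)" by (elim exE)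
    have "x = (\<Sum>\<mu>\<in>poleset R F. (\<alpha> - \<mu>) * kap * real (k \<mu>))"
      unfolding s(1) sum_negf[symmetric] by (intro sum.cong refl) (simp add: k r)
    thus "x \<in> {\<Sum>\<mu>\<in>poleset R F. (\<alpha> - \<mu>) * kap * real (k \<mu>) |k. True}" by blast
  next
    fix x assume "x \<in> {\<Sum>\<mu>\<in>poleset R F. (\<alpha> - \<mu>) * kap * real (k \<mu>) |k. True}"
    then obtain k where k: "x = (\<Sum>\<mu>\<in>poleset R F. (\<alpha> - \<mu>) * kap * real (k \<mu>))" by blast
    have "x = - (\<Sum>\<mu>\<in>poleset R F. ((\<mu> + 1) / (\<alpha> + 1) - 1) * real (k \<mu>))"
      unfolding k sum_negf[symmetric] by (intro sum.cong refl) (simp add: r)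
    thus "x \<in> nshift"
      unfolding nshift_def shift_semigroup_def set_sum_alt[OF finite_poleset] by blast
  qed
qed

lemma nshift_zero: "0 \<in> nshift"
  unfolding nshift_eq by (auto intro: exI[of _ "\<lambda>_. 0"])

lemma nshift_add: "s \<in> nshift \<Longrightarrow> t \<in> nshift \<Longrightarrow> s + t \<in> nshift"
proof -
  assume s: "s \<in> nshift" and t: "t \<in> nshift"
  from s obtain k where k: "s = (\<Sum>\<mu>\<in>poleset R F. (\<alpha> - \<mu>) * kap * real (k \<mu>))" by (auto simp: nshift_eq)
  from t obtain l where l: "t = (\<Sum>\<mu>\<in>poleset R F. (\<alpha> - \<mu>) * kap * real (l \<mu>))" by (auto simp: nshift_eq)
  have "s + t = (\<Sum>\<mu>\<in>poleset R F. (\<alpha> - \<mu>) * kap * real (k \<mu> + l \<mu>))"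
    unfolding k l sum.distrib[symmetric] by (intro sum.cong refl) (simp add: distrib_left)
  thus ?thesis unfolding nshift_eq by (auto intro: exI[of _ "\<lambda>\<mu>. k \<mu> + l \<mu>"])
qed

lemma nshift_base: "\<mu> \<in> poleset R F \<Longrightarrow> (\<alpha> - \<mu>) * kap \<in> nshift"
proof -
  assume \<mu>: "\<mu> \<in> poleset R F"
  have "(\<Sum>\<nu>\<in>poleset R F. (\<alpha> - \<nu>) * kap * real (if \<nu> = \<mu> then 1 else 0)) =
      (\<Sum>\<nu>\<in>poleset R F. if \<nu> = \<mu> then (\<alpha> - \<nu>) * kap else 0)" by (intro sum.cong) auto
  also have "\<dots> = (\<alpha> - \<mu>) * kap" using \<mu> finite_poleset by simp
  finally have "(\<alpha> - \<mu>) * kap = (\<Sum>\<nu>\<in>poleset R F. (\<alpha> - \<nu>) * kap * real (if \<nu> = \<mu> then 1 else 0))" by simp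
  thus ?thesis unfolding nshift_eq
    by (intro CollectI exI[of _ "\<lambda>\<nu>. if \<nu> = \<mu> then 1 else 0"] conjI TrueI)
qed

lemma nshift_nonneg: "s \<in> nshift \<Longrightarrow> s \<ge> 0"
  using poleset_Pol Pol_range kap(1) by (auto simp: nshift_eq intro!: sum_nonneg mult_nonneg_nonneg)

lemma setN_zero: "0 \<in> setN R F \<alpha>"
  unfolding setN_def by (rule CollectI, rule exI[of _ 0]) auto

lemma setN_nonneg: "t \<in> setN R F \<alpha> \<Longrightarrow> t \<ge> 0"
  unfolding setN_def
proof (elim CollectE exE conjE)
  fix K b \<theta>
  assume t: "t = (\<Sum>j=1..K. real (b j) * \<theta> j)" and \<theta>: "\<forall>j\<in>{1..K}. \<theta> j \<in> (uminus ` setL R F \<alpha>) \<inter> {0<..<R / (\<alpha> + 1)}"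
  have "\<theta> j \<ge> 0" if "j \<in> {1..K}" for j using \<theta> that by fastforce
  thus "t \<ge> 0" unfolding t by (intro sum_nonneg mult_nonneg_nonneg) auto
qed

lemma setN_add: "s \<in> setN R F \<alpha> \<Longrightarrow> t \<in> setN R F \<alpha> \<Longrightarrow> s + t \<in> setN R F \<alpha>"
proof -
  let ?D = "(uminus ` setL R F \<alpha>) \<inter> {0<..<R / (\<alpha> + 1)}"
  assume "s \<in> setN R F \<alpha>"
  then obtain K :: nat and b \<theta> where 1: "s = (\<Sum>j=1..K. real (b j) * \<theta> j)" "\<forall>j\<in>{1..K}. \<theta> j \<in> ?D"
    unfolding setN_def by (elim CollectE exE conjE) (rule that, assumption+)
  assume "t \<in> setN R F \<alpha>"
  then obtain K' :: nat and b' \<theta>' where 2: "t = (\<Sum>j=1..K'. real (b' j) * \<theta>' j)" "\<forall>j\<in>{1..K'}. \<theta>' j \<in> ?D"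
    unfolding setN_def by (elim CollectE exE conjE) (rule that, assumption+)
  define c where "c = (\<lambda>j. if j \<le> K then b j else b' (j - K))"
  define \<tau> where "\<tau> = (\<lambda>j. if j \<le> K then \<theta> j else \<theta>' (j - K))"
  have "(\<Sum>j=1..K+K'. real (c j) * \<tau> j) = (\<Sum>j=1..K. real (c j) * \<tau> j) + (\<Sum>j=1+K..K'+K. real (c j) * \<tau> j)"
    using sum.ub_add_nat[of 1 K "\<lambda>j. real (c j) * \<tau> j" K'] by (simp add: add.commute)
  also have "(\<Sum>j=1+K..K'+K. real (c j) * \<tau> j) = (\<Sum>j=1..K'. real (c (j+K)) * \<tau> (j+K))"
    by (rule sum.shift_bounds_cl_nat_ivl)
  also have "\<dots> = t" unfolding 2(1) by (intro sum.cong refl) (auto simp: c_def \<tau>_def)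
  also have "(\<Sum>j=1..K. real (c j) * \<tau> j) = s" unfolding 1(1) by (intro sum.cong refl) (auto simp: c_def \<tau>_def)
  finally have eq: "s + t = (\<Sum>j=1..K+K'. real (c j) * \<tau> j)" by simp
  have "\<tau> j \<in> ?D" if "j \<in> {1..K+K'}" for j
  proof (cases "j \<le> K")
    case True thus ?thesis using 1(2) that by (auto simp: \<tau>_def)
  next
    case False
    hence "j - K \<in> {1..K'}" using that by auto
    with 2(2) have "\<theta>' (j - K) \<in> ?D" by blast
    thus ?thesis using False by (simp add: \<tau>_def)
  qed
  thus ?thesis unfolding setN_def using eq by blast
qed

lemma setN_base: "- t \<in> setL R F \<alpha> \<Longrightarrow> 0 < t \<Longrightarrow> t < R * kap \<Longrightarrow> t \<in> setN R F \<alpha>"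
  unfolding setN_def
  by (rule CollectI, rule exI[of _ 1], rule exI[of _ "\<lambda>_. 1"], rule exI[of _ "\<lambda>_. t"])
     (auto simp: kap_def image_iff intro!: bexI[of _ "- t"])

lemma setL_shift: "\<mu> \<in> poleset R F \<Longrightarrow> s \<in> nshift \<Longrightarrow> \<mu> * kap - s \<in> setL R F \<alpha>"
proof -
  assume \<mu>: "\<mu> \<in> poleset R F" and s: "s \<in> nshift"
  have "- s \<in> shift_semigroup R F \<alpha>" using s by (auto simp: nshift_def)
  with \<mu> have "1 / (\<alpha> + 1) * \<mu> + (- s) \<in> setL R F \<alpha>" unfolding setL_def by (intro set_plus_intro imageI)
  thus ?thesis by (simp add: kap_def)
qed

definition Pp :: "real set" where "Pp = {\<nu>\<in>Pol. \<nu> > 0}"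
definition Pq :: "real set" where "Pq = Pp - {\<alpha>}"
definition Sx :: "real set" where "Sx = nshift + setN R F \<alpha>"
text \<open>The exponents occurring in the saddle point. Only positive poles below \<alpha> generate
  them, as in the saddle equation; without such poles the set is {0}, which is what leads to M =
  1.\<close>

definition S0 :: "real set" where "S0 = {\<Sum>\<nu>\<in>Pq. (\<alpha> - \<nu>) * kap * real (k \<nu>) |k. True}"
text \<open>The exponent of the error term in the theorem, and the accuracy to which everything is
  expanded.\<close>

definition TT :: real where "TT = min ((2 * real L - \<alpha>) / (2 * (\<alpha> + 1))) (R * kap)"

lemma TT: "TT > 0" "TT \<le> R * kap" "TT \<le> kap * (real L - \<alpha> / 2)"
proof -
  have "real L > \<alpha> / 2" using P1 by (simp add: P1_def)
  thus "TT > 0" "TT \<le> R * kap" using R_pos kap alpha_pos by (auto simp: TT_def)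
  have "(2 * real L - \<alpha>) / (2 * (\<alpha> + 1)) = kap * (real L - \<alpha> / 2)"
    using alpha_pos by (simp add: kap_def field_simps)
  thus "TT \<le> kap * (real L - \<alpha> / 2)" by (simp add: TT_def)
qed

lemma Pp: "finite Pp" "\<alpha> \<in> Pp" "Pp \<subseteq> poleset R F" "\<nu> \<in> Pp \<Longrightarrow> 0 < \<nu> \<and> \<nu> \<le> \<alpha>"
proof -
  show "finite Pp" unfolding Pp_def using finite_Pol by simp
qed (use alpha_Pol alpha_pos R_pos Pol_range[of \<nu>] in \<open>auto simp: Pp_def poleset_def Pol_def\<close>)

lemma Pq: "finite Pq" "Pp = insert \<alpha> Pq" "\<alpha> \<notin> Pq" "\<nu> \<in> Pq \<Longrightarrow> 0 < \<nu> \<and> \<nu> < \<alpha>"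
  using Pp(1,2) Pp(4)[of \<nu>] by (auto simp: Pq_def less_le)

lemma alpha_poleset: "\<alpha> \<in> poleset R F" "0 \<in> poleset R F"
  using Pp by (auto simp: poleset_def)

lemma Sx_nshift: "s \<in> nshift \<Longrightarrow> s \<in> Sx"
  unfolding Sx_def using set_plus_intro[OF _ setN_zero, of s nshift] by simp

lemma Sx_setN: "s \<in> setN R F \<alpha> \<Longrightarrow> s \<in> Sx"
  unfolding Sx_def using set_plus_intro[OF nshift_zero, of s] by simp

lemma Sx_add: "s \<in> Sx \<Longrightarrow> t \<in> Sx \<Longrightarrow> s + t \<in> Sx"
proof -
  assume s: "s \<in> Sx" and t: "t \<in> Sx"
  from s obtain a b where ab: "s = a + b" "a \<in> nshift" "b \<in> setN R F \<alpha>" unfolding Sx_def by (rule set_plus_elim)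
  from t obtain c d where cd: "t = c + d" "c \<in> nshift" "d \<in> setN R F \<alpha>" unfolding Sx_def by (rule set_plus_elim)
  have "(a + c) + (b + d) \<in> Sx" unfolding Sx_def using ab cd by (intro set_plus_intro nshift_add setN_add)
  thus ?thesis by (simp add: ab cd add_ac)
qed

lemma Sx_nonneg: "s \<in> Sx \<Longrightarrow> s \<ge> 0"
  unfolding Sx_def by (erule set_plus_elim) (use nshift_nonneg setN_nonneg in fastforce)

text \<open>The element 0 of \<open>poleset\<close> provides this exponent; even powers of the
  Gaussian width produce its multiples.\<close>

lemma Sx_ak: "\<alpha> * kap \<in> Sx"
  using Sx_nshift[OF nshift_base[OF alpha_poleset(2)]] by simp

lemma Sx_neg: "\<nu> \<in> Pol \<Longrightarrow> - R < \<nu> \<Longrightarrow> \<nu> < 0 \<Longrightarrow> - (\<nu> * kap) \<in> Sx"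
proof -
  assume "\<nu> \<in> Pol" "- R < \<nu>" "\<nu> < 0"
  hence "\<nu> \<in> poleset R F" by (auto simp: Pol_def poleset_def)
  from setL_shift[OF this nshift_zero] show ?thesis
    using kap(1) \<open>\<nu> < 0\<close> \<open>- R < \<nu>\<close> mult_strict_right_mono[OF \<open>- R < \<nu>\<close> kap(1)]
    by (intro Sx_setN setN_base) (auto simp: mult_neg_pos)
qed

text \<open>Multiplying the saddle value by n^{\<alpha>/(\<alpha>+1)} lowers each exponent by that
  amount. What then still decays is minus an element of \<open>setL\<close>, hence a generator of
  \<open>setN\<close>.\<close>

lemma Sx_big: "s \<in> nshift \<Longrightarrow> \<alpha> * kap < s \<Longrightarrow> s - \<alpha> * kap < R * kap \<Longrightarrow> s - \<alpha> * kap \<in> Sx"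
  using setL_shift[OF alpha_poleset(1), of s] by (intro Sx_setN setN_base) auto

text \<open>Below \<open>TT\<close> the component in \<open>nshift\<close> is smaller than
  R/(\<alpha>+1), hence also than (R+\<alpha>)/(\<alpha>+1), and so belongs to \<open>setM\<close>
  with the multiple 0 of \<alpha>/(\<alpha>+1).\<close>

lemma Sx_MN: "s \<in> Sx \<Longrightarrow> s < TT \<Longrightarrow> s \<in> setM R F \<alpha> + setN R F \<alpha>"
proof -
  assume s: "s \<in> Sx" "s < TT"
  from s(1) obtain a b where ab: "s = a + b" "a \<in> nshift" "b \<in> setN R F \<alpha>" unfolding Sx_def by (rule set_plus_elim)
  have "a \<le> s" using setN_nonneg[OF ab(3)] ab(1) by simp
  also have "\<dots> < R * kap" using s TT by simp
  also have "\<dots> \<le> (R + \<alpha>) / (\<alpha> + 1)" using alpha_pos by (simp add: kap_def divide_right_mono)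
  finally have "0 + a \<in> setM R F \<alpha>" unfolding setM_def
    by (intro set_plus_intro IntI) (use ab(2) nshift_nonneg[OF ab(2)] in \<open>auto simp: nshift_def intro: rev_image_eqI[of 0]\<close>)
  hence "a \<in> setM R F \<alpha>" by simp
  thus ?thesis unfolding ab(1) using ab(3) by (rule set_plus_intro)
qed

lemma S0_zero: "0 \<in> S0" unfolding S0_def by (auto intro: exI[of _ "\<lambda>_. 0"])

lemma S0_add: "s \<in> S0 \<Longrightarrow> t \<in> S0 \<Longrightarrow> s + t \<in> S0"
proof -
  assume s: "s \<in> S0" and t: "t \<in> S0"
  from s obtain k where k: "s = (\<Sum>\<mu>\<in>Pq. (\<alpha> - \<mu>) * kap * real (k \<mu>))" by (auto simp: S0_def)
  from t obtain l where l: "t = (\<Sum>\<mu>\<in>Pq. (\<alpha> - \<mu>) * kap * real (l \<mu>))" by (auto simp: S0_def)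
  have "s + t = (\<Sum>\<mu>\<in>Pq. (\<alpha> - \<mu>) * kap * real (k \<mu> + l \<mu>))"
    unfolding k l sum.distrib[symmetric] by (intro sum.cong refl) (simp add: distrib_left)
  thus ?thesis unfolding S0_def by (auto intro: exI[of _ "\<lambda>\<mu>. k \<mu> + l \<mu>"])
qed

lemma S0_nshift: "S0 \<subseteq> nshift"
proof
  fix s assume "s \<in> S0"
  then obtain k where k: "s = (\<Sum>\<mu>\<in>Pq. (\<alpha> - \<mu>) * kap * real (k \<mu>))" by (auto simp: S0_def)
  have "(\<Sum>\<mu>\<in>poleset R F. (\<alpha> - \<mu>) * kap * real (if \<mu> \<in> Pq then k \<mu> else 0)) =
      (\<Sum>\<mu>\<in>Pq. (\<alpha> - \<mu>) * kap * real (if \<mu> \<in> Pq then k \<mu> else 0))"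
    using Pp(3) Pq(2) by (intro sum.mono_neutral_right finite_poleset) auto
  also have "\<dots> = s" unfolding k by (intro sum.cong) auto
  finally have "s = (\<Sum>\<mu>\<in>poleset R F. (\<alpha> - \<mu>) * kap * real (if \<mu> \<in> Pq then k \<mu> else 0))" by simp
  thus "s \<in> nshift" unfolding nshift_eq
    by (intro CollectI exI[of _ "\<lambda>\<mu>. if \<mu> \<in> Pq then k \<mu> else 0"] conjI TrueI)
qed

lemma S0_base: "\<nu> \<in> Pp \<Longrightarrow> (\<alpha> - \<nu>) * kap \<in> S0"
proof (cases "\<nu> = \<alpha>")
  case False
  assume "\<nu> \<in> Pp"
  hence \<nu>: "\<nu> \<in> Pq" using False by (simp add: Pq_def)
  have "(\<Sum>\<mu>\<in>Pq. (\<alpha> - \<mu>) * kap * real (if \<mu> = \<nu> then 1 else 0)) =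
      (\<Sum>\<mu>\<in>Pq. if \<mu> = \<nu> then (\<alpha> - \<mu>) * kap else 0)" by (intro sum.cong) auto
  also have "\<dots> = (\<alpha> - \<nu>) * kap" using \<nu> Pq(1) by simp
  finally have "(\<alpha> - \<nu>) * kap = (\<Sum>\<mu>\<in>Pq. (\<alpha> - \<mu>) * kap * real (if \<mu> = \<nu> then 1 else 0))" by simp
  thus ?thesis unfolding S0_def
    by (intro CollectI exI[of _ "\<lambda>\<mu>. if \<mu> = \<nu> then 1 else 0"] conjI TrueI)
qed (simp add: S0_zero)

sublocale X0: scale sequentially "\<lambda>n. 1 / real n" "GX S0"
  by (rule scale_X) (use S0_zero S0_add S0_nshift nshift_nonneg in auto)

sublocale X: scale sequentially "\<lambda>n. 1 / real n" "GX Sx"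
  by (rule scale_X) (use Sx_nshift[OF nshift_zero] Sx_add Sx_nonneg in auto)

lemma X0_X: "g \<in> X0.cls T \<Longrightarrow> g \<in> X.cls T"
proof -
  assume "g \<in> X0.cls T"
  then obtain p where p: "p \<in> espan (GX S0)" "X0.ord T (\<lambda>a. g a - p a)" by (rule X0.clsE)
  have "(\<lambda>n. p n) \<in> espan (GX Sx)"
    by (rule espan_map[OF _ p(1)]) (use S0_nshift Sx_nshift in \<open>auto simp: GX_def\<close>)
  thus ?thesis using p(2) by (intro X.clsI)
qed

lemma ord_mon: "X.ord s (mon s)"
proof (rule X.ordI[of _ 1])
  show "\<forall>\<^sub>F n in sequentially. norm (mon s n) \<le> 1 * (1 / real n) powr s"
    using eventually_gt_at_top[of 0] by eventually_elim (simp only: norm_mon)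
qed

subsection \<open>The saddle point\<close>

definition aa :: "real \<Rightarrow> real" where "aa \<nu> = Re (acoef \<nu>)"

lemma acoef_Pp: "\<nu> \<in> Pp \<Longrightarrow> acoef \<nu> = of_real (aa \<nu>)"
  using Im_acoef[of \<nu>] by (auto simp: Pp_def aa_def complex_eq_iff)

lemma aa_alpha: "aa \<alpha> > 0" using acoef_alpha(2) by (simp add: aa_def)

text \<open>The limit of the rescaled saddle points: the solution of w^{\<alpha>+1} = \<alpha>
  a_\<alpha>, in which only the pole \<alpha> is left.\<close>

definition winf :: real where "winf = (\<alpha> * aa \<alpha>) powr kap"

lemma winf: "winf > 0" "winf powr (\<alpha> + 1) = \<alpha> * aa \<alpha>"
proof -
  have p: "\<alpha> * aa \<alpha> > 0" using aa_alpha alpha_pos by simp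
  thus "winf > 0" unfolding winf_def by (simp only: powr_gt_zero)
  show "winf powr (\<alpha> + 1) = \<alpha> * aa \<alpha>"
    unfolding winf_def powr_powr using kap(2) p by (simp add: mult.commute)
qed

text \<open>With \<open>\<rho> = n powr - kap * w\<close> the stationarity condition \<open>(logG f)' \<rho> = - n\<close> becomes, up to the terms
  without influence, \<open>w powr (\<alpha> + 1) = sbase n w\<close>.\<close>

definition sbase :: "nat \<Rightarrow> real \<Rightarrow> real" where
  "sbase n x = \<alpha> * aa \<alpha> + (\<Sum>\<nu>\<in>Pq. \<nu> * aa \<nu> * real n powr - ((\<alpha> - \<nu>) * kap) * x powr (\<alpha> - \<nu>))"

text \<open>The range is imposed for every n, so that positivity is available without restriction;
  the equation can be solved only for large n.\<close>

definition ww :: "nat \<Rightarrow> real" where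
  "ww = (SOME w. (\<forall>n. winf / 2 \<le> w n \<and> w n \<le> 2 * winf) \<and>
      (\<forall>\<^sub>F n in sequentially. w n powr (\<alpha> + 1) = sbase n (w n)))"

lemma tendsto_npow: "d > 0 \<Longrightarrow> (\<lambda>n. real n powr - d) \<longlonglongrightarrow> 0"
  by (rule tendsto_neg_powr[OF _ filterlim_real_sequentially]) simp

lemma sbase_tendsto: 
  assumes "\<And>n. winf / 2 \<le> x n \<and> x n \<le> 2 * winf"
  shows "(\<lambda>n. sbase n (x n)) \<longlonglongrightarrow> \<alpha> * aa \<alpha>"
proof -
  have "(\<lambda>n. sbase n (x n)) \<longlonglongrightarrow> \<alpha> * aa \<alpha> + (\<Sum>\<nu>\<in>Pq. 0)"
    unfolding sbase_def
  proof (intro tendsto_add tendsto_const tendsto_sum)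
    fix \<nu> assume \<nu>: "\<nu> \<in> Pq"
    hence d: "(\<alpha> - \<nu>) * kap > 0" using Pq(4)[of \<nu>] kap by simp
    show "(\<lambda>n. \<nu> * aa \<nu> * real n powr - ((\<alpha> - \<nu>) * kap) * x n powr (\<alpha> - \<nu>)) \<longlonglongrightarrow> 0"
    proof (rule Lim_null_comparison)
      show "\<forall>\<^sub>F n in sequentially. norm (\<nu> * aa \<nu> * real n powr - ((\<alpha> - \<nu>) * kap) * x n powr (\<alpha> - \<nu>)) \<le>
          \<bar>\<nu> * aa \<nu>\<bar> * real n powr - ((\<alpha> - \<nu>) * kap) * (2 * winf) powr (\<alpha> - \<nu>)"
      proof (rule always_eventually, rule allI)
        fix n
        have "0 \<le> x n" using assms[of n] winf by linarith
        hence "x n powr (\<alpha> - \<nu>) \<le> (2 * winf) powr (\<alpha> - \<nu>)"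
          using assms[of n] Pq(4)[OF \<nu>] by (intro powr_mono2) auto
        thus "norm (\<nu> * aa \<nu> * real n powr - ((\<alpha> - \<nu>) * kap) * x n powr (\<alpha> - \<nu>)) \<le>
          \<bar>\<nu> * aa \<nu>\<bar> * real n powr - ((\<alpha> - \<nu>) * kap) * (2 * winf) powr (\<alpha> - \<nu>)"
          unfolding real_norm_def abs_mult by (simp add: mult_left_mono)
      qed
      show "(\<lambda>n. \<bar>\<nu> * aa \<nu>\<bar> * real n powr - ((\<alpha> - \<nu>) * kap) * (2 * winf) powr (\<alpha> - \<nu>)) \<longlonglongrightarrow> 0"
        using tendsto_mult_left_zero[OF tendsto_mult_right_zero[OF tendsto_npow[OF d]]] .
    qed
  qed
  thus ?thesis by simp
qed

text \<open>The right-hand side tends to winf^{\<alpha>+1}, which lies strictly between the values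
  of w^{\<alpha>+1} at winf/2 and 2 winf, so the intermediate value theorem applies for large
  n.\<close>

lemma ww_exists:
  "\<exists>w. (\<forall>n. winf / 2 \<le> w n \<and> w n \<le> 2 * winf) \<and> (\<forall>\<^sub>F n in sequentially. w n powr (\<alpha> + 1) = sbase n (w n))"
proof -
  have a1: "\<alpha> + 1 > 0" using alpha_pos by simp
  have "\<forall>\<^sub>F n in sequentially. sbase n (winf / 2) > (winf / 2) powr (\<alpha> + 1)"
    by (rule order_tendstoD(1)[OF sbase_tendsto]) (use winf a1 powr_less_mono2[of "\<alpha> + 1" "winf / 2" winf] in auto)
  moreover have "\<forall>\<^sub>F n in sequentially. sbase n (2 * winf) < (2 * winf) powr (\<alpha> + 1)"
    by (rule order_tendstoD(2)[OF sbase_tendsto]) (use winf a1 powr_less_mono2[of "\<alpha> + 1" winf "2 * winf"] in auto)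
  ultimately have ev: "\<forall>\<^sub>F n in sequentially. \<exists>x. (winf / 2 \<le> x \<and> x \<le> 2 * winf) \<and> x powr (\<alpha> + 1) = sbase n x"
  proof eventually_elim
    case (elim n)
    have "\<exists>x\<ge>winf / 2. x \<le> 2 * winf \<and> x powr (\<alpha> + 1) - sbase n x = 0"
    proof (rule IVT')
      show "continuous_on {winf / 2..2 * winf} (\<lambda>x. x powr (\<alpha> + 1) - sbase n x)"
        unfolding sbase_def by (intro continuous_intros) (use winf in auto)
    qed (use elim winf in auto)
    thus ?case by auto
  qed
  define w where "w = (\<lambda>n. if \<exists>x. (winf / 2 \<le> x \<and> x \<le> 2 * winf) \<and> x powr (\<alpha> + 1) = sbase n x
    then SOME x. (winf / 2 \<le> x \<and> x \<le> 2 * winf) \<and> x powr (\<alpha> + 1) = sbase n x else winf)"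
  have 1: "(winf / 2 \<le> w n \<and> w n \<le> 2 * winf) \<and> w n powr (\<alpha> + 1) = sbase n (w n)"
    if "\<exists>x. (winf / 2 \<le> x \<and> x \<le> 2 * winf) \<and> x powr (\<alpha> + 1) = sbase n x" for n
    using someI_ex[OF that] that unfolding w_def by simp
  have "winf / 2 \<le> w n \<and> w n \<le> 2 * winf" for n
  proof (cases "\<exists>x. (winf / 2 \<le> x \<and> x \<le> 2 * winf) \<and> x powr (\<alpha> + 1) = sbase n x")
    case False
    hence "w n = winf" unfolding w_def by (rule if_not_P)
    thus ?thesis using winf by simp
  qed (use 1 in blast)
  moreover have "\<forall>\<^sub>F n in sequentially. w n powr (\<alpha> + 1) = sbase n (w n)"
    using ev by eventually_elim (use 1 in blast)
  ultimately show ?thesis by blast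
qed

lemma ww_range: "winf / 2 \<le> ww n" "ww n \<le> 2 * winf" "ww n > 0"
  and ww_eq: "\<forall>\<^sub>F n in sequentially. ww n powr (\<alpha> + 1) = sbase n (ww n)"
proof -
  note * = someI_ex[OF ww_exists, folded ww_def]
  show "winf / 2 \<le> ww n" "ww n \<le> 2 * winf" using * by auto
  thus "ww n > 0" using winf by linarith
  show "\<forall>\<^sub>F n in sequentially. ww n powr (\<alpha> + 1) = sbase n (ww n)" using * by simp
qed

lemma ww_eq': "\<forall>\<^sub>F n in sequentially. ww n = sbase n (ww n) powr kap"
  using ww_eq
proof eventually_elim
  case (elim n)
  have "(ww n powr (\<alpha> + 1)) powr kap = ww n" using ww_range(3)[of n] by (simp only: powr_powr kap(2) powr_one)
  thus ?case unfolding elim by simp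
qed

lemma ww_tendsto: "ww \<longlonglongrightarrow> winf"
proof -
  have "(\<lambda>n. sbase n (ww n) powr kap) \<longlonglongrightarrow> winf"
    unfolding winf_def
    by (rule tendsto_powr[OF sbase_tendsto tendsto_const]) (use ww_range aa_alpha alpha_pos in auto)
  thus ?thesis by (rule Lim_transform_eventually) (use ww_eq' in \<open>eventually_elim, simp\<close>)
qed

text \<open>Bootstrapping through w = \<open>sbase\<close>^{1/(\<alpha>+1)}. In \<open>sbase\<close>
  each occurrence of w carries a factor of order at least \<delta>, so accuracy k\<delta> on the
  right becomes accuracy (k+1)\<delta> on the left; boundedness of w starts the induction.\<close>

lemma ww_cls: "(\<lambda>n. of_real (ww n)) \<in> X0.cls T"
proof -
  \<comment> \<open>The least gap between \<alpha> and the other positive poles, scaled; the element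
    1 keeps the minimum meaningful when there are none.\<close>
  define \<delta> where "\<delta> = Min (insert 1 ((\<lambda>\<nu>. (\<alpha> - \<nu>) * kap) ` Pq))"
  have \<delta>: "\<delta> > 0" "\<And>\<nu>. \<nu> \<in> Pq \<Longrightarrow> \<delta> \<le> (\<alpha> - \<nu>) * kap"
    unfolding \<delta>_def using Pq kap(1) by auto
  have main: "(\<lambda>n. of_real (ww n)) \<in> X0.cls (real k * \<delta>)" for k
  proof (induction k)
    case 0
    show ?case by simp (rule X0.cls_ord[OF X0.tendsto_ord_0[OF tendsto_of_real[OF ww_tendsto]]])
  next
    case (Suc k)
    have 1: "(\<lambda>n. of_real (ww n powr q)) \<in> X0.cls (real k * \<delta>)" for q
    proof (cases "k = 0")
      case True
      have "(\<lambda>n. ww n powr q) \<longlonglongrightarrow> winf powr q" by (rule tendsto_powr[OF ww_tendsto tendsto_const]) (use winf in auto)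
      thus ?thesis unfolding True by simp (rule X0.cls_ord[OF X0.tendsto_ord_0[OF tendsto_of_real]])
    next
      case False
      thus ?thesis using \<delta>(1) by (intro X0.cls_powr_real[OF Suc.IH _ ww_tendsto winf(1)]) auto
    qed
    have 2: "(\<lambda>n. of_real (\<alpha> * aa \<alpha>) + (\<Sum>\<nu>\<in>Pq. of_real (\<nu> * aa \<nu>) * (mon ((\<alpha> - \<nu>) * kap) n * of_real (ww n powr (\<alpha> - \<nu>)))))
        \<in> X0.cls (real (Suc k) * \<delta>)"
    proof (intro X0.cls_add X0.cls_const X0.cls_sum X0.cls_cmult)
      fix \<nu> assume \<nu>: "\<nu> \<in> Pq"
      have "mon ((\<alpha> - \<nu>) * kap) \<in> GX S0" using S0_base[of \<nu>] \<nu> Pq(2) by (auto simp: GX_def)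
      from X0.cls_shift[OF this X0.ord_mono[OF ord_mon \<delta>(2)[OF \<nu>]] 1]
      show "(\<lambda>n. mon ((\<alpha> - \<nu>) * kap) n * of_real (ww n powr (\<alpha> - \<nu>))) \<in> X0.cls (real (Suc k) * \<delta>)"
        by (simp add: distrib_right add.commute)
    qed (use \<delta> in simp)
    have 3: "(\<lambda>n. of_real (sbase n (ww n))) \<in> X0.cls (real (Suc k) * \<delta>)"
    proof (rule X0.cls_cong[OF _ 2])
      show "\<forall>\<^sub>F n in sequentially. complex_of_real (sbase n (ww n)) = of_real (\<alpha> * aa \<alpha>) + (\<Sum>\<nu>\<in>Pq. of_real (\<nu> * aa \<nu>) * (mon ((\<alpha> - \<nu>) * kap) n * of_real (ww n powr (\<alpha> - \<nu>))))"
        using eventually_gt_at_top[of 0] by eventually_elim (simp add: sbase_def mon_eq mult.assoc)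
    qed
    have "(\<lambda>n. of_real (sbase n (ww n) powr kap)) \<in> X0.cls (real (Suc k) * \<delta>)"
      by (rule X0.cls_powr_real[OF 3 _ sbase_tendsto]) (use \<delta> ww_range aa_alpha alpha_pos in auto)
    thus ?case by (rule X0.cls_cong[rotated]) (use ww_eq' in \<open>eventually_elim, simp\<close>)
  qed
  define k where "k = nat \<lceil>T / \<delta>\<rceil>"
  have "real k \<ge> T / \<delta>" unfolding k_def by linarith
  hence "real k * \<delta> \<ge> T" using \<delta>(1) by (simp add: field_simps)
  thus ?thesis by (rule X0.cls_mono[OF main])
qed

end


subsection \<open>Integrals against the Gaussian weight\<close>

lemma gauss_even_integral:
  "\<exists>M. ((\<lambda>v::real. exp (- v\<^sup>2) * v ^ (2 * k)) has_integral M) UNIV \<and> (k = 0 \<longrightarrow> M = sqrt pi)"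
proof -
  have "has_bochner_integral lborel (\<lambda>v::real. exp (- v\<^sup>2) * v ^ (2 * k)) (2 *\<^sub>R ((sqrt pi / 2) * (fact (2 * k) / (2 ^ (2 * k) * fact k))))"
    by (rule has_bochner_integral_even_function[OF gaussian_moment_even_pos]) simp
  hence "((\<lambda>v::real. exp (- v\<^sup>2) * v ^ (2 * k)) has_integral (2 *\<^sub>R ((sqrt pi / 2) * (fact (2 * k) / (2 ^ (2 * k) * fact k))))) UNIV"
    using has_integral_integral_lborel[of "\<lambda>v::real. exp (- v\<^sup>2) * v ^ (2 * k)"]
    by (simp add: has_bochner_integral_iff)
  moreover have "k = 0 \<longrightarrow> 2 *\<^sub>R ((sqrt pi / 2) * (fact (2 * k) / (2 ^ (2 * k) * fact k))) = sqrt pi" by auto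
  ultimately show ?thesis by (intro exI conjI)
qed

text \<open>Markov's inequality for moments: outside [-V, V] one has v^{2j} \<ge> V^{2j}.\<close>

lemma gauss_tail:
  assumes "((\<lambda>v::real. exp (- v\<^sup>2) * v ^ (2 * k)) has_integral M) UNIV"
    "((\<lambda>v::real. exp (- v\<^sup>2) * v ^ (2 * (k + j))) has_integral M') UNIV" "V > 0"
  shows "\<bar>integral {-V..V} (\<lambda>v. exp (- v\<^sup>2) * v ^ (2 * k)) - M\<bar> \<le> M' / V ^ (2 * j)"
proof -
  let ?f = "\<lambda>v::real. exp (- v\<^sup>2) * v ^ (2 * k)"
  let ?I = "integral {-V..V} ?f"
  have pos': "exp (- v\<^sup>2) * v ^ (2 * k) \<ge> 0" for k and v :: real by (simp add: zero_le_even_power)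
  have "(?f has_integral ?I) {-V..V}"
    by (intro integrable_integral integrable_continuous_interval continuous_intros)
  hence r: "((\<lambda>v. if v \<in> {-V..V} then ?f v else 0) has_integral ?I) UNIV"
    by (simp only: has_integral_restrict_UNIV)
  have 1: "?I \<le> M"
  proof (rule has_integral_le[OF r assms(1)])
    fix v :: real
    show "(if v \<in> {-V..V} then ?f v else 0) \<le> ?f v" using pos'[of v k] by simp
  qed
  have 2: "M \<le> ?I + M' / V ^ (2 * j)"
  proof (rule has_integral_le[OF assms(1) has_integral_add[OF r has_integral_divide[OF assms(2)]]])
    fix v :: real
    show "?f v \<le> (if v \<in> {-V..V} then ?f v else 0) + exp (- v\<^sup>2) * v ^ (2 * (k + j)) / V ^ (2 * j)"
    proof (cases "v \<in> {-V..V}")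
      case True thus ?thesis using pos'[of v "k + j"] assms(3) by simp
    next
      case False
      hence "V \<le> \<bar>v\<bar>" by auto
      hence "V ^ (2 * j) \<le> \<bar>v\<bar> ^ (2 * j)" using assms(3) by (intro power_mono) auto
      hence "V ^ (2 * j) \<le> v ^ (2 * j)" by (simp add: power_even_abs)
      hence "?f v * V ^ (2 * j) \<le> ?f v * v ^ (2 * j)" using pos' by (intro mult_left_mono)
      thus ?thesis unfolding if_not_P[OF False] using assms(3) by (simp add: field_simps power_add distrib_left)
    qed
  qed
  show ?thesis using 1 2 by linarith
qed

section \<open>Expansions in n and the rescaled angle v\<close>

context partition_setting
begin

text \<open>The half-width of the major arc in units of the Gaussian width. It grows, so the cut-off
  tails are smaller than any power of n; and \<open>Vn\<close> cubed times \<open>mu\<close> still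
  decays like n^{-\<alpha> kap / 4}, so the cubic term of the exponent is small on the whole
  window.\<close>

definition Vn :: "nat \<Rightarrow> real" where "Vn n = real n powr (\<alpha> * kap / 12)"
definition mu :: "nat \<Rightarrow> real" where "mu n = real n powr - (\<alpha> * kap / 2)"

text \<open>Pairs (n, v) with n tending to infinity and |v| \<le> \<open>Vn n\<close>: statements
  along this filter hold for large n uniformly in v (\<open>eventually_FY\<close>), which lets the
  theory of \<open>scale\<close> be applied unchanged.\<close>

definition FY :: "(nat \<times> real) filter" where
  "FY = inf (filtercomap fst sequentially) (principal {a. \<bar>snd a\<bar> \<le> Vn (fst a)})"

definition ymon :: "real \<Rightarrow> nat \<Rightarrow> nat \<Rightarrow> nat \<times> real \<Rightarrow> complex" where
  "ymon s p q a = mon s (fst a) * of_real (snd a ^ p * mu (fst a) ^ q)"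

text \<open>The condition p \<le> 3q makes v^p mu^q decay like n^{-\<alpha> kap q / 4} on the
  window, and the cubic Taylor term is its extreme case. The parity condition makes q even whenever
  p is, so surviving Gaussian moments come with integral powers of n^{-\<alpha> kap}.\<close>

definition GY :: "(nat \<times> real \<Rightarrow> complex) set" where
  "GY = {ymon s p q |s p q. s \<in> Sx \<and> p \<le> 3 * q \<and> even (p + q)}"

lemma eventually_FY: "eventually P FY \<longleftrightarrow> (\<forall>\<^sub>F n in sequentially. \<forall>v. \<bar>v\<bar> \<le> Vn n \<longrightarrow> P (n, v))"
  (is "?l \<longleftrightarrow> ?r")
proof
  assume ?l
  then obtain Q where Q: "eventually Q sequentially" "\<forall>a. Q (fst a) \<longrightarrow> \<bar>snd a\<bar> \<le> Vn (fst a) \<longrightarrow> P a"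
    by (auto simp: FY_def eventually_inf_principal eventually_filtercomap)
  show ?r using Q(1) by eventually_elim (use Q(2) in auto)
next
  assume ?r
  thus ?l unfolding FY_def eventually_inf_principal eventually_filtercomap
    by (intro exI[of _ "\<lambda>n. \<forall>v. \<bar>v\<bar> \<le> Vn n \<longrightarrow> P (n, v)"] conjI) auto
qed

lemma eventually_FY_fst: "eventually P sequentially \<Longrightarrow> eventually (\<lambda>a. P (fst a)) FY"
  unfolding eventually_FY by (erule eventually_mono) simp

lemma tendsto_FY_fst:
  fixes g :: "nat \<Rightarrow> 'b::topological_space"
  shows "(g \<longlongrightarrow> l) sequentially \<Longrightarrow> ((\<lambda>a. g (fst a)) \<longlongrightarrow> l) FY"
  by (intro topological_tendstoI eventually_FY_fst) (rule topological_tendstoD)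

lemma mu_pos: "n > 0 \<Longrightarrow> mu n > 0" and Vn_pos: "n > 0 \<Longrightarrow> Vn n \<ge> 1" and Vn_nonneg: "Vn n \<ge> 0"
  unfolding mu_def Vn_def using kap ge_one_powr_ge_zero[of "real n" "\<alpha> * kap / 12"] by auto

lemma norm_ymon:
  assumes "n > 0" "\<bar>v\<bar> \<le> Vn n" "p \<le> 3 * q"
  shows "norm (ymon s p q (n, v)) \<le> (1 / real n) powr (s + \<alpha> * kap / 4 * real q)"
proof -
  have n: "real n > 0" using assms(1) by simp
  have "\<bar>v\<bar> ^ p \<le> Vn n ^ p" using assms by (intro power_mono) auto
  also have "\<dots> \<le> Vn n ^ (3 * q)" using Vn_pos[OF assms(1)] assms(3) by (intro power_increasing)
  finally have "\<bar>v\<bar> ^ p * mu n ^ q \<le> Vn n ^ (3 * q) * mu n ^ q"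
    using mu_pos[OF assms(1)] by (intro mult_right_mono) auto
  also have "\<dots> = ((real n powr (\<alpha> * kap / 12)) ^ 3 * real n powr - (\<alpha> * kap / 2)) ^ q"
    by (simp add: Vn_def mu_def power_mult power_mult_distrib)
  also have "(real n powr (\<alpha> * kap / 12)) ^ 3 = real n powr (\<alpha> * kap / 12 * 3)"
    using n by (simp add: powr_power)
  also have "\<dots> * real n powr - (\<alpha> * kap / 2) = real n powr - (\<alpha> * kap / 4)"
    unfolding powr_add[symmetric] by simp
  also have "\<dots> = (1 / real n) powr (\<alpha> * kap / 4)"
    by (simp add: powr_divide powr_minus_divide)
  also have "\<dots> ^ q = (1 / real n) powr (\<alpha> * kap / 4 * real q)"
    using n by (simp add: powr_power mult_ac)
  finally have "\<bar>v\<bar> ^ p * mu n ^ q \<le> (1 / real n) powr (\<alpha> * kap / 4 * real q)" .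
  hence "(1 / real n) powr s * (\<bar>v\<bar> ^ p * mu n ^ q) \<le> (1 / real n) powr s * (1 / real n) powr (\<alpha> * kap / 4 * real q)"
    by (rule mult_left_mono) simp
  moreover have "norm (ymon s p q (n, v)) = (1 / real n) powr s * (\<bar>v\<bar> ^ p * mu n ^ q)"
    using mu_pos[OF assms(1)] by (simp add: ymon_def norm_mult norm_mon[OF assms(1)] norm_power abs_mult power_abs)
  ultimately show ?thesis by (simp add: powr_add)
qed

lemma ymon_ord: "p \<le> 3 * q \<Longrightarrow> \<forall>\<^sub>F a in FY. norm (ymon s p q a) \<le> 1 * (1 / real (fst a)) powr (s + \<alpha> * kap / 4 * real q)"
  unfolding eventually_FY
  using eventually_gt_at_top[of 0] by (rule eventually_mono) (use norm_ymon in auto)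

sublocale Y: scale FY "\<lambda>a. 1 / real (fst a)" GY
proof
  show "FY \<noteq> bot"
  proof
    assume "FY = bot"
    hence "eventually (\<lambda>_. False) FY" by simp
    hence "\<forall>\<^sub>F n in sequentially. \<forall>v. \<not> \<bar>v\<bar> \<le> Vn n" unfolding eventually_FY by simp
    then obtain n where "\<forall>v. \<not> \<bar>v\<bar> \<le> Vn n" by (auto simp: eventually_sequentially)
    thus False using Vn_nonneg[of n] by (auto dest: spec[of _ 0])
  qed
  show "\<forall>\<^sub>F a in FY. 0 < 1 / real (fst a) \<and> 1 / real (fst a) \<le> 1" by (rule eventually_FY_fst[OF X.e_pos])
  show "((\<lambda>a. 1 / real (fst a)) \<longlongrightarrow> 0) FY" by (rule tendsto_FY_fst[OF X.e_lim])
  have "(\<lambda>_. 1) = ymon 0 0 0" by (simp add: ymon_def mon_def fun_eq_iff)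
  thus "(\<lambda>_. 1) \<in> GY" unfolding GY_def using Sx_nshift[OF nshift_zero] by fastforce
  show "(\<lambda>a. m a * m' a) \<in> GY" if mm: "m \<in> GY" "m' \<in> GY" for m m'
  proof -
    obtain s p q where 1: "m = ymon s p q" "s \<in> Sx" "p \<le> 3 * q" "even (p + q)" using mm(1) unfolding GY_def by blast
    obtain s' p' q' where 2: "m' = ymon s' p' q'" "s' \<in> Sx" "p' \<le> 3 * q'" "even (p' + q')" using mm(2) unfolding GY_def by blast
    have "(\<lambda>a. m a * m' a) = ymon (s + s') (p + p') (q + q')"
      unfolding 1 2 ymon_def fun_eq_iff mon_mult[OF Sx_nonneg[OF 1(2)] Sx_nonneg[OF 2(2)], symmetric]
      by (simp add: power_add mult_ac)
    moreover have "s + s' \<in> Sx" "p + p' \<le> 3 * (q + q')" "even ((p + p') + (q + q'))"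
      using 1 2 Sx_add by auto
    ultimately show ?thesis unfolding GY_def by blast
  qed
  show "m = (\<lambda>_. 1) \<or> (\<exists>\<delta>>0. \<exists>K. \<forall>\<^sub>F a in FY. norm (m a) \<le> K * (1 / real (fst a)) powr \<delta>)" if mm: "m \<in> GY" for m
  proof -
    obtain s p q where 1: "m = ymon s p q" "s \<in> Sx" "p \<le> 3 * q" "even (p + q)" using mm unfolding GY_def by blast
    show ?thesis
    proof (cases "s = 0 \<and> q = 0")
      case True
      thus ?thesis using 1 by (simp add: ymon_def mon_def fun_eq_iff)
    next
      case False
      have "s + \<alpha> * kap / 4 * real q > 0"
        using False Sx_nonneg[OF 1(2)] kap(4) by (cases "q = 0") (auto intro!: add_nonneg_pos)
      thus ?thesis using ymon_ord[OF 1(3), of s] 1(1) by blast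
    qed
  qed
qed

lemma ord_ymon: "p \<le> 3 * q \<Longrightarrow> Y.ord (s + \<alpha> * kap / 4 * real q) (ymon s p q)"
  by (rule Y.ordI[OF ymon_ord])

lemma XY_ord: "X.ord T g \<Longrightarrow> Y.ord T (\<lambda>a. g (fst a))"
proof -
  assume "X.ord T g"
  then obtain K where "\<forall>\<^sub>F n in sequentially. norm (g n) \<le> K * (1 / real n) powr T" by (rule X.ordE)
  thus ?thesis by (intro Y.ordI[OF eventually_FY_fst])
qed

lemma XY_cls: "g \<in> X.cls T \<Longrightarrow> (\<lambda>a. g (fst a)) \<in> Y.cls T"
proof -
  assume "g \<in> X.cls T"
  then obtain p where p: "p \<in> espan (GX Sx)" "X.ord T (\<lambda>a. g a - p a)" by (rule X.clsE)
  have "(\<lambda>a. p (fst a)) \<in> espan GY"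
  proof (rule espan_map[OF _ p(1)])
    fix m assume "m \<in> GX Sx"
    then obtain s where s: "s \<in> Sx" "m = mon s" by (auto simp: GX_def)
    have "(\<lambda>a. m (fst a)) = ymon s 0 0" by (simp add: s ymon_def fun_eq_iff)
    thus "(\<lambda>a. m (fst a)) \<in> GY" unfolding GY_def using s(1) by fastforce
  qed
  thus ?thesis using XY_ord[OF p(2)] by (intro Y.clsI)
qed

definition IG :: "nat \<Rightarrow> (nat \<times> real \<Rightarrow> complex) \<Rightarrow> complex" where
  "IG n E = integral {- Vn n..Vn n} (\<lambda>v. of_real (exp (- v\<^sup>2)) * E (n, v))"

lemma IG_add:
  fixes c :: complex
  assumes "continuous_on {- Vn n..Vn n} (\<lambda>v. g (n, v))" "continuous_on {- Vn n..Vn n} (\<lambda>v. h (n, v))"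
  shows "IG n (\<lambda>a. c * g a + h a) = c * IG n g + IG n h"
proof -
  have i: "(\<lambda>v. of_real (exp (- v\<^sup>2)) * g (n, v)) integrable_on {- Vn n..Vn n}"
    "(\<lambda>v. of_real (exp (- v\<^sup>2)) * h (n, v)) integrable_on {- Vn n..Vn n}"
    by (intro integrable_continuous_interval continuous_intros assms)+
  have "IG n (\<lambda>a. c * g a + h a) = integral {- Vn n..Vn n} (\<lambda>v. c * (of_real (exp (- v\<^sup>2)) * g (n, v)) + of_real (exp (- v\<^sup>2)) * h (n, v))"
    unfolding IG_def by (simp add: algebra_simps)
  also have "\<dots> = integral {- Vn n..Vn n} (\<lambda>v. c * (of_real (exp (- v\<^sup>2)) * g (n, v))) + IG n h"
    unfolding IG_def by (rule integral_add) (use i integrable_on_mult_right in auto)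
  also have "integral {- Vn n..Vn n} (\<lambda>v. c * (of_real (exp (- v\<^sup>2)) * g (n, v))) = c * IG n g"
    unfolding IG_def by simp
  finally show ?thesis .
qed

lemma gauss_Vn:
  "\<exists>M. (\<forall>T. X.ord T (\<lambda>n. of_real (integral {- Vn n..Vn n} (\<lambda>v. exp (- v\<^sup>2) * v ^ (2 * k)) - M))) \<and>
    (k = 0 \<longrightarrow> M = sqrt pi)"
proof -
  obtain M where M: "((\<lambda>v::real. exp (- v\<^sup>2) * v ^ (2 * k)) has_integral M) UNIV" "k = 0 \<longrightarrow> M = sqrt pi"
    using gauss_even_integral by blast
  have "X.ord T (\<lambda>n. of_real (integral {- Vn n..Vn n} (\<lambda>v. exp (- v\<^sup>2) * v ^ (2 * k)) - M))" for T
  proof -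
    define j where "j = nat \<lceil>6 * T / (\<alpha> * kap)\<rceil>"
    have "real j \<ge> 6 * T / (\<alpha> * kap)" unfolding j_def by linarith
    hence j: "\<alpha> * kap / 12 * real (2 * j) \<ge> T" using kap(4) by (simp add: field_simps)
    obtain M' where M': "((\<lambda>v::real. exp (- v\<^sup>2) * v ^ (2 * (k + j))) has_integral M') UNIV"
      using gauss_even_integral by blast
    have "X.ord (\<alpha> * kap / 12 * real (2 * j)) (\<lambda>n. of_real (integral {- Vn n..Vn n} (\<lambda>v. exp (- v\<^sup>2) * v ^ (2 * k)) - M))"
    proof (rule X.ordI[of _ M'])
      show "\<forall>\<^sub>F n in sequentially. norm (complex_of_real (integral {- Vn n..Vn n} (\<lambda>v. exp (- v\<^sup>2) * v ^ (2 * k)) - M)) \<le> M' * (1 / real n) powr (\<alpha> * kap / 12 * real (2 * j))"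
        using eventually_gt_at_top[of 0]
      proof eventually_elim
        case (elim n)
        have "Vn n > 0" using Vn_pos[OF elim] by linarith
        from gauss_tail[OF M(1) M' this]
        have "norm (complex_of_real (integral {- Vn n..Vn n} (\<lambda>v. exp (- v\<^sup>2) * v ^ (2 * k)) - M)) \<le> M' / Vn n ^ (2 * j)"
          by (simp only: norm_of_real)
        also have "Vn n ^ (2 * j) = real n powr (\<alpha> * kap / 12 * real (2 * j))"
          using elim by (simp add: Vn_def powr_power mult_ac)
        finally show ?case by (simp add: powr_divide)
      qed
    qed
    thus ?thesis by (rule X.ord_mono[OF _ j])
  qed
  thus ?thesis using M(2) by (intro exI[of _ M] conjI allI)
qed

lemma continuous_ymon: "continuous_on S (\<lambda>v. ymon s p q (n, v))"
  unfolding ymon_def by (simp, intro continuous_intros)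

text \<open>Odd p integrate to 0 by symmetry. For even p also q = 2r is even, mu^q equals
  n^{-\<alpha> kap r}, and the truncated moment is constant up to any power of n; the exponent
  remains in \<open>Sx\<close>.\<close>

lemma IG_ymon:
  assumes "s \<in> Sx" "p \<le> 3 * q" "even (p + q)" "T \<ge> 0"
  shows "(\<lambda>n. IG n (ymon s p q)) \<in> X.cls T"
proof -
  have eq: "IG n (ymon s p q) = mon s n * of_real (mu n ^ q) * of_real (integral {- Vn n..Vn n} (\<lambda>v. exp (- v\<^sup>2) * v ^ p))" for n
  proof -
    have i: "(\<lambda>v. exp (- v\<^sup>2) * v ^ p) integrable_on {- Vn n..Vn n}"
      by (intro integrable_continuous_interval continuous_intros)
    have "IG n (ymon s p q) = integral {- Vn n..Vn n} (\<lambda>v. (mon s n * of_real (mu n ^ q)) * of_real (exp (- v\<^sup>2) * v ^ p))"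
      unfolding IG_def ymon_def by (intro integral_cong) (simp add: mult_ac)
    also have "\<dots> = (mon s n * of_real (mu n ^ q)) * integral {- Vn n..Vn n} (\<lambda>v. of_real (exp (- v\<^sup>2) * v ^ p))"
      by (rule integral_mult_right)
    also have "integral {- Vn n..Vn n} (\<lambda>v. complex_of_real (exp (- v\<^sup>2) * v ^ p)) = of_real (integral {- Vn n..Vn n} (\<lambda>v. exp (- v\<^sup>2) * v ^ p))"
      using integral_linear[OF i bounded_linear_of_real] by (simp add: o_def)
    finally show ?thesis .
  qed
  show ?thesis
  proof (cases "even p")
    case False
    have "integral {- Vn n..Vn n} (\<lambda>v. exp (- v\<^sup>2) * v ^ p) = 0" for n
    proof -
      have "integral {- Vn n..Vn n} (\<lambda>v. exp (- v\<^sup>2) * v ^ p) = integral {- Vn n..- (- Vn n)} (\<lambda>v. exp (- (- v)\<^sup>2) * (- v) ^ p)"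
        using Henstock_Kurzweil_Integration.integral_reflect_real[of "Vn n" "- Vn n" "\<lambda>v. exp (- v\<^sup>2) * v ^ p"] by simp
      also have "\<dots> = - integral {- Vn n..Vn n} (\<lambda>v. exp (- v\<^sup>2) * v ^ p)"
        using False by (simp add: power_minus_odd)
      finally show ?thesis by simp
    qed
    hence "(\<lambda>n. IG n (ymon s p q)) = (\<lambda>_. 0)" by (simp add: eq)
    thus ?thesis using X.cls_const[of 0] by simp
  next
    case True
    then obtain k where k: "p = 2 * k" by blast
    from True assms(3) have "even q" by simp
    then obtain r where r: "q = 2 * r" by blast
    obtain M where M: "\<And>T. X.ord T (\<lambda>n. of_real (integral {- Vn n..Vn n} (\<lambda>v. exp (- v\<^sup>2) * v ^ (2 * k)) - M))"
      using gauss_Vn[of k] by (elim exE conjE) (rule that, erule spec)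
    have "s + \<alpha> * kap * real r \<in> Sx"
    proof (induction r)
      case (Suc r)
      from Sx_add[OF this Sx_ak] show ?case by (simp add: algebra_simps)
    qed (use assms in simp)
    hence 1: "mon (s + \<alpha> * kap * real r) \<in> X.cls T" by (intro X.cls_base) (auto simp: GX_def)
    have "(\<lambda>n. of_real M + complex_of_real (integral {- Vn n..Vn n} (\<lambda>v. exp (- v\<^sup>2) * v ^ p) - M)) \<in> X.cls T"
      unfolding k by (intro X.cls_add X.cls_const X.cls_ord M)
    hence 2: "(\<lambda>n. complex_of_real (integral {- Vn n..Vn n} (\<lambda>v. exp (- v\<^sup>2) * v ^ p))) \<in> X.cls T" by simp
    show ?thesis
    proof (rule X.cls_cong[OF _ X.cls_mult[OF 1 2 assms(4)]])
      show "\<forall>\<^sub>F n in sequentially. IG n (ymon s p q) = mon (s + \<alpha> * kap * real r) n * complex_of_real (integral {- Vn n..Vn n} (\<lambda>v. exp (- v\<^sup>2) * v ^ p))"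
        using eventually_gt_at_top[of 0]
      proof eventually_elim
        case (elim n)
        have "mu n ^ q = real n powr - (\<alpha> * kap * real r)"
          unfolding mu_def r using elim by (simp add: powr_power mult_ac)
        moreover have "real n powr - s * real n powr - (\<alpha> * kap * real r) = real n powr - (s + \<alpha> * kap * real r)"
          by (simp only: minus_add_distrib powr_add)
        ultimately have "mon s n * of_real (mu n ^ q) = mon (s + \<alpha> * kap * real r) n"
          by (simp only: mon_eq[OF elim] of_real_mult[symmetric])
        thus ?case by (simp only: eq)
      qed
    qed
  qed
qed

lemma espan_GY:
  assumes "p \<in> espan GY"
  shows "(\<forall>n S. continuous_on S (\<lambda>v. p (n, v))) \<and> (\<forall>T\<ge>0. (\<lambda>n. IG n p) \<in> X.cls T)"
  using assms
proof (induction rule: espan.induct)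
  case espan_zero
  have "(\<lambda>n. IG n (\<lambda>_. 0)) = (\<lambda>_. 0)" by (simp add: IG_def)
  thus ?case using X.cls_const[of 0] by simp
next
  case (espan_step p m c)
  obtain s k q where m: "m = ymon s k q" "s \<in> Sx" "k \<le> 3 * q" "even (k + q)"
    using espan_step.hyps(2) unfolding GY_def by blast
  have cm: "continuous_on S (\<lambda>v. m (n, v))" for n S unfolding m(1) by (rule continuous_ymon)
  have cp: "continuous_on S (\<lambda>v. p (n, v))" for n S using espan_step.IH by blast
  have "(\<lambda>n. IG n (\<lambda>a. c * m a + p a)) \<in> X.cls T" if T: "T \<ge> 0" for T
  proof -
    have "(\<lambda>n. IG n m) \<in> X.cls T" unfolding m(1) by (rule IG_ymon[OF m(2-4) T])
    moreover have "(\<lambda>n. IG n p) \<in> X.cls T" using espan_step.IH T by simp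
    ultimately have "(\<lambda>n. c * IG n m + IG n p) \<in> X.cls T" by (rule X.cls_add[OF X.cls_cmult[OF _ T]])
    thus ?thesis by (simp only: IG_add[OF cm cp])
  qed
  moreover have "continuous_on S (\<lambda>v. c * m (n, v) + p (n, v))" for n S by (intro continuous_intros cm cp)
  ultimately show ?case by blast
qed

lemma IG_ord:
  assumes "Y.ord d E" "\<forall>\<^sub>F n in sequentially. continuous_on {- Vn n..Vn n} (\<lambda>v. E (n, v))"
  shows "X.ord d (\<lambda>n. IG n E)"
proof -
  obtain K where K: "K \<ge> 0" "\<forall>\<^sub>F a in FY. norm (E a) \<le> K * (1 / real (fst a)) powr d" using assms(1) by (rule Y.ordE)
  obtain M where "((\<lambda>v::real. exp (- v\<^sup>2) * v ^ (2 * 0)) has_integral M) UNIV"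
    using gauss_even_integral[of 0] by blast
  hence M: "((\<lambda>v::real. exp (- v\<^sup>2)) has_integral M) UNIV" by simp
  from K(2) have "\<forall>\<^sub>F n in sequentially. \<forall>v. \<bar>v\<bar> \<le> Vn n \<longrightarrow> norm (E (n, v)) \<le> K * (1 / real n) powr d"
    unfolding eventually_FY by simp
  with assms(2) have "\<forall>\<^sub>F n in sequentially. norm (IG n E) \<le> (K * M) * (1 / real n) powr d"
  proof eventually_elim
    case (elim n)
    define D where "D = K * (1 / real n) powr d"
    have D: "D \<ge> 0" using K(1) by (simp add: D_def)
    have i: "((\<lambda>v::real. exp (- v\<^sup>2)) has_integral integral {- Vn n..Vn n} (\<lambda>v. exp (- v\<^sup>2))) {- Vn n..Vn n}"
      by (intro integrable_integral integrable_continuous_interval continuous_intros)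
    have "norm (IG n E) \<le> integral {- Vn n..Vn n} (\<lambda>v. D * exp (- v\<^sup>2))"
      unfolding IG_def
    proof (rule integral_norm_bound_integral)
      fix v assume "v \<in> {- Vn n..Vn n}"
      hence "norm (E (n, v)) \<le> D" using elim(2) by (auto simp: D_def)
      thus "norm (of_real (exp (- v\<^sup>2)) * E (n, v)) \<le> D * exp (- v\<^sup>2)"
        by (simp add: norm_mult mult.commute)
    next
      show "(\<lambda>v. of_real (exp (- v\<^sup>2)) * E (n, v)) integrable_on {- Vn n..Vn n}"
        by (rule integrable_continuous_interval, rule continuous_on_mult[OF _ elim(1)]) (intro continuous_intros)
      show "(\<lambda>v. D * exp (- v\<^sup>2)) integrable_on {- Vn n..Vn n}"
        by (intro integrable_continuous_interval continuous_intros)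
    qed
    also have "\<dots> = D * integral {- Vn n..Vn n} (\<lambda>v. exp (- v\<^sup>2))" by simp
    also have "D * integral {- Vn n..Vn n} (\<lambda>v. exp (- v\<^sup>2)) \<le> D * M"
      by (rule mult_left_mono[OF has_integral_subset_le[OF _ i M] D]) auto
    finally show ?case by (simp add: D_def mult_ac)
  qed
  thus ?thesis by (rule X.ordI)
qed

text \<open>The monomials are integrated one by one; the error term is integrated under the
  Gaussian, whose total mass is finite. The limit statement uses that E - 1 is of some positive
  order, by \<open>Y.cls_lim\<close>.\<close>

theorem IG_cls:
  assumes E: "E \<in> Y.cls T" and T: "T > 0"
    and cont: "\<forall>\<^sub>F n in sequentially. continuous_on {- Vn n..Vn n} (\<lambda>v. E (n, v))"
  shows "(\<lambda>n. IG n E) \<in> X.cls T" and "(E \<longlongrightarrow> 1) FY \<Longrightarrow> (\<lambda>n. IG n E) \<longlonglongrightarrow> of_real (sqrt pi)"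
proof -
  have diff: "\<forall>\<^sub>F n in sequentially. IG n E = IG n (\<lambda>a. E a - p a) + IG n p" if p: "p \<in> espan GY" for p
    using cont
  proof eventually_elim
    case (elim n)
    have cp: "continuous_on {- Vn n..Vn n} (\<lambda>v. p (n, v))" using espan_GY[OF p] by blast
    have "IG n (\<lambda>a. 1 * (E a - p a) + p a) = 1 * IG n (\<lambda>a. E a - p a) + IG n p"
      by (rule IG_add[OF continuous_on_diff[OF elim cp] cp])
    thus ?case by simp
  qed
  have ord: "X.ord d (\<lambda>n. IG n (\<lambda>a. E a - p a))" if p: "p \<in> espan GY" "Y.ord d (\<lambda>a. E a - p a)" for p d
  proof (rule IG_ord[OF p(2)])
    have cp: "continuous_on S (\<lambda>v. p (n, v))" for n S using espan_GY[OF p(1)] by blast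
    show "\<forall>\<^sub>F n in sequentially. continuous_on {- Vn n..Vn n} (\<lambda>v. E (n, v) - p (n, v))"
      using cont by eventually_elim (rule continuous_on_diff[OF _ cp])
  qed
  from E obtain p where p: "p \<in> espan GY" "Y.ord T (\<lambda>a. E a - p a)" by (rule Y.clsE)
  have "(\<lambda>n. IG n (\<lambda>a. E a - p a) + IG n p) \<in> X.cls T"
  proof (rule X.cls_add[OF X.cls_ord[OF ord[OF p]]])
    show "(\<lambda>n. IG n p) \<in> X.cls T" using espan_GY[OF p(1)] T by simp
  qed
  thus "(\<lambda>n. IG n E) \<in> X.cls T" by (rule X.cls_cong[OF diff[OF p(1)]])
  assume lim: "(E \<longlongrightarrow> 1) FY"
  obtain \<delta> where \<delta>: "\<delta> > 0" "Y.ord \<delta> (\<lambda>a. E a - 1)" using Y.cls_lim[OF E T lim] by (elim exE conjE)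
  have e1: "(\<lambda>_. 1) \<in> espan GY" by (rule espan_base[OF Y.one])
  have l1: "(\<lambda>n. IG n (\<lambda>a. E a - 1)) \<longlonglongrightarrow> 0" by (rule X.ord_tendsto_0[OF ord[OF e1 \<delta>(2)] \<delta>(1)])
  obtain M where M: "\<And>T. X.ord T (\<lambda>n. of_real (integral {- Vn n..Vn n} (\<lambda>v. exp (- v\<^sup>2) * v ^ (2 * 0)) - M))"
    "(0::nat) = 0 \<longrightarrow> M = sqrt pi"
    using gauss_Vn[of 0] by (elim exE conjE) (rule that, erule spec, assumption)
  have "IG n (\<lambda>_. 1) = of_real (integral {- Vn n..Vn n} (\<lambda>v. exp (- v\<^sup>2) * v ^ (2 * 0)))" for n
  proof -
    have i: "(\<lambda>v. exp (- v\<^sup>2) * v ^ (2 * 0)) integrable_on {- Vn n..Vn n}"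
      by (intro integrable_continuous_interval continuous_intros)
    have "IG n (\<lambda>_. 1) = integral {- Vn n..Vn n} (\<lambda>v. complex_of_real (exp (- v\<^sup>2) * v ^ (2 * 0)))"
      unfolding IG_def by simp
    also have "\<dots> = of_real (integral {- Vn n..Vn n} (\<lambda>v. exp (- v\<^sup>2) * v ^ (2 * 0)))"
      using integral_linear[OF i bounded_linear_of_real] by (simp only: o_def)
    finally show ?thesis .
  qed
  hence "(\<lambda>n. IG n (\<lambda>_. 1) - of_real (sqrt pi)) \<longlonglongrightarrow> 0"
    using X.ord_tendsto_0[OF M(1)[of 1]] M(2) by simp
  from tendsto_add[OF l1 this] have "(\<lambda>n. IG n (\<lambda>a. E a - 1) + IG n (\<lambda>_. 1) - of_real (sqrt pi)) \<longlonglongrightarrow> 0"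
    by (simp add: algebra_simps)
  hence "(\<lambda>n. IG n (\<lambda>a. E a - 1) + IG n (\<lambda>_. 1)) \<longlonglongrightarrow> of_real (sqrt pi)" by (simp add: LIM_zero_iff)
  thus "(\<lambda>n. IG n E) \<longlonglongrightarrow> of_real (sqrt pi)"
    by (rule Lim_transform_eventually) (use diff[OF e1] in \<open>eventually_elim, simp\<close>)
qed

end


section \<open>Local expansion at the saddle point\<close>

text \<open>The remainder is x^3 times a function analytic at 0, the sum of the binomial series from
  its fourth term on divided by x^3; in this form it can be expanded by
  \<open>cls_compose\<close>.\<close>

lemma powr_binomial_remainder:
  fixes a :: complex
  shows "\<exists>h. h analytic_on {0} \<and> (\<forall>x. norm x < 1 \<longrightarrow> (1 + x) powr a = 1 + a * x + a * (a - 1) / 2 * x\<^sup>2 + x ^ 3 * h x)"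
proof -
  define h where "h = (\<lambda>x. if x = 0 then a gchoose 3 else ((1 + x) powr a - (1 + a * x + a * (a - 1) / 2 * x\<^sup>2)) / x ^ 3)"
  have g2: "a gchoose 2 = a * (a - 1) / 2"
  proof -
    have "of_nat (Suc 1) * (a gchoose Suc 1) = a * ((a - 1) gchoose 1)" by (rule gbinomial_absorption)
    hence "2 * (a gchoose 2) = a * (a - 1)" unfolding gbinomial_1 Suc_1 by simp
    thus ?thesis by (metis nonzero_mult_div_cancel_left zero_neq_numeral)
  qed
  have s3: "(\<Sum>i<3. (a gchoose i) * x ^ i) = 1 + a * x + a * (a - 1) / 2 * x\<^sup>2" for x
  proof -
    have "{..<3::nat} = {0, 1, 2}" by auto
    thus ?thesis by (simp only: g2 gbinomial_0 gbinomial_1) (simp add: g2 add.assoc)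
  qed
  have sums: "(\<lambda>n. (a gchoose (n + 3)) * (x - 0) ^ n) sums h x" if "x \<in> ball 0 1" for x
  proof (cases "x = 0")
    case True
    thus ?thesis using powser_sums_zero[of "\<lambda>n. a gchoose (n + 3)"] by (simp add: h_def)
  next
    case False
    have "(\<lambda>n. (a gchoose n) * x ^ n) sums (1 + x) powr a" using that by (intro gen_binomial_complex) simp
    from sums_split_initial_segment[OF this, of 3]
    have "(\<lambda>n. (a gchoose (n + 3)) * x ^ (n + 3)) sums ((1 + x) powr a - (1 + a * x + a * (a - 1) / 2 * x\<^sup>2))"
      unfolding s3 .
    from sums_divide[OF this, of "x ^ 3"]
    have "(\<lambda>n. (a gchoose (n + 3)) * x ^ (n + 3) / x ^ 3) sums h x" using False by (simp add: h_def)
    moreover have "(a gchoose (n + 3)) * x ^ (n + 3) / x ^ 3 = (a gchoose (n + 3)) * (x - 0) ^ n" for n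
      using False by (simp add: power_add)
    ultimately show ?thesis by simp
  qed
  have "h holomorphic_on ball 0 1" by (rule power_series_holomorphic[OF sums])
  hence "h analytic_on {0}" by (rule analytic_on_subset[OF analytic_on_open[THEN iffD2, rotated]]) auto
  moreover have "(1 + x) powr a = 1 + a * x + a * (a - 1) / 2 * x\<^sup>2 + x ^ 3 * h x" for x
    by (cases "x = 0") (auto simp: h_def)
  ultimately show ?thesis by blast
qed

lemma powr_of_real_mult:
  fixes z s :: complex
  assumes "r > 0" "z \<noteq> 0"
  shows "(of_real r * z) powr s = of_real r powr s * z powr s"
  using assms by (simp add: powr_def Ln_times_of_real exp_add[symmetric] distrib_left Ln_of_real)

context partition_setting
begin

definition lam :: "nat \<Rightarrow> real" where "lam n = real n powr (\<alpha> * kap)"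
definition rho :: "nat \<Rightarrow> real" where "rho n = real n powr - kap * ww n"
text \<open>Normalised so that a_\<nu> rho^{-\<nu>} equals \<open>lam n\<close> times
  \<open>bb \<nu> n\<close> (\<open>lam_bb\<close>), with \<open>lam\<close> the order of magnitude
  of the whole exponent.\<close>

definition bb :: "real \<Rightarrow> nat \<Rightarrow> real" where
  "bb \<nu> n = aa \<nu> * real n powr - ((\<alpha> - \<nu>) * kap) * ww n powr - \<nu>"
text \<open>The value n rho + sum of a_\<nu> rho^{-\<nu>} of the leading exponent at the saddle
  point, divided by \<open>lam n\<close>.\<close>

definition Hr :: "nat \<Rightarrow> real" where "Hr n = ww n + (\<Sum>\<nu>\<in>Pp. bb \<nu> n)"
text \<open>The coefficient of x^2 in the leading exponent at rho (1 + x), divided by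
  \<open>lam n\<close>.\<close>

definition dd :: "nat \<Rightarrow> real" where "dd n = (\<Sum>\<nu>\<in>Pp. \<nu> * (\<nu> + 1) / 2 * bb \<nu> n)"
definition msq :: "nat \<Rightarrow> real" where "msq n = dd n powr - (1 / 2)"
text \<open>The relative displacement from the saddle point, scaled by \<open>mu\<close> and
  \<open>msq\<close> so that the quadratic term of the exponent is exactly -v^2
  (\<open>lam_xx2\<close>).\<close>

definition xx :: "nat \<times> real \<Rightarrow> complex" where
  "xx a = \<i> * of_real (snd a * mu (fst a) * msq (fst a))"
definition zz :: "nat \<times> real \<Rightarrow> complex" where "zz a = of_real (rho (fst a)) * (1 + xx a)"

lemma rho_pos: "n > 0 \<Longrightarrow> rho n > 0" using ww_range(3)[of n] by (simp add: rho_def)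

lemma ww_powr_tendsto: "(\<lambda>n. ww n powr q) \<longlonglongrightarrow> winf powr q"
  by (rule tendsto_powr[OF ww_tendsto tendsto_const]) (use winf in auto)

lemma ww_powr_cls: "T > 0 \<Longrightarrow> (\<lambda>n. of_real (ww n powr q)) \<in> X0.cls T"
  by (rule X0.cls_powr_real[OF ww_cls _ ww_tendsto winf(1)])

lemma bb_tendsto:
  assumes "\<nu> \<in> Pp"
  shows "bb \<nu> \<longlonglongrightarrow> (if \<nu> = \<alpha> then winf / \<alpha> else 0)"
proof (cases "\<nu> = \<alpha>")
  case True
  have "winf / \<alpha> = aa \<alpha> * winf powr - \<alpha>"
  proof -
    have "winf powr (\<alpha> + 1) * winf powr - \<alpha> = winf" using winf(1) by (simp flip: powr_add)
    thus ?thesis unfolding winf(2) using alpha_pos by (simp add: field_simps)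
  qed
  moreover have "(\<lambda>n. aa \<alpha> * ww n powr - \<alpha>) \<longlonglongrightarrow> aa \<alpha> * winf powr - \<alpha>"
    by (intro tendsto_intros ww_powr_tendsto)
  ultimately have "(\<lambda>n. aa \<alpha> * ww n powr - \<alpha>) \<longlonglongrightarrow> winf / \<alpha>" by simp
  hence "bb \<nu> \<longlonglongrightarrow> winf / \<alpha>"
  proof (rule Lim_transform_eventually)
    show "\<forall>\<^sub>F n in sequentially. aa \<alpha> * ww n powr - \<alpha> = bb \<nu> n"
      using eventually_gt_at_top[of 0] by eventually_elim (simp add: bb_def True)
  qed
  thus ?thesis using True by simp
next
  case False
  hence "\<nu> \<in> Pq" using assms by (simp add: Pq_def)
  hence "(\<alpha> - \<nu>) * kap > 0" using Pq(4)[of \<nu>] kap by simp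
  from tendsto_mult[OF tendsto_mult[OF tendsto_const tendsto_npow[OF this]] ww_powr_tendsto]
  have "(\<lambda>n. aa \<nu> * real n powr - ((\<alpha> - \<nu>) * kap) * ww n powr - \<nu>) \<longlonglongrightarrow> aa \<nu> * 0 * winf powr - \<nu>" .
  thus ?thesis using False unfolding bb_def[abs_def] by simp
qed

lemma bb_cls:
  assumes "\<nu> \<in> Pp" "T > 0"
  shows "(\<lambda>n. of_real (bb \<nu> n)) \<in> X0.cls T"
proof (rule X0.cls_cong)
  show "(\<lambda>n. of_real (aa \<nu>) * (mon ((\<alpha> - \<nu>) * kap) n * of_real (ww n powr - \<nu>))) \<in> X0.cls T"
    using S0_base[OF assms(1)] assms(2)
    by (intro X0.cls_cmult X0.cls_mult[OF X0.cls_base ww_powr_cls]) (auto simp: GX_def)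
  show "\<forall>\<^sub>F n in sequentially. complex_of_real (bb \<nu> n) = of_real (aa \<nu>) * (mon ((\<alpha> - \<nu>) * kap) n * of_real (ww n powr - \<nu>))"
    using eventually_gt_at_top[of 0] by eventually_elim (simp add: bb_def mon_eq mult.assoc)
qed

lemma Hr_cls: "T > 0 \<Longrightarrow> (\<lambda>n. of_real (Hr n)) \<in> X0.cls T"
  unfolding Hr_def of_real_add of_real_sum by (intro X0.cls_add X0.cls_sum ww_cls bb_cls)

lemma Hr_tendsto: "Hr \<longlonglongrightarrow> (1 + 1 / \<alpha>) * winf"
proof -
  have "Hr \<longlonglongrightarrow> winf + (\<Sum>\<nu>\<in>Pp. if \<nu> = \<alpha> then winf / \<alpha> else 0)"
    unfolding Hr_def[abs_def] by (intro tendsto_add tendsto_sum ww_tendsto bb_tendsto)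
  thus ?thesis using Pp(1,2) by (simp add: distrib_right)
qed

lemma dd_cls: "T > 0 \<Longrightarrow> (\<lambda>n. of_real (dd n)) \<in> X0.cls T"
  unfolding dd_def of_real_mult of_real_sum by (intro X0.cls_sum X0.cls_cmult bb_cls) auto

lemma dd_tendsto: "dd \<longlonglongrightarrow> (\<alpha> + 1) * winf / 2"
proof -
  have "dd \<longlonglongrightarrow> (\<Sum>\<nu>\<in>Pp. \<nu> * (\<nu> + 1) / 2 * (if \<nu> = \<alpha> then winf / \<alpha> else 0))"
    unfolding dd_def[abs_def] by (intro tendsto_mult tendsto_const tendsto_sum bb_tendsto)
  also have "(\<Sum>\<nu>\<in>Pp. \<nu> * (\<nu> + 1) / 2 * (if \<nu> = \<alpha> then winf / \<alpha> else 0)) = (\<Sum>\<nu>\<in>Pp. if \<nu> = \<alpha> then \<alpha> * (\<alpha> + 1) / 2 * (winf / \<alpha>) else 0)"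
    by (intro sum.cong) auto
  also have "\<dots> = (\<alpha> + 1) * winf / 2" using Pp(1,2) alpha_pos by simp
  finally show ?thesis .
qed

lemma dd_lim_pos: "(\<alpha> + 1) * winf / 2 > 0" using alpha_pos winf(1) by simp

lemma ev_dd_pos: "\<forall>\<^sub>F n in sequentially. dd n > 0"
  using order_tendstoD(1)[OF dd_tendsto dd_lim_pos] .

definition minf :: real where "minf = ((\<alpha> + 1) * winf / 2) powr - (1 / 2)"

lemma minf_pos: "minf > 0" using dd_lim_pos unfolding minf_def powr_gt_zero by linarith

lemma msq_tendsto: "msq \<longlonglongrightarrow> minf"
  unfolding msq_def[abs_def] minf_def by (rule tendsto_powr[OF dd_tendsto tendsto_const]) (use dd_lim_pos in auto)

lemma msq_cls: "T > 0 \<Longrightarrow> (\<lambda>n. of_real (msq n)) \<in> X.cls T"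
  unfolding msq_def by (rule X0_X[OF X0.cls_powr_real[OF dd_cls _ dd_tendsto dd_lim_pos]])

text \<open>The defining equation of \<open>ww\<close> multiplied by w^{-\<alpha>}. It says that the
  linear term of n z cancels those of the positive poles.\<close>

lemma saddle_eq: "\<forall>\<^sub>F n in sequentially. (\<Sum>\<nu>\<in>Pp. \<nu> * bb \<nu> n) = ww n"
  using ww_eq eventually_gt_at_top[of 0]
proof eventually_elim
  case (elim n)
  have w: "ww n > 0" by (rule ww_range)
  have "(\<Sum>\<nu>\<in>Pp. \<nu> * bb \<nu> n) = \<alpha> * bb \<alpha> n + (\<Sum>\<nu>\<in>Pq. \<nu> * bb \<nu> n)"
    unfolding Pq(2) using Pq(1,3) by simp
  also have "\<alpha> * bb \<alpha> n = ww n powr - \<alpha> * (\<alpha> * aa \<alpha>)" using elim by (simp add: bb_def)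
  also have "(\<Sum>\<nu>\<in>Pq. \<nu> * bb \<nu> n) = ww n powr - \<alpha> * (\<Sum>\<nu>\<in>Pq. \<nu> * aa \<nu> * real n powr - ((\<alpha> - \<nu>) * kap) * ww n powr (\<alpha> - \<nu>))"
    unfolding sum_distrib_left
  proof (rule sum.cong[OF refl])
    fix \<nu>
    have "ww n powr - \<alpha> * ww n powr (\<alpha> - \<nu>) = ww n powr - \<nu>" by (simp flip: powr_add)
    thus "\<nu> * bb \<nu> n = ww n powr - \<alpha> * (\<nu> * aa \<nu> * real n powr - ((\<alpha> - \<nu>) * kap) * ww n powr (\<alpha> - \<nu>))"
      unfolding bb_def by (simp add: mult_ac)
  qed
  also have "ww n powr - \<alpha> * (\<alpha> * aa \<alpha>) + \<dots> = ww n powr - \<alpha> * sbase n (ww n)"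
    by (simp add: sbase_def distrib_left)
  also have "\<dots> = ww n powr - \<alpha> * ww n powr (\<alpha> + 1)" by (simp only: elim(1))
  also have "\<dots> = ww n" using w by (simp flip: powr_add)
  finally show ?case .
qed

lemma xx_eq: "xx a = \<i> * (ymon 0 1 1 a * of_real (msq (fst a)))"
  by (simp add: xx_def ymon_def mon_def)

lemma ymon_GY: "p \<le> 3 * q \<Longrightarrow> even (p + q) \<Longrightarrow> ymon 0 p q \<in> GY"
  unfolding GY_def using Sx_nshift[OF nshift_zero] by blast

lemma ymon_ord_0: "p \<le> 3 * q \<Longrightarrow> Y.ord (\<alpha> * kap / 4 * real q) (ymon 0 p q)"
  using ord_ymon[of p q 0] by simp

lemma xx_cls: "xx \<in> Y.cls TT"
proof -
  have "(\<lambda>a. \<i> * (ymon 0 1 1 a * of_real (msq (fst a)))) \<in> Y.cls TT"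
    using TT(1) by (intro Y.cls_cmult Y.cls_mult[OF Y.cls_base[OF ymon_GY] XY_cls[OF msq_cls]]) auto
  thus ?thesis by (simp add: xx_eq[abs_def])
qed

lemma msq_ord: "Y.ord 0 (\<lambda>a. of_real (msq (fst a)))"
  by (rule XY_ord[OF X.tendsto_ord_0[OF tendsto_of_real[OF msq_tendsto]]])

lemma xx_tendsto: "(xx \<longlongrightarrow> 0) FY"
proof (rule Y.ord_tendsto_0)
  show "Y.ord (\<alpha> * kap / 4) xx"
    using Y.ord_cmult[OF Y.ord_mult[OF ymon_ord_0[of 1 1] msq_ord], of \<i>] by (simp add: xx_eq[abs_def])
qed (use kap in simp)

lemma n_rho: "n > 0 \<Longrightarrow> real n * rho n = lam n * ww n"
proof -
  assume n: "n > 0"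
  have "real n * real n powr - kap = real n powr (1 + - kap)" unfolding powr_add using n by simp
  thus ?thesis unfolding rho_def lam_def kap(3) by (simp add: mult.assoc[symmetric])
qed

lemma rho_powr: "n > 0 \<Longrightarrow> rho n powr - \<nu> = real n powr (kap * \<nu>) * ww n powr - \<nu>"
  unfolding rho_def using ww_range(3)[of n] by (simp add: powr_mult powr_powr)

lemma lam_bb: "n > 0 \<Longrightarrow> aa \<nu> * rho n powr - \<nu> = lam n * bb \<nu> n"
proof -
  assume n: "n > 0"
  have "real n powr (kap * \<nu>) = lam n * real n powr - ((\<alpha> - \<nu>) * kap)"
    unfolding lam_def powr_add[symmetric] by (simp add: algebra_simps)
  thus ?thesis unfolding rho_powr[OF n] bb_def by (simp add: mult_ac)
qed

lemma lam_mu: "n > 0 \<Longrightarrow> lam n * (mu n)\<^sup>2 = 1"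
proof -
  assume n: "n > 0"
  have "(mu n)\<^sup>2 = real n powr - (\<alpha> * kap)" using n by (simp add: mu_def powr_power)
  thus ?thesis using n unfolding lam_def by (simp flip: powr_add)
qed

lemma lam_xx2: "n > 0 \<Longrightarrow> dd n > 0 \<Longrightarrow> of_real (lam n) * (xx (n, v))\<^sup>2 * of_real (dd n) = - of_real (v\<^sup>2)"
proof -
  assume n: "n > 0" and d: "dd n > 0"
  have "(msq n)\<^sup>2 = dd n powr - 1"
    unfolding msq_def power2_eq_square powr_add[symmetric] by simp
  hence "(msq n)\<^sup>2 * dd n = 1" using d by (simp add: powr_neg_one)
  hence "lam n * (mu n)\<^sup>2 * ((msq n)\<^sup>2 * dd n) * v\<^sup>2 = v\<^sup>2" using lam_mu[OF n] by simp
  hence "(lam n * (v * mu n * msq n)\<^sup>2 * dd n) = v\<^sup>2" by (simp add: power_mult_distrib mult_ac)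
  hence "complex_of_real (lam n * (v * mu n * msq n)\<^sup>2 * dd n) = of_real (v\<^sup>2)" by (simp only:)
  thus ?thesis unfolding xx_def power_mult_distrib[of \<i>] by (simp add: algebra_simps)
qed

text \<open>Because lam mu^2 = 1, one factor mu is left over: the cubic term is the monomial with p
  = 3 and q = 1, which tends to 0 on the window.\<close>

lemma lam_xx3: "n > 0 \<Longrightarrow> of_real (lam n) * (xx (n, v)) ^ 3 = - \<i> * of_real (msq n) ^ 3 * ymon 0 3 1 (n, v)"
proof -
  assume n: "n > 0"
  have "lam n * (v * mu n * msq n) ^ 3 = lam n * (mu n)\<^sup>2 * (msq n ^ 3 * v ^ 3 * mu n)"
    by (simp add: power_mult_distrib power2_eq_square power3_eq_cube mult_ac)
  also have "\<dots> = msq n ^ 3 * v ^ 3 * mu n" by (simp add: lam_mu[OF n])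
  finally have "complex_of_real (lam n * (v * mu n * msq n) ^ 3) = of_real (msq n ^ 3 * v ^ 3 * mu n)" by (simp only:)
  thus ?thesis unfolding xx_def power_mult_distrib[of \<i>] by (simp add: ymon_def mon_def power3_eq_cube algebra_simps)
qed

end


section \<open>The integrand on the major arc\<close>

context partition_setting
begin

definition pref :: "nat \<Rightarrow> complex" where
  "pref n = exp (of_real (lam n * Hr n) + deriv F 0 - F 0 * of_real (ln (rho n)))"

text \<open>What is left of the exponent when the logarithm of \<open>pref\<close> and the Gaussian
  -v^2 are taken out; the integrand is \<open>pref\<close> times e^{-v^2} times exp of this
  (\<open>integrand_eq\<close>).\<close>

definition ss :: "nat \<times> real \<Rightarrow> complex" where
  "ss a = logG f (zz a) + of_nat (fst a) * zz a
     - (of_real (lam (fst a) * Hr (fst a)) + deriv F 0 - F 0 * of_real (ln (rho (fst a)))) + of_real ((snd a)\<^sup>2)"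

definition Ee :: "nat \<times> real \<Rightarrow> complex" where
  "Ee a = logG f (zz a) - ((\<Sum>\<nu>\<in>Pol. acoef \<nu> * zz a powr - of_real \<nu>) + (deriv F 0 - F 0 * Ln (zz a)))"

lemma Re_zz: "Re (zz a) = rho (fst a)"
  by (simp add: zz_def xx_def)

lemma Re_1_xx: "Re (1 + xx a) = 1" by (simp add: xx_def)

lemma xx_nz: "1 + xx a \<noteq> 0" using Re_1_xx[of a] by (metis zero_complex.sel(1) zero_neq_one)

lemma rho_tendsto: "rho \<longlonglongrightarrow> 0"
  using tendsto_mult[OF tendsto_npow[OF kap(1)] ww_tendsto] unfolding rho_def[abs_def] by simp

text \<open>As \<open>xx\<close> tends to 0 uniformly, z lies in the sector of
  \<open>logG_expansion\<close>, and |z| is O(n^{-kap}); the error O(|z|^R) is therefore O(n^{-R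
  kap}).\<close>

lemma Ee_ord: "Y.ord TT Ee"
proof -
  obtain \<eta> K where K: "\<eta> > 0" "K > 0" "\<forall>z. Re z > 0 \<and> \<bar>Im (Ln z)\<bar> \<le> \<eta> \<and> norm z \<le> 1 \<longrightarrow>
     norm (logG f z - ((\<Sum>\<nu>\<in>Pol. acoef \<nu> * z powr - of_real \<nu>) + (deriv F 0 - F 0 * Ln z))) \<le> K * norm z powr R"
    using logG_expansion by (elim exE conjE)
  have "((\<lambda>a. Im (Ln (1 + xx a))) \<longlongrightarrow> Im (Ln (1 + 0))) FY"
    by (intro tendsto_intros tendsto_Ln xx_tendsto) (auto simp: complex_nonpos_Reals_iff)
  hence "((\<lambda>a. Im (Ln (1 + xx a))) \<longlongrightarrow> 0) FY" by simp
  from tendstoD[OF this K(1)] have e1: "\<forall>\<^sub>F a in FY. \<bar>Im (Ln (1 + xx a))\<bar> < \<eta>" by simp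
  from tendstoD[OF xx_tendsto, of 1] have e2: "\<forall>\<^sub>F a in FY. norm (xx a) < 1" by simp
  have e3: "\<forall>\<^sub>F a in FY. rho (fst a) < 1 / 2"
    by (rule eventually_FY_fst[OF order_tendstoD(2)[OF rho_tendsto]]) simp
  have e4: "\<forall>\<^sub>F a in FY. fst a > 0" by (rule eventually_FY_fst[OF eventually_gt_at_top])
  have "\<forall>\<^sub>F a in FY. norm (Ee a) \<le> (K * (4 * winf) powr R) * (1 / real (fst a)) powr (R * kap)"
    using e1 e2 e3 e4
  proof eventually_elim
    case (elim a)
    define n where "n = fst a"
    have n: "n > 0" and r: "rho n > 0" using elim(4) rho_pos by (auto simp: n_def)
    have "norm (1 + xx a) \<le> 1 + norm (xx a)" using norm_triangle_ineq[of 1 "xx a"] by simp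
    also have "\<dots> \<le> 2" using elim(2) by simp
    finally have "norm (1 + xx a) \<le> 2" .
    hence "rho n * norm (1 + xx a) \<le> rho n * 2" using r by (intro mult_left_mono) auto
    hence nz: "norm (zz a) \<le> 2 * rho n" using r by (simp add: zz_def norm_mult n_def mult.commute)
    have "Ln (zz a) = of_real (ln (rho n)) + Ln (1 + xx a)"
      unfolding zz_def n_def[symmetric] using Ln_times_of_real[OF r xx_nz[of a]] r by (simp add: Ln_of_real)
    hence "\<bar>Im (Ln (zz a))\<bar> \<le> \<eta>" using elim(1) by simp
    moreover have "norm (zz a) \<le> 1" using nz elim(3) by (simp add: n_def)
    moreover have "Re (zz a) > 0" using r by (simp add: Re_zz n_def)
    ultimately have "norm (Ee a) \<le> K * norm (zz a) powr R" using K(3) unfolding Ee_def by blast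
    also have "2 * rho n \<le> 4 * winf * (1 / real n) powr kap"
    proof -
      have "rho n = (1 / real n) powr kap * ww n" using n by (simp add: rho_def powr_divide powr_minus_divide)
      also have "\<dots> \<le> (1 / real n) powr kap * (2 * winf)" by (intro mult_left_mono ww_range) auto
      finally show ?thesis by (simp add: mult_ac)
    qed
    hence "norm (zz a) powr R \<le> (4 * winf * (1 / real n) powr kap) powr R"
      using nz R_pos by (intro powr_mono2) auto
    also have "\<dots> = (4 * winf) powr R * (1 / real n) powr (R * kap)"
      using winf by (subst powr_mult) (auto simp: powr_powr mult.commute)
    finally show ?case using K(2) by (simp add: n_def mult_left_mono mult.assoc)
  qed
  hence "Y.ord (R * kap) Ee" by (rule Y.ordI)
  thus ?thesis by (rule Y.ord_mono) (rule TT)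
qed

definition hh :: "real \<Rightarrow> complex \<Rightarrow> complex" where
  "hh \<nu> = (SOME h. h analytic_on {0} \<and> (\<forall>x. norm x < 1 \<longrightarrow> (1 + x) powr - of_real \<nu> =
      1 + - of_real \<nu> * x + - of_real \<nu> * (- of_real \<nu> - 1) / 2 * x\<^sup>2 + x ^ 3 * h x))"

lemma hh: "hh \<nu> analytic_on {0}" "norm x < 1 \<Longrightarrow> (1 + x) powr - of_real \<nu> =
    1 - of_real \<nu> * x + of_real (\<nu> * (\<nu> + 1) / 2) * x\<^sup>2 + x ^ 3 * hh \<nu> x"
proof -
  note * = someI_ex[OF powr_binomial_remainder[of "- of_real \<nu>"], folded hh_def]
  show "hh \<nu> analytic_on {0}" using * by blast
  assume "norm x < 1"
  with * have "(1 + x) powr - of_real \<nu> =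
      1 + - of_real \<nu> * x + - of_real \<nu> * (- of_real \<nu> - 1) / 2 * x\<^sup>2 + x ^ 3 * hh \<nu> x" by blast
  thus "(1 + x) powr - of_real \<nu> = 1 - of_real \<nu> * x + of_real (\<nu> * (\<nu> + 1) / 2) * x\<^sup>2 + x ^ 3 * hh \<nu> x"
    by (simp add: algebra_simps)
qed

definition Pm :: "real set" where "Pm = {\<nu>\<in>Pol. \<nu> < 0}"

lemma Pol_split: "Pol = Pp \<union> Pm" "Pp \<inter> Pm = {}" "finite Pm"
proof -
  show "finite Pm" unfolding Pm_def using finite_Pol by simp
qed (auto simp: Pp_def Pm_def Pol_def)

text \<open>The three sources of \<open>ss\<close>: here the remainders of order three from the
  positive poles, in \<open>s2\<close> the logarithm, in \<open>s3\<close> the negative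
  poles.\<close>

definition s1 :: "nat \<times> real \<Rightarrow> complex" where
  "s1 a = (\<Sum>\<nu>\<in>Pp. - \<i> * (ymon 0 3 1 a * (of_real (msq (fst a)) ^ 3 * (of_real (bb \<nu> (fst a)) * hh \<nu> (xx a)))))"
definition s2 :: "nat \<times> real \<Rightarrow> complex" where "s2 a = - F 0 * Ln (1 + xx a)"
definition s3 :: "nat \<times> real \<Rightarrow> complex" where
  "s3 a = (\<Sum>\<nu>\<in>Pm. acoef \<nu> * (mon (- (\<nu> * kap)) (fst a) * (of_real (ww (fst a) powr - \<nu>) * (1 + xx a) powr - of_real \<nu>)))"

text \<open>Each positive pole is expanded to second order in x. The constant terms add up to
  \<open>lam * Hr\<close> with that of n z, the linear terms cancel by \<open>saddle_eq\<close>, and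
  the quadratic ones give -v^2, leaving the remainders.\<close>

lemma ss_eq: "\<forall>\<^sub>F a in FY. ss a = s1 a + s2 a + s3 a + Ee a"
proof -
  have e2: "\<forall>\<^sub>F a in FY. norm (xx a) < 1" using tendstoD[OF xx_tendsto, of 1] by simp
  show ?thesis
    using e2 eventually_FY_fst[OF saddle_eq] eventually_FY_fst[OF ev_dd_pos] eventually_FY_fst[OF eventually_gt_at_top[of 0]]
  proof eventually_elim
    case (elim a)
    obtain n v where a: "a = (n, v)" by (cases a)
    have n: "n > 0" and d: "dd n > 0" and x1: "norm (xx a) < 1" and se: "(\<Sum>\<nu>\<in>Pp. \<nu> * bb \<nu> n) = ww n"
      using elim by (auto simp: a)
    have r: "rho n > 0" by (rule rho_pos[OF n])
    let ?x = "xx a" and ?l = "complex_of_real (lam n)"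
    have zp: "zz a powr - of_real \<nu> = of_real (rho n powr - \<nu>) * (1 + ?x) powr - of_real \<nu>" for \<nu>
      unfolding zz_def using powr_of_real_mult[OF r xx_nz[of a], of "- of_real \<nu>"] r
        powr_of_real[of "rho n" "- \<nu>"] by (simp add: a)
    have P: "acoef \<nu> * zz a powr - of_real \<nu> = ?l * of_real (bb \<nu> n) - ?l * ?x * of_real (\<nu> * bb \<nu> n)
        + ?l * ?x\<^sup>2 * of_real (\<nu> * (\<nu> + 1) / 2 * bb \<nu> n) + ?l * ?x ^ 3 * (of_real (bb \<nu> n) * hh \<nu> ?x)" if "\<nu> \<in> Pp" for \<nu>
    proof -
      have "acoef \<nu> * zz a powr - of_real \<nu> = of_real (aa \<nu> * rho n powr - \<nu>) * (1 + ?x) powr - of_real \<nu>"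
        unfolding zp acoef_Pp[OF that] by simp
      also have "\<dots> = ?l * of_real (bb \<nu> n) * (1 - of_real \<nu> * ?x + of_real (\<nu> * (\<nu> + 1) / 2) * ?x\<^sup>2 + ?x ^ 3 * hh \<nu> ?x)"
        unfolding lam_bb[OF n] hh(2)[OF x1] by simp
      finally show ?thesis by (simp add: algebra_simps)
    qed
    have "(\<Sum>\<nu>\<in>Pp. acoef \<nu> * zz a powr - of_real \<nu>) = (\<Sum>\<nu>\<in>Pp. ?l * of_real (bb \<nu> n) - ?l * ?x * of_real (\<nu> * bb \<nu> n)
        + ?l * ?x\<^sup>2 * of_real (\<nu> * (\<nu> + 1) / 2 * bb \<nu> n) + ?l * ?x ^ 3 * (of_real (bb \<nu> n) * hh \<nu> ?x))"
      by (intro sum.cong P refl)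
    also have "\<dots> = ?l * of_real (\<Sum>\<nu>\<in>Pp. bb \<nu> n) - ?l * ?x * of_real (\<Sum>\<nu>\<in>Pp. \<nu> * bb \<nu> n)
        + ?l * ?x\<^sup>2 * of_real (dd n) + (\<Sum>\<nu>\<in>Pp. ?l * ?x ^ 3 * (of_real (bb \<nu> n) * hh \<nu> ?x))"
      unfolding sum.distrib sum_subtractf of_real_sum sum_distrib_left dd_def ..
    also have "?l * ?x\<^sup>2 * of_real (dd n) = - of_real (v\<^sup>2)" unfolding a by (rule lam_xx2[OF n d])
    also have "(\<Sum>\<nu>\<in>Pp. ?l * ?x ^ 3 * (of_real (bb \<nu> n) * hh \<nu> ?x)) = s1 a"
      unfolding s1_def a lam_xx3[OF n] by (intro sum.cong refl) (simp add: mult_ac)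
    finally have S1: "(\<Sum>\<nu>\<in>Pp. acoef \<nu> * zz a powr - of_real \<nu>) =
        ?l * of_real (Hr n - ww n) - ?l * ?x * of_real (ww n) + - of_real (v\<^sup>2) + s1 a"
      unfolding se Hr_def by simp
    have S3: "(\<Sum>\<nu>\<in>Pm. acoef \<nu> * zz a powr - of_real \<nu>) = s3 a"
      unfolding s3_def
    proof (rule sum.cong[OF refl])
      fix \<nu>
      have "of_real (rho n powr - \<nu>) = mon (- (\<nu> * kap)) n * of_real (ww n powr - \<nu>)"
        unfolding rho_powr[OF n] mon_eq[OF n] by (simp add: mult.commute)
      thus "acoef \<nu> * zz a powr - of_real \<nu> = acoef \<nu> * (mon (- (\<nu> * kap)) (fst a) * (of_real (ww (fst a) powr - \<nu>) * (1 + ?x) powr - of_real \<nu>))"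
        unfolding zp by (simp add: a mult.assoc)
    qed
    have S: "(\<Sum>\<nu>\<in>Pol. acoef \<nu> * zz a powr - of_real \<nu>) = ?l * of_real (Hr n - ww n) - ?l * ?x * of_real (ww n) + - of_real (v\<^sup>2) + s1 a + s3 a"
      unfolding Pol_split(1) sum.union_disjoint[OF Pp(1) Pol_split(3,2)] S1 S3 ..
    have "complex_of_real (real n * rho n) = of_real (lam n * ww n)" by (simp only: n_rho[OF n])
    hence nz: "of_nat n * zz a = ?l * of_real (ww n) * (1 + ?x)" by (simp add: zz_def a mult.assoc[symmetric])
    have L: "Ln (zz a) = of_real (ln (rho n)) + Ln (1 + ?x)"
      unfolding zz_def a fst_conv using Ln_times_of_real[OF r xx_nz[of a]] r by (simp add: Ln_of_real a)
    have "logG f (zz a) = Ee a + ((\<Sum>\<nu>\<in>Pol. acoef \<nu> * zz a powr - of_real \<nu>) + (deriv F 0 - F 0 * Ln (zz a)))"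
      by (simp add: Ee_def)
    hence "logG f (zz a) = Ee a + (?l * of_real (Hr n - ww n) - ?l * ?x * of_real (ww n) + - of_real (v\<^sup>2) + s1 a + s3 a
        + (deriv F 0 - F 0 * (of_real (ln (rho n)) + Ln (1 + ?x))))" unfolding S L .
    hence "ss a = Ee a + (?l * of_real (Hr n - ww n) - ?l * ?x * of_real (ww n) + - of_real (v\<^sup>2) + s1 a + s3 a
        + (deriv F 0 - F 0 * (of_real (ln (rho n)) + Ln (1 + ?x)))) + ?l * of_real (ww n) * (1 + ?x)
     - (of_real (lam n * Hr n) + deriv F 0 - F 0 * of_real (ln (rho n))) + of_real (v\<^sup>2)"
      unfolding ss_def nz[symmetric] by (simp add: a)
    thus ?case unfolding s2_def by (simp add: algebra_simps)
  qed
qed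

lemma s1_part:
  assumes "\<nu> \<in> Pp"
  shows "(\<lambda>a. of_real (msq (fst a)) ^ 3 * (of_real (bb \<nu> (fst a)) * hh \<nu> (xx a))) \<in> Y.cls TT"
    (is "?g \<in> _")
proof -
  have m: "(\<lambda>a. of_real (msq (fst a))) \<in> Y.cls TT" by (rule XY_cls[OF msq_cls[OF TT(1)]])
  have b: "(\<lambda>a. of_real (bb \<nu> (fst a))) \<in> Y.cls TT" by (rule XY_cls[OF X0_X[OF bb_cls[OF assms TT(1)]]])
  have h: "(\<lambda>a. hh \<nu> (xx a)) \<in> Y.cls TT" by (rule Y.cls_compose[OF xx_cls TT(1) xx_tendsto hh(1)])
  show ?thesis unfolding power3_eq_cube using TT(1) by (intro Y.cls_mult m b h) auto
qed

lemma s1_cls: "s1 \<in> Y.cls TT"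
  unfolding s1_def[abs_def] using TT(1)
  by (intro Y.cls_sum Y.cls_cmult Y.cls_mult[OF Y.cls_base[OF ymon_GY] s1_part]) auto

lemma s1_tendsto: "(s1 \<longlongrightarrow> 0) FY"
proof (rule Y.ord_tendsto_0)
  show "Y.ord (\<alpha> * kap / 4) s1"
    unfolding s1_def[abs_def]
  proof (intro Y.ord_sum Y.ord_cmult)
    fix \<nu> assume "\<nu> \<in> Pp"
    from Y.ord_mult[OF ymon_ord_0[of 3 1] Y.cls_ord_0[OF s1_part[OF this]]] TT(1)
    show "Y.ord (\<alpha> * kap / 4) (\<lambda>a. ymon 0 3 1 a * (of_real (msq (fst a)) ^ 3 * (of_real (bb \<nu> (fst a)) * hh \<nu> (xx a))))"
      by simp
  qed
qed (use kap in simp)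

lemma analytic_1_plus:
  "(\<lambda>x. Ln (1 + x)) analytic_on {0}" "(\<lambda>x. (1 + x) powr q) analytic_on {0}"
proof -
  have "1 + x \<notin> \<real>\<^sub>\<le>\<^sub>0" if "x \<in> ball 0 1" for x :: complex
    using that abs_Re_le_cmod[of x] by (auto simp: complex_nonpos_Reals_iff)
  hence "(\<lambda>x. Ln (1 + x)) holomorphic_on ball 0 1" "(\<lambda>x. (1 + x) powr q) holomorphic_on ball 0 1"
    by (intro holomorphic_intros; blast)+
  thus "(\<lambda>x. Ln (1 + x)) analytic_on {0}" "(\<lambda>x. (1 + x) powr q) analytic_on {0}"
    by (auto simp: analytic_at intro!: exI[of _ "ball 0 1"])
qed

lemma s2_cls: "s2 \<in> Y.cls TT"
  unfolding s2_def[abs_def] using TT(1)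
  by (intro Y.cls_cmult Y.cls_compose[OF xx_cls TT(1) xx_tendsto analytic_1_plus(1)]) auto

lemma s2_tendsto: "(s2 \<longlongrightarrow> 0) FY"
proof -
  have "(s2 \<longlongrightarrow> - F 0 * Ln (1 + 0)) FY" unfolding s2_def[abs_def]
    by (intro tendsto_intros tendsto_Ln xx_tendsto) (auto simp: complex_nonpos_Reals_iff)
  thus ?thesis by simp
qed

lemma s3_part:
  "(\<lambda>a. of_real (ww (fst a) powr - \<nu>) * (1 + xx a) powr - of_real \<nu>) \<in> Y.cls TT"
proof (rule Y.cls_mult)
  show "(\<lambda>a. of_real (ww (fst a) powr - \<nu>)) \<in> Y.cls TT"
    by (rule XY_cls[OF X0_X[OF ww_powr_cls[OF TT(1)]]])
  show "(\<lambda>a. (1 + xx a) powr - of_real \<nu>) \<in> Y.cls TT"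
    by (rule Y.cls_compose[OF xx_cls TT(1) xx_tendsto analytic_1_plus(2)])
qed (use TT in simp)

lemma s3_cls: "s3 \<in> Y.cls TT"
  unfolding s3_def[abs_def]
proof (intro Y.cls_sum Y.cls_cmult Y.cls_mult[OF _ s3_part])
  fix \<nu> assume \<nu>: "\<nu> \<in> Pm"
  show "(\<lambda>a. mon (- (\<nu> * kap)) (fst a)) \<in> Y.cls TT"
  proof (cases "\<nu> = - R")
    case True
    have "X.ord TT (mon (- (\<nu> * kap)))" by (rule X.ord_mono[OF ord_mon]) (use TT(2) in \<open>simp add: True\<close>)
    thus ?thesis by (rule Y.cls_ord[OF XY_ord])
  next
    case False
    hence "- (\<nu> * kap) \<in> Sx" using \<nu> Pol_range[of \<nu>] by (intro Sx_neg) (auto simp: Pm_def less_le)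
    thus ?thesis by (intro XY_cls X.cls_base) (auto simp: GX_def)
  qed
qed (use TT in auto)

lemma s3_tendsto: "(s3 \<longlongrightarrow> 0) FY"
proof -
  have "(s3 \<longlongrightarrow> (\<Sum>\<nu>\<in>Pm. acoef \<nu> * 0)) FY"
    unfolding s3_def[abs_def]
  proof (intro tendsto_sum tendsto_mult[OF tendsto_const])
    fix \<nu> assume \<nu>: "\<nu> \<in> Pm"
    from Y.ord_mult[OF XY_ord[OF ord_mon[of "- (\<nu> * kap)"]] Y.cls_ord_0[OF s3_part[of \<nu>]]] TT(1)
    have "Y.ord (- (\<nu> * kap)) (\<lambda>a. mon (- (\<nu> * kap)) (fst a) * (of_real (ww (fst a) powr - \<nu>) * (1 + xx a) powr - of_real \<nu>))" by simp
    thus "((\<lambda>a. mon (- (\<nu> * kap)) (fst a) * (of_real (ww (fst a) powr - \<nu>) * (1 + xx a) powr - of_real \<nu>)) \<longlongrightarrow> 0) FY"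
      by (rule Y.ord_tendsto_0) (use \<nu> kap(1) in \<open>simp add: Pm_def mult_neg_pos\<close>)
  qed
  thus ?thesis by simp
qed

lemma ss_cls: "ss \<in> Y.cls TT"
  by (rule Y.cls_cong[OF ss_eq]) (intro Y.cls_add s1_cls s2_cls s3_cls Y.cls_ord Ee_ord)

lemma ss_tendsto: "(ss \<longlongrightarrow> 0) FY"
proof -
  have "((\<lambda>a. s1 a + s2 a + s3 a + Ee a) \<longlongrightarrow> 0 + 0 + 0 + 0) FY"
    by (intro tendsto_add s1_tendsto s2_tendsto s3_tendsto Y.ord_tendsto_0[OF Ee_ord TT(1)])
  hence "((\<lambda>a. s1 a + s2 a + s3 a + Ee a) \<longlongrightarrow> 0) FY" by simp
  thus ?thesis by (rule Lim_transform_eventually) (use ss_eq in \<open>eventually_elim, simp\<close>)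
qed

lemma exp_ss_cls: "(\<lambda>a. exp (ss a)) \<in> Y.cls TT"
  by (rule Y.cls_compose[OF ss_cls TT(1) ss_tendsto]) (intro analytic_intros)

lemma exp_ss_tendsto: "((\<lambda>a. exp (ss a)) \<longlongrightarrow> 1) FY"
  using tendsto_exp[OF ss_tendsto] by simp

lemma integrand_eq: "exp (logG f (zz (n, v)) + of_nat n * zz (n, v)) = pref n * (of_real (exp (- v\<^sup>2)) * exp (ss (n, v)))"
  unfolding pref_def ss_def by (simp add: exp_of_real[symmetric] exp_add[symmetric] exp_diff[symmetric] del: exp_of_real)

end


section \<open>Major and minor arcs combined\<close>

context partition_setting
begin

lemma zz_Complex: "zz (n, v) = Complex (rho n) (rho n * mu n * msq n * v)"
  by (simp add: zz_def xx_def complex_eq_iff)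

lemma continuous_exp_ss:
  assumes "n > 0"
  shows "continuous_on S (\<lambda>v. exp (ss (n, v)))"
proof -
  have z: "continuous_on S (\<lambda>v. zz (n, v))" unfolding zz_def xx_def by simp (intro continuous_intros)
  have "continuous_on S (\<lambda>v. logG f (zz (n, v)))"
    by (rule continuous_on_compose2[OF continuous_logG z]) (use rho_pos[OF assms] in \<open>auto simp: Re_zz\<close>)
  thus ?thesis unfolding ss_def by simp (intro continuous_intros z)
qed

definition theta :: "nat \<Rightarrow> real" where "theta n = rho n * mu n * msq n * Vn n"

definition phi :: "nat \<Rightarrow> real \<Rightarrow> complex" where
  "phi n t = exp (logG f (Complex (rho n) t) + of_nat n * Complex (rho n) t)"

lemma continuous_phi: "n > 0 \<Longrightarrow> continuous_on S (phi n)"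
proof -
  assume n: "n > 0"
  have z: "continuous_on S (\<lambda>t. Complex (rho n) t)" by (intro continuous_intros)
  have "continuous_on S (\<lambda>t. logG f (Complex (rho n) t))"
    by (rule continuous_on_compose2[OF continuous_logG z]) (use rho_pos[OF n] in auto)
  thus ?thesis unfolding phi_def[abs_def] by (intro continuous_intros z)
qed

lemma major_arc:
  assumes "n > 0" "dd n > 0"
  shows "integral {- theta n..theta n} (phi n) = of_real (rho n * mu n * msq n) * pref n * IG n (\<lambda>a. exp (ss a))"
proof -
  define m where "m = rho n * mu n * msq n"
  have m: "m > 0" using rho_pos[OF assms(1)] mu_pos[OF assms(1)] assms(2) by (simp add: m_def msq_def)
  have im: "(\<lambda>x. x / m) ` {- theta n..theta n} = {- Vn n..Vn n}"
  proof -
    have "theta n = m * Vn n" by (simp add: theta_def m_def)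
    thus ?thesis using m Vn_nonneg[of n] by (simp add: image_divide_atLeastAtMost)
  qed
  have "(1 / \<bar>m\<bar>) *\<^sub>R integral {- theta n..theta n} (phi n) = integral {- Vn n..Vn n} (\<lambda>v. phi n (m * v))"
    using integral_stretch_real[of m "- theta n" "theta n" "phi n"] m unfolding im by simp
  also have "\<dots> = integral {- Vn n..Vn n} (\<lambda>v. pref n * (of_real (exp (- v\<^sup>2)) * exp (ss (n, v))))"
    by (intro integral_cong) (simp only: integrand_eq[symmetric] phi_def zz_Complex m_def)
  also have "\<dots> = pref n * IG n (\<lambda>a. exp (ss a))" unfolding IG_def by (rule integral_mult_right)
  finally have "of_real m * ((1 / \<bar>m\<bar>) *\<^sub>R integral {- theta n..theta n} (phi n)) = of_real m * (pref n * IG n (\<lambda>a. exp (ss a)))"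
    by simp
  hence "integral {- theta n..theta n} (phi n) = of_real m * (pref n * IG n (\<lambda>a. exp (ss a)))"
    using m by (simp add: scaleR_conv_of_real)
  thus ?thesis unfolding m_def by (simp only: mult.assoc)
qed

text \<open>At v = 0 the integrand is e^{n rho} G_f(rho), which equals \<open>pref\<close> times exp
  of \<open>ss\<close>, and \<open>ss\<close> tends to 0. This converts the minor arc bounds,
  relative to G_f(rho), into bounds relative to \<open>pref\<close>.\<close>

lemma norm_pref_bound: "\<forall>\<^sub>F n in sequentially. exp (real n * rho n + lg (rho n)) \<le> 2 * norm (pref n)"
proof -
  have "\<forall>\<^sub>F a in FY. norm (exp (ss a)) < 2"
    by (rule order_tendstoD(2)[OF tendsto_norm[OF exp_ss_tendsto]]) simp
  hence "\<forall>\<^sub>F n in sequentially. norm (exp (ss (n, 0))) < 2"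
    unfolding eventually_FY by (rule eventually_mono) (use Vn_nonneg in auto)
  thus ?thesis using eventually_gt_at_top[of 0]
  proof eventually_elim
    case (elim n)
    have "zz (n, 0) = of_real (rho n)" by (simp add: zz_def xx_def)
    hence "exp (of_real (real n * rho n + lg (rho n))) = pref n * exp (ss (n, 0))"
      using integrand_eq[of n 0] lg_sums(2)[OF rho_pos[OF elim(2)]] by (simp add: add.commute)
    hence "norm (exp (complex_of_real (real n * rho n + lg (rho n)))) = norm (pref n) * norm (exp (ss (n, 0)))"
      by (simp only: norm_mult)
    also have "\<dots> \<le> norm (pref n) * 2" using elim(1) by (intro mult_left_mono) auto
    finally show ?case by (simp add: mult.commute)
  qed
qed

text \<open>The contribution of the minor arcs in units of the major arc, written as a difference so
  that the decomposition of \<open>pf\<close> is exact.\<close>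

definition Rm :: "nat \<Rightarrow> complex" where
  "Rm n = pf f n * (2 * pi) / (of_real (rho n * mu n * msq n) * pref n) - IG n (\<lambda>a. exp (ss a))"

lemma Rm_bound:
  obtains c0 K where "c0 > 0" "K > 0"
    "\<forall>\<^sub>F n in sequentially. norm (Rm n) \<le> 4 * (K * rho n ^ Suc L + 2 * pi * exp (- (c0 * (mu n * msq n * Vn n)\<^sup>2 * rho n powr - (\<alpha> - \<alpha> / 12)))) / (rho n * mu n * msq n)"
proof -
  \<comment> \<open>This \<eta> leaves enough room: (mu Vn)^2 has order n^{-10 \<alpha> kap / 12}
    and rho^{-(\<alpha>-\<eta>)} has order n^{11 \<alpha> kap / 12}, so the product in the
    exponential still grows like n^{\<alpha> kap / 12}.\<close>
  have \<eta>: "\<alpha> / 12 > 0" using alpha_pos by simp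
  show thesis
  proof (rule minor_arcs[OF \<eta>])
  fix c0 K r0 :: real
  assume mi: "c0 > 0" "K > 0" "r0 > 0" "\<And>\<rho> \<theta> a b. 0 < \<rho> \<Longrightarrow> \<rho> \<le> r0 \<Longrightarrow> 0 \<le> \<theta> \<Longrightarrow> \<theta> \<le> \<rho> \<Longrightarrow> - pi \<le> a \<Longrightarrow> a \<le> b \<Longrightarrow> b \<le> pi \<Longrightarrow>
      (\<And>t. t \<in> {a..b} \<Longrightarrow> \<theta> \<le> \<bar>t\<bar>) \<Longrightarrow>
      integral {a..b} (\<lambda>t. norm (exp (logG f (Complex \<rho> t)))) \<le>
        exp (lg \<rho>) * (K * \<rho> ^ Suc L + 2 * pi * exp (- (c0 * (\<theta> / \<rho>)\<^sup>2 * \<rho> powr - (\<alpha> - \<alpha> / 12))))"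

  have "(\<lambda>n. real n powr - (\<alpha> * kap * 5 / 12) * msq n) \<longlonglongrightarrow> 0 * minf"
    by (intro tendsto_mult msq_tendsto tendsto_npow) (use kap in simp)
  hence "\<forall>\<^sub>F n in sequentially. real n powr - (\<alpha> * kap * 5 / 12) * msq n < 1"
    by (intro order_tendstoD(2)) auto
  moreover have "\<forall>\<^sub>F n in sequentially. rho n < min r0 1" by (rule order_tendstoD(2)[OF rho_tendsto]) (use mi in simp)
  ultimately have "\<forall>\<^sub>F n in sequentially. norm (Rm n) \<le> 4 * (K * rho n ^ Suc L + 2 * pi * exp (- (c0 * (mu n * msq n * Vn n)\<^sup>2 * rho n powr - (\<alpha> - \<alpha> / 12)))) / (rho n * mu n * msq n)"
    using norm_pref_bound ev_dd_pos eventually_gt_at_top[of 0]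
  proof eventually_elim
    case (elim n)
    have n: "n > 0" and r: "rho n > 0" "rho n \<le> r0" "rho n \<le> 1" using elim rho_pos[of n] by auto
    have ms: "msq n > 0" "mu n > 0" using elim(4) mu_pos[OF n] by (auto simp: msq_def)
    define m where "m = mu n * msq n * Vn n"
    have "mu n * Vn n = real n powr - (\<alpha> * kap * 5 / 12)" unfolding mu_def Vn_def powr_add[symmetric]
      by (rule arg_cong2[of _ _ _ _ "(powr)"]) (simp_all add: field_simps)
    hence "m = real n powr - (\<alpha> * kap * 5 / 12) * msq n" unfolding m_def by (simp add: mult_ac)
    hence m: "0 \<le> m" "m \<le> 1" using elim(1) ms by auto
    have th: "theta n = rho n * m" by (simp add: theta_def m_def mult_ac)
    have t: "0 \<le> theta n" "theta n \<le> rho n" "theta n / rho n = m"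
      using r m mult_left_mono[OF m(2), of "rho n"] by (auto simp: th)
    have tp: "theta n \<le> pi" using t(2) r(3) pi_gt3 by linarith
    define B where "B = K * rho n ^ Suc L + 2 * pi * exp (- (c0 * m\<^sup>2 * rho n powr - (\<alpha> - \<alpha> / 12)))"
    have arc: "norm (integral {a..b} (phi n)) \<le> 2 * norm (pref n) * B"
      if ab: "- pi \<le> a" "a \<le> b" "b \<le> pi" "\<And>t. t \<in> {a..b} \<Longrightarrow> theta n \<le> \<bar>t\<bar>" for a b
    proof -
      have ci: "continuous_on {a..b} (\<lambda>t. norm (exp (logG f (Complex (rho n) t))))"
      proof -
        have "continuous_on {a..b} (\<lambda>t. logG f (Complex (rho n) t))"
          by (rule continuous_on_compose2[OF continuous_logG]) (use r in \<open>auto intro!: continuous_intros\<close>)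
        thus ?thesis by (intro continuous_intros)
      qed
      have "norm (integral {a..b} (phi n)) \<le> integral {a..b} (\<lambda>t. exp (real n * rho n) * norm (exp (logG f (Complex (rho n) t))))"
      proof (rule integral_norm_bound_integral)
        show "phi n integrable_on {a..b}" by (rule integrable_continuous_interval[OF continuous_phi[OF n]])
        show "(\<lambda>t. exp (real n * rho n) * norm (exp (logG f (Complex (rho n) t)))) integrable_on {a..b}"
          by (intro integrable_continuous_interval continuous_on_mult ci continuous_on_const)
        fix t
        show "norm (phi n t) \<le> exp (real n * rho n) * norm (exp (logG f (Complex (rho n) t)))"
          by (simp add: phi_def exp_add norm_mult)
      qed
      also have "\<dots> = exp (real n * rho n) * integral {a..b} (\<lambda>t. norm (exp (logG f (Complex (rho n) t))))"
        by (rule integral_mult_right)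
      also have "\<dots> \<le> exp (real n * rho n) * (exp (lg (rho n)) * B)"
        using mi(4)[OF r(1,2) t(1,2) ab] unfolding t(3) B_def by (intro mult_left_mono) auto
      also have "\<dots> = exp (real n * rho n + lg (rho n)) * B" by (simp add: exp_add)
      also have "\<dots> \<le> 2 * norm (pref n) * B"
        using elim(3) mi(2) r(1) by (intro mult_right_mono) (auto simp: B_def)
      finally show ?thesis .
    qed
    have i: "phi n integrable_on {a..b}" for a b by (rule integrable_continuous_interval[OF continuous_phi[OF n]])
    have "integral {- pi..pi} (phi n) = integral {- pi..- theta n} (phi n) + integral {- theta n..pi} (phi n)"
      using t tp by (intro Henstock_Kurzweil_Integration.integral_combine[symmetric] i) auto
    also have "integral {- theta n..pi} (phi n) = integral {- theta n..theta n} (phi n) + integral {theta n..pi} (phi n)"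
      using t tp by (intro Henstock_Kurzweil_Integration.integral_combine[symmetric] i) auto
    finally have split: "integral {- pi..pi} (phi n) = integral {- pi..- theta n} (phi n) + (integral {- theta n..theta n} (phi n) + integral {theta n..pi} (phi n))" .
    have pfn: "pf f n * (2 * pi) = integral {- pi..pi} (phi n)"
      unfolding pf_integral[OF r(1)] phi_def[abs_def] by simp
    define P where "P = of_real (rho n * mu n * msq n) * pref n"
    have pr: "norm (pref n) > 0" by (simp add: pref_def)
    have P: "norm P = (rho n * mu n * msq n) * norm (pref n)"
      unfolding P_def norm_mult norm_of_real using r ms by simp
    hence P0: "P \<noteq> 0" using r ms pr by auto
    have "Rm n = (integral {- pi..- theta n} (phi n) + integral {theta n..pi} (phi n)) / P"
      unfolding Rm_def pfn split major_arc[OF n elim(4)] P_def[symmetric] using P0 by (simp add: add_divide_distrib)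
    hence "norm (Rm n) = norm (integral {- pi..- theta n} (phi n) + integral {theta n..pi} (phi n)) / norm P"
      by (simp only: norm_divide)
    also have "\<dots> \<le> (2 * norm (pref n) * B + 2 * norm (pref n) * B) / norm P"
      by (intro divide_right_mono norm_triangle_le add_mono arc) (use t tp pi_gt3 in auto)
    also have "\<dots> = 4 * B / (rho n * mu n * msq n)"
      unfolding P using pr by simp
    finally show ?case unfolding B_def m_def .
  qed
  thus thesis using mi(1,2) by (intro that[of c0 K])
  qed
qed

text \<open>The quotient rho^{L+1} / (rho mu) has order n^{-kap (L - \<alpha>/2)}, which is the
  source of the first exponent in \<open>TT\<close>; the other part is exponentially small in a
  power of n.\<close>

lemma Rm_ord: "X.ord TT Rm"
proof -
  obtain c0 K where c0: "c0 > 0" and K: "K > 0" and bd: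
    "\<forall>\<^sub>F n in sequentially. norm (Rm n) \<le> 4 * (K * rho n ^ Suc L + 2 * pi * exp (- (c0 * (mu n * msq n * Vn n)\<^sup>2 * rho n powr - (\<alpha> - \<alpha> / 12)))) / (rho n * mu n * msq n)"
    by (rule Rm_bound)
  define \<epsilon> where "\<epsilon> = \<alpha> * kap / 12"
  have \<epsilon>: "\<epsilon> > 0" using kap by (simp add: \<epsilon>_def)
  define c1 where "c1 = c0 * (minf / 2)\<^sup>2 * (2 * winf) powr - (\<alpha> - \<alpha> / 12)"
  have c1: "c1 > 0" using c0 minf_pos winf by (simp add: c1_def)
  define D where "D = winf / 2 * (minf / 2)"
  have D: "D > 0" using minf_pos winf by (simp add: D_def)
  have lim: "((\<lambda>x. exp (- (c1 * x powr \<epsilon>)) * x powr (kap + \<alpha> * kap / 2 + TT)) \<longlongrightarrow> 0) at_top"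
    using c1 \<epsilon> by real_asymp
  have "(\<lambda>n. exp (- (c1 * real n powr \<epsilon>)) * real n powr (kap + \<alpha> * kap / 2 + TT)) \<longlonglongrightarrow> 0"
    using filterlim_compose[OF lim filterlim_real_sequentially] .
  hence e1: "\<forall>\<^sub>F n in sequentially. exp (- (c1 * real n powr \<epsilon>)) * real n powr (kap + \<alpha> * kap / 2 + TT) < 1"
    by (rule order_tendstoD(2)) simp
  have e2: "\<forall>\<^sub>F n in sequentially. msq n > minf / 2"
    by (rule order_tendstoD(1)[OF msq_tendsto]) (use minf_pos in simp)
  have "\<forall>\<^sub>F n in sequentially. norm (Rm n) \<le> (4 * K * (2 * winf) ^ L / (minf / 2) + 8 * pi / D) * (1 / real n) powr TT"
    using bd e1 e2 eventually_gt_at_top[of 0]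
  proof eventually_elim
    case (elim n)
    have n: "n > 0" and nr: "real n \<ge> 1" and r: "rho n > 0" using elim rho_pos[of n] by auto
    have ms: "msq n > minf / 2" "msq n > 0" "mu n > 0" using elim(3) minf_pos mu_pos[OF n] by auto
    have inv: "(1 / real n) powr x = real n powr - x" for x using n by (simp add: powr_divide powr_minus_divide)
    have A: "rho n ^ Suc L / (rho n * mu n * msq n) \<le> (2 * winf) ^ L / (minf / 2) * (1 / real n) powr TT"
    proof -
      have "rho n ^ Suc L / (rho n * mu n * msq n) = rho n ^ L / mu n / msq n" using r ms by (simp add: field_simps)
      also have "rho n ^ L = ww n ^ L * real n powr - (kap * real L)"
        using n by (simp add: rho_def power_mult_distrib powr_power mult.commute)
      also have "ww n ^ L * real n powr - (kap * real L) / mu n = ww n ^ L * real n powr - (kap * (real L - \<alpha> / 2))"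
      proof -
        have "real n powr - (kap * real L) / mu n = real n powr (- (kap * real L) - - (\<alpha> * kap / 2))"
          unfolding mu_def by (rule powr_diff[symmetric])
        also have "- (kap * real L) - - (\<alpha> * kap / 2) = - (kap * (real L - \<alpha> / 2))" by (simp add: algebra_simps)
        finally show ?thesis by (simp only: times_divide_eq_right[symmetric])
      qed
      also have "ww n ^ L * real n powr - (kap * (real L - \<alpha> / 2)) \<le> (2 * winf) ^ L * (1 / real n) powr TT"
        unfolding inv using nr TT(3) winf ww_range[of n] less_imp_le[OF ww_range(3)[of n]]
        by (intro mult_mono power_mono powr_mono) auto
      hence "ww n ^ L * real n powr - (kap * (real L - \<alpha> / 2)) / msq n \<le> (2 * winf) ^ L * (1 / real n) powr TT / (minf / 2)"
        using ms minf_pos winf by (intro frac_le) auto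
      finally show ?thesis by (simp only: times_divide_eq_left)
    qed
    have B: "exp (- (c0 * (mu n * msq n * Vn n)\<^sup>2 * rho n powr - (\<alpha> - \<alpha> / 12))) / (rho n * mu n * msq n) \<le> 1 / D * (1 / real n) powr TT"
    proof -
      have e: "(mu n * Vn n)\<^sup>2 * real n powr (kap * (\<alpha> - \<alpha> / 12)) = real n powr \<epsilon>"
        unfolding mu_def Vn_def \<epsilon>_def power2_eq_square powr_add[symmetric] by (rule arg_cong2[of _ _ _ _ "(powr)"]) (simp_all add: field_simps)
      have "c1 * real n powr \<epsilon> = c0 * (minf / 2)\<^sup>2 * (mu n * Vn n)\<^sup>2 * (real n powr (kap * (\<alpha> - \<alpha> / 12)) * (2 * winf) powr - (\<alpha> - \<alpha> / 12))"
        unfolding e[symmetric] c1_def by (simp add: mult_ac)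
      also have "\<dots> \<le> c0 * (msq n)\<^sup>2 * (mu n * Vn n)\<^sup>2 * (real n powr (kap * (\<alpha> - \<alpha> / 12)) * ww n powr - (\<alpha> - \<alpha> / 12))"
      proof -
        have p1: "(minf / 2)\<^sup>2 \<le> (msq n)\<^sup>2" using ms minf_pos by (intro power_mono) auto
        have p2: "(2 * winf) powr - (\<alpha> - \<alpha> / 12) \<le> ww n powr - (\<alpha> - \<alpha> / 12)"
          using ww_range[of n] alpha_pos by (intro powr_mono2') auto
        show ?thesis
          by (rule mult_mono[OF mult_right_mono[OF mult_left_mono[OF p1]] mult_left_mono[OF p2]]) (use c0 in auto)
      qed
      also have "real n powr (kap * (\<alpha> - \<alpha> / 12)) * ww n powr - (\<alpha> - \<alpha> / 12) = rho n powr - (\<alpha> - \<alpha> / 12)"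
        by (rule rho_powr[OF n, symmetric])
      finally have "c1 * real n powr \<epsilon> \<le> c0 * (mu n * msq n * Vn n)\<^sup>2 * rho n powr - (\<alpha> - \<alpha> / 12)"
        by (simp add: power_mult_distrib mult_ac)
      hence 1: "exp (- (c0 * (mu n * msq n * Vn n)\<^sup>2 * rho n powr - (\<alpha> - \<alpha> / 12))) \<le> exp (- (c1 * real n powr \<epsilon>))" by simp
      have 2: "rho n * mu n * msq n \<ge> real n powr - (kap + \<alpha> * kap / 2) * D"
      proof -
        have "real n powr - (kap + \<alpha> * kap / 2) * D = real n powr - kap * (winf / 2) * (real n powr - (\<alpha> * kap / 2)) * (minf / 2)"
          unfolding D_def minus_add_distrib powr_add by (simp add: mult_ac)
        also have "\<dots> \<le> real n powr - kap * ww n * mu n * msq n"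
          unfolding mu_def using ms minf_pos winf ww_range[of n] by (intro mult_mono mult_right_mono mult_left_mono) auto
        finally show ?thesis by (simp add: rho_def)
      qed
      have "exp (- (c0 * (mu n * msq n * Vn n)\<^sup>2 * rho n powr - (\<alpha> - \<alpha> / 12))) / (rho n * mu n * msq n)
          \<le> exp (- (c1 * real n powr \<epsilon>)) / (real n powr - (kap + \<alpha> * kap / 2) * D)"
        using 1 2 D n by (intro frac_le) auto
      also have "\<dots> = exp (- (c1 * real n powr \<epsilon>)) * real n powr (kap + \<alpha> * kap / 2) / D"
        using n D by (simp add: powr_minus field_simps)
      also have "exp (- (c1 * real n powr \<epsilon>)) * real n powr (kap + \<alpha> * kap / 2) \<le> real n powr - TT"
      proof -
        have "exp (- (c1 * real n powr \<epsilon>)) * real n powr (kap + \<alpha> * kap / 2) * real n powr TT \<le> 1"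
          using elim(2) unfolding powr_add by (simp add: mult.assoc)
        hence "exp (- (c1 * real n powr \<epsilon>)) * real n powr (kap + \<alpha> * kap / 2) * real n powr TT * real n powr - TT \<le> 1 * real n powr - TT"
          by (rule mult_right_mono) simp
        moreover have "real n powr TT * real n powr - TT = 1" using n by (simp flip: powr_add)
        ultimately show ?thesis by (simp add: mult.assoc)
      qed
      hence "exp (- (c1 * real n powr \<epsilon>)) * real n powr (kap + \<alpha> * kap / 2) / D \<le> real n powr - TT / D"
        using D by (intro divide_right_mono) auto
      finally show ?thesis by (simp add: inv)
    qed
    have "norm (Rm n) \<le> 4 * K * (rho n ^ Suc L / (rho n * mu n * msq n)) + 8 * pi * (exp (- (c0 * (mu n * msq n * Vn n)\<^sup>2 * rho n powr - (\<alpha> - \<alpha> / 12))) / (rho n * mu n * msq n))"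
      using elim(1) by (simp only: add_divide_distrib distrib_left times_divide_eq_right mult.assoc)
    also have "\<dots> \<le> 4 * K * ((2 * winf) ^ L / (minf / 2) * (1 / real n) powr TT) + 8 * pi * (1 / D * (1 / real n) powr TT)"
      using K by (intro add_mono mult_left_mono A B) auto
    finally show ?case by (simp add: algebra_simps)
  qed
  thus ?thesis by (rule X.ordI)
qed

definition QQ :: "nat \<Rightarrow> complex" where "QQ n = IG n (\<lambda>a. exp (ss a)) + Rm n"

lemma QQ: "QQ \<in> X.cls TT" "QQ \<longlonglongrightarrow> of_real (sqrt pi)"
proof -
  have c: "\<forall>\<^sub>F n in sequentially. continuous_on {- Vn n..Vn n} (\<lambda>v. exp (ss (n, v)))"
    using eventually_gt_at_top[of 0] by eventually_elim (rule continuous_exp_ss)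
  note I = IG_cls[OF exp_ss_cls TT(1) c]
  show "QQ \<in> X.cls TT" unfolding QQ_def[abs_def] by (intro X.cls_add I(1) X.cls_ord Rm_ord)
  have "(\<lambda>n. IG n (\<lambda>a. exp (ss a)) + Rm n) \<longlonglongrightarrow> of_real (sqrt pi) + 0"
    by (intro tendsto_add I(2) exp_ss_tendsto X.ord_tendsto_0[OF Rm_ord TT(1)])
  thus "QQ \<longlonglongrightarrow> of_real (sqrt pi)" unfolding QQ_def[abs_def] by simp
qed

lemma pf_eq_QQ:
  "\<forall>\<^sub>F n in sequentially. pf f n = of_real (rho n * mu n * msq n) * pref n * QQ n / (2 * pi)"
  using ev_dd_pos eventually_gt_at_top[of 0]
proof eventually_elim
  case (elim n)
  have "rho n * mu n * msq n > 0" using rho_pos mu_pos elim by (simp add: msq_def)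
  hence "rho n * mu n * msq n \<noteq> 0" by linarith
  hence "complex_of_real (rho n * mu n * msq n) \<noteq> 0" by (simp only: of_real_eq_0_iff not_False_eq_True)
  moreover define P where "P = complex_of_real (rho n * mu n * msq n) * pref n"
  ultimately have "P \<noteq> 0" by (simp add: pref_def)
  moreover have "QQ n = pf f n * (2 * pi) / P" by (simp add: QQ_def Rm_def P_def)
  ultimately show ?case unfolding P_def[symmetric] by simp
qed

end


subsection \<open>The asymptotic formula\<close>

text \<open>Indices start at 2 as in the sums of the theorem; the empty set gives an empty index
  range.\<close>

lemma enumerate_finite_real_set:
  fixes D :: "real set"
  assumes "finite D"
  shows "\<exists>e. bij_betw e {2..Suc (card D)} D \<and> (\<forall>j\<in>{2..<Suc (card D)}. e j < e (Suc j))"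
proof -
  define xs where "xs = sorted_list_of_set D"
  have xs: "set xs = D" "distinct xs" "length xs = card D" "sorted_wrt (<) xs"
    using assms by (auto simp: xs_def)
  have 1: "bij_betw (\<lambda>j. j - 2) {2..Suc (card D)} {..<card D}"
    by (rule bij_betw_byWitness[of _ "\<lambda>j. j + 2"]) auto
  have 2: "bij_betw ((!) xs) {..<card D} D" by (rule bij_betw_nth) (use xs in auto)
  have "bij_betw (\<lambda>j. xs ! (j - 2)) {2..Suc (card D)} D"
    using bij_betw_trans[OF 1 2] by (simp add: o_def)
  moreover have "xs ! (j - 2) < xs ! (Suc j - 2)" if "j \<in> {2..<Suc (card D)}" for j
    by (rule sorted_wrt_nth_less[OF xs(4)]) (use that xs(3) in auto)
  ultimately show ?thesis by (intro exI[of _ "\<lambda>j. xs ! (j - 2)"]) simp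
qed

text \<open>All monomials with positive exponent tend to 0, so the constant term of the expansion
  must be the limit; it is split off and the other exponents are positive.\<close>

lemma cls_GX_explicit:
  assumes S: "0 \<in> S" "\<forall>s\<in>S. \<forall>t\<in>S. s + t \<in> S" "\<forall>s\<in>S. s \<ge> 0"
    and g: "g \<in> scale.cls sequentially (\<lambda>n. 1 / real n) (GX S) T" "T > 0" "g \<longlonglongrightarrow> l"
  shows "\<exists>D c. finite D \<and> D \<subseteq> S - {0} \<and>
    scale.ord sequentially (\<lambda>n. 1 / real n) T (\<lambda>n. g n - (l + (\<Sum>s\<in>D. c s * mon s n)))"
proof -
  interpret scale sequentially "\<lambda>n. 1 / real n" "GX S" by (rule scale_X) (use S in auto)
  from g(1) obtain p where p: "p \<in> espan (GX S)" "ord T (\<lambda>n. g n - p n)" by (rule clsE)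
  from espan_GX_explicit[OF p(1)] obtain D c where D: "finite D" "D \<subseteq> S" "p = (\<lambda>n. \<Sum>s\<in>D. c s * mon s n)"
    by (elim exE conjE)
  define c0 where "c0 = (if 0 \<in> D then c 0 else 0)"
  define D' where "D' = D - {0}"
  have eq: "p n = c0 + (\<Sum>s\<in>D'. c s * mon s n)" for n
  proof (cases "0 \<in> D")
    case True
    have "mon 0 n = 1" by (simp add: mon_def)
    thus ?thesis using True sum.remove[OF D(1) True, of "\<lambda>s. c s * mon s n"] by (simp add: D(3) c0_def D'_def)
  qed (simp add: D(3) c0_def D'_def)
  have "(\<lambda>n. c0 + (\<Sum>s\<in>D'. c s * mon s n)) \<longlonglongrightarrow> c0 + (\<Sum>s\<in>D'. c s * 0)"
  proof (intro tendsto_add tendsto_const tendsto_sum tendsto_mult)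
    fix s assume "s \<in> D'"
    hence s: "s > 0" using D(2) S(3) by (auto simp: D'_def less_le)
    have "ord s (mon s)"
    proof (rule ordI[of _ 1])
      show "\<forall>\<^sub>F n in sequentially. norm (mon s n) \<le> 1 * (1 / real n) powr s"
        using eventually_gt_at_top[of 0] by eventually_elim (simp only: norm_mon)
    qed
    thus "mon s \<longlonglongrightarrow> 0" by (rule ord_tendsto_0[OF _ s])
  qed
  hence pl: "p \<longlonglongrightarrow> c0" by (simp add: eq[abs_def])
  have "(\<lambda>n. g n - p n + p n) \<longlonglongrightarrow> 0 + c0" by (rule tendsto_add[OF ord_tendsto_0[OF p(2) g(2)] pl])
  hence "g \<longlonglongrightarrow> c0" by simp
  hence "l = c0" by (rule LIMSEQ_unique[OF g(3)])
  hence "ord T (\<lambda>n. g n - (l + (\<Sum>s\<in>D'. c s * mon s n)))" using p(2) by (simp add: eq)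
  moreover have "finite D'" "D' \<subseteq> S - {0}" using D by (auto simp: D'_def)
  ultimately show ?thesis by blast
qed

lemma zeta_real_nonzero:
  assumes "x > (1::real)"
  shows "zeta (of_real x) \<noteq> 0"
proof -
  have "(\<lambda>n. Re (of_nat (Suc n) powr (- complex_of_real x))) sums Re (zseries (of_real x))"
    by (rule sums_Re[OF zseries_sums]) (use assms in simp)
  moreover have "Re (of_nat (Suc n) powr (- complex_of_real x)) = real (Suc n) powr - x" for n
  proof -
    have "complex_of_real (real (Suc n)) powr of_real (- x) = of_real (real (Suc n) powr - x)"
      by (rule powr_of_real) simp
    thus ?thesis by (simp only: of_real_of_nat_eq of_real_minus Re_complex_of_real)
  qed
  ultimately have s: "(\<lambda>n. real (Suc n) powr - x) sums Re (zseries (of_real x))" by simp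
  have "(\<Sum>n<1. real (Suc n) powr - x) \<le> Re (zseries (of_real x))"
    unfolding sums_unique[OF s] by (rule sum_le_suminf[OF sums_summable[OF s]]) auto
  hence "Re (zeta (of_real x)) \<ge> 1" using zeta_eq_zseries[of "of_real x"] assms by simp
  thus ?thesis by auto
qed

lemma of_real_pos_not_nonpos_Ints: "x > 0 \<Longrightarrow> complex_of_real x \<notin> \<int>\<^sub>\<le>\<^sub>0"
  by (auto elim!: nonpos_Ints_cases' dest!: arg_cong[of _ _ Re])

context partition_setting
begin

lemma H_pole_F_pole: "x > 0 \<Longrightarrow> is_pole H (of_real x) \<Longrightarrow> is_pole F (of_real x)"
proof (rule ccontr)
  assume x: "x > 0" "is_pole H (of_real x)" "\<not> is_pole F (of_real x)"
  have "F analytic_on {of_real x}" by (rule F_analytic) (use x R_pos in auto)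
  moreover have "complex_of_real x \<notin> \<int>\<^sub>\<le>\<^sub>0" by (rule of_real_pos_not_nonpos_Ints[OF x(1)])
  ultimately have "H analytic_on {of_real x}" by (rule H_analytic)
  thus False using x(2) analytic_at_imp_no_pole by blast
qed

text \<open>Gamma(\<alpha>) zeta(\<alpha>+1) is not 0, so dividing it out of
  \<open>acoef \<alpha>\<close> gives the residue of F; then Gamma(\<alpha>+1) = \<alpha>
  Gamma(\<alpha>). The constant is therefore winf^{\<alpha>+1}, which links the saddle point to A_1
  and C.\<close>

lemma pole_const_eq: "pole_const F \<alpha> = of_real (\<alpha> * aa \<alpha>)"
proof -
  let ?a = "complex_of_real \<alpha>"
  define q where "q = (\<lambda>s. Gamma s * zeta (s + 1))"
  have "\<alpha> + 1 > 1" using alpha_pos by simp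
  from zeta_real_nonzero[OF this] have z: "zeta (?a + 1) \<noteq> 0" by simp
  have ng: "?a \<notin> \<int>\<^sub>\<le>\<^sub>0" by (rule of_real_pos_not_nonpos_Ints[OF alpha_pos])
  hence q0: "q ?a \<noteq> 0" using z by (simp add: q_def Gamma_eq_zero_iff)
  have a1: "?a + 1 \<noteq> 1" using alpha_pos by simp
  have "isCont zeta (?a + 1)"
    using holomorphic_on_imp_continuous_on[OF holomorphic_zeta] a1
    by (simp add: continuous_on_eq_continuous_at open_Compl)
  hence "isCont (\<lambda>s. zeta (s + 1)) ?a" by (intro isCont_o2[of _ "\<lambda>s. s + 1" zeta] continuous_intros)
  hence "isCont q ?a" unfolding q_def using ng by (intro continuous_intros isCont_Gamma continuous_ident) auto
  hence ql: "(q \<longlongrightarrow> q ?a) (at ?a)" by (simp add: isCont_def)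
  have "((\<lambda>s. (s - ?a) * H s / q s) \<longlongrightarrow> acoef \<alpha> / q ?a) (at ?a)"
    by (intro tendsto_divide acoef(2)[OF alpha_Pol] ql q0)
  moreover have "\<forall>\<^sub>F s in at ?a. (s - ?a) * H s / q s = F s * (s - ?a)"
    using tendsto_imp_eventually_ne[OF ql q0]
    by eventually_elim (simp add: q_def Lstar_def)
  ultimately have lim: "((\<lambda>s. F s * (s - ?a)) \<longlongrightarrow> acoef \<alpha> / q ?a) (at ?a)"
    by (rule Lim_transform_eventually)
  have "F meromorphic_on {s. Re s \<ge> - R}" using F_nice by (simp add: nicely_meromorphic_on_def)
  hence "F meromorphic_on {?a}" by (rule meromorphic_on_subset) (use alpha_pos R_pos in auto)
  hence "isolated_singularity_at F ?a" by (rule meromorphic_on_isolated_singularity)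
  then obtain r where r: "r > 0" "F analytic_on ball ?a r - {?a}" by (auto simp: isolated_singularity_at_def)
  have "residue F ?a = acoef \<alpha> / q ?a"
    by (rule residue_simple'[OF open_ball[of ?a r] _ analytic_imp_holomorphic[OF r(2)] lim]) (use r in simp)
  hence "residue F ?a * q ?a = acoef \<alpha>" using q0 by simp
  moreover have "Gamma (?a + 1) = ?a * Gamma ?a" using ng by (rule Gamma_plus1)
  ultimately have "pole_const F \<alpha> = ?a * acoef \<alpha>" unfolding pole_const_def q_def by (simp add: mult_ac)
  thus ?thesis using acoef_Pp[OF Pp(2)] by simp
qed

lemma pole_const_powr: "pole_const F \<alpha> powr (q / (of_real \<alpha> + 1)) = of_real winf powr q"
proof -
  have p: "\<alpha> * aa \<alpha> > 0" using alpha_pos aa_alpha by simp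
  have l: "ln (\<alpha> * aa \<alpha>) = (\<alpha> + 1) * ln winf" using winf by (metis ln_powr)
  have n: "of_real \<alpha> + 1 \<noteq> (0::complex)" using alpha_pos by (metis add_pos_pos less_irrefl of_real_0 of_real_1 of_real_add of_real_eq_iff zero_less_one)
  have "pole_const F \<alpha> \<noteq> 0" unfolding pole_const_eq of_real_eq_0_iff using p by linarith
  moreover have "Ln (pole_const F \<alpha>) = of_real ((\<alpha> + 1) * ln winf)"
    unfolding pole_const_eq Ln_of_real[OF p] l ..
  ultimately show ?thesis unfolding powr_def using winf(1) n by (simp add: Ln_of_real)
qed

lemma constA1_eq: "constA1 F \<alpha> = of_real ((1 + 1 / \<alpha>) * winf)"
  unfolding constA1_def pole_const_powr using winf(1) by simp

lemma constC_eq: "constC F \<alpha> = of_real winf powr (1 - F 0) * of_real minf * exp (deriv F 0) / (2 * pi) * of_real (sqrt pi)"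
proof -
  have s: "sqrt winf * minf / (2 * pi) * sqrt pi = 1 / sqrt (2 * pi * (\<alpha> + 1))"
  proof -
    have m: "minf = 1 / sqrt ((\<alpha> + 1) * winf / 2)"
      unfolding minf_def powr_minus inverse_eq_divide using dd_lim_pos by (subst powr_half_sqrt) auto
    have "sqrt winf * minf = sqrt (winf / ((\<alpha> + 1) * winf / 2))"
      unfolding m real_sqrt_divide[of winf] by (simp only: times_divide_eq_right mult_1_right)
    also have "winf / ((\<alpha> + 1) * winf / 2) = 2 / (\<alpha> + 1)" using winf(1) by simp
    finally have 1: "sqrt winf * minf = sqrt (2 / (\<alpha> + 1))" .
    have 2: "sqrt pi / (2 * pi) = sqrt (1 / (4 * pi))"
    proof -
      have "pi = sqrt pi * sqrt pi" by simp
      hence "sqrt pi / (2 * pi) = sqrt pi / (2 * (sqrt pi * sqrt pi))" by simp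
      also have "\<dots> = 1 / (2 * sqrt pi)" by (simp del: real_sqrt_mult_self)
      finally show ?thesis by (simp add: real_sqrt_divide real_sqrt_mult)
    qed
    have "sqrt winf * minf / (2 * pi) * sqrt pi = (sqrt winf * minf) * (sqrt pi / (2 * pi))" by simp
    also have "\<dots> = sqrt (2 / (\<alpha> + 1) * (1 / (4 * pi)))" unfolding 1 2 real_sqrt_mult ..
    also have "2 / (\<alpha> + 1) * (1 / (4 * pi)) = 1 / (2 * pi * (\<alpha> + 1))"
    proof -
      have nz: "(\<alpha> + 1) * (4 * pi) \<noteq> 0" "2 * pi * (\<alpha> + 1) \<noteq> 0" using alpha_pos by auto
      show ?thesis unfolding times_divide_times_eq frac_eq_eq[OF nz] by (simp add: algebra_simps)
    qed
    finally show ?thesis by (simp add: real_sqrt_divide)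
  qed
  have w: "of_real winf powr (1 - F 0) = of_real winf powr (1 / 2 - F 0) * of_real (sqrt winf)"
  proof -
    have "of_real winf powr (1 - F 0) = of_real winf powr ((1 / 2 - F 0) + of_real (1 / 2))" by simp
    also have "\<dots> = of_real winf powr (1 / 2 - F 0) * of_real winf powr of_real (1 / 2)" by (rule powr_add)
    also have "complex_of_real winf powr of_real (1 / 2) = of_real (sqrt winf)"
      using winf powr_of_real[of winf "1 / 2"] by (simp add: powr_half_sqrt)
    finally show ?thesis .
  qed
  have "complex_of_real (sqrt winf * minf / (2 * pi) * sqrt pi) = of_real (1 / sqrt (2 * pi * (\<alpha> + 1)))" by (simp only: s)
  hence s': "of_real (sqrt winf) * of_real minf / (2 * pi) * of_real (sqrt pi) = 1 / complex_of_real (sqrt (2 * pi * (\<alpha> + 1)))"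
    by simp
  have "of_real winf powr (1 - F 0) * of_real minf * exp (deriv F 0) / (2 * pi) * of_real (sqrt pi)
      = exp (deriv F 0) * of_real winf powr (1 / 2 - F 0) * (of_real (sqrt winf) * of_real minf / (2 * pi) * of_real (sqrt pi))"
    unfolding w by simp
  also have "\<dots> = constC F \<alpha>" unfolding s' constC_def pole_const_powr by simp
  finally show ?thesis ..
qed

lemma constC_nonzero: "constC F \<alpha> \<noteq> 0"
  unfolding constC_def pole_const_powr using winf(1) alpha_pos by simp

text \<open>What remains of p_f(n) when n^{-b} and exp(lam Hr) are divided out; its limit is
  C.\<close>

definition Q2 :: "nat \<Rightarrow> complex" where
  "Q2 n = of_real (ww n) powr (1 - F 0) * of_real (msq n) * exp (deriv F 0) / (2 * pi) * QQ n"

lemma Q2: "Q2 \<in> X.cls TT" "Q2 \<longlonglongrightarrow> constC F \<alpha>"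
proof -
  have 1: "(\<lambda>n. of_real (ww n) powr (1 - F 0)) \<in> X.cls TT"
    by (rule X0_X[OF X0.cls_powr[OF ww_cls TT(1) ww_tendsto winf(1)]])
  have "(\<lambda>n. (exp (deriv F 0) / (2 * pi)) * (of_real (ww n) powr (1 - F 0) * (of_real (msq n) * QQ n))) \<in> X.cls TT"
    using TT(1) by (intro X.cls_cmult X.cls_mult 1 msq_cls QQ(1)) auto
  thus "Q2 \<in> X.cls TT" unfolding Q2_def[abs_def] by (simp add: mult_ac)
  show "Q2 \<longlonglongrightarrow> constC F \<alpha>" unfolding Q2_def[abs_def] constC_eq
  proof (intro tendsto_mult tendsto_divide tendsto_const QQ(2) tendsto_of_real[OF msq_tendsto])
    show "(\<lambda>n. complex_of_real (ww n) powr (1 - F 0)) \<longlonglongrightarrow> of_real winf powr (1 - F 0)"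
      by (rule tendsto_powr_complex[OF _ tendsto_of_real[OF ww_tendsto] tendsto_const]) (use winf in \<open>simp add: complex_nonpos_Reals_iff\<close>)
  qed simp
qed

text \<open>The power of n comes from three sources: rho from the length element, rho^{-F(0)} from
  \<open>pref\<close>, and the Gaussian width mu. Together they give n^{-b} times
  w^{1-F(0)}.\<close>

lemma pf_eq_Q2:
  "\<forall>\<^sub>F n in sequentially. pf f n = 1 / of_nat n powr constb F \<alpha> * exp (of_real (lam n * Hr n)) * Q2 n"
  using pf_eq_QQ eventually_gt_at_top[of 0]
proof eventually_elim
  case (elim n)
  have n: "n > 0" and r: "rho n > 0" and w: "ww n > 0" using elim rho_pos ww_range by auto
  define l where "l = complex_of_real (ln (real n))"
  have lr: "complex_of_real (ln (rho n)) = - of_real kap * l + of_real (ln (ww n))"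
    unfolding rho_def l_def using n w by (simp add: ln_mult ln_powr)
  have e1: "of_real (rho n) = exp (- of_real kap * l + of_real (ln (ww n)))"
    unfolding lr[symmetric] using r by (simp add: exp_of_real)
  have e2: "of_real (mu n) = exp (- (of_real (\<alpha> * kap / 2) * l))"
    unfolding mu_def l_def powr_def using n by (simp flip: exp_of_real)
  have e3: "of_real (ww n) powr (1 - F 0) = exp ((1 - F 0) * of_real (ln (ww n)))"
    using w by (simp add: powr_def Ln_of_real)
  have e4: "1 / of_nat n powr constb F \<alpha> = exp (- (constb F \<alpha> * l))"
    using n by (simp add: powr_def l_def exp_minus field_simps Ln_of_nat)
  have cb: "constb F \<alpha> = of_real kap * (1 - F 0) + of_real (\<alpha> * kap / 2)"
    unfolding constb_def kap_def by (simp add: add_divide_distrib diff_divide_distrib)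
  have "of_real (rho n) * of_real (mu n) * pref n = 1 / of_nat n powr constb F \<alpha> * exp (of_real (lam n * Hr n)) * (of_real (ww n) powr (1 - F 0) * exp (deriv F 0))"
    unfolding e4 unfolding e1 e2 e3 pref_def lr exp_add[symmetric] cb by (rule arg_cong[of _ _ exp]) (simp add: algebra_simps)
  hence "(of_real (rho n) * of_real (mu n) * pref n) * of_real (msq n) * QQ n / (2 * pi) =
     (1 / of_nat n powr constb F \<alpha> * exp (of_real (lam n * Hr n)) * (of_real (ww n) powr (1 - F 0) * exp (deriv F 0))) * of_real (msq n) * QQ n / (2 * pi)"
    by (simp only:)
  thus ?case unfolding elim(1) Q2_def by (simp add: mult_ac)
qed

lemma S_props: "0 \<in> S0" "\<forall>s\<in>S0. \<forall>t\<in>S0. s + t \<in> S0" "\<forall>s\<in>S0. s \<ge> 0"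
  "0 \<in> Sx" "\<forall>s\<in>Sx. \<forall>t\<in>Sx. s + t \<in> Sx" "\<forall>s\<in>Sx. s \<ge> 0"
  using S0_zero S0_add S0_nshift nshift_nonneg Sx_nshift[OF nshift_zero] Sx_add Sx_nonneg by auto

lemma lam_mon: "n > 0 \<Longrightarrow> of_real (lam n) * mon s n = of_real (real n powr (\<alpha> * kap - s))"
  by (simp add: lam_def mon_eq powr_add[symmetric] flip: of_real_mult)

text \<open>The expansion of \<open>Hr\<close>, multiplied by n^{\<alpha> kap}, splits at s =
  \<alpha> kap: smaller or equal exponents give powers that do not decay and stay in the
  exponential, larger ones tend to 0, and exp of them is again expandable with limit 1.\<close>

lemma exponent_expansion:
  obtains D c where "finite D" "D \<subseteq> S0 \<inter> {0<..\<alpha> * kap}"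
    "(\<lambda>n. exp (of_real (lam n * Hr n) - (constA1 F \<alpha> * of_real (lam n) + (\<Sum>s\<in>D. c s * of_real (real n powr (\<alpha> * kap - s)))))) \<in> X.cls TT"
    "(\<lambda>n. exp (of_real (lam n * Hr n) - (constA1 F \<alpha> * of_real (lam n) + (\<Sum>s\<in>D. c s * of_real (real n powr (\<alpha> * kap - s)))))) \<longlonglongrightarrow> 1"
proof -
  \<comment> \<open>Multiplication by \<open>lam\<close> costs \<alpha> kap of accuracy, so
    \<open>Hr\<close> is expanded that much further.\<close>
  have T: "TT + \<alpha> * kap > 0" using TT kap by simp
  have "(\<lambda>n. complex_of_real (Hr n)) \<longlonglongrightarrow> constA1 F \<alpha>"
    unfolding constA1_eq by (rule tendsto_of_real[OF Hr_tendsto])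
  from cls_GX_explicit[OF S_props(1-3) Hr_cls[OF T] T this] obtain D0 c where D0: "finite D0" "D0 \<subseteq> S0 - {0}"
    "X.ord (TT + \<alpha> * kap) (\<lambda>n. of_real (Hr n) - (constA1 F \<alpha> + (\<Sum>s\<in>D0. c s * mon s n)))" by (elim exE conjE)
  define D where "D = {s\<in>D0. s \<le> \<alpha> * kap}"
  define Db where "Db = {s\<in>D0. s > \<alpha> * kap}"
  have split: "D0 = D \<union> Db" "D \<inter> Db = {}" "finite D" "finite Db" using D0(1) by (auto simp: D_def Db_def)
  define r where "r = (\<lambda>n. of_real (Hr n) - (constA1 F \<alpha> + (\<Sum>s\<in>D0. c s * mon s n)))"
  define g where "g = (\<lambda>n. of_real (lam n * Hr n) - (constA1 F \<alpha> * of_real (lam n) + (\<Sum>s\<in>D. c s * of_real (real n powr (\<alpha> * kap - s)))))"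
  have geq: "\<forall>\<^sub>F n in sequentially. g n = (\<Sum>s\<in>Db. c s * mon (s - \<alpha> * kap) n) + of_real (lam n) * r n"
    using eventually_gt_at_top[of 0]
  proof eventually_elim
    case (elim n)
    have "of_real (lam n) * r n = of_real (lam n * Hr n) - constA1 F \<alpha> * of_real (lam n) - (\<Sum>s\<in>D0. c s * (of_real (lam n) * mon s n))"
      unfolding r_def by (simp add: algebra_simps sum_distrib_left)
    also have "(\<Sum>s\<in>D0. c s * (of_real (lam n) * mon s n)) = (\<Sum>s\<in>D0. c s * of_real (real n powr (\<alpha> * kap - s)))"
      by (simp only: lam_mon[OF elim])
    also have "\<dots> = (\<Sum>s\<in>D. c s * of_real (real n powr (\<alpha> * kap - s))) + (\<Sum>s\<in>Db. c s * of_real (real n powr (\<alpha> * kap - s)))"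
      unfolding split(1) by (rule sum.union_disjoint[OF split(3,4,2)])
    also have "(\<Sum>s\<in>Db. c s * of_real (real n powr (\<alpha> * kap - s))) = (\<Sum>s\<in>Db. c s * mon (s - \<alpha> * kap) n)"
      by (simp add: mon_eq[OF elim])
    finally show ?case by (simp add: g_def algebra_simps)
  qed
  have lo: "X.ord TT (\<lambda>n. of_real (lam n) * r n)"
  proof -
    obtain K where K: "\<forall>\<^sub>F n in sequentially. norm (r n) \<le> K * (1 / real n) powr (TT + \<alpha> * kap)"
      using D0(3) unfolding r_def[symmetric] by (rule X.ordE)
    have "\<forall>\<^sub>F n in sequentially. norm (of_real (lam n) * r n) \<le> K * (1 / real n) powr TT"
      using K eventually_gt_at_top[of 0]
    proof eventually_elim
      case (elim n)
      have "lam n * norm (r n) \<le> lam n * (K * (1 / real n) powr (TT + \<alpha> * kap))"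
        using elim(1) by (rule mult_left_mono) (simp add: lam_def)
      also have "\<dots> = K * (1 / real n) powr TT * (lam n * (1 / real n) powr (\<alpha> * kap))" by (simp add: powr_add mult_ac)
      also have "lam n * (1 / real n) powr (\<alpha> * kap) = 1" using elim(2) by (simp add: lam_def powr_divide)
      finally show ?case by (simp add: norm_mult lam_def)
    qed
    thus ?thesis by (rule X.ordI)
  qed
  have mc: "mon (s - \<alpha> * kap) \<in> X.cls TT" if "s \<in> Db" for s
  proof (cases "s - \<alpha> * kap < R * kap")
    case True
    have "s \<in> nshift" "\<alpha> * kap < s" using that D0(2) S0_nshift by (auto simp: Db_def)
    from Sx_big[OF this True] show ?thesis by (intro X.cls_base) (auto simp: GX_def)
  next
    case False
    show ?thesis by (rule X.cls_ord[OF X.ord_mono[OF ord_mon]]) (use False TT(2) in simp)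
  qed
  have gc: "g \<in> X.cls TT"
    by (rule X.cls_cong[OF geq]) (use TT(1) in \<open>intro X.cls_add X.cls_sum X.cls_cmult mc X.cls_ord[OF lo]; simp\<close>)
  have "(\<lambda>n. (\<Sum>s\<in>Db. c s * mon (s - \<alpha> * kap) n) + of_real (lam n) * r n) \<longlonglongrightarrow> (\<Sum>s\<in>Db. c s * 0) + 0"
  proof (intro tendsto_add tendsto_sum tendsto_mult tendsto_const X.ord_tendsto_0[OF lo TT(1)])
    fix s assume "s \<in> Db"
    thus "mon (s - \<alpha> * kap) \<longlonglongrightarrow> 0" by (intro X.ord_tendsto_0[OF ord_mon]) (simp add: Db_def)
  qed
  hence "(\<lambda>n. (\<Sum>s\<in>Db. c s * mon (s - \<alpha> * kap) n) + of_real (lam n) * r n) \<longlonglongrightarrow> 0" by simp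
  hence gl: "g \<longlonglongrightarrow> 0" by (rule Lim_transform_eventually) (use geq in \<open>eventually_elim, simp\<close>)
  have "(\<lambda>n. exp (g n)) \<in> X.cls TT" by (rule X.cls_compose[OF gc TT(1) gl]) (intro analytic_intros)
  moreover have "(\<lambda>n. exp (g n)) \<longlonglongrightarrow> 1" using tendsto_exp[OF gl] by simp
  moreover have "D \<subseteq> S0 \<inter> {0<..\<alpha> * kap}" using D0(2) S_props(3) by (auto simp: D_def less_le)
  ultimately show thesis using split(3) unfolding g_def by (intro that)
qed

theorem asymptotic_formula:
  "\<exists>(M::nat) (N::nat) (a::nat \<Rightarrow> real) (\<beta>::nat \<Rightarrow> real) (A::nat \<Rightarrow> complex) (B::nat \<Rightarrow> complex)
           (E::nat \<Rightarrow> complex).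
      M \<ge> 1 \<and> N \<ge> 1 \<and>
      a 1 = \<alpha> / (\<alpha> + 1) \<and> (\<forall>j\<in>{1..<M}. a (Suc j) < a j) \<and> 0 \<le> a M \<and>
      (\<forall>j\<in>{1..M}. a j \<in> setL R F \<alpha>) \<and>
      (\<forall>j\<in>{2..N}. 0 < \<beta> j \<and> \<beta> j \<in> setM R F \<alpha> + setN R F \<alpha>) \<and>
      (\<forall>j\<in>{2..<N}. \<beta> j < \<beta> (Suc j)) \<and>
      E \<in> O(\<lambda>n. of_real (real n powr
              (- min ((2 * real L - \<alpha>) / (2 * (\<alpha> + 1))) (R / (\<alpha> + 1))))) \<and>
      (\<forall>\<^sub>F n in sequentially.
         pf f n = constC F \<alpha> / of_nat n powr constb F \<alpha>
           * exp (constA1 F \<alpha> * of_real (real n powr (\<alpha> / (\<alpha> + 1)))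
                  + (\<Sum>j=2..M. A j * of_real (real n powr a j)))
           * (1 + (\<Sum>j=2..N. B j / of_real (real n powr \<beta> j)) + E n)) \<and>
      ((\<forall>x::real. x > 0 \<and> is_pole F (of_real x) \<longrightarrow> x = \<alpha>) \<longrightarrow> M = 1)"
proof -
  have ak: "\<alpha> / (\<alpha> + 1) = \<alpha> * kap" by (simp add: kap_def)
  have TTeq: "min ((2 * real L - \<alpha>) / (2 * (\<alpha> + 1))) (R / (\<alpha> + 1)) = TT" by (simp add: TT_def kap_def)
  obtain D c where D: "finite D" "D \<subseteq> S0 \<inter> {0<..\<alpha> * kap}" and
    gc: "(\<lambda>n. exp (of_real (lam n * Hr n) - (constA1 F \<alpha> * of_real (lam n) + (\<Sum>s\<in>D. c s * of_real (real n powr (\<alpha> * kap - s)))))) \<in> X.cls TT" and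
    gl: "(\<lambda>n. exp (of_real (lam n * Hr n) - (constA1 F \<alpha> * of_real (lam n) + (\<Sum>s\<in>D. c s * of_real (real n powr (\<alpha> * kap - s)))))) \<longlonglongrightarrow> 1"
    by (rule exponent_expansion)
  define G where "G = (\<lambda>n. constA1 F \<alpha> * of_real (lam n) + (\<Sum>s\<in>D. c s * of_real (real n powr (\<alpha> * kap - s))))"
  \<comment> \<open>The whole second factor divided by C, hence with limit 1; it is this function
    that gets the final expansion.\<close>
  define Q3 where "Q3 = (\<lambda>n. exp (of_real (lam n * Hr n) - G n) * ((1 / constC F \<alpha>) * Q2 n))"
  have Q3c: "Q3 \<in> X.cls TT"
    unfolding Q3_def G_def using TT(1) by (intro X.cls_mult gc X.cls_cmult Q2) auto
  have "Q3 \<longlonglongrightarrow> 1 * ((1 / constC F \<alpha>) * constC F \<alpha>)"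
    unfolding Q3_def G_def by (intro tendsto_mult gl Q2 tendsto_const)
  hence Q3l: "Q3 \<longlonglongrightarrow> 1" using constC_nonzero by simp
  from cls_GX_explicit[OF S_props(4-6) Q3c TT(1) Q3l] obtain D1 d where D1: "finite D1" "D1 \<subseteq> Sx - {0}"
    "X.ord TT (\<lambda>n. Q3 n - (1 + (\<Sum>s\<in>D1. d s * mon s n)))" by (elim exE conjE)
  \<comment> \<open>Terms of exponent \<open>TT\<close> or more are absorbed by the error;
    membership of the others in \<open>setM + setN\<close> depends on this cut.\<close>
  define D2 where "D2 = {s\<in>D1. s < TT}"
  have D2: "finite D2" "D2 \<subseteq> D1" using D1 by (auto simp: D2_def)
  have D2ord: "X.ord TT (\<lambda>n. Q3 n - (1 + (\<Sum>s\<in>D2. d s * mon s n)))"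
  proof -
    have "X.ord TT (\<lambda>n. (Q3 n - (1 + (\<Sum>s\<in>D1. d s * mon s n))) + (\<Sum>s\<in>D1 - D2. d s * mon s n))"
      by (intro X.ord_add D1(3) X.ord_sum X.ord_cmult X.ord_mono[OF ord_mon]) (auto simp: D2_def)
    moreover have "(\<Sum>s\<in>D1. d s * mon s n) = (\<Sum>s\<in>D1 - D2. d s * mon s n) + (\<Sum>s\<in>D2. d s * mon s n)" for n
      by (rule sum.subset_diff[OF D2(2) D1(1)])
    ultimately show ?thesis by (simp add: algebra_simps)
  qed
  obtain e where e: "bij_betw e {2..Suc (card D)} D" "\<forall>j\<in>{2..<Suc (card D)}. e j < e (Suc j)"
    using enumerate_finite_real_set[OF D(1)] by (elim exE conjE)
  obtain \<beta> where \<beta>: "bij_betw \<beta> {2..Suc (card D2)} D2" "\<forall>j\<in>{2..<Suc (card D2)}. \<beta> j < \<beta> (Suc j)"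
    using enumerate_finite_real_set[OF D2(1)] by (elim exE conjE)
  \<comment> \<open>Index 1 is the main term; as \<open>e\<close> lists the set \<open>D\<close>
    increasingly, the exponents \<alpha> kap - e j decrease, and they stay nonnegative because
    \<open>D\<close> is bounded by \<alpha> kap.\<close>
  define a where "a = (\<lambda>j. if j = 1 then \<alpha> * kap else \<alpha> * kap - e j)"
  \<comment> \<open>With this definition the formula for p_f(n) is an identity for large n, and only
    the size of \<open>E\<close> has to be estimated.\<close>
  define E where "E = (\<lambda>n. Q3 n - (1 + (\<Sum>j=2..Suc (card D2). d (\<beta> j) / of_real (real n powr \<beta> j))))"
  have eD: "e j \<in> D" if "j \<in> {2..Suc (card D)}" for j using bij_betw_apply[OF e(1) that] .
  have bD: "\<beta> j \<in> D2" if "j \<in> {2..Suc (card D2)}" for j using bij_betw_apply[OF \<beta>(1) that] .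
  have dec: "\<forall>j\<in>{1..<Suc (card D)}. a (Suc j) < a j"
  proof
    fix j assume that: "j \<in> {1..<Suc (card D)}"
    show "a (Suc j) < a j"
  proof (cases "j = 1")
    case True
    hence "e (Suc j) > 0" using eD[of "Suc j"] D(2) that by auto
    thus ?thesis using True by (simp add: a_def)
  next
    case False
    thus ?thesis using e(2) that by (auto simp: a_def)
  qed
  qed
  have aL: "\<forall>j\<in>{1..Suc (card D)}. a j \<in> setL R F \<alpha>"
  proof
    fix j assume that: "j \<in> {1..Suc (card D)}"
    show "a j \<in> setL R F \<alpha>"
  proof (cases "j = 1")
    case True
    thus ?thesis using setL_shift[OF alpha_poleset(1) nshift_zero] by (simp add: a_def)
  next
    case False
    hence "e j \<in> nshift" using eD[of j] that D(2) S0_nshift by auto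
    thus ?thesis using setL_shift[OF alpha_poleset(1)] False by (simp add: a_def)
  qed
  qed
  have a0: "0 \<le> a (Suc (card D))"
  proof (cases "card D = 0")
    case False
    hence "e (Suc (card D)) \<in> D" by (intro eD) auto
    thus ?thesis using D(2) kap(4) by (auto simp: a_def)
  qed (use kap in \<open>simp add: a_def\<close>)
  have bMN: "\<forall>j\<in>{2..Suc (card D2)}. 0 < \<beta> j \<and> \<beta> j \<in> setM R F \<alpha> + setN R F \<alpha>"
  proof
    fix j assume that: "j \<in> {2..Suc (card D2)}"
    have b: "\<beta> j \<in> Sx" "\<beta> j \<noteq> 0" "\<beta> j < TT" using bD[OF that] D1(2) by (auto simp: D2_def)
    show "0 < \<beta> j \<and> \<beta> j \<in> setM R F \<alpha> + setN R F \<alpha>" using Sx_MN[OF b(1,3)] Sx_nonneg[OF b(1)] b(2) by simp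
  qed
  have sumB: "\<forall>\<^sub>F n in sequentially. (\<Sum>j=2..Suc (card D2). d (\<beta> j) / of_real (real n powr \<beta> j)) = (\<Sum>s\<in>D2. d s * mon s n)"
    using eventually_gt_at_top[of 0]
  proof eventually_elim
    case (elim n)
    have "(\<Sum>s\<in>D2. d s * mon s n) = (\<Sum>j=2..Suc (card D2). d (\<beta> j) * mon (\<beta> j) n)"
      by (rule sum.reindex_bij_betw[OF \<beta>(1), symmetric])
    thus ?case by (simp add: mon_eq[OF elim] powr_minus_divide)
  qed
  have sumA: "(\<Sum>j=2..Suc (card D). c (e j) * of_real (real n powr a j)) = (\<Sum>s\<in>D. c s * of_real (real n powr (\<alpha> * kap - s)))" for n
  proof -
    have "(\<Sum>s\<in>D. c s * complex_of_real (real n powr (\<alpha> * kap - s))) = (\<Sum>j=2..Suc (card D). c (e j) * of_real (real n powr (\<alpha> * kap - e j)))"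
      by (rule sum.reindex_bij_betw[OF e(1), symmetric])
    also have "\<dots> = (\<Sum>j=2..Suc (card D). c (e j) * of_real (real n powr a j))" by (intro sum.cong) (auto simp: a_def)
    finally show ?thesis ..
  qed
  have "X.ord TT E"
    by (rule X.ord_cong[OF _ D2ord]) (use sumB in \<open>eventually_elim, simp add: E_def\<close>)
  then obtain K where K: "\<forall>\<^sub>F n in sequentially. norm (E n) \<le> K * (1 / real n) powr TT" by (rule X.ordE)
  have EO: "E \<in> O(\<lambda>n. of_real (real n powr (- TT)))"
  proof (rule bigoI[of _ K])
    show "\<forall>\<^sub>F n in sequentially. norm (E n) \<le> K * norm (complex_of_real (real n powr - TT))"
      using K by eventually_elim (simp only: norm_of_real, simp add: powr_divide powr_minus_divide)
  qed
  have main: "\<forall>\<^sub>F n in sequentially. pf f n = constC F \<alpha> / of_nat n powr constb F \<alpha>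
           * exp (constA1 F \<alpha> * of_real (real n powr (\<alpha> * kap))
                  + (\<Sum>j=2..Suc (card D). c (e j) * of_real (real n powr a j)))
           * (1 + (\<Sum>j=2..Suc (card D2). d (\<beta> j) / of_real (real n powr \<beta> j)) + E n)"
    using pf_eq_Q2
  proof eventually_elim
    case (elim n)
    have "constA1 F \<alpha> * of_real (real n powr (\<alpha> * kap)) + (\<Sum>j=2..Suc (card D). c (e j) * of_real (real n powr a j)) = G n"
      unfolding sumA G_def lam_def ..
    moreover have "1 + (\<Sum>j=2..Suc (card D2). d (\<beta> j) / of_real (real n powr \<beta> j)) + E n = Q3 n" by (simp add: E_def)
    moreover have "exp (of_real (lam n * Hr n)) = exp (G n) * exp (of_real (lam n * Hr n) - G n)"
      unfolding exp_add[symmetric] by simp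
    ultimately show ?case unfolding elim Q3_def using constC_nonzero by simp
  qed
  \<comment> \<open>A positive pole of \<open>Lstar F\<close> is one of F, so no gap generates
    \<open>S0\<close>, which is then {0}; hence \<open>D\<close>, a set of positive elements of
    \<open>S0\<close>, is empty.\<close>
  have M1: "(\<forall>x::real. x > 0 \<and> is_pole F (of_real x) \<longrightarrow> x = \<alpha>) \<longrightarrow> Suc (card D) = 1"
  proof
    assume only: "\<forall>x::real. x > 0 \<and> is_pole F (of_real x) \<longrightarrow> x = \<alpha>"
    have "\<nu> = \<alpha>" if "\<nu> \<in> Pp" for \<nu>
      using only H_pole_F_pole[of \<nu>] that by (auto simp: Pp_def Pol_def)
    hence "Pq = {}" by (auto simp: Pq_def)
    hence "S0 = {0}" by (auto simp: S0_def)
    hence "D = {}" using D(2) by auto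
    thus "Suc (card D) = 1" by simp
  qed
  show ?thesis
    unfolding ak TTeq
    by (rule exI[of _ "Suc (card D)"], rule exI[of _ "Suc (card D2)"], rule exI[of _ a], rule exI[of _ \<beta>],
        rule exI[of _ "\<lambda>j. c (e j)"], rule exI[of _ "\<lambda>j. d (\<beta> j)"], rule exI[of _ E],
        rule conjI, simp, rule conjI, simp, rule conjI, simp add: a_def,
        intro conjI dec a0 aL bMN \<beta>(2) EO main M1)
qed

end

theorem theorem1p4:
  fixes f :: "nat \<Rightarrow> nat" and F :: "complex \<Rightarrow> complex" and \<alpha> R :: real and L :: nat
  assumes "R > 0" and "P1 f R F \<alpha> L" and "P3 f R F \<alpha>" and "P4 R F"
  shows "\<exists>(M::nat) (N::nat) (a::nat \<Rightarrow> real) (\<beta>::nat \<Rightarrow> real) (A::nat \<Rightarrow> complex) (B::nat \<Rightarrow> complex)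
           (E::nat \<Rightarrow> complex).
      M \<ge> 1 \<and> N \<ge> 1 \<and>
      a 1 = \<alpha> / (\<alpha> + 1) \<and> (\<forall>j\<in>{1..<M}. a (Suc j) < a j) \<and> 0 \<le> a M \<and>
      (\<forall>j\<in>{1..M}. a j \<in> setL R F \<alpha>) \<and>
      (\<forall>j\<in>{2..N}. 0 < \<beta> j \<and> \<beta> j \<in> setM R F \<alpha> + setN R F \<alpha>) \<and>
      (\<forall>j\<in>{2..<N}. \<beta> j < \<beta> (Suc j)) \<and>
      E \<in> O(\<lambda>n. of_real (real n powr
              (- min ((2 * real L - \<alpha>) / (2 * (\<alpha> + 1))) (R / (\<alpha> + 1))))) \<and>
      (\<forall>\<^sub>F n in sequentially.
         pf f n = constC F \<alpha> / of_nat n powr constb F \<alpha>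
           * exp (constA1 F \<alpha> * of_real (real n powr (\<alpha> / (\<alpha> + 1)))
                  + (\<Sum>j=2..M. A j * of_real (real n powr a j)))
           * (1 + (\<Sum>j=2..N. B j / of_real (real n powr \<beta> j)) + E n)) \<and>
      ((\<forall>x::real. x > 0 \<and> is_pole F (of_real x) \<longrightarrow> x = \<alpha>) \<longrightarrow> M = 1)"
proof -
  interpret partition_setting f F \<alpha> R L by unfold_locales (use assms in auto)
  show ?thesis by (rule asymptotic_formula)
qed

end
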